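(* Let $N\ge2$, let $\Omega\subset\mathbb{R}^N$ be a bounded open set with $C^2$ boundary, let $g\in L^\infty(\mathbb{R}^N\setminus\Omega)$, and for $s\in(0,1)$ let $u_s$ be the solution of the Poisson problem with exterior datum $g$. Let $\tilde g(r):=\frac{1}{r^{N-1}\omega_{N-1}}\int_{S_r}g\,d\sigma$ (defined for a.e. $r>0$ with $S_r\subset\mathbb{R}^N\setminus\Omega$). (i) If $c_g:=\lim_{r\to\infty}\tilde g(r)$ exists, then $u_s\to c_g$ almost uniformly in $\Omega$ as $s\to0^+$. (ii) If $c_g:=\lim_{r\to\infty}\tilde g(r)$ exists and $\int_1^\infty\frac{|\tilde g(r)-c_g|}{r}\,dr<\infty$, then the limit $$L_g(x):=c_N\lim_{r\to\infty}\int_{B_r\setminus\Omega}\frac{g(y)-c_g}{|x-y|^N}\,dy$$ exists for every $x\in\Omega$, and $$u_s=c_g+s\big(L_g+\rho_s\big)\quad\text{in }\Omega,$$ where $\rho_s\to0$ almost uniformly in $\Omega$ as $s\to0^+$.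
   Context: $S_r,B_r$ are the sphere and ball of radius $r$ centered at $0$, $\omega_{N-1}$ is the surface area of the unit sphere, and $c_N=\Gamma(\frac N2)\pi^{-N/2}=2/\omega_{N-1}$. For $s\in(0,1)$, $(-\Delta)^s u(x)=c_{N,s}\lim_{\epsilon\to0}\int_{\{|x-y|>\epsilon\}}\frac{u(x)-u(y)}{|x-y|^{N+2s}}dy$ with $c_{N,s}=\frac{4^s\Gamma(\frac N2+s)}{\Gamma(2-s)\pi^{N/2}}s(1-s)$; $u$ is $s$-harmonic in $\Omega$ if $\int u(-\Delta)^s\phi=0$ for all $\phi\in C_c^\infty(\Omega)$. The solution of the Poisson problem with exterior datum $g\in L^\infty(\mathbb{R}^N\setminus\Omega)$ is the unique $u_s\in L^\infty(\mathbb{R}^N)$ which is $s$-harmonic in $\Omega$ and equals $g$ a.e. on $\mathbb{R}^N\setminus\Omega$ (it is smooth in $\Omega$). $\delta_\Omega(x)=\operatorname{dist}(x,\partial\Omega)$. A family $v_s:\Omega\to\mathbb{R}$ converges almost uniformly in $\Omega$ to $v$ as $s\to0^+$ if $\|\delta_\Omega^\varepsilon(v_s-v)\|_{L^\infty(\Omega)}\to0$ for every $\varepsilon>0$. *)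

theory Defs
  imports "HOL-Analysis.Analysis"
begin

coinductive smooth_fun :: "('a::euclidean_space \<Rightarrow> real) \<Rightarrow> bool" where
  "(\<forall>x. f differentiable (at x)) \<Longrightarrow>
   (\<forall>v. smooth_fun (\<lambda>x. frechet_derivative f (at x) v)) \<Longrightarrow> smooth_fun f"

definition test_fun :: "'a::euclidean_space set \<Rightarrow> ('a \<Rightarrow> real) \<Rightarrow> bool" where
  "test_fun \<Omega> \<phi> \<longleftrightarrow> smooth_fun \<phi> \<and> compact (closure {x. \<phi> x \<noteq> 0})
      \<and> closure {x. \<phi> x \<noteq> 0} \<subseteq> \<Omega>"

definition c_Ns :: "nat \<Rightarrow> real \<Rightarrow> real" where
  "c_Ns N s = 4 powr s * Gamma (real N / 2 + s) / (Gamma (2 - s) * pi powr (real N / 2)) * s * (1 - s)"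

definition frac_lap :: "real \<Rightarrow> ('a::euclidean_space \<Rightarrow> real) \<Rightarrow> 'a \<Rightarrow> real" where
  "frac_lap s \<phi> x = c_Ns DIM('a) s *
     Lim (at_right 0) (\<lambda>\<epsilon>. LINT y : {y. norm (x - y) > \<epsilon>} | lebesgue.
            (\<phi> x - \<phi> y) / norm (x - y) powr (real DIM('a) + 2 * s))"

definition s_harmonic :: "real \<Rightarrow> 'a::euclidean_space set \<Rightarrow> ('a \<Rightarrow> real) \<Rightarrow> bool" where
  "s_harmonic s \<Omega> u \<longleftrightarrow>
     (\<forall>\<phi>. test_fun \<Omega> \<phi> \<longrightarrow> (LINT x | lebesgue. u x * frac_lap s \<phi> x) = 0)"

definition Linf_on :: "'a::euclidean_space set \<Rightarrow> ('a \<Rightarrow> real) \<Rightarrow> bool" where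
  "Linf_on A f \<longleftrightarrow> f \<in> borel_measurable lebesgue \<and> (\<exists>M. AE x in lebesgue. x \<in> A \<longrightarrow> \<bar>f x\<bar> \<le> M)"

definition poisson_solution :: "real \<Rightarrow> 'a::euclidean_space set \<Rightarrow> ('a \<Rightarrow> real) \<Rightarrow> ('a \<Rightarrow> real) \<Rightarrow> bool" where
  "poisson_solution s \<Omega> g u \<longleftrightarrow> Linf_on UNIV u \<and> s_harmonic s \<Omega> u
      \<and> (AE x in lebesgue. x \<notin> \<Omega> \<longrightarrow> u x = g x)"

definition C2_on :: "'a::euclidean_space set \<Rightarrow> ('a \<Rightarrow> real) \<Rightarrow> bool" where
  "C2_on U \<psi> \<longleftrightarrow> (\<exists>G H. (\<forall>x\<in>U. (\<psi> has_derivative (\<lambda>h. G x \<bullet> h)) (at x)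
                          \<and> (G has_derivative H x) (at x))
                    \<and> (\<forall>v. continuous_on U (\<lambda>x. H x v)))"

definition C2_boundary :: "'a::euclidean_space set \<Rightarrow> bool" where
  "C2_boundary \<Omega> \<longleftrightarrow> (\<forall>p\<in>frontier \<Omega>. \<exists>r>0. \<exists>\<psi>. C2_on (ball p r) \<psi>
      \<and> (\<forall>x\<in>ball p r. frechet_derivative \<psi> (at x) \<noteq> (\<lambda>h. 0))
      \<and> \<Omega> \<inter> ball p r = {x\<in>ball p r. \<psi> x < 0})"

definition omega_sphere :: "nat \<Rightarrow> real" where
  "omega_sphere N = 2 * pi powr (real N / 2) / Gamma (real N / 2)"

definition c_N :: "nat \<Rightarrow> real" where
  "c_N N = Gamma (real N / 2) * pi powr (- real N / 2)"

text \<open>Surface measure on the sphere S_r (cone construction):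
  sigma_r(A) = r^(N-1) * N * Lebesgue measure of {t theta : 0 < t <= 1, theta in A / r}.\<close>
definition sphere_surface :: "real \<Rightarrow> 'a::euclidean_space measure" where
  "sphere_surface r = density (distr (restrict_space lborel (ball 0 1)) borel
        (\<lambda>x. (r / norm x) *\<^sub>R x)) (\<lambda>_. ennreal (real DIM('a) * r ^ (DIM('a) - 1)))"

definition sph_mean :: "('a::euclidean_space \<Rightarrow> real) \<Rightarrow> real \<Rightarrow> real" where
  "sph_mean g r = (integral\<^sup>L (sphere_surface r) g) / (r ^ (DIM('a) - 1) * omega_sphere DIM('a))"

definition ess_lim_at_top :: "(real \<Rightarrow> real) \<Rightarrow> real \<Rightarrow> bool" where
  "ess_lim_at_top f c \<longleftrightarrow> (\<forall>e>0. \<exists>R. AE r in lborel. r > R \<longrightarrow> \<bar>f r - c\<bar> < e)"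

definition almost_unif_conv :: "'a::euclidean_space set \<Rightarrow> (real \<Rightarrow> 'a \<Rightarrow> real) \<Rightarrow> ('a \<Rightarrow> real) \<Rightarrow> bool" where
  "almost_unif_conv \<Omega> v w \<longleftrightarrow> (\<forall>\<epsilon>>0. \<forall>\<eta>>0. eventually (\<lambda>s.
      AE x in lebesgue. x \<in> \<Omega> \<longrightarrow> infdist x (frontier \<Omega>) powr \<epsilon> * \<bar>v s x - w x\<bar> \<le> \<eta>) (at_right 0))"

end

theory Submission
  imports Defs "HOL-Real_Asymp.Real_Asymp"
begin

text \<open>Write u = c + h on the complement of the domain and u = c + w inside it. Testing with mollifiers
  gives, after mollification, the pointwise equation (-Delta)^s w = f_s, where f_s(x) is c_{N,s} times the
  integral of h(y) |x - y|^(-N-2s). As s tends to 0 the operator tends to the identity, so w is close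
  to f_s: both (-Delta)^s f_s - f_s and the error terms are of size o(1) f_s + O(s^2), up to arbitrarily
  small negative powers of the distance delta to the boundary. These powers are absorbed by the barrier
  delta^(-eps), which satisfies (-Delta)^s delta^(-eps) >= c delta^(-eps-2s) for small s, because the
  boundary layer {delta < t} has volume O(t R^(N-1)) in balls of radius R. The barrier blows up at the
  boundary and hence dominates any bounded solution there, so the maximum principle yields the
  estimate of w - f_s, and uniqueness is not needed separately. Finally f_s is computed in polar
  coordinates: its far field only sees the spherical averages of g - c. Since only small s matter,
  all singular integrals of Lipschitz functions converge absolutely.\<close>

section \<open>Polar coordinates\<close>

text \<open>The normalisation drives everything. The kernel has mass
  \<open>omega_sphere N * r powr (-2 * s) / (2 * s)\<close> outside a ball of radius r, and
  \<open>c_Ns N s * omega_sphere N / (2 * s)\<close> tends to 1, whereas a term without the factor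
  1/s is multiplied by \<open>c_Ns N s\<close>, which is O(s), and dies. This makes
  \<open>c_Ns\<close> times the operator act almost like the identity on weighted Lipschitz
  functions, and it gives the barrier inequality too. The obstacle is that delta^(-2s) tends to 1
  only away from the boundary. Hence a loss delta^(-a) with small a > 0 is accepted: f_s and the
  deviation of the operator from the identity may each cost delta^(-eps/2), so that their product
  still fits under the barrier delta^(-eps). For the expansion the same estimate is run with f_s =
  O(s): the error is then a product of two small factors, one of them O(s), hence o(s). Three scales
  are nested: s is fixed, then the width tau of the boundary strip, then the mollification radius
  rho, whose error blows up at the boundary but vanishes with rho for fixed tau.\<close>

lemma nn_integral_lborel_scaleR:
  fixes F :: "'a::euclidean_space \<Rightarrow> ennreal"
  assumes [measurable]: "F \<in> borel_measurable borel" and t: "t > 0"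
  shows "(\<integral>\<^sup>+x. F (t *\<^sub>R x) \<partial>lborel) = ennreal (t powr - real DIM('a)) * (\<integral>\<^sup>+x. F x \<partial>lborel)"
proof -
  have "(\<integral>\<^sup>+x. F x \<partial>lborel) = ennreal (t ^ DIM('a)) * (\<integral>\<^sup>+x. F (t *\<^sub>R x) \<partial>lborel)"
    using t by (subst lborel_affine[of t 0])
      (simp_all add: nn_integral_density nn_integral_distr nn_integral_cmult)
  moreover have "ennreal (t powr - real DIM('a)) * ennreal (t ^ DIM('a)) = 1"
    using t by (simp add: ennreal_mult[symmetric] powr_minus powr_realpow)
  ultimately show ?thesis
    by (simp add: mult.assoc[symmetric])
qed

lemma nn_integral_lborel_mult_pos:
  fixes F :: "real \<Rightarrow> ennreal"
  assumes [measurable]: "F \<in> borel_measurable borel" and t: "t > 0"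
  shows "(\<integral>\<^sup>+r. F r \<partial>lborel) = ennreal t * (\<integral>\<^sup>+r. F (t * r) \<partial>lborel)"
  using nn_integral_real_affine[of F t 0] t by simp

lemma nn_integral_powr_tail:
  assumes "a > 0" "b > 0"
  shows "(\<integral>\<^sup>+r. ennreal (r powr (-1 - a)) * indicator {b..} r \<partial>lborel) = ennreal (b powr (-a) / a)"
proof -
  have lim: "((\<lambda>x. - (x powr (-a)) / a) \<longlongrightarrow> 0) at_top"
    using assms by real_asymp
  have "(\<integral>\<^sup>+r. ennreal (r powr (-1 - a)) * indicator {b..} r \<partial>lborel) = ennreal (0 - (- (b powr (-a)) / a))"
    by (rule nn_integral_FTC_atLeast[OF _ _ _ lim])
      (use assms in \<open>auto intro!: derivative_eq_intros simp: field_simps powr_diff powr_minus\<close>)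
  then show ?thesis by simp
qed

lemma nn_integral_powr_head:
  assumes "a > 0" "b > 0"
  shows "(\<integral>\<^sup>+r. ennreal (r powr (a - 1)) * indicator {0<..<b} r \<partial>lborel) = ennreal (b powr a / a)"
proof -
  \<comment> \<open>For \<open>a < 1\<close> the integrand is unbounded at 0, so the derivative is
    used only in the open interval; the antiderivative is continuous up to 0, where
    \<open>0 powr a = 0\<close>.\<close>
  have "((\<lambda>r. r powr (a - 1)) has_integral (b powr a / a - 0 powr a / a)) {0..b}"
    using assms
    by (intro fundamental_theorem_of_calculus_interior)
       (auto intro!: continuous_on_powr' continuous_on_id continuous_on_const continuous_on_divide derivative_eq_intros
          simp: has_real_derivative_iff_has_vector_derivative[symmetric] field_simps powr_diff)
  then have "((\<lambda>r. r powr (a - 1)) has_integral (b powr a / a)) {0..b}" by simp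
  from nn_integral_has_integral_lebesgue'[OF _ this] have "(\<integral>\<^sup>+r. ennreal (r powr (a - 1)) * indicator {0..b} r \<partial>lborel) = ennreal (b powr a / a)"
    by simp
  moreover have "(\<integral>\<^sup>+r. ennreal (r powr (a - 1)) * indicator {0<..<b} r \<partial>lborel) =
     (\<integral>\<^sup>+r. ennreal (r powr (a - 1)) * indicator {0..b} r \<partial>lborel)"
    by (rule nn_integral_cong_AE)
       (use AE_lborel_singleton[of 0] AE_lborel_singleton[of b] in \<open>eventually_elim, auto simp: indicator_def\<close>)
  ultimately show ?thesis by simp
qed

text \<open>Substitute r = |x| t in the inner radial integral, then y = t x after Fubini; the remaining
  t-integral of t^(-1-N) over t > |y| cancels the weight |y|^N.\<close>

lemma nn_integral_polar:
  fixes F :: "'a::euclidean_space \<Rightarrow> ennreal"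
  assumes [measurable]: "F \<in> borel_measurable borel"
  shows "(\<integral>\<^sup>+y. F y \<partial>lborel) =
    (\<integral>\<^sup>+r. indicator {0<..} r * ennreal (real DIM('a) * r powr (real DIM('a) - 1)) *
       (\<integral>\<^sup>+x. indicator (ball 0 1) x * F ((r / norm x) *\<^sub>R x) \<partial>(lborel :: 'a measure)) \<partial>lborel)"
proof -
  let ?n = "real DIM('a)"
  let ?w = "\<lambda>r. indicator {0<..} r * ennreal (?n * r powr (?n - 1))"
  have n0: "?n > 0" by simp
  have [measurable]: "Measurable.pred borel (\<lambda>x::'a. x \<in> ball 0 r)" for r by simp
  have "(\<integral>\<^sup>+r. ?w r * (\<integral>\<^sup>+x. indicator (ball 0 1) x * F ((r / norm x) *\<^sub>R x) \<partial>(lborel :: 'a measure)) \<partial>lborel) =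
    (\<integral>\<^sup>+r. (\<integral>\<^sup>+x. ?w r * (indicator (ball 0 1) x * F ((r / norm x) *\<^sub>R x)) \<partial>(lborel :: 'a measure)) \<partial>lborel)"
    by (intro nn_integral_cong nn_integral_cmult[symmetric]) (measurable; simp)
  also have "\<dots> = (\<integral>\<^sup>+x. (\<integral>\<^sup>+r. ?w r * (indicator (ball 0 1) x * F ((r / norm x) *\<^sub>R x)) \<partial>lborel) \<partial>(lborel :: 'a measure))"
    by (rule lborel_pair.Fubini') measurable
  also have "\<dots> = (\<integral>\<^sup>+x. (\<integral>\<^sup>+t. ?w t * (indicator (ball 0 1) x * (ennreal (norm x powr ?n) * F (t *\<^sub>R x))) \<partial>lborel) \<partial>(lborel :: 'a measure))"
  proof (rule nn_integral_cong_AE)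
    have "AE x in (lborel :: 'a measure). x \<noteq> 0" by (rule AE_lborel_singleton)
    then show "AE x in lborel. (\<integral>\<^sup>+r. ?w r * (indicator (ball 0 1) x * F ((r / norm x) *\<^sub>R x)) \<partial>lborel) =
       (\<integral>\<^sup>+t. ?w t * (indicator (ball 0 1) x * (ennreal (norm x powr ?n) * F (t *\<^sub>R x))) \<partial>lborel)"
    proof eventually_elim
      case (elim x)
      then have nx: "norm x > 0" by simp
      have *: "ennreal (norm x) * (?w (norm x * t)) = ennreal (norm x powr ?n) * ?w t" for t
      proof (cases "t > 0")
        case True
        have "norm x * (?n * (norm x * t) powr (?n - 1)) = norm x powr ?n * (?n * t powr (?n - 1))"
          using nx True by (simp add: powr_mult powr_diff)
        then show ?thesis using nx True by (simp add: ennreal_mult[symmetric])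
      next
        case False
        then have "\<not> norm x * t > 0" using nx by (simp add: zero_less_mult_iff)
        then show ?thesis using False by simp
      qed
      have "(\<integral>\<^sup>+r. ?w r * (indicator (ball 0 1) x * F ((r / norm x) *\<^sub>R x)) \<partial>lborel) =
        ennreal (norm x) * (\<integral>\<^sup>+r. ?w (norm x * r) * (indicator (ball 0 1) x * F (((norm x * r) / norm x) *\<^sub>R x)) \<partial>lborel)"
        by (rule nn_integral_lborel_mult_pos[OF _ nx]) measurable
      also have "\<dots> = (\<integral>\<^sup>+r. ennreal (norm x) * ?w (norm x * r) * (indicator (ball 0 1) x * F (r *\<^sub>R x)) \<partial>lborel)"
        using nx by (subst nn_integral_cmult[symmetric]) (auto simp: mult.assoc)
      also have "\<dots> = (\<integral>\<^sup>+t. ?w t * (indicator (ball 0 1) x * (ennreal (norm x powr ?n) * F (t *\<^sub>R x))) \<partial>lborel)"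
        unfolding * by (simp add: mult_ac)
      finally show ?case .
    qed
  qed
  also have "\<dots> = (\<integral>\<^sup>+t. (\<integral>\<^sup>+x. ?w t * (indicator (ball 0 1) x * (ennreal (norm x powr ?n) * F (t *\<^sub>R x))) \<partial>(lborel :: 'a measure)) \<partial>lborel)"
    by (rule lborel_pair.Fubini'[symmetric]) measurable
  \<comment> \<open>With y = t x the constraint norm x < 1 becomes norm y < t, and the powers
    t^(N-1) t^(-N) t^(-N) combine to t^(-1-N).\<close>
  also have "\<dots> = (\<integral>\<^sup>+t. (\<integral>\<^sup>+y. (ennreal (norm y powr ?n) * F y) * (ennreal (?n * t powr (-1 - ?n)) * indicator {norm y<..} t) \<partial>(lborel :: 'a measure)) \<partial>lborel)"
  proof (rule nn_integral_cong)
    fix t :: real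
    show "(\<integral>\<^sup>+x. ?w t * (indicator (ball 0 1) x * (ennreal (norm x powr ?n) * F (t *\<^sub>R x))) \<partial>(lborel :: 'a measure)) =
      (\<integral>\<^sup>+y. (ennreal (norm y powr ?n) * F y) * (ennreal (?n * t powr (-1 - ?n)) * indicator {norm y<..} t) \<partial>(lborel :: 'a measure))"
    proof (cases "t > 0")
      case False
      then have "\<not> norm (y::'a) < t" for y by (meson norm_ge_zero le_less_trans not_less)
      then show ?thesis using False by simp
    next
      case True
      let ?G = "\<lambda>y. ?w t * (indicator (ball 0 t) y * (ennreal (t powr (-?n) * norm y powr ?n) * F y))"
      have "(\<integral>\<^sup>+x. ?w t * (indicator (ball 0 1) x * (ennreal (norm x powr ?n) * F (t *\<^sub>R x))) \<partial>(lborel :: 'a measure)) =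
        (\<integral>\<^sup>+x. ?G (t *\<^sub>R x) \<partial>lborel)"
        using True by (intro nn_integral_cong)
          (auto simp: indicator_def powr_mult powr_minus field_simps)
      also have "\<dots> = ennreal (t powr - ?n) * (\<integral>\<^sup>+x. ?G x \<partial>lborel)"
        by (rule nn_integral_lborel_scaleR[OF _ True]) measurable
      also have "\<dots> = (\<integral>\<^sup>+x. ennreal (t powr - ?n) * ?G x \<partial>lborel)"
        by (rule nn_integral_cmult[symmetric]) measurable
      also have "\<dots> = (\<integral>\<^sup>+y. (ennreal (norm y powr ?n) * F y) * (ennreal (?n * t powr (-1 - ?n)) * indicator {norm y<..} t) \<partial>(lborel :: 'a measure))"
      proof (rule nn_integral_cong)
        fix y :: 'a
        have "t powr - ?n * (?n * t powr (?n - 1) * (t powr (-?n) * norm y powr ?n)) =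
          norm y powr ?n * (?n * (t powr - ?n * t powr (?n - 1) * t powr (-?n)))" by (simp add: mult_ac)
        also have "t powr - ?n * t powr (?n - 1) * t powr (-?n) = t powr (-1 - ?n)"
          by (simp only: powr_add[symmetric]) (rule arg_cong[where f="(powr) t"], simp)
        finally have eq: "t powr - ?n * (?n * t powr (?n - 1) * (t powr (-?n) * norm y powr ?n)) =
          norm y powr ?n * (?n * t powr (-1 - ?n))" .
        have "ennreal (t powr - ?n) * ?G y = ennreal (t powr - ?n * (?n * t powr (?n - 1) * (t powr (-?n) * norm y powr ?n))) * (indicator (ball 0 t) y * F y)"
          using True by (simp add: ennreal_mult mult_ac)
        also have "\<dots> = (ennreal (norm y powr ?n) * F y) * (ennreal (?n * t powr (-1 - ?n)) * indicator {norm y<..} t)"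
          unfolding eq by (subst ennreal_mult) (auto simp: mult_ac indicator_def)
        finally show "ennreal (t powr - ?n) * ?G y = (ennreal (norm y powr ?n) * F y) * (ennreal (?n * t powr (-1 - ?n)) * indicator {norm y<..} t)" .
      qed
      finally show ?thesis .
    qed
  qed
  also have "\<dots> = (\<integral>\<^sup>+y. (\<integral>\<^sup>+t. (ennreal (norm y powr ?n) * F y) * (ennreal (?n * t powr (-1 - ?n)) * indicator {norm y<..} t) \<partial>lborel) \<partial>(lborel :: 'a measure))"
    by (rule lborel_pair.Fubini'[symmetric]) (auto simp: indicator_def, measurable)
  also have "\<dots> = (\<integral>\<^sup>+y. F y \<partial>(lborel :: 'a measure))"
  proof (rule nn_integral_cong_AE)
    have "AE x in (lborel :: 'a measure). x \<noteq> 0" by (rule AE_lborel_singleton)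
    then show "AE y in (lborel :: 'a measure). (\<integral>\<^sup>+t. (ennreal (norm y powr ?n) * F y) * (ennreal (?n * t powr (-1 - ?n)) * indicator {norm y<..} t) \<partial>lborel) = F y"
    proof eventually_elim
      case (elim y)
      then have ny: "norm y > 0" by simp
      have "(\<integral>\<^sup>+t. ennreal (t powr (-1 - ?n)) * indicator {norm y<..} t \<partial>lborel) = (\<integral>\<^sup>+t. ennreal (t powr (-1 - ?n)) * indicator {norm y..} t \<partial>lborel)"
        by (rule nn_integral_cong_AE)
          (use AE_lborel_singleton[of "norm y"] in \<open>eventually_elim, auto simp: indicator_def\<close>)
      also have "\<dots> = ennreal (norm y powr (-?n) / ?n)"
        by (rule nn_integral_powr_tail[OF n0 ny])
      finally have "(\<integral>\<^sup>+t. ennreal (t powr (-1 - ?n)) * indicator {norm y<..} t \<partial>lborel) = ennreal (norm y powr (-?n) / ?n)" .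
      then have "(\<integral>\<^sup>+t. ennreal ?n * (ennreal (t powr (-1 - ?n)) * indicator {norm y<..} t) \<partial>lborel) = ennreal (norm y powr (-?n))"
        by (subst nn_integral_cmult) (auto simp: ennreal_mult[symmetric])
      then have "(\<integral>\<^sup>+t. ennreal (?n * t powr (-1 - ?n)) * indicator {norm y<..} t \<partial>lborel) = ennreal (norm y powr (-?n))"
        by (simp add: ennreal_mult mult.assoc)
      then have "(\<integral>\<^sup>+t. (ennreal (norm y powr ?n) * F y) * (ennreal (?n * t powr (-1 - ?n)) * indicator {norm y<..} t) \<partial>lborel)
        = ennreal (norm y powr ?n) * F y * ennreal (norm y powr (-?n))"
        by (subst nn_integral_cmult) auto
      also have "\<dots> = ennreal (norm y powr ?n * norm y powr (-?n)) * F y"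
        by (simp add: ennreal_mult mult_ac)
      also have "norm y powr ?n * norm y powr (-?n) = 1"
        using ny by (simp add: powr_minus)
      finally show ?case by simp
    qed
  qed
  finally show ?thesis ..
qed

text \<open>Ties the Gamma formula for the surface area to the cone construction in
  \<open>sphere_surface\<close>, whose total mass at radius 1 is N times the ball volume; the Gamma
  recursion at N/2 supplies that factor.\<close>

lemma omega_sphere_eq: "omega_sphere DIM('a::euclidean_space) = real DIM('a) * measure lborel (ball (0::'a) 1)"
proof -
  have G: "Gamma (real DIM('a) / 2 + 1) = real DIM('a) / 2 * Gamma (real DIM('a) / 2)"
    by (rule Gamma_plus1) (auto dest: nonpos_Ints_nonpos)
  have "Gamma (real DIM('a) / 2) > 0" by (intro Gamma_real_pos) auto
  then show ?thesis
    unfolding omega_sphere_def content_ball[OF zero_le_one] unit_ball_vol_def G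
    by (simp add: divide_simps)
qed

lemma omega_sphere_pos: "n > 0 \<Longrightarrow> omega_sphere n > 0"
  unfolding omega_sphere_def by (intro divide_pos_pos mult_pos_pos Gamma_real_pos) auto

lemma nn_integral_radial:
  fixes f :: "real \<Rightarrow> ennreal"
  assumes [measurable]: "f \<in> borel_measurable borel"
  shows "(\<integral>\<^sup>+y. f (norm (y::'a::euclidean_space)) \<partial>lborel) =
    ennreal (omega_sphere DIM('a)) *
      (\<integral>\<^sup>+r. indicator {0<..} r * ennreal (r powr (real DIM('a) - 1)) * f r \<partial>lborel)"
proof -
  let ?n = "real DIM('a)" and ?v = "measure lborel (ball (0::'a) 1)"
  have [measurable]: "Measurable.pred borel (\<lambda>x::'a. x \<in> ball 0 1)" by simp
  have v: "emeasure lborel (ball (0::'a) 1) = ennreal ?v"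
    by (simp add: emeasure_ball content_ball)
  have "(\<integral>\<^sup>+y. f (norm (y::'a)) \<partial>lborel) =
    (\<integral>\<^sup>+r. indicator {0<..} r * ennreal (?n * r powr (?n - 1)) *
       (\<integral>\<^sup>+x. indicator (ball 0 1) x * f (norm ((r / norm x) *\<^sub>R x)) \<partial>(lborel :: 'a measure)) \<partial>lborel)"
    by (rule nn_integral_polar) measurable
  also have "\<dots> = (\<integral>\<^sup>+r. ennreal (omega_sphere DIM('a)) * (indicator {0<..} r * ennreal (r powr (?n - 1)) * f r) \<partial>lborel)"
  proof (rule nn_integral_cong)
    fix r :: real
    have "indicator {0<..} r * (\<integral>\<^sup>+x. indicator (ball 0 1) x * f (norm ((r / norm x) *\<^sub>R x)) \<partial>(lborel :: 'a measure)) =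
       indicator {0<..} r * (\<integral>\<^sup>+x. f r * indicator (ball 0 1) x \<partial>(lborel :: 'a measure))"
    proof (cases "r > 0")
      case True
      \<comment> \<open>Division by zero gives 0, so at \<open>x = 0\<close> the rescaled point is 0
        and not on the sphere of radius \<open>r\<close>; this null set is removed.\<close>
      have "AE x in (lborel :: 'a measure). x \<noteq> 0" by (rule AE_lborel_singleton)
      then have "AE x in (lborel :: 'a measure). indicator (ball 0 1) x * f (norm ((r / norm x) *\<^sub>R x)) = f r * indicator (ball 0 1) x"
        by eventually_elim (use True in \<open>auto simp: mult.commute\<close>)
      then have "(\<integral>\<^sup>+x. indicator (ball 0 1) x * f (norm ((r / norm x) *\<^sub>R x)) \<partial>(lborel :: 'a measure)) =
        (\<integral>\<^sup>+x. f r * indicator (ball 0 1) x \<partial>(lborel :: 'a measure))"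
        by (rule nn_integral_cong_AE)
      then show ?thesis by simp
    qed auto
    also have "(\<integral>\<^sup>+x. f r * indicator (ball 0 1) x \<partial>(lborel :: 'a measure)) = f r * ennreal ?v"
      by (subst nn_integral_cmult) (auto simp: v)
    finally have A: "indicator {0<..} r * (\<integral>\<^sup>+x. indicator (ball 0 1) x * f (norm ((r / norm x) *\<^sub>R x)) \<partial>(lborel :: 'a measure)) = indicator {0<..} r * (f r * ennreal ?v)" .
    have "indicator {0<..} r * ennreal (?n * r powr (?n - 1)) * (\<integral>\<^sup>+x. indicator (ball 0 1) x * f (norm ((r / norm x) *\<^sub>R x)) \<partial>(lborel :: 'a measure)) =
       ennreal (?n * r powr (?n - 1)) * (indicator {0<..} r * (\<integral>\<^sup>+x. indicator (ball 0 1) x * f (norm ((r / norm x) *\<^sub>R x)) \<partial>(lborel :: 'a measure)))" by (simp only: mult_ac)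
    also have "\<dots> = ennreal (omega_sphere DIM('a)) * (indicator {0<..} r * ennreal (r powr (?n - 1)) * f r)"
      unfolding A omega_sphere_eq by (simp add: ennreal_mult mult_ac)
    finally show "indicator {0<..} r * ennreal (?n * r powr (?n - 1)) * (\<integral>\<^sup>+x. indicator (ball 0 1) x * f (norm ((r / norm x) *\<^sub>R x)) \<partial>(lborel :: 'a measure)) =
       ennreal (omega_sphere DIM('a)) * (indicator {0<..} r * ennreal (r powr (?n - 1)) * f r)" .
  qed
  also have "\<dots> = ennreal (omega_sphere DIM('a)) *
      (\<integral>\<^sup>+r. indicator {0<..} r * ennreal (r powr (?n - 1)) * f r \<partial>lborel)"
    by (rule nn_integral_cmult) measurable
  finally show ?thesis .
qed

lemma nn_integral_norm_powr_tail:
  assumes "a > 0" "b > 0"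
  shows "(\<integral>\<^sup>+y. ennreal (norm (y::'a::euclidean_space) powr (- (real DIM('a) + a))) * indicator {b..} (norm y) \<partial>lborel)
    = ennreal (omega_sphere DIM('a) * b powr (-a) / a)"
proof -
  let ?n = "real DIM('a)"
  have "(\<integral>\<^sup>+y. ennreal (norm (y::'a) powr (- (?n + a))) * indicator {b..} (norm y) \<partial>lborel) =
    ennreal (omega_sphere DIM('a)) *
      (\<integral>\<^sup>+r. indicator {0<..} r * ennreal (r powr (?n - 1)) * (ennreal (r powr (- (?n + a))) * indicator {b..} r) \<partial>lborel)"
    by (rule nn_integral_radial) measurable
  also have "(\<integral>\<^sup>+r. indicator {0<..} r * ennreal (r powr (?n - 1)) * (ennreal (r powr (- (?n + a))) * indicator {b..} r) \<partial>lborel)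
    = (\<integral>\<^sup>+r. ennreal (r powr (-1 - a)) * indicator {b..} r \<partial>lborel)"
    using assms by (intro nn_integral_cong)
      (auto simp: indicator_def ennreal_mult[symmetric] powr_add[symmetric])
  also have "\<dots> = ennreal (b powr (-a) / a)"
    by (rule nn_integral_powr_tail[OF assms])
  finally show ?thesis
    using omega_sphere_pos[of "DIM('a)"] assms by (simp add: ennreal_mult[symmetric])
qed

lemma nn_integral_norm_powr_head:
  assumes "a > 0" "b > 0"
  shows "(\<integral>\<^sup>+y. ennreal (norm (y::'a::euclidean_space) powr (a - real DIM('a))) * indicator {..<b} (norm y) \<partial>lborel)
    = ennreal (omega_sphere DIM('a) * b powr a / a)"
proof -
  let ?n = "real DIM('a)"
  have "(\<integral>\<^sup>+y. ennreal (norm (y::'a) powr (a - ?n)) * indicator {..<b} (norm y) \<partial>lborel) =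
    ennreal (omega_sphere DIM('a)) *
      (\<integral>\<^sup>+r. indicator {0<..} r * ennreal (r powr (?n - 1)) * (ennreal (r powr (a - ?n)) * indicator {..<b} r) \<partial>lborel)"
    by (rule nn_integral_radial) measurable
  also have "(\<integral>\<^sup>+r. indicator {0<..} r * ennreal (r powr (?n - 1)) * (ennreal (r powr (a - ?n)) * indicator {..<b} r) \<partial>lborel)
    = (\<integral>\<^sup>+r. ennreal (r powr (a - 1)) * indicator {0<..<b} r \<partial>lborel)"
    using assms by (intro nn_integral_cong)
      (auto simp: indicator_def ennreal_mult[symmetric] powr_add[symmetric])
  also have "\<dots> = ennreal (b powr a / a)"
    by (rule nn_integral_powr_head[OF assms])
  finally show ?thesis
    using omega_sphere_pos[of "DIM('a)"] assms by (simp add: ennreal_mult[symmetric])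
qed

lemma nn_integral_shift:
  fixes F :: "'a::euclidean_space \<Rightarrow> ennreal"
  assumes [measurable]: "F \<in> borel_measurable borel"
  shows "(\<integral>\<^sup>+y. F (x - y) \<partial>lborel) = (\<integral>\<^sup>+y. F y \<partial>lborel)"
  by (subst (2) lborel_affine[of "-1" x])
    (simp_all add: nn_integral_density nn_integral_distr)

section \<open>Spherical averages\<close>

text \<open>The average of \<open>sph_mean\<close> as one Lebesgue integral over the unit ball. The
  measure \<open>sphere_surface r\<close> changes with \<open>r\<close>; here \<open>r\<close> is
  only a parameter of the integrand, so measurability in \<open>r\<close> and polar coordinates are
  directly available.\<close>

definition sph_avg :: "('a::euclidean_space \<Rightarrow> real) \<Rightarrow> real \<Rightarrow> real" where
  "sph_avg h r = real DIM('a) / omega_sphere DIM('a) *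
     (LINT x|lborel. indicator (ball 0 1) x * h ((r / norm x) *\<^sub>R x))"

lemma borel_measurable_sph_avg [measurable]:
  fixes h :: "'a::euclidean_space \<Rightarrow> real"
  assumes [measurable]: "h \<in> borel_measurable borel"
  shows "sph_avg h \<in> borel_measurable borel"
proof -
  have [measurable]: "Measurable.pred borel (\<lambda>x::'a. x \<in> ball 0 1)" by simp
  show ?thesis unfolding sph_avg_def by measurable
qed

lemma sph_mean_eq_sph_avg:
  fixes g :: "'a::euclidean_space \<Rightarrow> real"
  assumes [measurable]: "g \<in> borel_measurable borel" and r: "r > 0"
  shows "sph_mean g r = sph_avg g r"
proof -
  let ?n = "DIM('a)"
  have [measurable]: "Measurable.pred borel (\<lambda>x::'a. x \<in> ball 0 1)" by simp
  have [measurable]: "(\<lambda>x::'a. (r / norm x) *\<^sub>R x) \<in> restrict_space lborel (ball 0 1) \<rightarrow>\<^sub>M borel"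
    by (rule measurable_restrict_space1) measurable
  have "integral\<^sup>L (sphere_surface r) g =
    (LINT x|distr (restrict_space lborel (ball 0 1)) borel (\<lambda>x. (r / norm x) *\<^sub>R x). (real ?n * r ^ (?n - 1)) *\<^sub>R g x)"
    unfolding sphere_surface_def using r by (intro integral_density) auto
  also have "\<dots> = (LINT x|restrict_space lborel (ball 0 1). (real ?n * r ^ (?n - 1)) *\<^sub>R g ((r / norm x) *\<^sub>R x))"
    by (rule integral_distr) auto
  also have "\<dots> = (LINT x|lborel. indicator (ball 0 1) x *\<^sub>R ((real ?n * r ^ (?n - 1)) *\<^sub>R g ((r / norm x) *\<^sub>R x)))"
    by (subst integral_restrict_space) auto
  also have "\<dots> = (LINT x|lborel. (real ?n * r ^ (?n - 1)) * (indicator (ball 0 1) x * g ((r / norm x) *\<^sub>R x)))"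
    by (simp add: mult_ac)
  also have "\<dots> = (real ?n * r ^ (?n - 1)) * (LINT x|lborel. indicator (ball 0 1) x * g ((r / norm x) *\<^sub>R x))"
    by simp
  finally show ?thesis using r by (simp add: sph_mean_def sph_avg_def)
qed

lemma integrable_sph_avg:
  fixes h :: "'a::euclidean_space \<Rightarrow> real"
  assumes [measurable]: "h \<in> borel_measurable borel" and b: "\<And>y. \<bar>h y\<bar> \<le> M"
  shows "integrable lborel (\<lambda>x. indicator (ball 0 1) x * h ((r / norm x) *\<^sub>R x))"
proof -
  have [measurable]: "Measurable.pred borel (\<lambda>x::'a. x \<in> ball 0 1)" by simp
  show ?thesis
  proof (rule Bochner_Integration.integrable_bound)
    show "integrable lborel (\<lambda>x::'a. M * indicator (ball 0 1) x)"
      by (intro integrable_mult_right integrable_real_indicator) (auto simp: emeasure_ball)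
    show "(\<lambda>x. indicator (ball 0 1) x * h ((r / norm x) *\<^sub>R x)) \<in> borel_measurable lborel"
      by measurable
    show "AE x in lborel. norm (indicator (ball 0 1) x * h ((r / norm x) *\<^sub>R x)) \<le> norm (M * indicator (ball (0::'a) 1) x)"
      using b by (auto simp: indicator_def abs_mult intro!: AE_I2 order.trans[OF b])
  qed
qed

lemma sph_avg_const: "sph_avg (\<lambda>_::'a::euclidean_space. c) r = c"
  using omega_sphere_pos[of "DIM('a)"] omega_sphere_eq[where 'a='a]
  by (simp add: sph_avg_def)

lemma sph_avg_bound:
  fixes h :: "'a::euclidean_space \<Rightarrow> real"
  assumes [measurable]: "h \<in> borel_measurable borel" and b: "\<And>y. \<bar>h y\<bar> \<le> M"
  shows "\<bar>sph_avg h r\<bar> \<le> M"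
proof -
  have w: "real DIM('a) / omega_sphere DIM('a) \<ge> 0"
    using omega_sphere_pos[of "DIM('a)"] by simp
  have M: "M \<ge> 0" using b[of 0] by linarith
  note i = integrable_sph_avg[OF assms]
  have ic: "integrable lborel (\<lambda>x::'a. indicator (ball 0 1) x * M)"
    using integrable_sph_avg[of "\<lambda>_::'a. M" M 1] M by simp
  have "\<bar>LINT x|lborel. indicator (ball 0 1) x * h ((r / norm x) *\<^sub>R x)\<bar> \<le>
    (LINT x|lborel. indicator (ball (0::'a) 1) x * M)"
    by (intro integral_abs_bound[THEN order_trans] integral_mono integrable_abs i ic)
      (use b in \<open>auto simp: abs_mult indicator_def\<close>)
  then have "\<bar>sph_avg h r\<bar> \<le> sph_avg (\<lambda>_::'a. M) r"
    unfolding sph_avg_def abs_mult abs_of_nonneg[OF w] using w by (rule mult_left_mono)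
  then show ?thesis by (simp add: sph_avg_const)
qed

text \<open>The exceptional set is null in space, so by polar coordinates its trace on almost every
  sphere is null. This is how the almost everywhere defined datum passes to averages over spheres,
  which are themselves null sets.\<close>

lemma AE_sph_avg_cong:
  fixes h :: "'a::euclidean_space \<Rightarrow> real"
  assumes [measurable]: "h \<in> borel_measurable borel" "g \<in> borel_measurable borel"
    and b: "\<And>y. \<bar>h y\<bar> \<le> M" and eq: "AE y in lborel. norm y \<ge> R \<longrightarrow> h y = g y - c" and R: "R > 0"
  shows "AE r in lborel. r \<ge> R \<longrightarrow> sph_avg h r = sph_mean g r - c"
proof -
  let ?n = "real DIM('a)"
  have [measurable]: "Measurable.pred borel (\<lambda>x::'a. x \<in> ball 0 1)" by simp
  let ?F = "\<lambda>y. indicator {y. norm y \<ge> R \<and> h y \<noteq> g y - c} y :: ennreal"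
  have "0 = (\<integral>\<^sup>+y. ?F y \<partial>lborel)"
    using eq by (subst nn_integral_0_iff_AE[THEN iffD2]) (auto elim!: eventually_mono)
  also have "\<dots> = (\<integral>\<^sup>+r. indicator {0<..} r * ennreal (?n * r powr (?n - 1)) *
       (\<integral>\<^sup>+x. indicator (ball 0 1) x * ?F ((r / norm x) *\<^sub>R x) \<partial>(lborel :: 'a measure)) \<partial>lborel)"
    by (rule nn_integral_polar) measurable
  finally have "AE r in lborel. indicator {0<..} r * ennreal (?n * r powr (?n - 1)) *
       (\<integral>\<^sup>+x. indicator (ball 0 1) x * ?F ((r / norm x) *\<^sub>R x) \<partial>(lborel :: 'a measure)) = 0"
    by (subst (asm) eq_commute, subst (asm) nn_integral_0_iff_AE) auto
  then show ?thesis
  proof eventually_elim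
    case (elim r)
    show ?case
    proof
      assume r: "r \<ge> R"
      with R elim have "(\<integral>\<^sup>+x. indicator (ball 0 1) x * ?F ((r / norm x) *\<^sub>R x) \<partial>(lborel :: 'a measure)) = 0"
        by (auto simp: indicator_def split: if_splits)
      then have "AE x in lborel. indicator (ball 0 1) x * ?F ((r / norm x) *\<^sub>R x) = 0"
        by (subst (asm) nn_integral_0_iff_AE) auto
      with AE_lborel_singleton[of "0::'a"]
      have ae: "AE x in lborel. indicator (ball 0 1) x * g ((r / norm x) *\<^sub>R x) =
         indicator (ball 0 1) x * h ((r / norm x) *\<^sub>R x) + indicator (ball 0 1) x * c"
        by eventually_elim (use r R in \<open>auto simp: indicator_def split: if_splits\<close>)
      have ic: "integrable lborel (\<lambda>x::'a. indicator (ball 0 1) x * c)"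
        using integrable_sph_avg[of "\<lambda>_::'a. c" "\<bar>c\<bar>" 1] by simp
      have "sph_avg g r = ?n / omega_sphere DIM('a) * (LINT x|lborel. indicator (ball 0 1) x * h ((r / norm x) *\<^sub>R x) + indicator (ball 0 1) x * c)"
        unfolding sph_avg_def by (subst integral_cong_AE[OF _ _ ae]) auto
      also have "\<dots> = sph_avg h r + sph_avg (\<lambda>_::'a. c) r"
        unfolding sph_avg_def
        by (subst Bochner_Integration.integral_add[OF integrable_sph_avg[OF assms(1) b] ic])
          (simp add: distrib_left)
      finally show "sph_avg h r = sph_mean g r - c"
        using r R by (simp add: sph_avg_const sph_mean_eq_sph_avg)
    qed
  qed
qed

text \<open>A radial weight is constant on spheres, so only the spherical averages of
  \<open>h\<close> enter. Polar coordinates are stated for nonnegative functions, hence the detour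
  through \<open>h + M\<close>.\<close>

lemma integral_shell_sph_avg:
  fixes h :: "'a::euclidean_space \<Rightarrow> real" and w :: "real \<Rightarrow> real"
  assumes [measurable]: "h \<in> borel_measurable borel" "w \<in> borel_measurable borel"
    and b: "\<And>y. \<bar>h y\<bar> \<le> M" and w: "\<And>r. 0 \<le> w r" and w0: "\<And>r. r \<le> 0 \<Longrightarrow> w r = 0"
    and int: "integrable lborel (\<lambda>y::'a. w (norm y))"
  shows "integrable lborel (\<lambda>r. r powr (real DIM('a) - 1) * w r)"
    and "(LINT y|lborel. h y * w (norm y)) =
       omega_sphere DIM('a) * (LINT r|lborel. r powr (real DIM('a) - 1) * w r * sph_avg h r)"
proof -
  let ?n = "real DIM('a)" and ?o = "omega_sphere DIM('a)"
  have [measurable]: "Measurable.pred borel (\<lambda>x::'a. x \<in> ball 0 1)" by simp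
  have o: "?o > 0" by (simp add: omega_sphere_pos)
  have fin: "(\<integral>\<^sup>+y. ennreal (w (norm (y::'a))) \<partial>lborel) < \<infinity>"
    using int w by (simp add: integrable_iff_bounded)
  also have "(\<integral>\<^sup>+y. ennreal (w (norm (y::'a))) \<partial>lborel) = ennreal ?o * (\<integral>\<^sup>+r. indicator {0<..} r * ennreal (r powr (?n - 1)) * ennreal (w r) \<partial>lborel)"
    by (rule nn_integral_radial) measurable
  also have "(\<integral>\<^sup>+r. indicator {0<..} r * ennreal (r powr (?n - 1)) * ennreal (w r) \<partial>lborel) =
    (\<integral>\<^sup>+r. ennreal (r powr (?n - 1) * w r) \<partial>lborel)"
    \<comment> \<open>\<open>w0\<close> takes over the role of the indicator of the positive
      half-line.\<close>
    using w w0 by (intro nn_integral_cong) (auto simp: indicator_def ennreal_mult)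
  finally have fin': "(\<integral>\<^sup>+r. ennreal (r powr (?n - 1) * w r) \<partial>lborel) < \<infinity>"
    using o by (auto simp: ennreal_mult_less_top)
  show i1: "integrable lborel (\<lambda>r. r powr (?n - 1) * w r)"
    using fin' w by (simp add: integrable_iff_bounded)
  have i2: "integrable lborel (\<lambda>r. r powr (?n - 1) * w r * sph_avg k r)"
    if "k \<in> borel_measurable borel" "\<And>y. \<bar>k y\<bar> \<le> K" for k :: "'a \<Rightarrow> real" and K
  proof (rule Bochner_Integration.integrable_bound)
    show "integrable lborel (\<lambda>r. K * (r powr (?n - 1) * w r))"
      using i1 by simp
    show "(\<lambda>r. r powr (?n - 1) * w r * sph_avg k r) \<in> borel_measurable lborel" using that by measurable
    show "AE r in lborel. norm (r powr (?n - 1) * w r * sph_avg k r) \<le> norm (K * (r powr (?n - 1) * w r))"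
      using sph_avg_bound[OF that] w
      by (auto simp: abs_mult mult.commute[of K] intro!: AE_I2 mult_left_mono order.trans[OF sph_avg_bound[OF that]])
  qed
  have i3: "integrable lborel (\<lambda>y. k y * w (norm y))"
    if [measurable]: "k \<in> borel_measurable borel" and K: "\<And>y. \<bar>k y\<bar> \<le> K" for k :: "'a \<Rightarrow> real" and K
  proof (rule Bochner_Integration.integrable_bound)
    show "integrable lborel (\<lambda>y::'a. K * w (norm y))" using int by simp
    show "AE y in lborel. norm (k y * w (norm y)) \<le> norm (K * w (norm y))"
      using w by (auto simp: abs_mult intro!: AE_I2 mult_right_mono order.trans[OF K])
  qed measurable
  have pos: "(LINT y|lborel. k y * w (norm y)) = ?o * (LINT r|lborel. r powr (?n - 1) * w r * sph_avg k r)"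
    if [measurable]: "k \<in> borel_measurable borel" and K: "\<And>y. \<bar>k y\<bar> \<le> K" and k0: "\<And>y. 0 \<le> k y" for k :: "'a \<Rightarrow> real" and K
  proof -
    have a0: "0 \<le> sph_avg k r" for r
      using o k0 unfolding sph_avg_def by (intro mult_nonneg_nonneg integral_nonneg_AE) auto
    have "ennreal (LINT y|lborel. k y * w (norm y)) = (\<integral>\<^sup>+y. ennreal (k y * w (norm y)) \<partial>lborel)"
      using i3[OF that(1) K] k0 w by (intro nn_integral_eq_integral[symmetric]) auto
    also have "\<dots> = (\<integral>\<^sup>+r. indicator {0<..} r * ennreal (?n * r powr (?n - 1)) *
       (\<integral>\<^sup>+x. indicator (ball 0 1) x * ennreal (k ((r / norm x) *\<^sub>R x) * w (norm ((r / norm x) *\<^sub>R x))) \<partial>(lborel :: 'a measure)) \<partial>lborel)"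
      by (rule nn_integral_polar) measurable
    also have "\<dots> = (\<integral>\<^sup>+r. ennreal (?o * (r powr (?n - 1) * w r * sph_avg k r)) \<partial>lborel)"
    proof (rule nn_integral_cong)
      fix r :: real
      show "indicator {0<..} r * ennreal (?n * r powr (?n - 1)) *
       (\<integral>\<^sup>+x. indicator (ball 0 1) x * ennreal (k ((r / norm x) *\<^sub>R x) * w (norm ((r / norm x) *\<^sub>R x))) \<partial>(lborel :: 'a measure)) = ennreal (?o * (r powr (?n - 1) * w r * sph_avg k r))"
      proof (cases "r > 0")
        case True
        have "(\<integral>\<^sup>+x. indicator (ball 0 1) x * ennreal (k ((r / norm x) *\<^sub>R x) * w (norm ((r / norm x) *\<^sub>R x))) \<partial>(lborel :: 'a measure)) =
          (\<integral>\<^sup>+x. ennreal (w r) * ennreal (indicator (ball 0 1) x * k ((r / norm x) *\<^sub>R x)) \<partial>(lborel :: 'a measure))"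
          by (rule nn_integral_cong_AE, use AE_lborel_singleton[of "0::'a"] in eventually_elim)
            (use True w k0 in \<open>auto simp: indicator_def ennreal_mult[symmetric] mult.commute\<close>)
        also have "\<dots> = ennreal (w r) * (\<integral>\<^sup>+x. ennreal (indicator (ball 0 1) x * k ((r / norm x) *\<^sub>R x)) \<partial>(lborel :: 'a measure))"
          by (rule nn_integral_cmult) measurable
        also have "(\<integral>\<^sup>+x. ennreal (indicator (ball 0 1) x * k ((r / norm x) *\<^sub>R x)) \<partial>(lborel :: 'a measure)) =
          ennreal (LINT x|lborel. indicator (ball 0 1) x * k ((r / norm x) *\<^sub>R x))"
          using k0 by (intro nn_integral_eq_integral integrable_sph_avg[OF that(1) K]) auto
        also have "(LINT x|lborel. indicator (ball 0 1) x * k ((r / norm x) *\<^sub>R x)) = ?o / ?n * sph_avg k r"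
          using o by (simp add: sph_avg_def)
        finally show ?thesis using True w a0 o
          by (simp add: ennreal_mult[symmetric] mult_ac)
      qed (use w0 in auto)
    qed
    also have "\<dots> = ennreal (LINT r|lborel. ?o * (r powr (?n - 1) * w r * sph_avg k r))"
      using i2[OF that(1) K] w a0 o by (intro nn_integral_eq_integral) auto
    finally show ?thesis
      using k0 w a0 o by (subst (asm) ennreal_inj) (auto intro!: integral_nonneg_AE)
  qed
  have M: "M \<ge> 0" using b[of 0] by linarith
  \<comment> \<open>Adding the bound \<open>M\<close> makes the function nonnegative; the formula
    for the constant \<open>M\<close> is subtracted again afterwards.\<close>
  let ?k = "\<lambda>y. h y + M"
  have k: "?k \<in> borel_measurable borel" "\<And>y. \<bar>?k y\<bar> \<le> 2 * M" "\<And>y. 0 \<le> ?k y"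
    using b by (auto simp: abs_le_iff) (smt (verit) b)+
  have c: "(\<lambda>_::'a. M) \<in> borel_measurable borel" "\<And>y::'a. \<bar>M\<bar> \<le> M" using M by auto
  have ka: "sph_avg ?k r = sph_avg h r + M" for r
  proof -
    have "sph_avg ?k r = sph_avg h r + sph_avg (\<lambda>_::'a. M) r"
      unfolding sph_avg_def distrib_left[of "indicator _ _"]
      by (subst Bochner_Integration.integral_add[OF integrable_sph_avg[OF assms(1) b] integrable_sph_avg[OF c]])
        (simp add: distrib_left)
    then show ?thesis by (simp add: sph_avg_const)
  qed
  have "(LINT y|lborel. h y * w (norm y)) = (LINT y|lborel. ?k y * w (norm y)) - (LINT y|lborel. M * w (norm (y::'a)))"
    using i3[OF k(1,2)] i3[OF c] by (subst Bochner_Integration.integral_diff[symmetric]) (auto simp: distrib_right)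
  also have "\<dots> = ?o * (LINT r|lborel. r powr (?n - 1) * w r * sph_avg ?k r) - ?o * (LINT r|lborel. r powr (?n - 1) * w r * sph_avg (\<lambda>_::'a. M) r)"
    by (subst pos[OF k], subst pos[OF c M]) simp
  also have "\<dots> = ?o * (LINT r|lborel. r powr (?n - 1) * w r * sph_avg ?k r - r powr (?n - 1) * w r * sph_avg (\<lambda>_::'a. M) r)"
    using i2[OF k(1,2)] i2[OF c] by (subst Bochner_Integration.integral_diff) (auto simp: right_diff_distrib)
  also have "\<dots> = ?o * (LINT r|lborel. r powr (?n - 1) * w r * sph_avg h r)"
    unfolding ka sph_avg_const by (simp add: distrib_left)
  finally show "(LINT y|lborel. h y * w (norm y)) = ?o * (LINT r|lborel. r powr (?n - 1) * w r * sph_avg h r)" .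
qed

section \<open>Volume of neighbourhoods of the boundary\<close>

lemma emeasure_lborel_translate:
  fixes A :: "'a::euclidean_space set"
  assumes [measurable]: "A \<in> sets borel"
  shows "emeasure lborel {z. z + v \<in> A} = emeasure lborel A"
proof -
  have "emeasure lborel A = emeasure (distr lborel borel ((+) v)) A"
    by (simp add: lborel_distr_plus)
  also have "\<dots> = emeasure lborel {z. z + v \<in> A}"
    by (subst emeasure_distr) (auto intro!: arg_cong2[where f=emeasure] simp: add.commute)
  finally show ?thesis ..
qed

lemma infdist_less_obtain:
  assumes "infdist y S < t" "S \<noteq> {}"
  obtains q where "q \<in> S" "dist y q < t"
  using assms by (auto simp: infdist_def cINF_less_iff)

text \<open>A frontier point lies outside the open set, so the defining function is nonnegative
  there; a positive value would persist on a neighbourhood missing \<open>\<Omega>\<close>, which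
  contradicts membership in the closure.\<close>

lemma frontier_level:
  fixes \<psi> :: "'a::euclidean_space \<Rightarrow> real"
  assumes "open \<Omega>" "continuous_on (ball p r) \<psi>" "\<Omega> \<inter> ball p r = {x \<in> ball p r. \<psi> x < 0}"
    "q \<in> frontier \<Omega>" "q \<in> ball p r"
  shows "\<psi> q = 0"
proof -
  have "q \<notin> \<Omega>" using assms by (simp add: frontier_def interior_open)
  then have "\<psi> q \<ge> 0" using assms by force
  moreover have "\<psi> q \<le> 0"
  proof (rule ccontr)
    assume "\<not> \<psi> q \<le> 0"
    then have "q \<in> \<psi> -` {0<..} \<inter> ball p r" using assms by auto
    moreover have "open (\<psi> -` {0<..} \<inter> ball p r)"
      using assms(2) by (metis continuous_on_open_vimage open_ball open_greaterThan)
    ultimately have "\<psi> -` {0<..} \<inter> ball p r \<inter> \<Omega> \<noteq> {}"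
      using assms(4) by (subst open_Int_closure_eq_empty[symmetric]) (auto simp: frontier_def)
    then show False using assms(3) by force
  qed
  ultimately show ?thesis by simp
qed

text \<open>In a chart the defining function grows at least linearly in some direction e, so translates
  of the t-neighbourhood of the boundary by multiples of a fixed multiple of t e are disjoint;
  counting them bounds the volume of the neighbourhood.\<close>

lemma chart_volume:
  fixes \<Omega> :: "'a::euclidean_space set"
  assumes opn: "open \<Omega>" and C2: "C2_boundary \<Omega>" and p: "p \<in> frontier \<Omega>"
  obtains \<rho> C where "\<rho> > 0" "C > 0"
    "\<And>x R t. ball x R \<subseteq> ball p \<rho> \<Longrightarrow> 0 < t \<Longrightarrow> t \<le> R \<Longrightarrow>
       emeasure lborel {y \<in> ball x R. infdist y (frontier \<Omega>) < t} \<le> ennreal (C * t * R ^ (DIM('a) - 1))"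
proof -
  from C2 p obtain r \<psi> where r: "r > 0" and c2: "C2_on (ball p r) \<psi>"
    and nz: "\<And>x. x \<in> ball p r \<Longrightarrow> frechet_derivative \<psi> (at x) \<noteq> (\<lambda>h. 0)"
    and \<Omega>: "\<Omega> \<inter> ball p r = {x\<in>ball p r. \<psi> x < 0}"
    unfolding C2_boundary_def by blast
  from c2 obtain G H where G: "\<And>x. x \<in> ball p r \<Longrightarrow> (\<psi> has_derivative (\<lambda>h. G x \<bullet> h)) (at x)"
    and H: "\<And>x. x \<in> ball p r \<Longrightarrow> (G has_derivative H x) (at x)"
    unfolding C2_on_def by blast
  have pr: "p \<in> ball p r" using r by simp
  have cont: "continuous_on (ball p r) \<psi>"
    using G by (meson continuous_at_imp_continuous_on has_derivative_continuous)
  have "G p \<noteq> 0" using nz[OF pr] frechet_derivative_at[OF G[OF pr]] by auto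
  then obtain b where b: "b \<in> Basis" "G p \<bullet> b \<noteq> 0"
    by (meson euclidean_all_zero_iff)
  \<comment> \<open>A signed basis vector is enough: it has norm 1 and the gradient at
    \<open>p\<close> has positive slope along it.\<close>
  define e where "e = sgn (G p \<bullet> b) *\<^sub>R b"
  have e: "norm e = 1" "G p \<bullet> e > 0"
    using b by (auto simp: e_def sgn_if)
  define c where "c = (G p \<bullet> e) / 2"
  define L where "L = norm (G p) + 1"
  have c: "c > 0" and L: "L > 0" using e by (auto simp: c_def L_def add_nonneg_pos)
  have "isCont G p" using H[OF pr] by (rule has_derivative_continuous)
  \<comment> \<open>Deviating by less than \<open>c\<close>, half the slope at \<open>p\<close>,
    leaves slope at least \<open>c\<close> along \<open>e\<close>; deviating by less than 1 keeps
    the gradient below \<open>L\<close>.\<close>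
  moreover have "min c 1 > 0" using c by simp
  ultimately obtain d where d: "d > 0" "\<And>x. dist x p < d \<Longrightarrow> dist (G x) (G p) < min c 1"
    unfolding continuous_at_eps_delta by blast
  define \<rho>1 where "\<rho>1 = min r d"
  have \<rho>1: "\<rho>1 > 0" "ball p \<rho>1 \<subseteq> ball p r" using r d by (auto simp: \<rho>1_def)
  have Ge: "G x \<bullet> e \<ge> c" and GL: "norm (G x) \<le> L" if "x \<in> ball p \<rho>1" for x
  proof -
    have dd: "norm (G x - G p) < c" "norm (G x - G p) < 1"
      using d(2)[of x] that by (auto simp: \<rho>1_def dist_commute[of p] dist_norm[symmetric])
    have "\<bar>(G x - G p) \<bullet> e\<bar> \<le> norm (G x - G p)"
      using Cauchy_Schwarz_ineq2[of "G x - G p" e] e by simp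
    then show "G x \<bullet> e \<ge> c" using dd by (simp add: inner_diff_left c_def)
    show "norm (G x) \<le> L" using dd norm_triangle_sub[of "G x" "G p"] by (simp add: L_def)
  qed
  have lip: "\<bar>\<psi> y - \<psi> q\<bar> \<le> L * norm (y - q)" if "y \<in> ball p \<rho>1" "q \<in> ball p \<rho>1" for y q
  proof -
    have "norm (\<psi> y - \<psi> q) \<le> L * norm (y - q)"
    proof (rule differentiable_bound[OF convex_ball _ _ that])
      fix x assume x: "x \<in> ball p \<rho>1"
      show "(\<psi> has_derivative (\<lambda>h. G x \<bullet> h)) (at x within ball p \<rho>1)"
        using G x \<rho>1 by (meson has_derivative_at_withinI subsetD)
      show "onorm (\<lambda>h. G x \<bullet> h) \<le> L"
        by (rule onorm_le) (metis GL[OF x] Cauchy_Schwarz_ineq2 mult_right_mono norm_ge_zero order_trans real_norm_def)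
    qed
    then show ?thesis by simp
  qed
  have grow: "\<psi> (y + \<tau> *\<^sub>R e) - \<psi> y \<ge> c * \<tau>"
    if y: "y \<in> ball p \<rho>1" "y + \<tau> *\<^sub>R e \<in> ball p \<rho>1" and \<tau>: "\<tau> \<ge> 0" for y \<tau>
  proof (cases "\<tau> = 0")
    case False
    then have \<tau>: "\<tau> > 0" using \<tau> by simp
    have seg: "y + u *\<^sub>R e \<in> ball p \<rho>1" if "0 \<le> u" "u \<le> \<tau>" for u
    proof -
      have "y + u *\<^sub>R e = (1 - u / \<tau>) *\<^sub>R y + (u / \<tau>) *\<^sub>R (y + \<tau> *\<^sub>R e)"
        using \<tau> by (simp add: algebra_simps)
      also have "\<dots> \<in> ball p \<rho>1"
        using that \<tau> by (intro convexD[OF convex_ball y]) auto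
      finally show ?thesis .
    qed
    have "\<exists>z>0. z < \<tau> \<and> \<psi> (y + \<tau> *\<^sub>R e) - \<psi> (y + 0 *\<^sub>R e) = (\<tau> - 0) * (G (y + z *\<^sub>R e) \<bullet> e)"
    proof (rule MVT2[OF \<tau>])
      fix u assume u: "0 \<le> u" "u \<le> \<tau>"
      have "y + u *\<^sub>R e \<in> ball p r" using seg[OF u] \<rho>1 by auto
      then have "((\<lambda>u. \<psi> (y + u *\<^sub>R e)) has_derivative (\<lambda>h. G (y + u *\<^sub>R e) \<bullet> (h *\<^sub>R e))) (at u)"
        by (intro has_derivative_compose[of "\<lambda>u. y + u *\<^sub>R e" "\<lambda>h. h *\<^sub>R e" u UNIV \<psi> "\<lambda>h. G (y + u *\<^sub>R e) \<bullet> h"] G)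
          (auto intro!: derivative_eq_intros)
      then show "((\<lambda>u. \<psi> (y + u *\<^sub>R e)) has_real_derivative G (y + u *\<^sub>R e) \<bullet> e) (at u)"
        by (simp add: has_field_derivative_def mult_commute_abs)
    qed
    then obtain z where z: "z > 0" "z < \<tau>" "\<psi> (y + \<tau> *\<^sub>R e) - \<psi> y = \<tau> * (G (y + z *\<^sub>R e) \<bullet> e)"
      by auto
    have "\<tau> * (G (y + z *\<^sub>R e) \<bullet> e) \<ge> \<tau> * c"
      using z \<tau> by (intro mult_left_mono Ge seg) auto
    then show ?thesis using z by (simp add: mult.commute)
  qed simp
  \<comment> \<open>Inside the layer the defining function has modulus at most L t, so two of its
    values differ by at most 2 L t. A shift by m t along \<open>e\<close> raises it by at least m c
    t = (2 L + 1) t, which is more.\<close>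
  define m where "m = (2 * L + 1) / c"
  have m: "m > 0" "m * c = 2 * L + 1" using L c by (auto simp: m_def)
  let ?v = "unit_ball_vol (real DIM('a))"
  have v: "?v > 0" by (simp add: unit_ball_vol_pos)
  define C where "C = m * ?v * (2 + m) ^ DIM('a)"
  have C: "C > 0" using m v by (simp add: C_def)
  show ?thesis
  \<comment> \<open>Halving the radius keeps the nearby frontier points in the chart: they are
    within t <= R <= rho1/2 of a point of the ball of radius rho1/2.\<close>
  proof (rule that[of "\<rho>1 / 2" C])
    show "\<rho>1 / 2 > 0" "C > 0" using \<rho>1 C by auto
    fix x :: 'a and R t :: real
    assume sub: "ball x R \<subseteq> ball p (\<rho>1 / 2)" and t: "0 < t" "t \<le> R"
    then have R: "R > 0" "R \<le> \<rho>1 / 2" using zero_le_dist[of x p] by (auto simp: ball_subset_ball_iff simp del: zero_le_dist)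
    define A where "A = {y \<in> ball x R. infdist y (frontier \<Omega>) < t}"
    have Ao: "open A"
    proof -
      have "A = ball x R \<inter> (\<lambda>y. infdist y (frontier \<Omega>)) -` {..<t}" by (auto simp: A_def)
      then show ?thesis
        by (auto intro!: open_Int open_vimage continuous_on_infdist continuous_on_id)
    qed
    then have Am [measurable]: "A \<in> sets borel" by simp
    have A\<rho>: "y \<in> ball p \<rho>1" and A\<psi>: "\<bar>\<psi> y\<bar> \<le> L * t" if yA: "y \<in> A" for y
    proof -
      have y: "y \<in> ball p (\<rho>1 / 2)" using yA sub by (auto simp: A_def)
      then show y': "y \<in> ball p \<rho>1" using \<rho>1 by auto
      obtain q where q: "q \<in> frontier \<Omega>" "dist y q < t"
        using yA p infdist_less_obtain[of y "frontier \<Omega>" t] by (auto simp: A_def)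
      have "dist p q < \<rho>1"
        using q y t R dist_triangle[of p q y] by auto
      then have "q \<in> ball p \<rho>1" by simp
      then have "\<bar>\<psi> y - \<psi> q\<bar> \<le> L * norm (y - q)" "\<psi> q = 0"
        using lip[OF y'] frontier_level[OF opn cont \<Omega> q(1)] \<rho>1 by auto
      moreover have "L * norm (y - q) \<le> L * t"
        using q L by (intro mult_left_mono) (auto simp: dist_norm)
      ultimately show "\<bar>\<psi> y\<bar> \<le> L * t" by simp
    qed
    \<comment> \<open>About R/(m t) translates: few enough that all shifts are at most R, so their
      union stays in a ball of radius comparable to R, and enough to gain the factor t/R in the
      volume.\<close>
    define K where "K = nat \<lceil>R / (m * t)\<rceil>"
    have mt: "m * t > 0" using m t by simp
    have K: "real K \<ge> R / (m * t)" "real K < R / (m * t) + 1"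
      using R mt by (auto simp: K_def) (linarith | simp)+
    define B where "B k = {z. z + (real k * (m * t)) *\<^sub>R e \<in> A}" for k
    have Bm [measurable]: "B k \<in> sets borel" for k
    proof -
      have "(\<lambda>z. z + (real k * (m * t)) *\<^sub>R e) -` A \<inter> space borel \<in> sets borel"
        by (rule measurable_sets[OF _ Am]) measurable
      then show ?thesis by (simp add: B_def vimage_def)
    qed
    have BA: "emeasure lborel (B k) = emeasure lborel A" for k
      unfolding B_def by (rule emeasure_lborel_translate) measurable
    have disj1: "B j \<inter> B k = {}" if "j < k" for j k
    proof (rule ccontr)
      assume "B j \<inter> B k \<noteq> {}"
      then obtain z where z: "z + (real j * (m * t)) *\<^sub>R e \<in> A" "z + (real k * (m * t)) *\<^sub>R e \<in> A"
        by (auto simp: B_def)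
      let ?y = "z + (real j * (m * t)) *\<^sub>R e" and ?\<tau> = "(real k - real j) * (m * t)"
      have eq: "z + (real k * (m * t)) *\<^sub>R e = ?y + ?\<tau> *\<^sub>R e"
        by (simp add: algebra_simps)
      have "real k - real j \<ge> 1" using that by linarith
      then have \<tau>: "?\<tau> \<ge> m * t" using mt mult_right_mono[of 1 "real k - real j" "m * t"] by simp
      have "c * ?\<tau> \<le> \<psi> (?y + ?\<tau> *\<^sub>R e) - \<psi> ?y"
        using z mt \<tau> by (intro grow A\<rho>) (auto simp: eq[symmetric])
      also have "\<dots> \<le> 2 * (L * t)"
        using A\<psi>[OF z(1)] A\<psi>[OF z(2)] unfolding eq by linarith
      finally have "c * (m * t) \<le> 2 * (L * t)"
        using mult_left_mono[OF \<tau>, of c] c by linarith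
      moreover have "c * (m * t) = 2 * (L * t) + t"
      proof -
        have "c * (m * t) = (m * c) * t" by simp
        then show ?thesis unfolding m(2) by (simp add: distrib_right)
      qed
      ultimately show False using t by simp
    qed
    have disj: "disjoint_family_on B {..<K}"
      unfolding disjoint_family_on_def using disj1 by (metis Int_commute linorder_neqE_nat)
    have sub': "(\<Union>k<K. B k) \<subseteq> ball x ((2 + m) * R)"
    proof
      fix z assume "z \<in> (\<Union>k<K. B k)"
      then obtain k where k: "k < K" "z \<in> B k" by auto
      have k1: "real k * (m * t) \<le> R"
      proof -
        have "real k \<le> real K - 1" using k by linarith
        then have "real k \<le> R / (m * t)" using K by linarith
        then show ?thesis using mt by (simp add: field_simps)
      qed
      have "norm (x - z) \<le> norm (x - (z + (real k * (m * t)) *\<^sub>R e)) + norm ((real k * (m * t)) *\<^sub>R e)"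
        using norm_triangle_ineq[of "x - (z + (real k * (m * t)) *\<^sub>R e)" "(real k * (m * t)) *\<^sub>R e"] by simp
      also have "\<dots> < R + R"
        using k k1 e mt by (intro add_less_le_mono) (auto simp: B_def A_def dist_norm)
      also have "\<dots> \<le> (2 + m) * R" using m R by (simp add: algebra_simps)
      finally show "z \<in> ball x ((2 + m) * R)" by (simp add: dist_norm)
    qed
    have "ennreal (real K) * emeasure lborel A = (\<Sum>k<K. emeasure lborel (B k))"
      by (simp add: BA ennreal_of_nat_eq_real_of_nat)
    also have "\<dots> = emeasure lborel (\<Union>k<K. B k)"
      by (rule sum_emeasure) (use disj in auto)
    also have "\<dots> \<le> emeasure lborel (ball x ((2 + m) * R))"
      by (rule emeasure_mono[OF sub']) simp
    also have "\<dots> = ennreal (?v * ((2 + m) * R) ^ DIM('a))"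
      using m R by (intro emeasure_ball) simp
    finally have le: "ennreal (real K) * emeasure lborel A \<le> ennreal (?v * ((2 + m) * R) ^ DIM('a))" .
    have mtR: "m * t / R > 0" using mt R by simp
    have "1 \<le> (m * t / R) * real K"
      using K(1) mt R by (simp add: field_simps)
    then have "emeasure lborel A \<le> ennreal ((m * t / R) * real K) * emeasure lborel A"
      by (metis ennreal_1 ennreal_leI mult_right_mono zero_le mult_1)
    also have "\<dots> = ennreal (m * t / R) * (ennreal (real K) * emeasure lborel A)"
      using mtR by (subst ennreal_mult) (auto simp: mult.assoc)
    also have "\<dots> \<le> ennreal (m * t / R) * ennreal (?v * ((2 + m) * R) ^ DIM('a))"
      by (intro mult_left_mono le) simp
    also have "\<dots> = ennreal ((m * t / R) * (?v * ((2 + m) * R) ^ DIM('a)))"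
      using mtR v m R by (intro ennreal_mult[symmetric]) auto
    also have "(m * t / R) * (?v * ((2 + m) * R) ^ DIM('a)) = C * t * R ^ (DIM('a) - 1)"
    proof -
      have "R ^ DIM('a) = R * R ^ (DIM('a) - 1)"
        by (metis DIM_positive power_eq_if not_gr_zero)
      then show ?thesis using R by (simp add: C_def power_mult_distrib)
    qed
    finally show "emeasure lborel {y \<in> ball x R. infdist y (frontier \<Omega>) < t} \<le> ennreal (C * t * R ^ (DIM('a) - 1))"
      by (simp add: A_def)
  qed
qed

text \<open>Compactness of the frontier reduces the bound to finitely many charts. A small ball
  meeting the layer lies in one chart; for a larger ball and thin layer, the layers of all charts
  are summed; for a thick layer the full ball volume suffices.\<close>

lemma boundary_volume:
  fixes \<Omega> :: "'a::euclidean_space set"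
  assumes bdd: "bounded \<Omega>" and opn: "open \<Omega>" and C2: "C2_boundary \<Omega>" and ne: "frontier \<Omega> \<noteq> {}"
    and P: "P > 0"
  obtains C where "C > 0"
    "\<And>x R t. 0 < t \<Longrightarrow> t \<le> R \<Longrightarrow> R \<le> P \<Longrightarrow>
       emeasure lborel {y \<in> ball x R. infdist y (frontier \<Omega>) < t} \<le> ennreal (C * t * R ^ (DIM('a) - 1))"
proof -
  let ?S = "frontier \<Omega>" and ?n = "DIM('a)" and ?v = "unit_ball_vol (real DIM('a))"
  have "\<forall>p\<in>?S. \<exists>z. fst z > 0 \<and> snd z > 0 \<and>
      (\<forall>x R t. ball x R \<subseteq> ball p (fst z) \<longrightarrow> 0 < t \<longrightarrow> t \<le> R \<longrightarrow>
       emeasure lborel {y \<in> ball x R. infdist y ?S < t} \<le> ennreal (snd z * t * R ^ (?n - 1)))"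
  proof
    fix p assume "p \<in> ?S"
    from chart_volume[OF opn C2 this] obtain \<rho> C where
      "\<rho> > 0" "C > 0" "\<And>x R t. ball x R \<subseteq> ball p \<rho> \<Longrightarrow> 0 < t \<Longrightarrow> t \<le> R \<Longrightarrow>
       emeasure lborel {y \<in> ball x R. infdist y ?S < t} \<le> ennreal (C * t * R ^ (?n - 1))" by blast
    then show "\<exists>z. fst z > 0 \<and> snd z > 0 \<and>
      (\<forall>x R t. ball x R \<subseteq> ball p (fst z) \<longrightarrow> 0 < t \<longrightarrow> t \<le> R \<longrightarrow>
       emeasure lborel {y \<in> ball x R. infdist y ?S < t} \<le> ennreal (snd z * t * R ^ (?n - 1)))"
      by (intro exI[of _ "(\<rho>, C)"]) auto
  qed
  from bchoice[OF this] obtain z where z: "\<forall>p\<in>?S. fst (z p) > 0 \<and> snd (z p) > 0 \<and>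
      (\<forall>x R t. ball x R \<subseteq> ball p (fst (z p)) \<longrightarrow> 0 < t \<longrightarrow> t \<le> R \<longrightarrow>
       emeasure lborel {y \<in> ball x R. infdist y ?S < t} \<le> ennreal (snd (z p) * t * R ^ (?n - 1)))" ..
  define \<rho> where "\<rho> p = fst (z p)" for p
  define C where "C p = snd (z p)" for p
  have \<rho>: "\<And>p. p \<in> ?S \<Longrightarrow> \<rho> p > 0" and C: "\<And>p. p \<in> ?S \<Longrightarrow> C p > 0"
    and V: "\<And>p x R t. p \<in> ?S \<Longrightarrow> ball x R \<subseteq> ball p (\<rho> p) \<Longrightarrow> 0 < t \<Longrightarrow> t \<le> R \<Longrightarrow>
       emeasure lborel {y \<in> ball x R. infdist y ?S < t} \<le> ennreal (C p * t * R ^ (?n - 1))"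
    using z unfolding \<rho>_def C_def by blast+
  have "compact ?S" using bdd by (rule compact_frontier_bounded)
  then obtain T where T: "T \<subseteq> ?S" "finite T" "?S \<subseteq> (\<Union>p\<in>T. ball p (\<rho> p / 4))"
  proof (rule compactE_image[of ?S ?S "\<lambda>p. ball p (\<rho> p / 4)"])
    show "?S \<subseteq> (\<Union>p\<in>?S. ball p (\<rho> p / 4))"
    proof
      fix p assume p: "p \<in> ?S"
      then have "p \<in> ball p (\<rho> p / 4)" using \<rho> by simp
      then show "p \<in> (\<Union>p\<in>?S. ball p (\<rho> p / 4))" using p by blast
    qed
  qed auto
  have Tne: "T \<noteq> {}" using T ne by auto
  \<comment> \<open>One eighth suffices: a ball of radius at most \<open>r0\<close> that meets the
    layer has its centre within rho/4 + 2 rho/8 of a chart centre, hence stays inside that chart. A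
    layer thinner than \<open>r0\<close> lies in the balls of radius rho/2.\<close>
  define r0 where "r0 = Min ((\<lambda>p. \<rho> p / 8) ` T)"
  have r0: "r0 > 0" using T Tne \<rho> by (auto simp: r0_def)
  have r0le: "r0 \<le> \<rho> p / 8" if "p \<in> T" for p unfolding r0_def using T that by (intro Min_le) auto
  have v: "?v > 0" by (simp add: unit_ball_vol_pos)
  define C1 where "C1 = (\<Sum>p\<in>T. C p)"
  define C2 where "C2 = (\<Sum>p\<in>T. C p * (\<rho> p / 2) ^ (?n - 1))"
  \<comment> \<open>One summand for each of the three regimes. In the second, R^(N-1) is bounded
    below by r0^(N-1); in the third, R is at most (P/r0) t.\<close>
  define C3 where "C3 = C1 + C2 / r0 ^ (?n - 1) + ?v * P / r0"
  have TS: "C p > 0" "\<rho> p > 0" if "p \<in> T" for p using that T C \<rho> by blast+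
  have C1: "C1 > 0" unfolding C1_def using T Tne TS by (intro sum_pos) auto
  have C2: "C2 > 0" unfolding C2_def using T Tne TS by (intro sum_pos mult_pos_pos zero_less_power) auto
  have le3: "C1 \<le> C3" "C2 / r0 ^ (?n - 1) \<le> C3" "?v * P / r0 \<le> C3"
    using C1 C2 r0 v P by (simp_all add: C3_def)
  have near: "\<exists>p\<in>T. \<exists>q. dist p q < \<rho> p / 4 \<and> dist y q < t" if lt: "infdist y ?S < t" for y t
  proof -
    obtain q where q: "q \<in> ?S" "dist y q < t" using infdist_less_obtain[OF lt ne] by blast
    then obtain p where "p \<in> T" "q \<in> ball p (\<rho> p / 4)" using T(3) by blast
    then show ?thesis using q by auto
  qed
  show ?thesis
  proof (rule that[of C3])
    show "C3 > 0" using C1 le3 by linarith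
    fix x :: 'a and R t :: real
    assume t: "0 < t" "t \<le> R" and R: "R \<le> P"
    then have R0: "R > 0" by linarith
    let ?A = "{y \<in> ball x R. infdist y ?S < t}"
    have mono: "ennreal (c * t * R ^ (?n - 1)) \<le> ennreal (C3 * t * R ^ (?n - 1))" if "c \<le> C3" for c
      using that t R0 by (intro ennreal_leI mult_right_mono) auto
    consider "R \<le> r0" | "R > r0" "t \<le> r0" | "t > r0" by linarith
    then show "emeasure lborel ?A \<le> ennreal (C3 * t * R ^ (?n - 1))"
    proof cases
      case 1
      show ?thesis
      proof (cases "?A = {}")
        case False
        then obtain y where y: "dist x y < R" "infdist y ?S < t" by auto
        obtain p q where pq: "p \<in> T" "dist p q < \<rho> p / 4" "dist y q < t" using near[OF y(2)] by auto
        have "dist x p \<le> dist x y + dist y q + dist p q"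
          using dist_triangle[of x p y] dist_triangle[of y p q] dist_commute[of q p] by linarith
        then have "dist x p + R \<le> \<rho> p"
          using pq y 1 r0le[OF pq(1)] t by linarith
        then have "ball x R \<subseteq> ball p (\<rho> p)" by (simp add: ball_subset_ball_iff)
        then have "emeasure lborel ?A \<le> ennreal (C p * t * R ^ (?n - 1))"
          using V pq T t by blast
        also have "\<dots> \<le> ennreal (C3 * t * R ^ (?n - 1))"
        proof (rule mono)
          have "C p \<le> C1" unfolding C1_def using T C pq by (intro member_le_sum) (auto intro: less_imp_le)
          then show "C p \<le> C3" using le3 by linarith
        qed
        finally show ?thesis .
      qed (simp only: emeasure_empty zero_le)
    next
      case 2
      let ?B = "\<lambda>p. {y \<in> ball p (\<rho> p / 2). infdist y ?S < t}"
      have Bm: "?B p \<in> sets borel" for p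
      proof -
        have "?B p = ball p (\<rho> p / 2) \<inter> (\<lambda>y. infdist y ?S) -` {..<t}" by auto
        then show ?thesis
          by (auto intro!: borel_open open_Int open_vimage continuous_on_infdist continuous_on_id)
      qed
      have "?A \<subseteq> (\<Union>p\<in>T. ?B p)"
      proof
        fix y assume y: "y \<in> ?A"
        then obtain p q where pq: "p \<in> T" "dist p q < \<rho> p / 4" "dist y q < t" using near[of y t] by auto
        have "dist p y < \<rho> p / 2"
          using dist_triangle2[of p y q] pq 2 r0le[OF pq(1)] TS(2)[OF pq(1)] by linarith
        then show "y \<in> (\<Union>p\<in>T. ?B p)" using pq y by auto
      qed
      then have "emeasure lborel ?A \<le> emeasure lborel (\<Union>p\<in>T. ?B p)"
        using Bm T by (intro emeasure_mono) auto
      also have "\<dots> \<le> (\<Sum>p\<in>T. emeasure lborel (?B p))"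
        using Bm T by (intro emeasure_subadditive_finite) auto
      also have "\<dots> \<le> (\<Sum>p\<in>T. ennreal (C p * t * (\<rho> p / 2) ^ (?n - 1)))"
      proof (rule sum_mono)
        fix p assume p: "p \<in> T"
        then have "\<rho> p > 0" using \<rho> T by auto
        then show "emeasure lborel (?B p) \<le> ennreal (C p * t * (\<rho> p / 2) ^ (?n - 1))"
          using p T t 2 r0le[OF p] by (intro V) auto
      qed
      also have "\<dots> = ennreal (\<Sum>p\<in>T. C p * t * (\<rho> p / 2) ^ (?n - 1))"
        using C \<rho> T t by (intro sum_ennreal mult_nonneg_nonneg zero_le_power) (use TS in \<open>auto intro: less_imp_le\<close>)
      also have "(\<Sum>p\<in>T. C p * t * (\<rho> p / 2) ^ (?n - 1)) = C2 * t"
        unfolding C2_def sum_distrib_right by (intro sum.cong) (auto simp only: mult_ac)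
      also have "ennreal (C2 * t) \<le> ennreal ((C2 / r0 ^ (?n - 1)) * t * R ^ (?n - 1))"
      proof (rule ennreal_leI)
        have "r0 ^ (?n - 1) \<le> R ^ (?n - 1)" using 2 r0 by (intro power_mono) auto
        then have "C2 * t * r0 ^ (?n - 1) \<le> C2 * t * R ^ (?n - 1)" using C2 t by (intro mult_left_mono) auto
        then show "C2 * t \<le> (C2 / r0 ^ (?n - 1)) * t * R ^ (?n - 1)"
          using r0 by (simp add: field_simps)
      qed
      also have "\<dots> \<le> ennreal (C3 * t * R ^ (?n - 1))" by (rule mono) (rule le3)
      finally show ?thesis .
    next
      case 3
      have "emeasure lborel ?A \<le> emeasure lborel (ball x R)" by (rule emeasure_mono) auto
      also have "\<dots> = ennreal (?v * R ^ ?n)" using R0 by (simp add: emeasure_ball)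
      also have "\<dots> \<le> ennreal ((?v * P / r0) * t * R ^ (?n - 1))"
      proof (rule ennreal_leI)
        have "R * r0 \<le> P * t" using R 3 r0 P by (intro mult_mono) auto
        then have "R \<le> P / r0 * t" using r0 by (simp add: field_simps)
        then have "?v * R * R ^ (?n - 1) \<le> ?v * (P / r0 * t) * R ^ (?n - 1)"
          using v R0 by (intro mult_right_mono mult_left_mono) auto
        moreover have "R ^ ?n = R * R ^ (?n - 1)"
          by (metis DIM_positive power_eq_if not_gr_zero)
        ultimately show "?v * R ^ ?n \<le> (?v * P / r0) * t * R ^ (?n - 1)" by (simp add: mult_ac)
      qed
      also have "\<dots> \<le> ennreal (C3 * t * R ^ (?n - 1))" by (rule mono) (rule le3)
      finally show ?thesis .
    qed
  qed
qed

section \<open>Dyadic integrals of negative powers of the boundary distance\<close>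

lemma dyadic_below:
  fixes d R :: real
  assumes "0 < d" "d < R"
  obtains j where "R * (1/2) ^ Suc j \<le> d" "d < R * (1/2) ^ j"
proof -
  have "\<exists>m. (1/2::real) ^ m < d / R" using assms by (intro real_arch_pow_inv) auto
  then have ex: "\<exists>m. R * (1/2) ^ m \<le> d" using assms by (auto simp: field_simps intro: less_imp_le)
  define m where "m = (LEAST m. R * (1/2) ^ m \<le> d)"
  have m: "R * (1/2) ^ m \<le> d" unfolding m_def by (rule LeastI_ex[OF ex])
  have "m \<noteq> 0" using m assms by (intro notI) simp
  then obtain j where j: "m = Suc j" by (cases m) auto
  have "\<not> R * (1/2) ^ j \<le> d" using j not_less_Least[of j "\<lambda>m. R * (1/2) ^ m \<le> d"] by (simp add: m_def)
  then show ?thesis using m j that[of j] by auto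
qed

lemma dyadic_above:
  fixes d r :: real
  assumes "0 < r" "r \<le> d"
  obtains k where "r * 2 ^ k \<le> d" "d < r * 2 ^ Suc k"
proof -
  have "\<exists>m. d / r < (2::real) ^ m" by (rule real_arch_pow) simp
  then have ex: "\<exists>m. d < r * 2 ^ m" using assms by (auto simp: field_simps)
  define m where "m = (LEAST m. d < r * 2 ^ m)"
  have m: "d < r * 2 ^ m" unfolding m_def by (rule LeastI_ex[OF ex])
  have "m \<noteq> 0" using m assms by (intro notI) auto
  then obtain j where j: "m = Suc j" by (cases m) auto
  have "\<not> d < r * 2 ^ j" using j not_less_Least[of j "\<lambda>m. d < r * 2 ^ m"] by (simp add: m_def)
  then show ?thesis using m j that[of j] by auto
qed

lemma ennreal_le_suminf:
  fixes f :: "nat \<Rightarrow> ennreal"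
  shows "f k \<le> (\<Sum>k. f k)"
  using sum_le_suminf[of f "{k}"] by simp

lemma suminf_ennreal_geometric:
  assumes "0 \<le> q" "q < 1" "0 \<le> c"
  shows "(\<Sum>j. ennreal (c * q ^ j)) = ennreal (c / (1 - q))"
proof -
  have "summable (\<lambda>j. c * q ^ j)" using assms by (intro summable_mult summable_geometric) auto
  then have "(\<Sum>j. ennreal (c * q ^ j)) = ennreal (\<Sum>j. c * q ^ j)"
    using assms by (intro suminf_ennreal2) auto
  also have "(\<Sum>j. c * q ^ j) = c / (1 - q)"
    using assms by (subst suminf_mult) (auto intro: summable_geometric simp: suminf_geometric)
  finally show ?thesis .
qed

text \<open>Where d is about R 2^(-j), the weight is about R^(-eps) 2^(eps j) and the volume is
  O(R^N 2^(-j)): a geometric series with ratio 2^(-(1-eps)), convergent because eps < 1. The points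
  with d >= R give the ball volume in the constant.\<close>

lemma ball_integral_powr:
  fixes d :: "'a::euclidean_space \<Rightarrow> real"
  assumes [measurable]: "d \<in> borel_measurable borel" and d0: "\<And>y. d y \<ge> 0"
    and C: "C > 0" and \<epsilon>: "0 < \<epsilon>" "\<epsilon> < 1"
    and V: "\<And>x R t. 0 < t \<Longrightarrow> t \<le> R \<Longrightarrow> R \<le> P \<Longrightarrow>
       emeasure lborel {y \<in> ball x R. d y < t} \<le> ennreal (C * t * R ^ (DIM('a) - 1))"
    and R: "0 < R" "R \<le> P"
  shows "(\<integral>\<^sup>+y. ennreal (d y powr -\<epsilon>) * indicator (ball x R) y \<partial>lborel)
     \<le> ennreal ((unit_ball_vol (real DIM('a)) + 2 * C / (1 - (1/2) powr (1 - \<epsilon>))) * R powr (real DIM('a) - \<epsilon>))"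
proof -
  let ?n = "real DIM('a)" and ?v = "unit_ball_vol (real DIM('a))"
  let ?a = "\<lambda>j. (R * (1/2) ^ Suc j) powr -\<epsilon>"
  let ?B = "\<lambda>j. {y \<in> ball x R. d y < R * (1/2) ^ j}"
  have v: "?v > 0" by (simp add: unit_ball_vol_pos)
  have [measurable]: "Measurable.pred borel (\<lambda>y. y \<in> ball x R)" by simp
  have [measurable]: "?B j \<in> sets borel" for j by measurable
  have q: "(1/2::real) powr (1 - \<epsilon>) < 1" using \<epsilon> powr_less_mono2[of "1 - \<epsilon>" "1/2" 1] by simp
  have Rn: "R ^ (DIM('a) - 1) = R powr (?n - 1)"
    using R by (subst powr_realpow[symmetric]) (auto simp: of_nat_diff)
  have pw: "ennreal (d y powr -\<epsilon>) * indicator (ball x R) y \<le>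
     ennreal (R powr -\<epsilon>) * indicator (ball x R) y + (\<Sum>j. ennreal (?a j) * indicator (?B j) y)" for y
  proof (cases "y \<in> ball x R \<and> d y > 0")
    case True
    show ?thesis
    proof (cases "d y \<ge> R")
      case ge: True
      have "d y powr -\<epsilon> \<le> R powr -\<epsilon>" using ge R \<epsilon> by (intro powr_mono2') auto
      then have "ennreal (d y powr -\<epsilon>) * indicator (ball x R) y \<le> ennreal (R powr -\<epsilon>) * indicator (ball x R) y"
        by (intro mult_right_mono ennreal_leI) auto
      then show ?thesis by (meson add_increasing2 zero_le)
    next
      case False
      then obtain j where j: "R * (1/2) ^ Suc j \<le> d y" "d y < R * (1/2) ^ j"
        using dyadic_below[of "d y" R] True by auto
      have "d y powr -\<epsilon> \<le> ?a j" using j R \<epsilon> by (intro powr_mono2') auto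
      then have "ennreal (d y powr -\<epsilon>) * indicator (ball x R) y \<le> ennreal (?a j) * indicator (?B j) y"
        using True j by (auto simp: indicator_def intro!: ennreal_leI)
      also have "\<dots> \<le> (\<Sum>j. ennreal (?a j) * indicator (?B j) y)"
        by (rule ennreal_le_suminf)
      finally show ?thesis by (meson add_increasing zero_le)
    qed
  next
    case False
    \<comment> \<open>Where \<open>d\<close> vanishes the integrand does too, because
      \<open>0 powr a = 0\<close>.\<close>
    then have "d y = 0 \<or> y \<notin> ball x R" using d0[of y] by auto
    then show ?thesis by auto
  qed
  have "(\<integral>\<^sup>+y. ennreal (d y powr -\<epsilon>) * indicator (ball x R) y \<partial>lborel) \<le>
    (\<integral>\<^sup>+y. ennreal (R powr -\<epsilon>) * indicator (ball x R) y + (\<Sum>j. ennreal (?a j) * indicator (?B j) y) \<partial>lborel)"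
    by (rule nn_integral_mono) (rule pw)
  also have "\<dots> = ennreal (R powr -\<epsilon>) * emeasure lborel (ball x R) + (\<Sum>j. ennreal (?a j) * emeasure lborel (?B j))"
    by (subst nn_integral_add, measurable, subst nn_integral_suminf, measurable)
       (simp add: nn_integral_cmult_indicator)
  also have "\<dots> \<le> ennreal (?v * R powr (?n - \<epsilon>)) + (\<Sum>j. ennreal (2 * C * R powr (?n - \<epsilon>) * ((1/2) powr (1 - \<epsilon>)) ^ j))"
  proof (rule add_mono)
    have "R powr -\<epsilon> * (?v * R ^ DIM('a)) = ?v * R powr (?n - \<epsilon>)"
      using R by (simp add: powr_realpow[symmetric] powr_diff powr_minus field_simps)
    then show "ennreal (R powr -\<epsilon>) * emeasure lborel (ball x R) \<le> ennreal (?v * R powr (?n - \<epsilon>))"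
      using R v by (simp add: emeasure_ball ennreal_mult[symmetric])
    show "(\<Sum>j. ennreal (?a j) * emeasure lborel (?B j)) \<le> (\<Sum>j. ennreal (2 * C * R powr (?n - \<epsilon>) * ((1/2) powr (1 - \<epsilon>)) ^ j))"
    proof (rule suminf_le)
      fix j
      have "(1/2::real) ^ j \<le> 1" by (simp add: power_le_one)
      then have "emeasure lborel (?B j) \<le> ennreal (C * (R * (1/2) ^ j) * R ^ (DIM('a) - 1))"
        using R by (intro V) auto
      then have "ennreal (?a j) * emeasure lborel (?B j) \<le> ennreal (?a j) * ennreal (C * (R * (1/2) ^ j) * R ^ (DIM('a) - 1))"
        by (rule mult_left_mono) simp
      also have "\<dots> = ennreal (?a j * (C * (R * (1/2) ^ j) * R ^ (DIM('a) - 1)))"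
        using C R by (intro ennreal_mult[symmetric]) auto
      also have "\<dots> \<le> ennreal (2 * C * R powr (?n - \<epsilon>) * ((1/2) powr (1 - \<epsilon>)) ^ j)"
      proof (rule ennreal_leI)
        have h: "((1/2::real)) ^ k = (1/2) powr real k" for k by (simp add: powr_realpow)
        have p2: "(1/2::real) powr -\<epsilon> \<le> 2"
        proof -
          have "(1/2::real) powr -\<epsilon> = 2 powr \<epsilon>" by (simp add: powr_minus powr_divide)
          also have "\<dots> \<le> 2 powr 1" using \<epsilon> by (intro powr_mono) auto
          finally show ?thesis by simp
        qed
        have "?a j = R powr -\<epsilon> * ((1/2) powr -\<epsilon> * (1/2) powr (- \<epsilon> * real j))"
          using R unfolding h by (simp add: powr_mult powr_powr powr_add[symmetric] algebra_simps)
        moreover have "((1/2::real) powr (1 - \<epsilon>)) ^ j = (1/2) powr (- \<epsilon> * real j) * (1/2) powr real j"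
          by (simp add: powr_realpow[symmetric] powr_powr powr_add[symmetric] algebra_simps)
        moreover have "R powr (?n - \<epsilon>) = R powr -\<epsilon> * (R * R powr (?n - 1))"
          using R by (simp add: powr_diff powr_minus field_simps)
        ultimately have "?a j * (C * (R * (1/2) ^ j) * R ^ (DIM('a) - 1)) =
          (1/2) powr -\<epsilon> * (C * R powr (?n - \<epsilon>) * ((1/2) powr (1 - \<epsilon>)) ^ j)"
          unfolding Rn unfolding h by (simp only: mult_ac)
        also have "\<dots> \<le> 2 * (C * R powr (?n - \<epsilon>) * ((1/2) powr (1 - \<epsilon>)) ^ j)"
          using C by (intro mult_right_mono p2) auto
        finally show "?a j * (C * (R * (1/2) ^ j) * R ^ (DIM('a) - 1)) \<le> 2 * C * R powr (?n - \<epsilon>) * ((1/2) powr (1 - \<epsilon>)) ^ j"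
          by simp
      qed
      finally show "ennreal (?a j) * emeasure lborel (?B j) \<le> ennreal (2 * C * R powr (?n - \<epsilon>) * ((1/2) powr (1 - \<epsilon>)) ^ j)" .
    qed auto
  qed
  also have "(\<Sum>j. ennreal (2 * C * R powr (?n - \<epsilon>) * ((1/2) powr (1 - \<epsilon>)) ^ j)) = ennreal (2 * C * R powr (?n - \<epsilon>) / (1 - (1/2) powr (1 - \<epsilon>)))"
    using q C by (intro suminf_ennreal_geometric) auto
  also have "ennreal (?v * R powr (?n - \<epsilon>)) + \<dots> = ennreal ((?v + 2 * C / (1 - (1/2) powr (1 - \<epsilon>))) * R powr (?n - \<epsilon>))"
    using q C v by (subst ennreal_plus[symmetric]) (auto simp: distrib_right)
  finally show ?thesis .
qed

text \<open>Summation over the annuli where norm (x - y) is between r 2^k and r 2^(k+1). The growth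
  exponent N - eps against the kernel leaves (r 2^k)^(-eps-2s). Convergence comes from eps alone, so
  the constant does not degenerate as s tends to 0; a bounded density would cost 1/s here.\<close>

lemma tail_integral_of_ball_growth:
  fixes q :: "'a::euclidean_space \<Rightarrow> ennreal"
  assumes [measurable]: "q \<in> borel_measurable borel" and C: "C > 0" and \<epsilon>: "0 < \<epsilon>" "\<epsilon> < 1"
    and V: "\<And>R. 0 < R \<Longrightarrow> (\<integral>\<^sup>+y. q y * indicator (ball x R) y \<partial>lborel) \<le> ennreal (C * R powr (real DIM('a) - \<epsilon>))"
    and r: "0 < r" and s: "s \<ge> 0"
  shows "(\<integral>\<^sup>+y. q y * ennreal (norm (x - y) powr - (real DIM('a) + 2 * s)) * indicator {r..} (norm (x - y)) \<partial>lborel)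
     \<le> ennreal (C * 2 ^ DIM('a) / (1 - (1/2) powr \<epsilon>) * r powr (- \<epsilon> - 2 * s))"
proof -
  let ?n = "real DIM('a)"
  let ?a = "\<lambda>k. (r * 2 ^ k) powr - (?n + 2 * s)"
  have [measurable]: "Measurable.pred borel (\<lambda>y. y \<in> ball x R)" for R by simp
  have q: "(1/2::real) powr \<epsilon> < 1" using \<epsilon> powr_less_mono2[of \<epsilon> "1/2" 1] by simp
  have pw: "q y * ennreal (norm (x - y) powr - (?n + 2 * s)) * indicator {r..} (norm (x - y)) \<le>
     (\<Sum>k. ennreal (?a k) * (q y * indicator (ball x (r * 2 ^ Suc k)) y))" for y
  proof (cases "norm (x - y) \<ge> r")
    case True
    obtain k where k: "r * 2 ^ k \<le> norm (x - y)" "norm (x - y) < r * 2 ^ Suc k"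
      using dyadic_above[OF r True] .
    have "norm (x - y) powr - (?n + 2 * s) \<le> ?a k" using k r s by (intro powr_mono2') auto
    then have "q y * ennreal (norm (x - y) powr - (?n + 2 * s)) * indicator {r..} (norm (x - y)) \<le> q y * ennreal (?a k)"
      using True by (auto intro!: mult_left_mono ennreal_leI)
    also have "\<dots> = ennreal (?a k) * (q y * indicator (ball x (r * 2 ^ Suc k)) y)"
      using k by (simp add: dist_norm mult.commute)
    also have "\<dots> \<le> (\<Sum>k. ennreal (?a k) * (q y * indicator (ball x (r * 2 ^ Suc k)) y))"
      by (rule ennreal_le_suminf)
    finally show ?thesis .
  qed auto
  have "(\<integral>\<^sup>+y. q y * ennreal (norm (x - y) powr - (?n + 2 * s)) * indicator {r..} (norm (x - y)) \<partial>lborel) \<le>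
    (\<integral>\<^sup>+y. (\<Sum>k. ennreal (?a k) * (q y * indicator (ball x (r * 2 ^ Suc k)) y)) \<partial>lborel)"
    by (rule nn_integral_mono) (rule pw)
  also have "\<dots> = (\<Sum>k. ennreal (?a k) * (\<integral>\<^sup>+y. q y * indicator (ball x (r * 2 ^ Suc k)) y \<partial>lborel))"
    by (subst nn_integral_suminf, measurable) (simp add: nn_integral_cmult)
  also have "\<dots> \<le> (\<Sum>k. ennreal (C * 2 ^ DIM('a) * r powr (- \<epsilon> - 2 * s) * ((1/2) powr \<epsilon>) ^ k))"
  proof (rule suminf_le)
    fix k
    have "ennreal (?a k) * (\<integral>\<^sup>+y. q y * indicator (ball x (r * 2 ^ Suc k)) y \<partial>lborel) \<le>
       ennreal (?a k) * ennreal (C * (r * 2 ^ Suc k) powr (?n - \<epsilon>))"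
      using r by (intro mult_left_mono V) auto
    also have "\<dots> = ennreal (?a k * (C * (r * 2 ^ Suc k) powr (?n - \<epsilon>)))"
      using C by (intro ennreal_mult[symmetric]) auto
    also have "\<dots> \<le> ennreal (C * 2 ^ DIM('a) * r powr (- \<epsilon> - 2 * s) * ((1/2) powr \<epsilon>) ^ k)"
    proof (rule ennreal_leI)
      let ?b = "r * 2 ^ k"
      have b: "?b > 0" using r by simp
      have "(r * 2 ^ Suc k) powr (?n - \<epsilon>) = ?b powr (?n - \<epsilon>) * 2 powr (?n - \<epsilon>)"
        using b by (subst powr_mult[symmetric]) (auto simp: mult_ac)
      also have "\<dots> \<le> ?b powr (?n - \<epsilon>) * 2 powr ?n"
        using \<epsilon> by (intro mult_left_mono powr_mono) auto
      finally have 1: "(r * 2 ^ Suc k) powr (?n - \<epsilon>) \<le> ?b powr (?n - \<epsilon>) * 2 ^ DIM('a)"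
        by (simp add: powr_realpow)
      have 2: "?a k * ?b powr (?n - \<epsilon>) = ?b powr (- \<epsilon> - 2 * s)"
        by (subst powr_add[symmetric]) (simp add: algebra_simps)
      have "?b powr (- \<epsilon> - 2 * s) = r powr (- \<epsilon> - 2 * s) * (2 powr real k) powr (- \<epsilon> - 2 * s)"
        using r by (simp add: powr_mult powr_realpow)
      also have "(2 powr real k) powr (- \<epsilon> - 2 * s) \<le> (2 powr real k) powr (- \<epsilon>)"
        using s by (intro powr_mono) (auto simp: ge_one_powr_ge_zero)
      also have "(2 powr real k) powr (- \<epsilon>) = ((1/2) powr \<epsilon>) ^ k"
        by (simp add: powr_realpow[symmetric] powr_powr powr_divide powr_minus field_simps)
      finally have 3: "?b powr (- \<epsilon> - 2 * s) \<le> r powr (- \<epsilon> - 2 * s) * ((1/2) powr \<epsilon>) ^ k"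
        using r by (simp add: mult_left_mono)
      have "?a k * (C * (r * 2 ^ Suc k) powr (?n - \<epsilon>)) \<le> ?a k * (C * (?b powr (?n - \<epsilon>) * 2 ^ DIM('a)))"
        using C by (intro mult_left_mono 1) auto
      also have "\<dots> = C * 2 ^ DIM('a) * (?a k * ?b powr (?n - \<epsilon>))" by (simp only: mult_ac)
      also have "\<dots> = C * 2 ^ DIM('a) * ?b powr (- \<epsilon> - 2 * s)" by (simp only: 2)
      also have "\<dots> \<le> C * 2 ^ DIM('a) * (r powr (- \<epsilon> - 2 * s) * ((1/2) powr \<epsilon>) ^ k)"
        using C by (intro mult_left_mono 3) auto
      finally show "?a k * (C * (r * 2 ^ Suc k) powr (?n - \<epsilon>)) \<le> C * 2 ^ DIM('a) * r powr (- \<epsilon> - 2 * s) * ((1/2) powr \<epsilon>) ^ k"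
        by (simp only: mult_ac)
    qed
    finally show "ennreal (?a k) * (\<integral>\<^sup>+y. q y * indicator (ball x (r * 2 ^ Suc k)) y \<partial>lborel) \<le>
      ennreal (C * 2 ^ DIM('a) * r powr (- \<epsilon> - 2 * s) * ((1/2) powr \<epsilon>) ^ k)" .
  qed auto
  also have "\<dots> = ennreal (C * 2 ^ DIM('a) * r powr (- \<epsilon> - 2 * s) / (1 - (1/2) powr \<epsilon>))"
    using q C by (intro suminf_ennreal_geometric) auto
  finally show ?thesis by (simp add: mult_ac)
qed

section \<open>The kernel and the domain\<close>

lemma integral_nn_bound:
  fixes f :: "'a::euclidean_space \<Rightarrow> real"
  assumes [measurable]: "f \<in> borel_measurable borel" and c: "0 \<le> c"
    and le: "(\<integral>\<^sup>+y. ennreal \<bar>f y\<bar> \<partial>lborel) \<le> ennreal c"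
  shows "integrable lborel f" "\<bar>LINT y|lborel. f y\<bar> \<le> c"
proof -
  show i: "integrable lborel f"
    using le by (intro integrableI_bounded) (auto simp: less_top[symmetric] top_unique)
  have "ennreal (norm (LINT y|lborel. f y)) \<le> (\<integral>\<^sup>+y. ennreal (norm (f y)) \<partial>lborel)"
    by (rule integral_norm_bound_ennreal[OF i])
  also have "\<dots> \<le> ennreal c" using le by simp
  finally show "\<bar>LINT y|lborel. f y\<bar> \<le> c" using c by (simp add: ennreal_le_iff)
qed

lemma powr_diff_bound:
  fixes a b u v :: real
  assumes a: "a > 0" and b: "0 < b" "b \<le> u" "b \<le> v"
  shows "\<bar>u powr -a - v powr -a\<bar> \<le> a * b powr (-a - 1) * \<bar>u - v\<bar>"
proof -
  have *: "\<bar>u powr -a - v powr -a\<bar> \<le> a * b powr (-a - 1) * \<bar>u - v\<bar>" if uv: "b \<le> u" "u < v" for u v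
  proof -
    have "\<exists>z>u. z < v \<and> v powr -a - u powr -a = (v - u) * (- a * z powr (-a - 1))"
      using uv b by (intro MVT2) (auto intro!: derivative_eq_intros simp: field_simps powr_diff)
    then obtain z where z: "z > u" "z < v" "v powr -a - u powr -a = (v - u) * (- a * z powr (-a - 1))" by blast
    have "z powr (-a - 1) \<le> b powr (-a - 1)" using z uv b a by (intro powr_mono2') auto
    then have "(v - u) * (a * z powr (-a - 1)) \<le> (v - u) * (a * b powr (-a - 1))"
      using uv a by (intro mult_left_mono) auto
    moreover have "0 \<le> (v - u) * (a * z powr (-a - 1))" using uv a by simp
    moreover have "u powr -a - v powr -a = (v - u) * (a * z powr (-a - 1))" using z(3) by simp
    ultimately show ?thesis using uv by (simp add: mult_ac)
  qed
  show ?thesis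
    using *[of u v] *[of v u] b by (cases u v rule: linorder_cases) (auto simp: abs_minus_commute)
qed

text \<open>The value at 0 is 0, by the convention for \<open>powr\<close>. The case
  \<open>s = 0\<close> is included: it is the kernel of the limit L_g.\<close>

definition frac_ker :: "real \<Rightarrow> 'a::euclidean_space \<Rightarrow> real" where
  "frac_ker s z = norm z powr - (real DIM('a) + 2 * s)"

text \<open>The fractional Laplacian without the constant \<open>c_Ns\<close> and as an ordinary
  integral instead of a principal value.\<close>

definition nl_op :: "real \<Rightarrow> ('a::euclidean_space \<Rightarrow> real) \<Rightarrow> 'a \<Rightarrow> real" where
  "nl_op s G x = (LINT y|lborel. (G x - G y) * frac_ker s (x - y))"

text \<open>At a point where \<open>h\<close> vanishes this is minus \<open>nl_op s h\<close>.
  Multiplied by \<open>c_Ns\<close> it is the function f_s.\<close>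

definition ext_pot :: "real \<Rightarrow> ('a::euclidean_space \<Rightarrow> real) \<Rightarrow> 'a \<Rightarrow> real" where
  "ext_pot s h x = (LINT y|lborel. h y * frac_ker s (x - y))"

lemma frac_ker_nonneg [simp]: "0 \<le> frac_ker s z"
  by (simp add: frac_ker_def)

lemma frac_ker_minus [simp]: "frac_ker s (- z) = frac_ker s z"
  by (simp add: frac_ker_def)

lemma borel_measurable_frac_ker [measurable]:
  "frac_ker s \<in> borel_measurable (borel :: 'a::euclidean_space measure)"
  unfolding frac_ker_def by measurable

text \<open>The factor \<open>1 / (2 * s)\<close> in this mass is what \<open>c_Ns\<close>
  compensates: the product tends to 1 as s tends to 0.\<close>

lemma nn_integral_frac_ker_tail:
  fixes x :: "'a::euclidean_space"
  assumes "s > 0" "r > 0"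
  shows "(\<integral>\<^sup>+y. ennreal (frac_ker s (x - y) * indicator {r..} (norm (x - y))) \<partial>lborel) =
    ennreal (omega_sphere DIM('a) * r powr (-2 * s) / (2 * s))"
proof -
  have "(\<integral>\<^sup>+y. ennreal (frac_ker s (x - y) * indicator {r..} (norm (x - y))) \<partial>lborel) =
    (\<integral>\<^sup>+y. ennreal (frac_ker s (y::'a) * indicator {r..} (norm y)) \<partial>lborel)"
    by (rule nn_integral_shift) measurable
  also have "\<dots> = (\<integral>\<^sup>+y. ennreal (norm (y::'a) powr (- (real DIM('a) + 2 * s))) * indicator {r..} (norm y) \<partial>lborel)"
    by (intro nn_integral_cong) (auto simp: indicator_def frac_ker_def)
  also have "\<dots> = ennreal (omega_sphere DIM('a) * r powr (-(2 * s)) / (2 * s))"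
    using assms by (intro nn_integral_norm_powr_tail) auto
  finally show ?thesis by simp
qed

lemma has_integral_frac_ker_tail:
  fixes x :: "'a::euclidean_space"
  assumes "s > 0" "r > 0"
  shows "has_bochner_integral lborel (\<lambda>y. frac_ker s (x - y) * indicator {r..} (norm (x - y)))
    (omega_sphere DIM('a) * r powr (-2 * s) / (2 * s))"
  using assms omega_sphere_pos[of "DIM('a)"]
  by (intro has_bochner_integral_nn_integral nn_integral_frac_ker_tail) (auto, measurable)

lemma has_integral_frac_ker_head:
  fixes x :: "'a::euclidean_space"
  assumes "s < 1/2" "r > 0"
  shows "has_bochner_integral lborel (\<lambda>y. norm (x - y) * frac_ker s (x - y) * indicator {..<r} (norm (x - y)))
    (omega_sphere DIM('a) * r powr (1 - 2 * s) / (1 - 2 * s))"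
proof (intro has_bochner_integral_nn_integral)
  show "(\<lambda>y. norm (x - y) * frac_ker s (x - y) * indicator {..<r} (norm (x - y))) \<in> borel_measurable lborel"
    by measurable
  show "AE y in lborel. 0 \<le> norm (x - y) * frac_ker s (x - y) * indicator {..<r} (norm (x - y))" by simp
  show "0 \<le> omega_sphere DIM('a) * r powr (1 - 2 * s) / (1 - 2 * s)"
    using assms omega_sphere_pos[of "DIM('a)"] by simp
  have "(\<integral>\<^sup>+y. ennreal (norm (x - y) * frac_ker s (x - y) * indicator {..<r} (norm (x - y))) \<partial>lborel) =
    (\<integral>\<^sup>+y. ennreal (norm (y::'a) * frac_ker s y * indicator {..<r} (norm y)) \<partial>lborel)"
    by (rule nn_integral_shift) measurable
  also have "\<dots> = (\<integral>\<^sup>+y. ennreal (norm (y::'a) powr ((1 - 2 * s) - real DIM('a))) * indicator {..<r} (norm y) \<partial>lborel)"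
  proof (rule nn_integral_cong)
    fix y :: 'a
    have "norm y * norm y powr (- (real DIM('a) + 2 * s)) = norm y powr 1 * norm y powr (- (real DIM('a) + 2 * s))"
      by simp
    also have "\<dots> = norm y powr ((1 - 2 * s) - real DIM('a))"
      by (subst powr_add[symmetric]) (simp add: algebra_simps)
    finally show "ennreal (norm y * frac_ker s y * indicator {..<r} (norm y)) =
      ennreal (norm y powr ((1 - 2 * s) - real DIM('a))) * indicator {..<r} (norm y)"
      by (auto simp: indicator_def frac_ker_def)
  qed
  also have "\<dots> = ennreal (omega_sphere DIM('a) * r powr (1 - 2 * s) / (1 - 2 * s))"
    using assms by (intro nn_integral_norm_powr_head) auto
  finally show "(\<integral>\<^sup>+y. ennreal (norm (x - y) * frac_ker s (x - y) * indicator {..<r} (norm (x - y))) \<partial>lborel) =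
     ennreal (omega_sphere DIM('a) * r powr (1 - 2 * s) / (1 - 2 * s))" .
qed

text \<open>A bounded nonempty set has a nonempty frontier. Without it \<open>infdist\<close> would
  take its default value 0 and the boundary distance would be meaningless.\<close>

locale C2_domain =
  fixes \<Omega> :: "'a::euclidean_space set"
  assumes bdd: "bounded \<Omega>" and opn: "open \<Omega>" and C2: "C2_boundary \<Omega>" and ne: "\<Omega> \<noteq> {}"
begin

definition \<delta> :: "'a \<Rightarrow> real" where "\<delta> y = infdist y (frontier \<Omega>)"

text \<open>A bounded set that carries the functions in the comparison argument. The outer layer is
  included because the barrier lives on \<open>\<delta> y \<le> \<tau>\<close> on both sides of the
  boundary, with \<open>\<tau> < 1\<close>.\<close>

definition nbd :: "'a set" where "nbd = \<Omega> \<union> {y. \<delta> y \<le> 1}"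

lemma frontier_ne: "frontier \<Omega> \<noteq> {}"
  using bdd ne by (auto simp: frontier_eq_empty)

lemma \<delta>_nonneg [simp]: "0 \<le> \<delta> y" by (simp add: \<delta>_def infdist_nonneg)

lemma \<delta>_lipschitz: "\<bar>\<delta> x - \<delta> y\<bar> \<le> norm (x - y)"
  using infdist_triangle_abs[of x "frontier \<Omega>" y] by (simp add: \<delta>_def dist_norm)

lemma continuous_on_\<delta>: "continuous_on S \<delta>"
  unfolding \<delta>_def by (intro continuous_on_infdist continuous_on_id)

lemma borel_measurable_\<delta> [measurable]: "\<delta> \<in> borel_measurable borel"
  by (intro borel_measurable_continuous_onI continuous_on_\<delta>)

lemma \<Omega>_borel [measurable]: "\<Omega> \<in> sets borel" using opn by simp

lemma nbd_borel [measurable]: "nbd \<in> sets borel"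
  unfolding nbd_def by measurable

text \<open>The segment from an inner to an outer point meets the frontier, at a point no farther
  from either end than the ends are from each other.\<close>

lemma \<delta>_cross:
  assumes "x \<in> \<Omega>" "y \<notin> \<Omega>"
  shows "\<delta> x \<le> norm (x - y)" "\<delta> y \<le> norm (x - y)"
proof -
  have "closed_segment x y \<inter> frontier \<Omega> \<noteq> {}"
    using assms by (intro connected_Int_frontier) auto
  then obtain q where q: "q \<in> closed_segment x y" "q \<in> frontier \<Omega>" by auto
  have "\<delta> x \<le> dist x q" "\<delta> y \<le> dist y q" unfolding \<delta>_def using q by (auto intro: infdist_le)
  moreover have "dist x q \<le> dist x y" "dist y q \<le> dist x y"
    using dist_in_closed_segment[OF q(1)] by (auto simp: dist_commute)
  ultimately show "\<delta> x \<le> norm (x - y)" "\<delta> y \<le> norm (x - y)" by (auto simp: dist_norm)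
qed

lemma \<delta>_pos: "x \<in> \<Omega> \<Longrightarrow> 0 < \<delta> x"
proof -
  assume "x \<in> \<Omega>"
  then have "x \<notin> frontier \<Omega>" using opn by (simp add: frontier_def interior_open)
  then have "\<delta> x \<noteq> 0"
    unfolding \<delta>_def using frontier_ne frontier_closed in_closed_iff_infdist_zero by blast
  then show ?thesis using \<delta>_nonneg[of x] by linarith
qed

lemma mem_\<Omega>I: "x \<in> \<Omega> \<Longrightarrow> norm (x - y) < \<delta> x \<Longrightarrow> y \<in> \<Omega>"
  using \<delta>_cross(1) by force

text \<open>One radius for all crude bounds, selected once so that later constants depend on the
  domain only. \<open>R0 \<ge> 1\<close> allows powers of \<open>R0\<close> with exponent in [0,1]
  to be replaced by \<open>R0\<close> itself.\<close>

definition R0 :: real where "R0 = (SOME R. R \<ge> 1 \<and> nbd \<subseteq> ball 0 R \<and> (\<forall>x\<in>\<Omega>. \<delta> x < R))"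

lemma R0: "R0 \<ge> 1" "nbd \<subseteq> ball 0 R0" "x \<in> \<Omega> \<Longrightarrow> \<delta> x < R0"
proof -
  obtain B where B: "B > 0" "\<And>x. x \<in> \<Omega> \<Longrightarrow> norm x \<le> B"
    using bdd bounded_pos by metis
  have cl: "norm q \<le> B" if "q \<in> frontier \<Omega>" for q
  proof -
    have "closure \<Omega> \<subseteq> cball 0 B" using B by (intro closure_minimal) auto
    then show ?thesis using that by (auto simp: frontier_def)
  qed
  obtain q where q: "q \<in> frontier \<Omega>" using frontier_ne by blast
  have "\<exists>R. R \<ge> 1 \<and> nbd \<subseteq> ball 0 R \<and> (\<forall>x\<in>\<Omega>. \<delta> x < R)"
  proof (intro exI[of _ "2 * B + 3"] conjI ballI subsetI)
    fix y assume y: "y \<in> nbd"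
    show "y \<in> ball 0 (2 * B + 3)"
    proof (cases "y \<in> \<Omega>")
      case False
      then have "infdist y (frontier \<Omega>) < 2" using y by (auto simp: nbd_def \<delta>_def)
      then obtain p where "p \<in> frontier \<Omega>" "dist y p < 2" using frontier_ne infdist_less_obtain by blast
      then show ?thesis using cl[of p] norm_triangle_sub[of y p] B by (auto simp: dist_norm)
    qed (use B in force)
  next
    fix x assume x: "x \<in> \<Omega>"
    have "\<delta> x \<le> dist x q" unfolding \<delta>_def using q by (rule infdist_le)
    also have "\<dots> \<le> B + B" using B(2)[OF x] cl[OF q] norm_triangle_ineq4[of x q] by (simp add: dist_norm)
    finally show "\<delta> x < 2 * B + 3" using B by simp
  qed (use B in auto)
  then have "R0 \<ge> 1 \<and> nbd \<subseteq> ball 0 R0 \<and> (\<forall>x\<in>\<Omega>. \<delta> x < R0)"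
    unfolding R0_def by (rule someI_ex)
  then show "R0 \<ge> 1" "nbd \<subseteq> ball 0 R0" "x \<in> \<Omega> \<Longrightarrow> \<delta> x < R0" by auto
qed

lemma \<Omega>_norm: "x \<in> \<Omega> \<Longrightarrow> norm x < R0"
  using R0(2) by (auto simp: nbd_def)

text \<open>The boundary lies in every layer and the layers have volume O(t). The result excludes
  the points where \<open>\<delta> y powr -\<epsilon>\<close> has the default value 0 although it
  must dominate the positive barrier.\<close>

lemma AE_\<delta>_pos: "AE y in lborel. \<delta> y > 0"
proof -
  let ?N = "{y \<in> ball 0 R0. \<delta> y = 0}"
  have [measurable]: "Measurable.pred borel (\<lambda>y. y \<in> ball (0::'a) R0)" by simp
  obtain C where C: "C > 0" "\<And>x R t. 0 < t \<Longrightarrow> t \<le> R \<Longrightarrow> R \<le> R0 \<Longrightarrow>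
       emeasure lborel {y \<in> ball x R. \<delta> y < t} \<le> ennreal (C * t * R ^ (DIM('a) - 1))"
    using boundary_volume[OF bdd opn C2 frontier_ne, of R0] R0(1) unfolding \<delta>_def by auto
  define c where "c = C * R0 ^ (DIM('a) - 1)"
  have c: "c > 0" using C R0(1) by (simp add: c_def)
  have "emeasure lborel ?N \<le> 0"
  proof (rule ennreal_le_epsilon)
    fix e :: real assume e: "e > 0"
    define t where "t = min R0 (e / c)"
    have t: "0 < t" "t \<le> R0" "c * t \<le> e"
      using e c R0(1) by (auto simp: t_def min_def field_simps split: if_splits)
    have "emeasure lborel ?N \<le> emeasure lborel {y \<in> ball 0 R0. \<delta> y < t}"
      using t by (intro emeasure_mono) auto
    also have "\<dots> \<le> ennreal (C * t * R0 ^ (DIM('a) - 1))" using C(2)[of t R0 0] t by simp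
    also have "\<dots> \<le> ennreal e" using t by (intro ennreal_leI) (simp add: c_def mult_ac)
    finally show "emeasure lborel ?N \<le> 0 + ennreal e" by simp
  qed
  then have "AE y in lborel. y \<notin> ?N" by (intro AE_not_in null_setsI) auto
  then show ?thesis
  proof eventually_elim
    case (elim y)
    have "y \<in> nbd" if "\<delta> y = 0" using that by (simp add: nbd_def)
    then have "\<delta> y \<noteq> 0" using elim R0(2) by auto
    then show ?case using \<delta>_nonneg[of y] by linarith
  qed
qed

text \<open>The weight has ball growth of order N - eps at every radius: up to \<open>R0\<close> by
  the dyadic estimate, and beyond because it is supported in \<open>ball 0 R0\<close> and its
  integral no longer grows. The constant is uniform in \<open>s\<close>.\<close>

lemma weight_tail:
  assumes \<epsilon>: "0 < \<epsilon>" "\<epsilon> < 1"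
  obtains C where "C > 0" "\<And>x r s. 0 < r \<Longrightarrow> 0 \<le> s \<Longrightarrow>
    (\<integral>\<^sup>+y. ennreal (\<delta> y powr -\<epsilon> * indicator nbd y * frac_ker s (x - y) * indicator {r..} (norm (x - y))) \<partial>lborel)
      \<le> ennreal (C * r powr (- \<epsilon> - 2 * s))"
proof -
  let ?n = "real DIM('a)"
  obtain C where C: "C > 0" "\<And>x R t. 0 < t \<Longrightarrow> t \<le> R \<Longrightarrow> R \<le> R0 \<Longrightarrow>
       emeasure lborel {y \<in> ball x R. \<delta> y < t} \<le> ennreal (C * t * R ^ (DIM('a) - 1))"
    using boundary_volume[OF bdd opn C2 frontier_ne, of R0] R0(1) unfolding \<delta>_def by auto
  define C1 where "C1 = unit_ball_vol ?n + 2 * C / (1 - (1/2) powr (1 - \<epsilon>))"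
  have p1: "(1/2::real) powr (1 - \<epsilon>) < 1" using \<epsilon> powr_less_mono2[of "1 - \<epsilon>" "1/2" 1] by simp
  have p2: "(1/2::real) powr \<epsilon> < 1" using \<epsilon> powr_less_mono2[of \<epsilon> "1/2" 1] by simp
  have C1: "C1 > 0" using C p1 by (auto simp: C1_def intro!: add_pos_nonneg)
  let ?q = "\<lambda>y. ennreal (\<delta> y powr -\<epsilon>) * indicator nbd y"
  have [measurable]: "?q \<in> borel_measurable borel" by measurable
  have g: "(\<integral>\<^sup>+y. ?q y * indicator (ball x R) y \<partial>lborel) \<le> ennreal (C1 * R powr (?n - \<epsilon>))" if R: "0 < R" for x R
  proof -
    have b: "(\<integral>\<^sup>+y. ennreal (\<delta> y powr -\<epsilon>) * indicator (ball x R) y \<partial>lborel) \<le> ennreal (C1 * R powr (?n - \<epsilon>))" if "0 < R" "R \<le> R0" for x R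
      unfolding C1_def using C \<epsilon> that by (intro ball_integral_powr[where P=R0]) auto
    show ?thesis
    proof (cases "R \<le> R0")
      case True
      have "(\<integral>\<^sup>+y. ?q y * indicator (ball x R) y \<partial>lborel) \<le> (\<integral>\<^sup>+y. ennreal (\<delta> y powr -\<epsilon>) * indicator (ball x R) y \<partial>lborel)"
        by (intro nn_integral_mono) (auto simp: indicator_def)
      then show ?thesis using b[OF R True] by (rule order_trans)
    next
      case False
      have "(\<integral>\<^sup>+y. ?q y * indicator (ball x R) y \<partial>lborel) \<le> (\<integral>\<^sup>+y. ennreal (\<delta> y powr -\<epsilon>) * indicator (ball 0 R0) y \<partial>lborel)"
        using R0(2) by (intro nn_integral_mono) (auto simp: indicator_def)
      also have "\<dots> \<le> ennreal (C1 * R0 powr (?n - \<epsilon>))" using b[of R0] R0(1) by simp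
      also have "\<dots> \<le> ennreal (C1 * R powr (?n - \<epsilon>))"
      proof (intro ennreal_leI mult_left_mono powr_mono2)
        have "?n \<ge> 1" by (simp add: Suc_leI)
        then show "0 \<le> ?n - \<epsilon>" using \<epsilon> by linarith
      qed (use C1 False R0(1) in auto)
      finally show ?thesis .
    qed
  qed
  show ?thesis
  proof (rule that[of "C1 * 2 ^ DIM('a) / (1 - (1/2) powr \<epsilon>)"])
    show "C1 * 2 ^ DIM('a) / (1 - (1/2) powr \<epsilon>) > 0" using C1 p2 by simp
    fix x :: 'a and r s :: real assume rs: "0 < r" "0 \<le> s"
    have "(\<integral>\<^sup>+y. ennreal (\<delta> y powr -\<epsilon> * indicator nbd y * frac_ker s (x - y) * indicator {r..} (norm (x - y))) \<partial>lborel) =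
      (\<integral>\<^sup>+y. ?q y * ennreal (norm (x - y) powr - (?n + 2 * s)) * indicator {r..} (norm (x - y)) \<partial>lborel)"
      by (intro nn_integral_cong) (auto simp: indicator_def frac_ker_def ennreal_mult)
    also have "\<dots> \<le> ennreal (C1 * 2 ^ DIM('a) / (1 - (1/2) powr \<epsilon>) * r powr (- \<epsilon> - 2 * s))"
      by (rule tail_integral_of_ball_growth) (use C1 \<epsilon> g rs in auto)
    finally show "(\<integral>\<^sup>+y. ennreal (\<delta> y powr -\<epsilon> * indicator nbd y * frac_ker s (x - y) * indicator {r..} (norm (x - y))) \<partial>lborel)
      \<le> ennreal (C1 * 2 ^ DIM('a) / (1 - (1/2) powr \<epsilon>) * r powr (- \<epsilon> - 2 * s))" .
  qed
qed

section \<open>The nonlocal operator and exterior potentials\<close>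

text \<open>The precise form of closeness to the identity. The integral is split at distance
  delta/2. The inner part is controlled by the Lipschitz bound; in the outer part the term with
  \<open>G x\<close> is computed exactly and carries the factor 1/(2s), while the term with
  \<open>G y\<close> is bounded by \<open>weight_tail\<close>. The error constant is independent of
  \<open>s\<close>, so it disappears after multiplication by \<open>c_Ns\<close>.\<close>

lemma op_estimate:
  assumes \<epsilon>: "0 < \<epsilon>" "\<epsilon> < 1"
  obtains C where "C > 0"
    "\<And>s x G A \<Lambda>. \<lbrakk>0 < s; s \<le> 1/4; x \<in> \<Omega>; G \<in> borel_measurable borel; 0 \<le> A; 0 \<le> \<Lambda>;
      AE y in lborel. \<bar>G y\<bar> \<le> A * (\<delta> y powr -\<epsilon> * indicator nbd y);
      \<And>y. norm (x - y) < \<delta> x / 2 \<Longrightarrow> \<bar>G x - G y\<bar> \<le> \<Lambda> * \<delta> x powr (-1 - \<epsilon>) * norm (x - y)\<rbrakk> \<Longrightarrow>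
      integrable lborel (\<lambda>y. (G x - G y) * frac_ker s (x - y)) \<and>
      \<bar>nl_op s G x - G x * (omega_sphere DIM('a) * (\<delta> x / 2) powr (-2 * s) / (2 * s))\<bar>
        \<le> C * (A + \<Lambda>) * \<delta> x powr (- \<epsilon> - 2 * s)"
proof -
  let ?o = "omega_sphere DIM('a)"
  have o: "?o > 0" by (simp add: omega_sphere_pos)
  obtain C where C: "C > 0" "\<And>x r s. 0 < r \<Longrightarrow> 0 \<le> s \<Longrightarrow>
    (\<integral>\<^sup>+y. ennreal (\<delta> y powr -\<epsilon> * indicator nbd y * frac_ker s (x - y) * indicator {r..} (norm (x - y))) \<partial>lborel)
      \<le> ennreal (C * r powr (- \<epsilon> - 2 * s))"
    using weight_tail[OF \<epsilon>] by blast
  show ?thesis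
  proof (rule that[of "2 * ?o + 4 * C"])
    show "2 * ?o + 4 * C > 0" using o C by simp
    fix s :: real and x :: 'a and G :: "'a \<Rightarrow> real" and A \<Lambda> :: real
    assume s: "0 < s" "s \<le> 1/4" and x: "x \<in> \<Omega>" and [measurable]: "G \<in> borel_measurable borel"
      and A: "0 \<le> A" and \<Lambda>: "0 \<le> \<Lambda>"
      and GA: "AE y in lborel. \<bar>G y\<bar> \<le> A * (\<delta> y powr -\<epsilon> * indicator nbd y)"
      and GL: "\<And>y. norm (x - y) < \<delta> x / 2 \<Longrightarrow> \<bar>G x - G y\<bar> \<le> \<Lambda> * \<delta> x powr (-1 - \<epsilon>) * norm (x - y)"
    define d where "d = \<delta> x"
    define r where "r = d / 2"
    have d: "d > 0" and r: "r > 0" using \<delta>_pos[OF x] by (auto simp: d_def r_def)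
    let ?f1 = "\<lambda>y. (G x - G y) * frac_ker s (x - y) * indicator {..<r} (norm (x - y))"
    let ?f2 = "\<lambda>y. G x * (frac_ker s (x - y) * indicator {r..} (norm (x - y)))"
    let ?f3 = "\<lambda>y. G y * (frac_ker s (x - y) * indicator {r..} (norm (x - y)))"
    define c1 where "c1 = \<Lambda> * d powr (-1 - \<epsilon>) * (?o * r powr (1 - 2 * s) / (1 - 2 * s))"
    have c1: "c1 \<ge> 0" using \<Lambda> o s by (auto simp: c1_def intro!: mult_nonneg_nonneg divide_nonneg_pos)
    have head: "has_bochner_integral lborel (\<lambda>y. norm (x - y) * frac_ker s (x - y) * indicator {..<r} (norm (x - y)))
       (?o * r powr (1 - 2 * s) / (1 - 2 * s))"
      using s r by (intro has_integral_frac_ker_head) auto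
    have "(\<integral>\<^sup>+y. ennreal \<bar>?f1 y\<bar> \<partial>lborel) \<le>
      (\<integral>\<^sup>+y. ennreal (\<Lambda> * d powr (-1 - \<epsilon>) * (norm (x - y) * frac_ker s (x - y) * indicator {..<r} (norm (x - y)))) \<partial>lborel)"
    proof (intro nn_integral_mono ennreal_leI)
      fix y
      show "\<bar>?f1 y\<bar> \<le> \<Lambda> * d powr (-1 - \<epsilon>) * (norm (x - y) * frac_ker s (x - y) * indicator {..<r} (norm (x - y)))"
      proof (cases "norm (x - y) < r")
        case True
        then have "\<bar>G x - G y\<bar> * frac_ker s (x - y) \<le> (\<Lambda> * d powr (-1 - \<epsilon>) * norm (x - y)) * frac_ker s (x - y)"
          using GL[of y] by (intro mult_right_mono) (auto simp: r_def d_def)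
        then show ?thesis using True by (simp add: abs_mult mult_ac)
      qed simp
    qed
    also have "\<dots> = ennreal c1"
      unfolding c1_def
      by (subst nn_integral_eq_integral)
        (use head \<Lambda> in \<open>auto simp: has_bochner_integral_iff\<close>)
    finally have f1: "integrable lborel ?f1" "\<bar>LINT y|lborel. ?f1 y\<bar> \<le> c1"
      using integral_nn_bound[of ?f1 c1] c1 by auto
    have "has_bochner_integral lborel ?f2 (G x * (?o * r powr (-2 * s) / (2 * s)))"
      using s r by (intro has_bochner_integral_mult_right has_integral_frac_ker_tail) auto
    then have f2: "integrable lborel ?f2" "(LINT y|lborel. ?f2 y) = G x * (?o * r powr (-2 * s) / (2 * s))"
      by (auto simp: has_bochner_integral_iff)
    define c3 where "c3 = A * (C * r powr (- \<epsilon> - 2 * s))"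
    have c3: "c3 \<ge> 0" using A C by (simp add: c3_def)
    have "(\<integral>\<^sup>+y. ennreal \<bar>?f3 y\<bar> \<partial>lborel) \<le>
      (\<integral>\<^sup>+y. ennreal A * ennreal (\<delta> y powr -\<epsilon> * indicator nbd y * frac_ker s (x - y) * indicator {r..} (norm (x - y))) \<partial>lborel)"
    proof (rule nn_integral_mono_AE, use GA in eventually_elim)
      case (elim y)
      have "\<bar>?f3 y\<bar> = \<bar>G y\<bar> * (frac_ker s (x - y) * indicator {r..} (norm (x - y)))"
        by (simp add: abs_mult indicator_def)
      also have "\<dots> \<le> (A * (\<delta> y powr -\<epsilon> * indicator nbd y)) * (frac_ker s (x - y) * indicator {r..} (norm (x - y)))"
        by (rule mult_right_mono[OF elim]) simp
      finally have "ennreal \<bar>?f3 y\<bar> \<le> ennreal (A * (\<delta> y powr -\<epsilon> * indicator nbd y * frac_ker s (x - y) * indicator {r..} (norm (x - y))))"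
        by (intro ennreal_leI) (simp add: mult_ac)
      then show ?case using A by (subst (asm) ennreal_mult) auto
    qed
    also have "\<dots> \<le> ennreal A * ennreal (C * r powr (- \<epsilon> - 2 * s))"
      using C(2)[OF r, of s x] s by (subst nn_integral_cmult) (auto intro: mult_left_mono)
    also have "\<dots> = ennreal c3" unfolding c3_def using A C by (intro ennreal_mult[symmetric]) auto
    finally have f3: "integrable lborel ?f3" "\<bar>LINT y|lborel. ?f3 y\<bar> \<le> c3"
      using integral_nn_bound[of ?f3 c3] c3 by auto
    have split: "(\<lambda>y. (G x - G y) * frac_ker s (x - y)) = (\<lambda>y. ?f1 y + ?f2 y - ?f3 y)"
      by (auto simp: fun_eq_iff indicator_def algebra_simps)
    have int: "integrable lborel (\<lambda>y. (G x - G y) * frac_ker s (x - y))"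
      unfolding split using f1 f2 f3 by (intro Bochner_Integration.integrable_diff Bochner_Integration.integrable_add)
    have "nl_op s G x = (LINT y|lborel. ?f1 y) + (LINT y|lborel. ?f2 y) - (LINT y|lborel. ?f3 y)"
      unfolding nl_op_def split
      using f1 f2 f3 by (simp only: Bochner_Integration.integral_diff Bochner_Integration.integral_add Bochner_Integration.integrable_add)
    then have "\<bar>nl_op s G x - G x * (?o * r powr (-2 * s) / (2 * s))\<bar> \<le> c1 + c3"
      using f1 f2 f3 by linarith
    also have "\<dots> \<le> (2 * ?o + 4 * C) * (A + \<Lambda>) * d powr (- \<epsilon> - 2 * s)"
    proof -
      have "r powr (1 - 2 * s) \<le> d powr (1 - 2 * s)" using s r d by (intro powr_mono2) (auto simp: r_def)
      \<comment> \<open>Here \<open>s \<le> 1/4\<close> keeps the first moment of the kernel near 0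
        uniformly bounded.\<close>
      moreover have "1 / (1 - 2 * s) \<le> 2" using s by (simp add: field_simps)
      ultimately have "r powr (1 - 2 * s) * (1 / (1 - 2 * s)) \<le> d powr (1 - 2 * s) * 2"
        using s by (intro mult_mono) auto
      then have "\<Lambda> * d powr (-1 - \<epsilon>) * ?o * (r powr (1 - 2 * s) * (1 / (1 - 2 * s))) \<le> \<Lambda> * d powr (-1 - \<epsilon>) * ?o * (d powr (1 - 2 * s) * 2)"
        using \<Lambda> o by (intro mult_left_mono) auto
      also have "\<dots> = 2 * ?o * \<Lambda> * (d powr (-1 - \<epsilon>) * d powr (1 - 2 * s))" by simp
      also have "d powr (-1 - \<epsilon>) * d powr (1 - 2 * s) = d powr (- \<epsilon> - 2 * s)"
        by (subst powr_add[symmetric]) simp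
      finally have 1: "c1 \<le> 2 * ?o * \<Lambda> * d powr (- \<epsilon> - 2 * s)" by (simp add: c1_def mult_ac)
      have "r powr (- \<epsilon> - 2 * s) = d powr (- \<epsilon> - 2 * s) * 2 powr (\<epsilon> + 2 * s)"
        using d by (simp add: r_def powr_divide powr_minus[of 2 "\<epsilon> + 2 * s", symmetric] powr_minus_divide divide_simps powr_add[symmetric])
      also have "2 powr (\<epsilon> + 2 * s) \<le> 2 powr (2::real)" using \<epsilon> s by (intro powr_mono) auto
      finally have "r powr (- \<epsilon> - 2 * s) \<le> d powr (- \<epsilon> - 2 * s) * 4" by (simp add: mult_left_mono)
      then have "A * C * r powr (- \<epsilon> - 2 * s) \<le> A * C * (d powr (- \<epsilon> - 2 * s) * 4)"
        using A C by (intro mult_left_mono) auto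
      then have 2: "c3 \<le> 4 * C * A * d powr (- \<epsilon> - 2 * s)" by (simp add: c3_def mult_ac)
      have "c1 + c3 \<le> (2 * ?o * \<Lambda> + 4 * C * A) * d powr (- \<epsilon> - 2 * s)" using 1 2 by (simp add: distrib_right)
      also have "\<dots> \<le> ((2 * ?o + 4 * C) * (A + \<Lambda>)) * d powr (- \<epsilon> - 2 * s)"
      proof (rule mult_right_mono)
        have "2 * ?o * A \<ge> 0" "4 * C * \<Lambda> \<ge> 0" using o C A \<Lambda> by auto
        then show "2 * ?o * \<Lambda> + 4 * C * A \<le> (2 * ?o + 4 * C) * (A + \<Lambda>)" by (simp add: algebra_simps)
      qed simp
      finally show ?thesis .
    qed
    finally show "integrable lborel (\<lambda>y. (G x - G y) * frac_ker s (x - y)) \<and>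
      \<bar>nl_op s G x - G x * (?o * (\<delta> x / 2) powr (-2 * s) / (2 * s))\<bar> \<le> (2 * ?o + 4 * C) * (A + \<Lambda>) * \<delta> x powr (- \<epsilon> - 2 * s)"
      using int by (simp only: r_def d_def)
  qed
qed

text \<open>The support of \<open>h\<close> is at distance at least \<open>\<delta> x\<close> from
  \<open>x\<close>, so only a tail of the kernel enters and the singularity is never seen.\<close>

lemma ext_pot_bound:
  assumes [measurable]: "h \<in> borel_measurable borel" and hM: "\<And>y. \<bar>h y\<bar> \<le> M" and h0: "\<And>y. y \<in> \<Omega> \<Longrightarrow> h y = 0"
    and s: "s > 0" and x: "x \<in> \<Omega>"
  shows "integrable lborel (\<lambda>y. h y * frac_ker s (x - y))"
    "\<bar>ext_pot s h x\<bar> \<le> M * (omega_sphere DIM('a) * \<delta> x powr (-2 * s) / (2 * s))"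
proof -
  let ?c = "omega_sphere DIM('a) * \<delta> x powr (-2 * s) / (2 * s)"
  have M: "M \<ge> 0" using hM[of 0] by linarith
  have c: "?c \<ge> 0" using s omega_sphere_pos[of "DIM('a)"] by simp
  have "(\<integral>\<^sup>+y. ennreal \<bar>h y * frac_ker s (x - y)\<bar> \<partial>lborel) \<le>
    (\<integral>\<^sup>+y. ennreal M * ennreal (frac_ker s (x - y) * indicator {\<delta> x..} (norm (x - y))) \<partial>lborel)"
  proof (rule nn_integral_mono)
    fix y
    have "\<bar>h y\<bar> \<le> M * indicator {\<delta> x..} (norm (x - y))"
      using hM[of y] h0[of y] mem_\<Omega>I[OF x, of y] by (auto simp: indicator_def)
    then have "\<bar>h y\<bar> * frac_ker s (x - y) \<le> M * indicator {\<delta> x..} (norm (x - y)) * frac_ker s (x - y)"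
      by (rule mult_right_mono) simp
    then show "ennreal \<bar>h y * frac_ker s (x - y)\<bar> \<le> ennreal M * ennreal (frac_ker s (x - y) * indicator {\<delta> x..} (norm (x - y)))"
      using M by (auto simp: ennreal_mult[symmetric] abs_mult mult_ac intro!: ennreal_leI)
  qed
  also have "\<dots> = ennreal M * ennreal ?c"
    using nn_integral_frac_ker_tail[OF s \<delta>_pos[OF x], of x] by (subst nn_integral_cmult) auto
  also have "\<dots> = ennreal (M * ?c)" using M c by (rule ennreal_mult[symmetric])
  finally have le: "(\<integral>\<^sup>+y. ennreal \<bar>h y * frac_ker s (x - y)\<bar> \<partial>lborel) \<le> ennreal (M * ?c)" .
  show "integrable lborel (\<lambda>y. h y * frac_ker s (x - y))"
    by (rule integral_nn_bound(1)[OF _ mult_nonneg_nonneg[OF M c] le]) measurable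
  show "\<bar>ext_pot s h x\<bar> \<le> M * ?c"
    unfolding ext_pot_def by (rule integral_nn_bound(2)[OF _ mult_nonneg_nonneg[OF M c] le]) measurable
qed

lemma frac_ker_diff:
  fixes u v :: 'a
  assumes b: "0 < b" "b \<le> norm u" "b \<le> norm v" and s: "0 \<le> s"
  shows "\<bar>frac_ker s u - frac_ker s v\<bar> \<le> (real DIM('a) + 2 * s) * b powr (- (real DIM('a) + 2 * s) - 1) * norm (u - v)"
proof -
  have "real DIM('a) + 2 * s > 0" using s by (simp add: add_pos_nonneg)
  from powr_diff_bound[OF this b]
  have "\<bar>frac_ker s u - frac_ker s v\<bar> \<le> (real DIM('a) + 2 * s) * b powr (- (real DIM('a) + 2 * s) - 1) * \<bar>norm u - norm v\<bar>"
    by (simp add: frac_ker_def)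
  also have "\<dots> \<le> (real DIM('a) + 2 * s) * b powr (- (real DIM('a) + 2 * s) - 1) * norm (u - v)"
    using s by (intro mult_left_mono norm_triangle_ineq3) auto
  finally show ?thesis .
qed

text \<open>For s <= 1/4 it dominates (N + 2s) 2^(N+2s+1) \<open>omega_sphere N\<close> / (1 + 2s),
  the constant produced by the gradient of the kernel and its tail integral.\<close>

definition lip_const :: real where
  "lip_const = (real DIM('a) + 1) * 2 powr (real DIM('a) + 2) * omega_sphere DIM('a)"

text \<open>The kernel difference is of order norm (x - x') times norm (x - y)^(-N-1-2s), integrated
  over norm (x - y) >= delta. The extra power makes the tail integral converge without a factor
  1/s.\<close>

lemma ext_pot_lipschitz:
  assumes [measurable]: "h \<in> borel_measurable borel" and hM: "\<And>y. \<bar>h y\<bar> \<le> M" and h0: "\<And>y. y \<in> \<Omega> \<Longrightarrow> h y = 0"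
    and s: "0 < s" "s \<le> 1/4" and x: "x \<in> \<Omega>" and x': "norm (x - x') \<le> \<delta> x / 2"
  shows "\<bar>ext_pot s h x - ext_pot s h x'\<bar> \<le> lip_const * M * \<delta> x powr (-1 - 2 * s) * norm (x - x')"
proof -
  let ?n = "real DIM('a)" and ?o = "omega_sphere DIM('a)"
  define d where "d = \<delta> x"
  have d: "d > 0" using \<delta>_pos[OF x] by (simp add: d_def)
  have M: "M \<ge> 0" using hM[of 0] by linarith
  have o: "?o > 0" by (simp add: omega_sphere_pos)
  have "x' \<in> \<Omega>" using x x' d by (intro mem_\<Omega>I[OF x]) (auto simp: d_def)
  note i = ext_pot_bound(1)[OF assms(1) hM h0 s(1) x] ext_pot_bound(1)[OF assms(1) hM h0 s(1) this]
  let ?K = "(?n + 2 * s) * 2 powr (?n + 2 * s + 1) * norm (x - x')"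
  let ?a = "1 + 2 * s"
  have K: "?K \<ge> 0" using s by simp
  let ?c = "M * (?K * (?o * d powr (- ?a) / ?a))"
  have tail: "(\<integral>\<^sup>+y. ennreal (norm (x - y) powr (- (?n + ?a))) * indicator {d..} (norm (x - y)) \<partial>lborel) = ennreal (?o * d powr (- ?a) / ?a)"
    using s d by (subst nn_integral_shift[of "\<lambda>z. ennreal (norm z powr (- (?n + ?a))) * indicator {d..} (norm z)"])
      (measurable, intro nn_integral_norm_powr_tail, auto)
  have "(\<integral>\<^sup>+y. ennreal \<bar>h y * frac_ker s (x - y) - h y * frac_ker s (x' - y)\<bar> \<partial>lborel) \<le>
    (\<integral>\<^sup>+y. ennreal (M * ?K) * (ennreal (norm (x - y) powr (- (?n + ?a))) * indicator {d..} (norm (x - y))) \<partial>lborel)"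
  proof (rule nn_integral_mono)
    fix y
    show "ennreal \<bar>h y * frac_ker s (x - y) - h y * frac_ker s (x' - y)\<bar> \<le>
      ennreal (M * ?K) * (ennreal (norm (x - y) powr (- (?n + ?a))) * indicator {d..} (norm (x - y)))"
    proof (cases "y \<in> \<Omega>")
      case False
      then have dy: "d \<le> norm (x - y)" using mem_\<Omega>I[OF x, of y] by (force simp: d_def)
      \<comment> \<open>A displacement by at most delta/2, hence at most half of norm (x - y), keeps
        both arguments of the kernel at least \<open>?b\<close> away from 0.\<close>
      let ?b = "norm (x - y) / 2"
      have b: "0 < ?b" using dy d by linarith
      have "?b \<le> norm (x' - y)"
        using norm_triangle_ineq[of "x - x'" "x' - y"] x' dy by (simp add: d_def)
      then have "\<bar>frac_ker s (x - y) - frac_ker s (x' - y)\<bar> \<le> (?n + 2 * s) * ?b powr (- (?n + 2 * s) - 1) * norm ((x - y) - (x' - y))"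
        using b s by (intro frac_ker_diff) auto
      also have "?b powr (- (?n + 2 * s) - 1) = norm (x - y) powr (- (?n + ?a)) * 2 powr (?n + 2 * s + 1)"
      proof -
        have "?b powr (- (?n + ?a)) = norm (x - y) powr (- (?n + ?a)) / 2 powr (- (?n + ?a))"
          by (rule powr_divide)
        moreover have "- (?n + 2 * s) - 1 = - (?n + ?a)" "?n + 2 * s + 1 = ?n + ?a" by simp_all
        ultimately show ?thesis by (simp only: powr_minus[of 2] divide_inverse inverse_inverse_eq)
      qed
      finally have k: "\<bar>frac_ker s (x - y) - frac_ker s (x' - y)\<bar> \<le> ?K * norm (x - y) powr (- (?n + ?a))"
        by (simp add: mult_ac)
      have "\<bar>h y * frac_ker s (x - y) - h y * frac_ker s (x' - y)\<bar> = \<bar>h y\<bar> * \<bar>frac_ker s (x - y) - frac_ker s (x' - y)\<bar>"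
        by (simp add: abs_mult[symmetric] right_diff_distrib)
      also have "\<dots> \<le> M * (?K * norm (x - y) powr (- (?n + ?a)))"
        using hM M k by (intro mult_mono) auto
      finally have "\<bar>h y * frac_ker s (x - y) - h y * frac_ker s (x' - y)\<bar> \<le> (M * ?K) * norm (x - y) powr (- (?n + ?a))"
        by (simp only: mult.assoc)
      moreover have "ennreal (M * ?K) * (ennreal (norm (x - y) powr (- (?n + ?a))) * indicator {d..} (norm (x - y))) =
        ennreal ((M * ?K) * norm (x - y) powr (- (?n + ?a)))"
        using M K dy by (subst ennreal_mult) auto
      ultimately show ?thesis by (simp only: ennreal_leI)
    qed (simp add: h0)
  qed
  also have "\<dots> = ennreal (M * ?K) * ennreal (?o * d powr (- ?a) / ?a)"
    by (subst nn_integral_cmult) (measurable, simp only: tail)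
  also have "\<dots> = ennreal ?c"
    using M K o s by (subst ennreal_mult[symmetric]) (auto simp: mult.assoc)
  finally have le: "(\<integral>\<^sup>+y. ennreal \<bar>h y * frac_ker s (x - y) - h y * frac_ker s (x' - y)\<bar> \<partial>lborel) \<le> ennreal ?c" .
  have "?c \<ge> 0" using M K o s by (intro mult_nonneg_nonneg) auto
  then have "\<bar>LINT y|lborel. h y * frac_ker s (x - y) - h y * frac_ker s (x' - y)\<bar> \<le> ?c"
    by (intro integral_nn_bound(2)[OF _ _ le]) auto
  then have "\<bar>ext_pot s h x - ext_pot s h x'\<bar> \<le> ?c"
    unfolding ext_pot_def using i by (simp only: Bochner_Integration.integral_diff)
  also have "\<dots> \<le> lip_const * M * d powr (-1 - 2 * s) * norm (x - x')"
  proof -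
    have "(?n + 2 * s) * 2 powr (?n + 2 * s + 1) \<le> (?n + 1) * 2 powr (?n + 2)"
      using s by (intro mult_mono powr_mono) auto
    moreover have "1 / ?a \<le> 1" using s by simp
    ultimately have "((?n + 2 * s) * 2 powr (?n + 2 * s + 1)) * (1 / ?a) \<le> ((?n + 1) * 2 powr (?n + 2)) * 1"
      using s by (intro mult_mono) auto
    then have "(M * norm (x - x') * ?o * d powr (- ?a)) * (((?n + 2 * s) * 2 powr (?n + 2 * s + 1)) * (1 / ?a)) \<le>
       (M * norm (x - x') * ?o * d powr (- ?a)) * (((?n + 1) * 2 powr (?n + 2)) * 1)"
      using M o by (intro mult_left_mono) auto
    moreover have "- ?a = -1 - 2 * s" by simp
    ultimately show ?thesis unfolding lip_const_def by (simp add: mult_ac)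
  qed
  finally show ?thesis by (simp add: d_def)
qed

end

section \<open>A smooth compactly supported mollifier\<close>

text \<open>\<open>flat 0\<close> is the standard smooth function that is flat at 0. The negative
  powers are added because the derivative of \<open>flat k\<close> is a combination of
  \<open>flat (k + 1)\<close> and \<open>flat (k + 2)\<close>.\<close>

definition flat :: "nat \<Rightarrow> real \<Rightarrow> real" where
  "flat k t = (if t > 0 then exp (-1 / t) / t ^ k else 0)"

lemma power_le_exp:
  fixes x :: real
  assumes "0 \<le> x"
  shows "x ^ n \<le> fact n * exp x"
proof -
  have "(\<lambda>i. inverse (fact i) *\<^sub>R x ^ i) sums exp x" by (rule exp_converges)
  then have "(\<Sum>i\<in>{n}. inverse (fact i) *\<^sub>R x ^ i) \<le> exp x"
    using assms by (intro sum_le_suminf[where f="\<lambda>i. inverse (fact i) *\<^sub>R x ^ i", THEN order_trans])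
      (auto simp: sums_iff)
  then have "inverse (fact n) * x ^ n \<le> exp x" by simp
  then show ?thesis by (simp add: divide_simps mult.commute)
qed

lemma flat_nonneg: "0 \<le> flat k t"
  by (simp add: flat_def)

text \<open>Decay of every order at 0, from a single term of the exponential series. Order 2 gives
  the derivative 0 at the origin; order 0 gives boundedness.\<close>

lemma flat_le: "flat k t \<le> fact (k + j) * \<bar>t\<bar> ^ j"
proof (cases "t > 0")
  case True
  have "(1 / t) ^ (k + j) \<le> fact (k + j) * exp (1 / t)" using True by (intro power_le_exp) auto
  then have "(1 / t) ^ (k + j) * (exp (- (1 / t)) * t ^ j) \<le> fact (k + j) * exp (1 / t) * (exp (- (1 / t)) * t ^ j)"
    using True by (intro mult_right_mono) auto
  moreover have "(1 / t) ^ (k + j) * (exp (- (1 / t)) * t ^ j) = flat k t"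
    using True by (simp add: flat_def power_add power_one_over field_simps)
  moreover have "fact (k + j) * exp (1 / t) * (exp (- (1 / t)) * t ^ j) = fact (k + j) * t ^ j"
    by (simp add: exp_minus)
  ultimately show ?thesis using True by simp
qed (simp add: flat_def)

lemma flat_deriv: "(flat k has_real_derivative (flat (k + 2) t - real k * flat (k + 1) t)) (at t)"
proof (cases t "0::real" rule: linorder_cases)
  case less
  have "((\<lambda>t. 0) has_real_derivative 0) (at t)" by simp
  then have "(flat k has_real_derivative 0) (at t)"
    by (rule has_field_derivative_transform_within_open[where S="{..<0}"]) (use less in \<open>auto simp: flat_def\<close>)
  then show ?thesis using less by (simp add: flat_def)
next
  case greater
  have "((\<lambda>t. exp (-1 / t) / t ^ k) has_real_derivative (exp (-1 / t) / t ^ (k + 2) - real k * (exp (-1 / t) / t ^ (k + 1)))) (at t)"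
  proof (cases k)
    case 0
    then show ?thesis using greater by (auto intro!: derivative_eq_intros simp: power2_eq_square)
  next
    case (Suc j)
    have e: "((\<lambda>t. exp (-1 / t)) has_real_derivative exp (-1 / t) * (1 / (t * t))) (at t)"
      using greater by (auto intro!: derivative_eq_intros)
    have p: "((\<lambda>t. t ^ Suc j) has_real_derivative real (Suc j) * t ^ j) (at t)"
      by (rule DERIV_cong[OF DERIV_pow]) simp
    have "((\<lambda>t. exp (-1 / t) / t ^ Suc j) has_real_derivative
      (exp (-1 / t) * (1 / (t * t)) * t ^ Suc j - exp (-1 / t) * (real (Suc j) * t ^ j)) / (t ^ Suc j * t ^ Suc j)) (at t)"
      by (rule DERIV_divide[OF e p]) (use greater in auto)
    then have "((\<lambda>t. exp (-1 / t) / t ^ Suc j) has_real_derivative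
      exp (-1 / t) / t ^ (Suc j + 2) - real (Suc j) * (exp (-1 / t) / t ^ (Suc j + 1))) (at t)"
      by (rule DERIV_cong) (use greater in \<open>simp add: divide_simps; simp add: algebra_simps\<close>)
    then show ?thesis using Suc by simp
  qed
  then have "(flat k has_real_derivative (exp (-1 / t) / t ^ (k + 2) - real k * (exp (-1 / t) / t ^ (k + 1)))) (at t)"
    by (rule has_field_derivative_transform_within_open[where S="{0<..}"]) (use greater in \<open>auto simp: flat_def\<close>)
  then show ?thesis using greater by (simp add: flat_def)
next
  case equal
  have "((\<lambda>h. (flat k (0 + h) - flat k 0) / h) \<longlongrightarrow> 0) (at 0)"
  proof (rule Lim_null_comparison)
    show "\<forall>\<^sub>F h in at (0::real). norm ((flat k (0 + h) - flat k 0) / h) \<le> fact (k + 2) * \<bar>h\<bar>"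
    proof (rule eventually_at_filter[THEN iffD2], rule always_eventually, intro allI impI)
      fix h :: real assume h: "h \<noteq> 0"
      have "flat k h \<le> fact (k + 2) * \<bar>h\<bar> ^ 2" by (rule flat_le)
      then show "norm ((flat k (0 + h) - flat k 0) / h) \<le> fact (k + 2) * \<bar>h\<bar>"
        using h flat_nonneg[of k h] by (simp add: flat_def[of k 0] divide_simps power2_eq_square mult.assoc)
    qed
    show "((\<lambda>h. fact (k + 2) * \<bar>h\<bar>) \<longlongrightarrow> 0) (at (0::real))"
      by (intro tendsto_eq_intros) auto
  qed
  then have "(flat k has_real_derivative 0) (at 0)" by (simp only: DERIV_def)
  then show ?thesis using equal by (simp add: flat_def[of _ 0])
qed

text \<open>The invariant for coinduction. Smoothness is a coinductive predicate, so it suffices to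
  have a class of differentiable functions that contains the bump and is closed under directional
  derivatives. Linear functionals are included because the chain rule produces them.\<close>

inductive bump_algebra :: "real \<Rightarrow> 'a::euclidean_space \<Rightarrow> ('a \<Rightarrow> real) \<Rightarrow> bool" for r x where
  const: "bump_algebra r x (\<lambda>_. c)"
| inner: "bump_algebra r x (\<lambda>y. y \<bullet> v)"
| flat: "bump_algebra r x (\<lambda>y. flat k (r - (x - y) \<bullet> (x - y)))"
| add: "bump_algebra r x f \<Longrightarrow> bump_algebra r x g \<Longrightarrow> bump_algebra r x (\<lambda>y. f y + g y)"
| mult: "bump_algebra r x f \<Longrightarrow> bump_algebra r x g \<Longrightarrow> bump_algebra r x (\<lambda>y. f y * g y)"

lemma bump_algebra_deriv:
  assumes "bump_algebra r x f"
  shows "\<exists>f'. (\<forall>y. (f has_derivative f' y) (at y)) \<and> (\<forall>v. bump_algebra r x (\<lambda>y. f' y v))"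
  using assms
proof induction
  case (const c)
  show ?case by (intro exI[of _ "\<lambda>_ _. 0"]) (auto intro: bump_algebra.const)
next
  case (inner w)
  show ?case
    by (intro exI[of _ "\<lambda>_ v. v \<bullet> w"]) (auto intro!: derivative_eq_intros bump_algebra.const)
next
  case (flat k)
  let ?q = "\<lambda>y. r - (x - y) \<bullet> (x - y)"
  let ?f' = "\<lambda>y v. (flat (k + 2) (?q y) + (- real k) * flat (k + 1) (?q y)) * ((- 2) * (y \<bullet> v) + 2 * (x \<bullet> v))"
  show ?case
  proof (intro exI[of _ ?f'] conjI allI)
    fix y
    have q: "(?q has_derivative (\<lambda>v. 2 * ((x - y) \<bullet> v))) (at y)"
      by (auto intro!: derivative_eq_intros simp: inner_commute algebra_simps)
    have "(flat k has_derivative (*) (flat (k + 2) (?q y) - real k * flat (k + 1) (?q y))) (at (?q y))"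
      using flat_deriv unfolding has_field_derivative_def .
    from has_derivative_compose[OF q this]
    show "((\<lambda>y. flat k (?q y)) has_derivative ?f' y) (at y)"
      by (rule has_derivative_eq_rhs) (simp add: fun_eq_iff inner_diff_left)
  next
    fix v
    show "bump_algebra r x (\<lambda>y. ?f' y v)"
      by (intro bump_algebra.intros)
  qed
next
  case (add f g)
  then obtain f' g' where f: "\<forall>y. (f has_derivative f' y) (at y)" "\<forall>v. bump_algebra r x (\<lambda>y. f' y v)"
    and g: "\<forall>y. (g has_derivative g' y) (at y)" "\<forall>v. bump_algebra r x (\<lambda>y. g' y v)" by blast
  show ?case
    by (intro exI[of _ "\<lambda>y v. f' y v + g' y v"])
      (use f g in \<open>auto intro!: has_derivative_add bump_algebra.add\<close>)
next
  case (mult f g)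
  then obtain f' g' where f: "\<forall>y. (f has_derivative f' y) (at y)" "\<forall>v. bump_algebra r x (\<lambda>y. f' y v)"
    and g: "\<forall>y. (g has_derivative g' y) (at y)" "\<forall>v. bump_algebra r x (\<lambda>y. g' y v)" by blast
  show ?case
    by (intro exI[of _ "\<lambda>y v. f y * g' y v + f' y v * g y"])
      (use f g mult.hyps in \<open>auto intro!: has_derivative_mult bump_algebra.add bump_algebra.mult\<close>)
qed

lemma bump_algebra_smooth: "bump_algebra r x f \<Longrightarrow> smooth_fun f"
proof (coinduction arbitrary: f)
  case (smooth_fun f)
  then obtain f' where f': "\<And>y. (f has_derivative f' y) (at y)" "\<And>v. bump_algebra r x (\<lambda>y. f' y v)"
    using bump_algebra_deriv by blast
  have "frechet_derivative f (at y) = f' y" for y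
    using frechet_derivative_at[OF f'(1)] by simp
  then show ?case using f' by (auto simp: differentiable_def)
qed

text \<open>The squared norm keeps the inner function polynomial, hence smooth at the centre as
  well.\<close>

definition bump :: "real \<Rightarrow> 'a::euclidean_space \<Rightarrow> real" where
  "bump \<rho> z = flat 0 (\<rho>\<^sup>2 - z \<bullet> z)"

definition mollifier :: "real \<Rightarrow> 'a::euclidean_space \<Rightarrow> real" where
  "mollifier \<rho> z = bump \<rho> z / (LINT y|lborel. bump \<rho> (y::'a))"

lemma flat0_lipschitz: "\<bar>flat 0 a - flat 0 b\<bar> \<le> 2 * \<bar>a - b\<bar>"
proof -
  have "norm (flat 0 a - flat 0 b) \<le> 2 * norm (a - b)"
  proof (rule field_differentiable_bound[of UNIV])
    show "(flat 0 has_field_derivative flat 2 z) (at z within UNIV)" for z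
      using flat_deriv[of 0 z] by (simp add: numeral_2_eq_2)
    show "norm (flat 2 z) \<le> 2" for z
      using flat_le[of 2 z 0] flat_nonneg[of 2 z] by (simp add: fact_numeral)
  qed auto
  then show ?thesis by simp
qed

lemma flat_max: "flat 0 (max 0 t) = flat 0 t"
  by (simp add: flat_def max_def)

text \<open>The polynomial inside is not globally Lipschitz, but \<open>flat 0\<close> only sees its
  positive part, which lives on the ball of radius rho and has slope at most 2 rho there.\<close>

lemma bump_lipschitz:
  assumes \<rho>: "\<rho> > 0"
  shows "\<bar>bump \<rho> a - bump \<rho> b\<bar> \<le> 4 * \<rho> * norm (a - b)"
proof -
  have le: "max 0 (\<rho>\<^sup>2 - a \<bullet> a) - max 0 (\<rho>\<^sup>2 - b \<bullet> b) \<le> 2 * \<rho> * norm (a - b)" for a b :: 'a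
  proof (cases "norm a \<le> \<rho>")
    case True
    \<comment> \<open>Capping the norm of \<open>b\<close> at rho turns the positive part at
      \<open>b\<close> into the difference of squares rho^2 - m^2.\<close>
    define m where "m = min \<rho> (norm b)"
    have "max 0 (\<rho>\<^sup>2 - b \<bullet> b) \<ge> \<rho>\<^sup>2 - m\<^sup>2" using \<rho>
      by (auto simp: m_def min_def dot_square_norm)
    moreover have "max 0 (\<rho>\<^sup>2 - a \<bullet> a) = \<rho>\<^sup>2 - (norm a)\<^sup>2"
      using True by (simp add: dot_square_norm max_def power_mono)
    moreover have "m\<^sup>2 - (norm a)\<^sup>2 \<le> 2 * \<rho> * norm (a - b)"
    proof (cases "norm a \<le> m")
      case le: True
      have "m\<^sup>2 - (norm a)\<^sup>2 = (m + norm a) * (m - norm a)" by (simp add: power2_eq_square algebra_simps)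
      also have "\<dots> \<le> (2 * \<rho>) * norm (a - b)"
      proof (rule mult_mono)
        show "m + norm a \<le> 2 * \<rho>" using True by (simp add: m_def)
        show "m - norm a \<le> norm (a - b)"
          using norm_triangle_ineq3[of b a] by (simp add: m_def norm_minus_commute)
      qed (use le \<rho> in auto)
      finally show ?thesis .
    next
      case False
      have "m \<ge> 0" using \<rho> by (simp add: m_def)
      then have "m\<^sup>2 \<le> (norm a)\<^sup>2" using False by (intro power_mono) auto
      moreover have "0 \<le> 2 * \<rho> * norm (a - b)" using \<rho> by simp
      ultimately show ?thesis by linarith
    qed
    ultimately show ?thesis by linarith
  next
    case False
    then have "\<rho>\<^sup>2 \<le> a \<bullet> a" using \<rho> by (simp add: dot_square_norm power_mono)
    then have "max 0 (\<rho>\<^sup>2 - a \<bullet> a) = 0" by simp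
    moreover have "0 \<le> 2 * \<rho> * norm (a - b)" using \<rho> by simp
    ultimately show ?thesis using max.cobounded1[of 0 "\<rho>\<^sup>2 - b \<bullet> b"] by linarith
  qed
  have "\<bar>bump \<rho> a - bump \<rho> b\<bar> \<le> 2 * \<bar>max 0 (\<rho>\<^sup>2 - a \<bullet> a) - max 0 (\<rho>\<^sup>2 - b \<bullet> b)\<bar>"
    using flat0_lipschitz[of "max 0 (\<rho>\<^sup>2 - a \<bullet> a)" "max 0 (\<rho>\<^sup>2 - b \<bullet> b)"]
    by (simp add: flat_max bump_def)
  also have "\<dots> \<le> 2 * (2 * \<rho> * norm (a - b))"
    using le[of a b] le[of b a] by (simp add: abs_le_iff norm_minus_commute)
  finally show ?thesis by simp
qed

lemma bump_zero: "\<rho> > 0 \<Longrightarrow> \<rho> \<le> norm z \<Longrightarrow> bump \<rho> z = 0"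
  by (simp add: bump_def flat_def dot_square_norm power_mono not_less)

lemma bump_pos: "norm z < \<rho> \<Longrightarrow> 0 < bump \<rho> z"
  by (simp add: bump_def flat_def dot_square_norm power_strict_mono)

lemma bump_nonneg: "0 \<le> bump \<rho> z" by (simp add: bump_def flat_nonneg)

lemma bump_le1: "bump \<rho> z \<le> 1"
  using flat_le[of 0 _ 0] by (simp add: bump_def)

lemma borel_measurable_flat [measurable]: "flat k \<in> borel_measurable borel"
  unfolding flat_def by measurable

lemma borel_measurable_bump [measurable]: "bump \<rho> \<in> borel_measurable borel"
  unfolding bump_def by measurable

lemma integrable_bump:
  assumes "\<rho> > 0"
  shows "integrable lborel (bump \<rho> :: 'a::euclidean_space \<Rightarrow> real)"
proof (rule Bochner_Integration.integrable_bound)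
  show "integrable lborel (indicator (ball (0::'a) \<rho>) :: 'a \<Rightarrow> real)"
    by (intro integrable_real_indicator) (use assms in \<open>auto simp: emeasure_ball\<close>)
  show "AE z in lborel. norm (bump \<rho> z) \<le> norm (indicator (ball (0::'a) \<rho>) z :: real)"
  proof (rule AE_I2)
    fix z :: 'a
    show "norm (bump \<rho> z) \<le> norm (indicator (ball (0::'a) \<rho>) z :: real)"
      using bump_zero[OF assms, of z] bump_nonneg[of \<rho> z] bump_le1[of \<rho> z]
      by (cases "norm z < \<rho>") auto
  qed
qed measurable

lemma bump_integral_pos:
  assumes "\<rho> > 0"
  shows "(LINT y|lborel. bump \<rho> (y::'a::euclidean_space)) > 0"
proof -
  have "(LINT y|lborel. bump \<rho> (y::'a)) \<noteq> 0"
  proof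
    assume "(LINT y|lborel. bump \<rho> (y::'a)) = 0"
    then have "AE y in lborel. bump \<rho> (y::'a) = 0"
      using integral_nonneg_eq_0_iff_AE[OF integrable_bump[OF assms]] bump_nonneg by (metis (mono_tags, lifting) AE_I2)
    then have "AE y in lborel. y \<notin> ball (0::'a) \<rho>"
      by eventually_elim (use bump_pos in force)
    then have "emeasure lborel (ball (0::'a) \<rho>) = 0"
      by (subst (asm) AE_iff_null_sets[symmetric]) auto
    moreover have "unit_ball_vol (real DIM('a)) * \<rho> ^ DIM('a) > 0"
      using assms by (intro mult_pos_pos unit_ball_vol_pos) auto
    ultimately show False using assms by (simp add: emeasure_ball)
  qed
  moreover have "(LINT y|lborel. bump \<rho> (y::'a)) \<ge> 0" using bump_nonneg by (intro integral_nonneg_AE) auto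
  ultimately show ?thesis by linarith
qed

lemma borel_measurable_mollifier [measurable]: "mollifier \<rho> \<in> borel_measurable borel"
  unfolding mollifier_def by measurable

lemma mollifier_nonneg: "\<rho> > 0 \<Longrightarrow> 0 \<le> mollifier \<rho> z"
  unfolding mollifier_def by (intro divide_nonneg_pos bump_nonneg bump_integral_pos)

lemma mollifier_zero: "\<rho> > 0 \<Longrightarrow> \<rho> \<le> norm z \<Longrightarrow> mollifier \<rho> z = 0"
  by (simp add: mollifier_def bump_zero)

lemma mollifier_integral:
  assumes "\<rho> > 0"
  shows "has_bochner_integral lborel (mollifier \<rho> :: 'a::euclidean_space \<Rightarrow> real) 1"
proof -
  have "has_bochner_integral lborel (\<lambda>z::'a. bump \<rho> z / (LINT y|lborel. bump \<rho> (y::'a))) ((LINT y|lborel. bump \<rho> (y::'a)) / (LINT y|lborel. bump \<rho> (y::'a)))"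
    using integrable_bump[OF assms] by (intro has_bochner_integral_divide_zero) (auto simp: has_bochner_integral_iff)
  then show ?thesis using bump_integral_pos[OF assms, where 'a='a] by (simp add: mollifier_def[abs_def])
qed

lemma mollifier_lipschitz:
  assumes "\<rho> > 0"
  obtains L where "L > 0" "\<And>a b :: 'a::euclidean_space. \<bar>mollifier \<rho> a - mollifier \<rho> b\<bar> \<le> L * norm (a - b)"
proof
  let ?Z = "LINT y|lborel. bump \<rho> (y::'a)"
  have Z: "?Z > 0" by (rule bump_integral_pos[OF assms])
  show "4 * \<rho> / ?Z > 0" using assms Z by simp
  fix a b :: 'a
  have "\<bar>mollifier \<rho> a - mollifier \<rho> b\<bar> = \<bar>bump \<rho> a - bump \<rho> b\<bar> / ?Z"
    using Z by (simp add: mollifier_def diff_divide_distrib[symmetric])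
  also have "\<dots> \<le> 4 * \<rho> * norm (a - b) / ?Z" using Z by (intro divide_right_mono bump_lipschitz assms) auto
  finally show "\<bar>mollifier \<rho> a - mollifier \<rho> b\<bar> \<le> 4 * \<rho> / ?Z * norm (a - b)" by simp
qed

lemma mollifier_bounded:
  assumes "\<rho> > 0"
  obtains B where "B > 0" "\<And>a :: 'a::euclidean_space. mollifier \<rho> a \<le> B"
proof
  let ?Z = "LINT y|lborel. bump \<rho> (y::'a)"
  have Z: "?Z > 0" by (rule bump_integral_pos[OF assms])
  show "1 / ?Z > 0" using Z by simp
  show "mollifier \<rho> a \<le> 1 / ?Z" for a :: 'a
    unfolding mollifier_def using Z bump_le1 by (intro divide_right_mono) auto
qed

lemma test_fun_mollifier:
  assumes \<rho>: "\<rho> > 0" and sub: "cball x \<rho> \<subseteq> \<Omega>"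
  shows "test_fun \<Omega> (\<lambda>y. mollifier \<rho> (x - y))"
proof -
  have "bump_algebra (\<rho>\<^sup>2) x (\<lambda>y. (1 / (LINT y|lborel. bump \<rho> (y::'a))) * flat 0 (\<rho>\<^sup>2 - (x - y) \<bullet> (x - y)))"
    by (intro bump_algebra.intros)
  then have sm: "smooth_fun (\<lambda>y. mollifier \<rho> (x - y))"
    using bump_algebra_smooth by (simp add: mollifier_def bump_def)
  have "{y. mollifier \<rho> (x - y) \<noteq> 0} \<subseteq> cball x \<rho>"
  proof
    fix y assume "y \<in> {y. mollifier \<rho> (x - y) \<noteq> 0}"
    then have "\<not> \<rho> \<le> norm (x - y)" using mollifier_zero[OF \<rho>, of "x - y"] by auto
    then show "y \<in> cball x \<rho>" by (simp add: dist_norm)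
  qed
  then have c: "closure {y. mollifier \<rho> (x - y) \<noteq> 0} \<subseteq> cball x \<rho>"
    by (intro closure_minimal) auto
  then have "compact (closure {y. mollifier \<rho> (x - y) \<noteq> 0})"
    by (intro compact_eq_bounded_closed[THEN iffD2] conjI bounded_subset[OF bounded_cball c] closed_closure)
  then show ?thesis using sm c sub by (auto simp: test_fun_def)
qed

section \<open>Mollified solutions\<close>

lemma lborel_distr_reflect: "distr lborel borel (\<lambda>y. x - y) = (lborel :: 'a::euclidean_space measure)"
  by (subst (2) lborel_affine[of "-1" x]) (auto simp: density_1)

lemma integral_reflect:
  fixes f :: "'a::euclidean_space \<Rightarrow> real"
  assumes [measurable]: "f \<in> borel_measurable borel"
  shows "(LINT y|lborel. f (x - y)) = (LINT y|lborel. f y)"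
    "integrable lborel (\<lambda>y. f (x - y)) \<longleftrightarrow> integrable lborel f"
proof -
  show "(LINT y|lborel. f (x - y)) = (LINT y|lborel. f y)"
    by (subst (2) lborel_distr_reflect[symmetric, of x]) (simp add: integral_distr)
  show "integrable lborel (\<lambda>y. f (x - y)) \<longleftrightarrow> integrable lborel f"
    by (subst (2) lborel_distr_reflect[symmetric, of x]) (simp add: integrable_distr_eq)
qed

lemma integral_translate:
  fixes f :: "'a::euclidean_space \<Rightarrow> real"
  assumes [measurable]: "f \<in> borel_measurable borel"
  shows "(LINT y|lborel. f (y + x)) = (LINT y|lborel. f y)"
    "integrable lborel (\<lambda>y. f (y + x)) \<longleftrightarrow> integrable lborel f"
  using integral_reflect[of "\<lambda>y. f (- y)" "- x"] integral_reflect[of f 0] by (simp_all add: add.commute)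

text \<open>For s < 1/2 the singular integral of a bounded Lipschitz function converges absolutely,
  so the principal value is an ordinary integral.\<close>

lemma nl_op_lipschitz_integrable:
  fixes \<phi> :: "'a::euclidean_space \<Rightarrow> real"
  assumes [measurable]: "\<phi> \<in> borel_measurable borel" and L: "\<And>y. \<bar>\<phi> x - \<phi> y\<bar> \<le> L * norm (x - y)"
    and B: "\<And>y. \<bar>\<phi> y\<bar> \<le> B" and s: "0 < s" "s < 1/2"
  shows "integrable lborel (\<lambda>y. (\<phi> x - \<phi> y) * frac_ker s (x - y))"
proof (rule Bochner_Integration.integrable_bound)
  let ?w = "\<lambda>y. L * (norm (x - y) * frac_ker s (x - y) * indicator {..<1} (norm (x - y))) +
     2 * B * (frac_ker s (x - y) * indicator {1..} (norm (x - y)))"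
  show "integrable lborel ?w"
    using has_integral_frac_ker_head[OF s(2), of 1 x] has_integral_frac_ker_tail[OF s(1), of 1 x]
    by (intro Bochner_Integration.integrable_add integrable_mult_right) (auto simp: has_bochner_integral_iff)
  show "AE y in lborel. norm ((\<phi> x - \<phi> y) * frac_ker s (x - y)) \<le> norm (?w y)"
  proof (rule AE_I2)
    fix y
    have "\<bar>\<phi> x - \<phi> y\<bar> \<le> 2 * B" using B[of x] B[of y] by linarith
    then have "\<bar>\<phi> x - \<phi> y\<bar> * frac_ker s (x - y) \<le> 2 * B * frac_ker s (x - y)"
      "\<bar>\<phi> x - \<phi> y\<bar> * frac_ker s (x - y) \<le> L * norm (x - y) * frac_ker s (x - y)"
      using L[of y] by (auto intro: mult_right_mono)
    then have "\<bar>\<phi> x - \<phi> y\<bar> * frac_ker s (x - y) \<le> ?w y"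
      by (cases "norm (x - y) < 1") (auto simp: mult.assoc)
    then show "norm ((\<phi> x - \<phi> y) * frac_ker s (x - y)) \<le> norm (?w y)"
      by (simp add: abs_mult)
  qed
qed measurable

text \<open>Cutting out a ball of radius e costs at most the Lipschitz constant times the first
  moment of the kernel there, which is O(e^(1-2s)).\<close>

lemma frac_lap_eq:
  fixes \<phi> :: "'a::euclidean_space \<Rightarrow> real"
  assumes [measurable]: "\<phi> \<in> borel_measurable borel" and L: "\<And>y. \<bar>\<phi> x - \<phi> y\<bar> \<le> L * norm (x - y)"
    and B: "\<And>y. \<bar>\<phi> y\<bar> \<le> B" and s: "0 < s" "s < 1/2"
  shows "frac_lap s \<phi> x = c_Ns DIM('a) s * nl_op s \<phi> x"
proof -
  let ?o = "omega_sphere DIM('a)"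
  let ?f = "\<lambda>y. (\<phi> x - \<phi> y) * frac_ker s (x - y)"
  let ?I = "\<lambda>e. LINT y : {y. norm (x - y) > e} | lebesgue.
            (\<phi> x - \<phi> y) / norm (x - y) powr (real DIM('a) + 2 * s)"
  have i: "integrable lborel ?f" by (rule nl_op_lipschitz_integrable[OF assms])
  have [measurable]: "{y. e < norm (x - y)} \<in> sets borel" for e by measurable
  have I: "?I e = (LINT y|lborel. indicator {y. norm (x - y) > e} y * ?f y)" for e
  proof -
    have "?I e = (LINT y|lebesgue. indicator {y. norm (x - y) > e} y * ?f y)"
      unfolding set_lebesgue_integral_def by (simp only: frac_ker_def powr_minus_divide times_divide_eq_right mult_1_right real_scaleR_def)
    also have "\<dots> = (LINT y|lborel. indicator {y. norm (x - y) > e} y * ?f y)"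
      by (rule integral_completion) measurable
    finally show ?thesis .
  qed
  have "((\<lambda>e. nl_op s \<phi> x - ?I e) \<longlongrightarrow> 0) (at_right 0)"
  proof (rule Lim_null_comparison)
    show "\<forall>\<^sub>F e in at_right 0. norm (nl_op s \<phi> x - ?I e) \<le> L * (?o * (2 * e) powr (1 - 2 * s) / (1 - 2 * s))"
      using eventually_at_right_less
    proof eventually_elim
      case (elim e)
      \<comment> \<open>The omitted set is a closed ball of radius \<open>e\<close>, the moment
        formula is for open balls; radius \<open>2 * e\<close> covers it.\<close>
      have hb: "has_bochner_integral lborel (\<lambda>y. norm (x - y) * frac_ker s (x - y) * indicator {..<2*e} (norm (x - y)))
        (?o * (2 * e) powr (1 - 2 * s) / (1 - 2 * s))"
        using elim by (intro has_integral_frac_ker_head[OF s(2)]) auto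
      have ii: "integrable lborel (\<lambda>y. indicator {y. norm (x - y) > e} y * ?f y)"
        by (rule Bochner_Integration.integrable_bound[OF i]) (auto simp: indicator_def)
      have "nl_op s \<phi> x - ?I e = (LINT y|lborel. ?f y - indicator {y. norm (x - y) > e} y * ?f y)"
        unfolding nl_op_def I using i ii by (rule Bochner_Integration.integral_diff[symmetric])
      also have "\<bar>\<dots>\<bar> \<le> (LINT y|lborel. L * (norm (x - y) * frac_ker s (x - y) * indicator {..<2*e} (norm (x - y))))"
      proof (intro integral_abs_bound[THEN order_trans] integral_mono)
        show "integrable lborel (\<lambda>y. \<bar>?f y - indicator {y. norm (x - y) > e} y * ?f y\<bar>)"
          using i ii by (intro integrable_abs Bochner_Integration.integrable_diff)
        show "integrable lborel (\<lambda>y. L * (norm (x - y) * frac_ker s (x - y) * indicator {..<2*e} (norm (x - y))))"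
          using hb by (intro integrable_mult_right) (auto simp: has_bochner_integral_iff)
        fix y
        have "\<bar>\<phi> x - \<phi> y\<bar> * frac_ker s (x - y) \<le> L * norm (x - y) * frac_ker s (x - y)"
          using L[of y] by (intro mult_right_mono) auto
        moreover have "0 \<le> L * (norm (x - y) * frac_ker s (x - y))"
          unfolding mult.assoc[symmetric] by (rule mult_nonneg_nonneg[OF order_trans[OF abs_ge_zero L]]) simp
        ultimately show "\<bar>?f y - indicator {y. norm (x - y) > e} y * ?f y\<bar> \<le> L * (norm (x - y) * frac_ker s (x - y) * indicator {..<2*e} (norm (x - y)))"
          using elim by (auto simp: indicator_def abs_mult mult.assoc)
      qed
      also have "\<dots> = L * (?o * (2 * e) powr (1 - 2 * s) / (1 - 2 * s))"
        using hb by (simp add: has_bochner_integral_iff)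
      finally show ?case by simp
    qed
    have "((\<lambda>e. (2 * e) powr (1 - 2 * s)) \<longlongrightarrow> 0) (at_right 0)"
      using s by real_asymp
    from tendsto_mult_left[OF this, of "L * (?o / (1 - 2 * s))"]
    show "((\<lambda>e. L * (?o * (2 * e) powr (1 - 2 * s) / (1 - 2 * s))) \<longlongrightarrow> 0) (at_right 0)"
      by (simp add: mult_ac)
  qed
  then have "(?I \<longlongrightarrow> nl_op s \<phi> x) (at_right 0)"
    by (rule Lim_transform2[OF tendsto_const, of "nl_op s \<phi> x"])
  then have "Lim (at_right 0) ?I = nl_op s \<phi> x"
    by (intro tendsto_Lim) auto
  then show ?thesis unfolding frac_lap_def by simp
qed

definition mollify :: "real \<Rightarrow> ('a::euclidean_space \<Rightarrow> real) \<Rightarrow> 'a \<Rightarrow> real" where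
  "mollify \<rho> f x = (LINT y|lborel. f y * mollifier \<rho> (x - y))"

lemma borel_measurable_mollify [measurable]:
  assumes [measurable]: "f \<in> borel_measurable borel"
  shows "mollify \<rho> f \<in> borel_measurable borel"
  unfolding mollify_def by measurable

lemma mollify_integrable:
  fixes f :: "'a::euclidean_space \<Rightarrow> real"
  assumes [measurable]: "f \<in> borel_measurable borel" and B: "\<And>y. \<bar>f y\<bar> \<le> B" and \<rho>: "\<rho> > 0"
  shows "integrable lborel (\<lambda>y. f y * mollifier \<rho> (x - y))"
proof (rule Bochner_Integration.integrable_bound)
  show "integrable lborel (\<lambda>y. B * mollifier \<rho> (x - y))"
    using mollifier_integral[OF \<rho>, where 'a='a] integral_reflect(2)[of "mollifier \<rho>" x]
    by (intro integrable_mult_right) (auto simp: has_bochner_integral_iff)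
  show "AE y in lborel. norm (f y * mollifier \<rho> (x - y)) \<le> norm (B * mollifier \<rho> (x - y))"
    using B mollifier_nonneg[OF \<rho>] by (auto simp: abs_mult intro!: AE_I2 mult_right_mono order.trans[OF B])
qed measurable

lemma mollify_const:
  fixes x :: "'a::euclidean_space"
  assumes "\<rho> > 0" shows "mollify \<rho> (\<lambda>_. c) x = c"
  using mollifier_integral[OF assms, where 'a='a] integral_reflect(1)[of "mollifier \<rho>" x]
  by (simp add: mollify_def has_bochner_integral_iff)

lemma mollify_bound:
  fixes f :: "'a::euclidean_space \<Rightarrow> real"
  assumes [measurable]: "f \<in> borel_measurable borel" and B: "\<And>y. \<bar>f y\<bar> \<le> B" and \<rho>: "\<rho> > 0"
  shows "\<bar>mollify \<rho> f x\<bar> \<le> B"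
proof -
  have "\<bar>mollify \<rho> f x\<bar> \<le> (LINT y|lborel. B * mollifier \<rho> (x - y))"
    unfolding mollify_def
  proof (intro integral_abs_bound[THEN order_trans] integral_mono integrable_abs mollify_integrable[OF assms])
    show "integrable lborel (\<lambda>y. B * mollifier \<rho> (x - y))"
      using mollify_integrable[of "\<lambda>_. B" "\<bar>B\<bar>" \<rho> x] \<rho> by simp
    show "\<bar>f y * mollifier \<rho> (x - y)\<bar> \<le> B * mollifier \<rho> (x - y)" for y
      using B[of y] mollifier_nonneg[OF \<rho>, of "x - y"] by (auto simp: abs_mult intro!: mult_right_mono)
  qed
  also have "\<dots> = B" using mollify_const[OF \<rho>, of B x] by (simp add: mollify_def)
  finally show ?thesis .
qed

text \<open>Continuity makes the maximum in the comparison argument attained. The increment of the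
  mollifier is supported in a ball of fixed radius and small there.\<close>

lemma continuous_on_mollify:
  fixes f :: "'a::euclidean_space \<Rightarrow> real"
  assumes [measurable]: "f \<in> borel_measurable borel" and B: "\<And>y. \<bar>f y\<bar> \<le> B" and \<rho>: "\<rho> > 0"
  shows "continuous_on S (mollify \<rho> f)"
proof -
  obtain L where L: "L > 0" "\<And>a b :: 'a. \<bar>mollifier \<rho> a - mollifier \<rho> b\<bar> \<le> L * norm (a - b)"
    using mollifier_lipschitz[OF \<rho>] by blast
  have Bp: "B \<ge> 0" using B[of 0] by linarith
  have vol: "emeasure lborel (ball x (\<rho> + 1)) = ennreal (unit_ball_vol (real DIM('a)) * (\<rho> + 1) ^ DIM('a))" for x :: 'a
    using \<rho> by (simp add: emeasure_ball)
  define V where "V = unit_ball_vol (real DIM('a)) * (\<rho> + 1) ^ DIM('a)"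
  have V: "V > 0" using \<rho> by (auto simp: V_def intro!: mult_pos_pos unit_ball_vol_pos)
  have le: "\<bar>mollify \<rho> f x - mollify \<rho> f x'\<bar> \<le> B * L * V * norm (x - x')" if x': "norm (x - x') < 1" for x x'
  proof -
    have "mollify \<rho> f x - mollify \<rho> f x' = (LINT y|lborel. f y * mollifier \<rho> (x - y) - f y * mollifier \<rho> (x' - y))"
      unfolding mollify_def using mollify_integrable[OF assms] by (intro Bochner_Integration.integral_diff[symmetric])
    also have "\<bar>\<dots>\<bar> \<le> B * L * norm (x - x') * V"
    proof (rule integral_nn_bound(2))
      have "(\<integral>\<^sup>+y. ennreal \<bar>f y * mollifier \<rho> (x - y) - f y * mollifier \<rho> (x' - y)\<bar> \<partial>lborel) \<le>
        (\<integral>\<^sup>+y. ennreal (B * L * norm (x - x')) * indicator (ball x (\<rho> + 1)) y \<partial>lborel)"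
      proof (rule nn_integral_mono)
        fix y
        have "\<bar>f y * mollifier \<rho> (x - y) - f y * mollifier \<rho> (x' - y)\<bar> = \<bar>f y\<bar> * \<bar>mollifier \<rho> (x - y) - mollifier \<rho> (x' - y)\<bar>"
          by (simp add: abs_mult[symmetric] right_diff_distrib)
        also have "\<dots> \<le> B * (L * norm (x - x'))"
          using B[of y] L(2)[of "x - y" "x' - y"] Bp by (intro mult_mono) auto
        finally have 1: "\<bar>f y * mollifier \<rho> (x - y) - f y * mollifier \<rho> (x' - y)\<bar> \<le> B * L * norm (x - x')" by simp
        have 2: "mollifier \<rho> (x - y) = 0 \<and> mollifier \<rho> (x' - y) = 0" if "y \<notin> ball x (\<rho> + 1)"
          using that x' norm_triangle_ineq[of "x - x'" "x' - y"]
          by (intro conjI mollifier_zero[OF \<rho>]) (auto simp: dist_norm)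
        show "ennreal \<bar>f y * mollifier \<rho> (x - y) - f y * mollifier \<rho> (x' - y)\<bar> \<le> ennreal (B * L * norm (x - x')) * indicator (ball x (\<rho> + 1)) y"
          using 1 2 by (cases "y \<in> ball x (\<rho> + 1)") (auto intro!: ennreal_leI)
      qed
      also have "\<dots> = ennreal (B * L * norm (x - x') * V)"
        using Bp L(1) V by (subst nn_integral_cmult_indicator) (auto simp: vol V_def[symmetric] ennreal_mult[symmetric])
      finally show "(\<integral>\<^sup>+y. ennreal \<bar>f y * mollifier \<rho> (x - y) - f y * mollifier \<rho> (x' - y)\<bar> \<partial>lborel) \<le> ennreal (B * L * norm (x - x') * V)" .
    qed (use Bp L(1) V in auto)
    finally show ?thesis by (simp add: mult_ac)
  qed
  show ?thesis
  proof (rule continuous_at_imp_continuous_on, intro ballI)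
    fix x
    have "((\<lambda>x'. mollify \<rho> f x' - mollify \<rho> f x) \<longlongrightarrow> 0) (at x)"
    proof (rule Lim_null_comparison)
      have "\<forall>\<^sub>F x' in at x. dist x' x < 1" by (rule eventually_at_ball'[THEN eventually_mono]) (auto simp: dist_commute)
      then show "\<forall>\<^sub>F x' in at x. norm (mollify \<rho> f x' - mollify \<rho> f x) \<le> B * L * V * norm (x' - x)"
        by eventually_elim (use le in \<open>auto simp: dist_norm\<close>)
      show "((\<lambda>x'. B * L * V * norm (x' - x)) \<longlongrightarrow> 0) (at x)"
        by (auto intro!: tendsto_eq_intros)
    qed
    then show "isCont (mollify \<rho> f) x" by (simp add: isCont_def LIM_zero_iff)
  qed
qed

lemma fubini_nn:
  fixes f :: "'a::euclidean_space \<Rightarrow> 'a \<Rightarrow> real"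
  assumes [measurable]: "(\<lambda>(x, y). f x y) \<in> borel_measurable (borel \<Otimes>\<^sub>M borel)"
    and fin: "(\<integral>\<^sup>+x. (\<integral>\<^sup>+y. ennreal \<bar>f x y\<bar> \<partial>lborel) \<partial>lborel) < \<infinity>"
  shows "(LINT x|lborel. (LINT y|lborel. f x y)) = (LINT y|lborel. (LINT x|lborel. f x y))"
    "integrable lborel (\<lambda>x. LINT y|lborel. f x y)"
    "integrable lborel (\<lambda>y. LINT x|lborel. f x y)"
proof -
  have i: "integrable (lborel \<Otimes>\<^sub>M lborel) (\<lambda>(x, y). f x y)"
  proof (rule integrableI_bounded)
    have "(\<integral>\<^sup>+z. ennreal (norm (case z of (x, y) \<Rightarrow> f x y)) \<partial>(lborel \<Otimes>\<^sub>M lborel)) =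
      (\<integral>\<^sup>+x. (\<integral>\<^sup>+y. ennreal \<bar>f x y\<bar> \<partial>lborel) \<partial>lborel)"
      by (subst lborel.nn_integral_fst[symmetric]) auto
    then show "(\<integral>\<^sup>+z. ennreal (norm (case z of (x, y) \<Rightarrow> f x y)) \<partial>(lborel \<Otimes>\<^sub>M lborel)) < \<infinity>"
      using fin by simp
  qed simp
  show "(LINT x|lborel. (LINT y|lborel. f x y)) = (LINT y|lborel. (LINT x|lborel. f x y))"
    using lborel_pair.Fubini_integral[OF i] by simp
  show "integrable lborel (\<lambda>x. LINT y|lborel. f x y)"
    using lborel_pair.integrable_fst[OF i] by simp
  show "integrable lborel (\<lambda>y. LINT x|lborel. f x y)"
    using lborel_pair.integrable_snd[OF i] by simp
qed

text \<open>The two bounds serve small and large shifts: the minimum of K norm z and 2, times the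
  kernel, is integrable for 0 < s < 1/2. This justifies Fubini in the next lemma.\<close>

lemma mollifier_L1_increment:
  assumes \<rho>: "\<rho> > 0"
  obtains K where "K > 0" "\<And>x z :: 'a::euclidean_space. norm z < 1 \<Longrightarrow>
     (\<integral>\<^sup>+y. ennreal \<bar>mollifier \<rho> (x - y) - mollifier \<rho> (x - z - y)\<bar> \<partial>lborel) \<le> ennreal (K * norm z)"
   "\<And>x z :: 'a. (\<integral>\<^sup>+y. ennreal \<bar>mollifier \<rho> (x - y) - mollifier \<rho> (x - z - y)\<bar> \<partial>lborel) \<le> 2"
proof -
  obtain L where L: "L > 0" "\<And>a b :: 'a. \<bar>mollifier \<rho> a - mollifier \<rho> b\<bar> \<le> L * norm (a - b)"
    using mollifier_lipschitz[OF \<rho>] by blast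
  define V where "V = unit_ball_vol (real DIM('a)) * (\<rho> + 1) ^ DIM('a)"
  have V: "V > 0" using \<rho> by (auto simp: V_def intro!: mult_pos_pos unit_ball_vol_pos)
  have vol: "emeasure lborel (ball x (\<rho> + 1)) = ennreal V" for x :: 'a
    using \<rho> by (simp add: emeasure_ball V_def)
  have one: "(\<integral>\<^sup>+y. ennreal (mollifier \<rho> (x - y)) \<partial>lborel) = 1" for x :: 'a
  proof -
    have "(\<integral>\<^sup>+y. ennreal (mollifier \<rho> (x - y)) \<partial>lborel) = (\<integral>\<^sup>+y. ennreal (mollifier \<rho> (y :: 'a)) \<partial>lborel)"
      by (rule nn_integral_shift) measurable
    also have "\<dots> = ennreal 1"
      using mollifier_integral[OF \<rho>, where 'a='a] mollifier_nonneg[OF \<rho>]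
      by (subst nn_integral_eq_integral) (auto simp: has_bochner_integral_iff)
    finally show ?thesis by simp
  qed
  show ?thesis
  proof (rule that[of "L * V"])
    show "L * V > 0" using L V by simp
    fix x z :: 'a
    show "(\<integral>\<^sup>+y. ennreal \<bar>mollifier \<rho> (x - y) - mollifier \<rho> (x - z - y)\<bar> \<partial>lborel) \<le> 2"
    proof -
      have "(\<integral>\<^sup>+y. ennreal \<bar>mollifier \<rho> (x - y) - mollifier \<rho> (x - z - y)\<bar> \<partial>lborel) \<le>
        (\<integral>\<^sup>+y. ennreal (mollifier \<rho> (x - y)) + ennreal (mollifier \<rho> (x - z - y)) \<partial>lborel)"
      proof (rule nn_integral_mono)
        fix y
        have "0 \<le> mollifier \<rho> (x - y)" "0 \<le> mollifier \<rho> (x - z - y)" by (auto intro: mollifier_nonneg[OF \<rho>])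
        then show "ennreal \<bar>mollifier \<rho> (x - y) - mollifier \<rho> (x - z - y)\<bar> \<le> ennreal (mollifier \<rho> (x - y)) + ennreal (mollifier \<rho> (x - z - y))"
          by (auto simp flip: ennreal_plus intro!: ennreal_leI)
      qed
      also have "\<dots> = 1 + 1" by (subst nn_integral_add) (auto simp: one)
      finally show ?thesis by simp
    qed
    assume z: "norm z < 1"
    have "(\<integral>\<^sup>+y. ennreal \<bar>mollifier \<rho> (x - y) - mollifier \<rho> (x - z - y)\<bar> \<partial>lborel) \<le>
      (\<integral>\<^sup>+y. ennreal (L * norm z) * indicator (ball x (\<rho> + 1)) y \<partial>lborel)"
    proof (rule nn_integral_mono)
      fix y
      have 1: "\<bar>mollifier \<rho> (x - y) - mollifier \<rho> (x - z - y)\<bar> \<le> L * norm z"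
        using L(2)[of "x - y" "x - z - y"] by simp
      have 2: "mollifier \<rho> (x - y) = 0 \<and> mollifier \<rho> (x - z - y) = 0" if "y \<notin> ball x (\<rho> + 1)"
        using that z norm_triangle_ineq[of z "x - z - y"]
        by (intro conjI mollifier_zero[OF \<rho>]) (auto simp: dist_norm)
      show "ennreal \<bar>mollifier \<rho> (x - y) - mollifier \<rho> (x - z - y)\<bar> \<le> ennreal (L * norm z) * indicator (ball x (\<rho> + 1)) y"
        using 1 2 by (cases "y \<in> ball x (\<rho> + 1)") (auto intro!: ennreal_leI)
    qed
    also have "\<dots> = ennreal (L * V * norm z)"
      using L(1) V by (subst nn_integral_cmult_indicator) (auto simp: vol ennreal_mult[symmetric] mult_ac)
    finally show "(\<integral>\<^sup>+y. ennreal \<bar>mollifier \<rho> (x - y) - mollifier \<rho> (x - z - y)\<bar> \<partial>lborel) \<le> ennreal (L * V * norm z)" .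
  qed
qed

text \<open>The translated mollifier is an admissible test function. Symmetry of the kernel moves
  the operator from the test function to \<open>v\<close>, so testing at \<open>x\<close> is the
  same as evaluating the operator on the mollified function at \<open>x\<close>. The Borel function
  \<open>v\<close> replaces \<open>u\<close>, which is only Lebesgue measurable.\<close>

lemma harmonic_mollify:
  fixes u v :: "'a::euclidean_space \<Rightarrow> real"
  assumes um: "u \<in> borel_measurable lebesgue" and [measurable]: "v \<in> borel_measurable borel"
    and eq: "AE y in lebesgue. u y = v y" and B: "\<And>y. \<bar>v y\<bar> \<le> B"
    and harm: "s_harmonic s \<Omega> u" and s: "0 < s" "s < 1/2" and c: "c_Ns DIM('a) s \<noteq> 0"
    and \<rho>: "\<rho> > 0" and sub: "cball x \<rho> \<subseteq> \<Omega>"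
  shows "integrable lborel (\<lambda>y. (mollify \<rho> v x - mollify \<rho> v y) * frac_ker s (x - y))"
    "nl_op s (mollify \<rho> v) x = 0"
proof -
  let ?c = "c_Ns DIM('a) s" and ?U = "mollify \<rho> v" and ?\<eta> = "mollifier \<rho> :: 'a \<Rightarrow> real"
  let ?\<phi> = "\<lambda>y. ?\<eta> (x - y)"
  obtain L where L: "L > 0" "\<And>a b :: 'a. \<bar>?\<eta> a - ?\<eta> b\<bar> \<le> L * norm (a - b)"
    using mollifier_lipschitz[OF \<rho>] by blast
  obtain E where E: "E > 0" "\<And>a :: 'a. ?\<eta> a \<le> E"
    using mollifier_bounded[OF \<rho>] by blast
  have Bp: "B \<ge> 0" using B[of 0] by linarith
  have fl: "frac_lap s ?\<phi> y = ?c * nl_op s ?\<phi> y" for y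
  proof (rule frac_lap_eq[where L=L and B=E])
    show "\<bar>?\<phi> y - ?\<phi> z\<bar> \<le> L * norm (y - z)" for z
      using L(2)[of "x - y" "x - z"] by (simp add: norm_minus_commute)
    show "\<bar>?\<phi> z\<bar> \<le> E" for z using E(2) mollifier_nonneg[OF \<rho>, of "x - z"] by simp
  qed (use s in auto)
  have [measurable]: "nl_op s ?\<phi> \<in> borel_measurable borel"
    unfolding nl_op_def by measurable
  have "0 = (LINT y|lebesgue. u y * frac_lap s ?\<phi> y)"
    using harm test_fun_mollifier[OF \<rho> sub] unfolding s_harmonic_def by auto
  also have "\<dots> = (LINT y|lebesgue. u y * (?c * nl_op s ?\<phi> y))" unfolding fl ..
  also have "\<dots> = (LINT y|lebesgue. v y * (?c * nl_op s ?\<phi> y))"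
  proof (rule integral_cong_AE)
    show "AE y in lebesgue. u y * (?c * nl_op s ?\<phi> y) = v y * (?c * nl_op s ?\<phi> y)"
      using eq by eventually_elim simp
    have "nl_op s ?\<phi> \<in> borel_measurable lebesgue" "v \<in> borel_measurable lebesgue"
      by (auto intro!: measurable_completion)
    then show "(\<lambda>y. u y * (?c * nl_op s ?\<phi> y)) \<in> borel_measurable lebesgue"
      "(\<lambda>y. v y * (?c * nl_op s ?\<phi> y)) \<in> borel_measurable lebesgue"
      using um by measurable
  qed
  also have "\<dots> = (LINT y|lborel. v y * (?c * nl_op s ?\<phi> y))"
    by (rule integral_completion) measurable
  also have "\<dots> = ?c * (LINT y|lborel. v y * nl_op s ?\<phi> y)"
    by (simp only: mult.left_commute[of _ ?c] integral_mult_right_zero)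
  finally have zero: "(LINT y|lborel. v y * nl_op s ?\<phi> y) = 0" using c by simp
  \<comment> \<open>In the increment variable \<open>z\<close> both orders of integration are
    recognisable: over \<open>y\<close> first it is the increment of the mollification times the
    kernel, over \<open>z\<close> first it is \<open>v\<close> times the operator on the test
    function.\<close>
  let ?f = "\<lambda>z y. v y * (?\<eta> (x - y) - ?\<eta> (x - z - y)) * frac_ker s z"
  obtain K where K: "K > 0" "\<And>x z :: 'a. norm z < 1 \<Longrightarrow>
     (\<integral>\<^sup>+y. ennreal \<bar>?\<eta> (x - y) - ?\<eta> (x - z - y)\<bar> \<partial>lborel) \<le> ennreal (K * norm z)"
   "\<And>x z :: 'a. (\<integral>\<^sup>+y. ennreal \<bar>?\<eta> (x - y) - ?\<eta> (x - z - y)\<bar> \<partial>lborel) \<le> 2"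
    using mollifier_L1_increment[OF \<rho>, where 'a='a] by blast
  let ?w = "\<lambda>z::'a. K * (norm z * frac_ker s z * indicator {..<1} (norm z)) + 2 * (frac_ker s z * indicator {1..} (norm z))"
  have w0: "0 \<le> ?w z" for z using K(1) by simp
  have wi: "integrable lborel ?w"
    using has_integral_frac_ker_head[OF s(2), of 1 "0::'a"] has_integral_frac_ker_tail[OF s(1), of 1 "0::'a"]
    by (intro Bochner_Integration.integrable_add integrable_mult_right) (auto simp: has_bochner_integral_iff)
  have "(\<integral>\<^sup>+z. (\<integral>\<^sup>+y. ennreal \<bar>?f z y\<bar> \<partial>lborel) \<partial>lborel) \<le> (\<integral>\<^sup>+z. ennreal B * ennreal (?w z) \<partial>lborel)"
  proof (rule nn_integral_mono)
    fix z :: 'a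
    have "(\<integral>\<^sup>+y. ennreal \<bar>?f z y\<bar> \<partial>lborel) \<le> (\<integral>\<^sup>+y. ennreal (B * frac_ker s z) * ennreal \<bar>?\<eta> (x - y) - ?\<eta> (x - z - y)\<bar> \<partial>lborel)"
    proof (rule nn_integral_mono)
      fix y
      have "\<bar>?f z y\<bar> = \<bar>v y\<bar> * (frac_ker s z * \<bar>?\<eta> (x - y) - ?\<eta> (x - z - y)\<bar>)" by (simp add: abs_mult)
      also have "\<dots> \<le> B * (frac_ker s z * \<bar>?\<eta> (x - y) - ?\<eta> (x - z - y)\<bar>)" by (intro mult_right_mono B) simp
      finally show "ennreal \<bar>?f z y\<bar> \<le> ennreal (B * frac_ker s z) * ennreal \<bar>?\<eta> (x - y) - ?\<eta> (x - z - y)\<bar>"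
        using Bp by (subst ennreal_mult[symmetric]) (auto intro!: ennreal_leI simp: mult.assoc)
    qed
    also have "\<dots> = ennreal (B * frac_ker s z) * (\<integral>\<^sup>+y. ennreal \<bar>?\<eta> (x - y) - ?\<eta> (x - z - y)\<bar> \<partial>lborel)"
      by (rule nn_integral_cmult) measurable
    also have "\<dots> \<le> ennreal B * ennreal (?w z)"
    proof (cases "norm z < 1")
      case True
      have "ennreal (B * frac_ker s z) * (\<integral>\<^sup>+y. ennreal \<bar>?\<eta> (x - y) - ?\<eta> (x - z - y)\<bar> \<partial>lborel) \<le> ennreal (B * frac_ker s z) * ennreal (K * norm z)"
        by (intro mult_left_mono K(2) True) simp
      also have "\<dots> = ennreal B * ennreal (?w z)"
        using True Bp K(1) by (simp add: ennreal_mult[symmetric] mult_ac)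
      finally show ?thesis .
    next
      case False
      have "ennreal (B * frac_ker s z) * (\<integral>\<^sup>+y. ennreal \<bar>?\<eta> (x - y) - ?\<eta> (x - z - y)\<bar> \<partial>lborel) \<le> ennreal (B * frac_ker s z) * ennreal 2"
        using K(3)[of x z] by (intro mult_left_mono) auto
      also have "\<dots> = ennreal B * ennreal (?w z)"
        using False Bp by (subst (1 2) ennreal_mult[symmetric]) (auto simp: mult_ac)
      finally show ?thesis .
    qed
    finally show "(\<integral>\<^sup>+y. ennreal \<bar>?f z y\<bar> \<partial>lborel) \<le> ennreal B * ennreal (?w z)" .
  qed
  also have "\<dots> = ennreal B * (\<integral>\<^sup>+z. ennreal (?w z) \<partial>lborel)" by (rule nn_integral_cmult) measurable
  also have "\<dots> < \<infinity>"
    using wi w0 by (subst nn_integral_eq_integral) (auto simp: ennreal_mult_less_top)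
  finally have fin: "(\<integral>\<^sup>+z. (\<integral>\<^sup>+y. ennreal \<bar>?f z y\<bar> \<partial>lborel) \<partial>lborel) < \<infinity>" .
  have fm: "(\<lambda>(z, y). ?f z y) \<in> borel_measurable (borel \<Otimes>\<^sub>M borel)" by measurable
  have in1: "(LINT y|lborel. ?f z y) = (?U x - ?U (x - z)) * frac_ker s z" for z
  proof -
    have "(LINT y|lborel. ?f z y) = (LINT y|lborel. v y * ?\<eta> (x - y) - v y * ?\<eta> (x - z - y)) * frac_ker s z"
      by (simp add: right_diff_distrib)
    also have "(LINT y|lborel. v y * ?\<eta> (x - y) - v y * ?\<eta> (x - z - y)) = ?U x - ?U (x - z)"
      unfolding mollify_def using mollify_integrable[of v B \<rho>] B \<rho> by (subst Bochner_Integration.integral_diff) auto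
    finally show ?thesis .
  qed
  have in2: "(LINT z|lborel. ?f z y) = v y * nl_op s ?\<phi> y" for y
  proof -
    have "nl_op s ?\<phi> y = (LINT z|lborel. (?\<phi> y - ?\<phi> (z + y)) * frac_ker s (y - (z + y)))"
      unfolding nl_op_def by (rule integral_translate(1)[symmetric]) measurable
    also have "\<dots> = (LINT z|lborel. (?\<eta> (x - y) - ?\<eta> (x - z - y)) * frac_ker s z)"
      by (simp add: algebra_simps)
    finally show ?thesis by (simp add: mult.assoc)
  qed
  have rm: "(\<lambda>y. (?U x - ?U y) * frac_ker s (x - y)) \<in> borel_measurable borel" by measurable
  show "integrable lborel (\<lambda>y. (?U x - ?U y) * frac_ker s (x - y))"
    using fubini_nn(2)[OF fm fin] integral_reflect(2)[OF rm, of x] unfolding in1 by simp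
  have "nl_op s ?U x = (LINT z|lborel. (?U x - ?U (x - z)) * frac_ker s z)"
    using integral_reflect(1)[OF rm, of x] unfolding nl_op_def by simp
  also have "\<dots> = (LINT z|lborel. (LINT y|lborel. ?f z y))" unfolding in1 ..
  also have "\<dots> = (LINT y|lborel. (LINT z|lborel. ?f z y))" by (rule fubini_nn(1)[OF fm fin])
  also have "\<dots> = 0" unfolding in2 by (rule zero)
  finally show "nl_op s ?U x = 0" .
qed

section \<open>The equation for the mollified solution\<close>

context C2_domain
begin

lemma mollify_ext_zero:
  assumes h0: "\<And>y. y \<in> \<Omega> \<Longrightarrow> h y = 0" and x: "x \<in> \<Omega>" and \<rho>: "0 < \<rho>" "\<rho> \<le> \<delta> x"
  shows "mollify \<rho> h x = 0"
proof -
  have "h y * mollifier \<rho> (x - y) = 0" for y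
    using h0[of y] mem_\<Omega>I[OF x, of y] mollifier_zero[OF \<rho>(1), of "x - y"] \<rho>(2) by (cases "norm (x - y) < \<rho>") auto
  then show ?thesis unfolding mollify_def by (simp only: Bochner_Integration.integral_zero)
qed

text \<open>Mollification commutes with the potential by Fubini, so the left side is an average of
  the potential over a ball of radius rho, compared with its centre value by the Lipschitz bound.
  With rho <= delta/2 the translated exterior data stay at distance at least delta/2 from
  \<open>x\<close>.\<close>

lemma ext_pot_mollify:
  assumes [measurable]: "h \<in> borel_measurable borel" and hM: "\<And>y. \<bar>h y\<bar> \<le> M" and h0: "\<And>y. y \<in> \<Omega> \<Longrightarrow> h y = 0"
    and s: "0 < s" "s \<le> 1/4" and x: "x \<in> \<Omega>" and \<rho>: "0 < \<rho>" "\<rho> \<le> \<delta> x / 2"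
  shows "integrable lborel (\<lambda>y. mollify \<rho> h y * frac_ker s (x - y))"
    "\<bar>ext_pot s (mollify \<rho> h) x - ext_pot s h x\<bar> \<le> lip_const * M * \<delta> x powr (-1 - 2 * s) * \<rho>"
proof -
  let ?\<eta> = "mollifier \<rho> :: 'a \<Rightarrow> real"
  let ?f = "\<lambda>t y. h (y - t) * ?\<eta> t * frac_ker s (x - y)"
  have M: "M \<ge> 0" using hM[of 0] by linarith
  have d2: "\<delta> x / 2 > 0" using \<delta>_pos[OF x] by simp
  have \<eta>0: "0 \<le> ?\<eta> t" for t by (rule mollifier_nonneg[OF \<rho>(1)])
  have \<eta>i: "integrable lborel ?\<eta>" "(LINT t|lborel. ?\<eta> t) = 1"
    using mollifier_integral[OF \<rho>(1), where 'a='a] by (auto simp: has_bochner_integral_iff)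
  have fm: "(\<lambda>(t, y). ?f t y) \<in> borel_measurable (borel \<Otimes>\<^sub>M borel)" by measurable
  let ?k = "\<lambda>y. frac_ker s (x - y) * indicator {\<delta> x / 2..} (norm (x - y))"
  let ?c = "omega_sphere DIM('a) * (\<delta> x / 2) powr (-2 * s) / (2 * s)"
  have "(\<integral>\<^sup>+t. (\<integral>\<^sup>+y. ennreal \<bar>?f t y\<bar> \<partial>lborel) \<partial>lborel) \<le> (\<integral>\<^sup>+t. ennreal (?\<eta> t * M) * ennreal ?c \<partial>lborel)"
  proof (rule nn_integral_mono)
    fix t
    have "(\<integral>\<^sup>+y. ennreal \<bar>?f t y\<bar> \<partial>lborel) \<le> (\<integral>\<^sup>+y. ennreal (?\<eta> t * M) * ennreal (?k y) \<partial>lborel)"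
    proof (rule nn_integral_mono)
      fix y
      have "\<bar>?f t y\<bar> \<le> (?\<eta> t * M) * ?k y"
      proof (cases "?\<eta> t = 0 \<or> y - t \<in> \<Omega>")
        case True
        then show ?thesis using \<eta>0[of t] M h0 by auto
      next
        case False
        then have "norm t < \<rho>" using mollifier_zero[OF \<rho>(1), of t] by force
        moreover have "\<delta> x \<le> norm (x - (y - t))" using False mem_\<Omega>I[OF x, of "y - t"] by force
        ultimately have "\<delta> x / 2 \<le> norm (x - y)"
          using norm_triangle_ineq[of "x - y" t] \<rho> by (simp add: algebra_simps)
        moreover have "\<bar>h (y - t)\<bar> * (?\<eta> t * frac_ker s (x - y)) \<le> M * (?\<eta> t * frac_ker s (x - y))"
          using \<eta>0[of t] by (intro mult_right_mono hM) auto
        ultimately show ?thesis using \<eta>0[of t] by (simp add: abs_mult mult_ac)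
      qed
      then show "ennreal \<bar>?f t y\<bar> \<le> ennreal (?\<eta> t * M) * ennreal (?k y)"
        using \<eta>0[of t] M by (subst ennreal_mult[symmetric]) (auto intro!: ennreal_leI)
    qed
    also have "\<dots> = ennreal (?\<eta> t * M) * (\<integral>\<^sup>+y. ennreal (?k y) \<partial>lborel)" by (rule nn_integral_cmult) measurable
    also have "(\<integral>\<^sup>+y. ennreal (?k y) \<partial>lborel) = ennreal ?c" by (rule nn_integral_frac_ker_tail[OF s(1) d2])
    finally show "(\<integral>\<^sup>+y. ennreal \<bar>?f t y\<bar> \<partial>lborel) \<le> ennreal (?\<eta> t * M) * ennreal ?c" .
  qed
  also have "\<dots> = (\<integral>\<^sup>+t. ennreal (?\<eta> t * M) \<partial>lborel) * ennreal ?c" by (rule nn_integral_multc) measurable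
  also have "\<dots> < \<infinity>"
    using \<eta>i \<eta>0 M by (subst nn_integral_eq_integral) (auto simp: ennreal_mult_less_top)
  finally have fin: "(\<integral>\<^sup>+t. (\<integral>\<^sup>+y. ennreal \<bar>?f t y\<bar> \<partial>lborel) \<partial>lborel) < \<infinity>" .
  have in1: "(LINT t|lborel. ?f t y) = mollify \<rho> h y * frac_ker s (x - y)" for y
  proof -
    have "mollify \<rho> h y = (LINT t|lborel. h (y - t) * ?\<eta> (y - (y - t)))"
      unfolding mollify_def by (rule integral_reflect(1)[symmetric]) measurable
    then show ?thesis by simp
  qed
  have in2: "(LINT y|lborel. ?f t y) = ?\<eta> t * ext_pot s h (x - t)" for t
  proof -
    have "(LINT y|lborel. h (y - t) * frac_ker s (x - y)) = (LINT y|lborel. h ((y + t) - t) * frac_ker s (x - (y + t)))"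
      by (rule integral_translate(1)[symmetric]) measurable
    also have "\<dots> = ext_pot s h (x - t)" by (simp add: ext_pot_def algebra_simps)
    finally have "(LINT y|lborel. ?\<eta> t * (h (y - t) * frac_ker s (x - y))) = ?\<eta> t * ext_pot s h (x - t)"
      by simp
    then show ?thesis by (simp add: mult_ac)
  qed
  show "integrable lborel (\<lambda>y. mollify \<rho> h y * frac_ker s (x - y))"
    using fubini_nn(3)[OF fm fin] unfolding in1 .
  have i2: "integrable lborel (\<lambda>t. ?\<eta> t * ext_pot s h (x - t))"
    using fubini_nn(2)[OF fm fin] unfolding in2 .
  have e: "ext_pot s (mollify \<rho> h) x = (LINT t|lborel. ?\<eta> t * ext_pot s h (x - t))"
    using fubini_nn(1)[OF fm fin] unfolding in1 in2 by (simp add: ext_pot_def)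
  define c where "c = lip_const * M * \<delta> x powr (-1 - 2 * s) * \<rho>"
  have lp: "lip_const \<ge> 0" using omega_sphere_pos[of "DIM('a)"] by (simp add: lip_const_def)
  have "ext_pot s (mollify \<rho> h) x - ext_pot s h x = (LINT t|lborel. ?\<eta> t * ext_pot s h (x - t) - ?\<eta> t * ext_pot s h x)"
    unfolding e using i2 \<eta>i by (subst Bochner_Integration.integral_diff) auto
  also have "\<bar>\<dots>\<bar> \<le> (LINT t|lborel. ?\<eta> t * c)"
  proof (intro integral_abs_bound[THEN order_trans] integral_mono)
    show "integrable lborel (\<lambda>t. \<bar>?\<eta> t * ext_pot s h (x - t) - ?\<eta> t * ext_pot s h x\<bar>)"
      using i2 \<eta>i by (intro integrable_abs Bochner_Integration.integrable_diff) auto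
    show "integrable lborel (\<lambda>t. ?\<eta> t * c)" using \<eta>i by simp
    fix t
    show "\<bar>?\<eta> t * ext_pot s h (x - t) - ?\<eta> t * ext_pot s h x\<bar> \<le> ?\<eta> t * c"
    proof (cases "?\<eta> t = 0")
      case False
      then have t: "norm t < \<rho>" using mollifier_zero[OF \<rho>(1), of t] by force
      have "\<bar>ext_pot s h x - ext_pot s h (x - t)\<bar> \<le> lip_const * M * \<delta> x powr (-1 - 2 * s) * norm (x - (x - t))"
        by (rule ext_pot_lipschitz[OF assms(1) hM h0 s x]) (use t \<rho> in auto)
      also have "\<dots> \<le> c" unfolding c_def using t lp M by (intro mult_left_mono) auto
      finally have "?\<eta> t * \<bar>ext_pot s h x - ext_pot s h (x - t)\<bar> \<le> ?\<eta> t * c" by (intro mult_left_mono \<eta>0)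
      moreover have "\<bar>?\<eta> t * ext_pot s h (x - t) - ?\<eta> t * ext_pot s h x\<bar> = ?\<eta> t * \<bar>ext_pot s h x - ext_pot s h (x - t)\<bar>"
        using \<eta>0[of t] by (simp add: right_diff_distrib[symmetric] abs_mult abs_minus_commute)
      ultimately show ?thesis by simp
    qed simp
  qed
  also have "\<dots> = c" using \<eta>i by simp
  finally show "\<bar>ext_pot s (mollify \<rho> h) x - ext_pot s h x\<bar> \<le> lip_const * M * \<delta> x powr (-1 - 2 * s) * \<rho>"
    by (simp add: c_def)
qed

text \<open>The mollification of \<open>u\<close> is c + W + H. The constant is annihilated, and H
  vanishes at \<open>x\<close>, so the operator on H is minus its potential. Harmonicity therefore
  says that the operator on W equals the potential of H, which differs from that of \<open>h\<close>
  by O(rho).\<close>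

lemma mollified_equation:
  assumes um: "u \<in> borel_measurable lebesgue"
    and [measurable]: "w \<in> borel_measurable borel" "h \<in> borel_measurable borel"
    and eq: "AE y in lebesgue. u y = c + w y + h y" and B: "\<And>y. \<bar>w y\<bar> \<le> B"
    and hM: "\<And>y. \<bar>h y\<bar> \<le> M" and h0: "\<And>y. y \<in> \<Omega> \<Longrightarrow> h y = 0"
    and harm: "s_harmonic s \<Omega> u" and s: "0 < s" "s \<le> 1/4" and cN: "c_Ns DIM('a) s \<noteq> 0"
    and x: "x \<in> \<Omega>" and \<rho>: "0 < \<rho>" "\<rho> \<le> \<delta> x / 2"
  shows "integrable lborel (\<lambda>y. (mollify \<rho> w x - mollify \<rho> w y) * frac_ker s (x - y))"
    "\<bar>nl_op s (mollify \<rho> w) x - ext_pot s h x\<bar> \<le> lip_const * M * \<delta> x powr (-1 - 2 * s) * \<rho>"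
proof -
  let ?v = "\<lambda>y. c + w y + h y" and ?W = "mollify \<rho> w" and ?H = "mollify \<rho> h"
  have vm: "?v \<in> borel_measurable borel" by measurable
  have sub: "cball x \<rho> \<subseteq> \<Omega>"
    using \<rho> \<delta>_pos[OF x] by (intro subsetI mem_\<Omega>I[OF x]) (auto simp: dist_norm)
  have vB: "\<bar>?v y\<bar> \<le> \<bar>c\<bar> + B + M" for y using B[of y] hM[of y] by linarith
  have U: "mollify \<rho> ?v y = c + ?W y + ?H y" for y
  proof -
    have i0: "integrable lborel (\<lambda>z. c * mollifier \<rho> (y - z))"
      using mollify_integrable[of "\<lambda>_. c" "\<bar>c\<bar>" \<rho> y] \<rho>(1) by simp
    note i1 = mollify_integrable[OF assms(2) B \<rho>(1), of y] and i2 = mollify_integrable[OF assms(3) hM \<rho>(1), of y]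
    have "mollify \<rho> ?v y = (LINT z|lborel. c * mollifier \<rho> (y - z) + w z * mollifier \<rho> (y - z) + h z * mollifier \<rho> (y - z))"
      unfolding mollify_def by (simp add: distrib_right)
    also have "\<dots> = mollify \<rho> (\<lambda>_. c) y + ?W y + ?H y"
      unfolding mollify_def
      by (simp only: Bochner_Integration.integral_add[OF Bochner_Integration.integrable_add[OF i0 i1] i2]
        Bochner_Integration.integral_add[OF i0 i1])
    finally show ?thesis by (simp add: mollify_const[OF \<rho>(1)])
  qed
  have s2: "s < 1/2" using s by simp
  note hm = harmonic_mollify[OF um vm eq vB harm s(1) s2 cN \<rho>(1) sub]
  have Hx: "?H x = 0" by (rule mollify_ext_zero[OF h0 x \<rho>(1)]) (use \<rho> \<delta>_pos[OF x] in auto)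
  note p = ext_pot_mollify[OF assms(3) hM h0 s x \<rho>]
  have e: "(\<lambda>y. (?W x - ?W y) * frac_ker s (x - y)) =
     (\<lambda>y. (mollify \<rho> ?v x - mollify \<rho> ?v y) * frac_ker s (x - y) + ?H y * frac_ker s (x - y))"
    unfolding U Hx by (auto simp: fun_eq_iff algebra_simps)
  show "integrable lborel (\<lambda>y. (?W x - ?W y) * frac_ker s (x - y))"
    unfolding e using hm(1) p(1) by (rule Bochner_Integration.integrable_add)
  have "nl_op s ?W x = nl_op s (mollify \<rho> ?v) x + ext_pot s ?H x"
    unfolding nl_op_def ext_pot_def e using hm(1) p(1) by (rule Bochner_Integration.integral_add)
  then show "\<bar>nl_op s ?W x - ext_pot s h x\<bar> \<le> lip_const * M * \<delta> x powr (-1 - 2 * s) * \<rho>"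
    using hm(2) p(2) by simp
qed

end

text \<open>The closed neighbourhoods of radius 1/(m+1) decrease to the compact set and have finite
  volume, so continuity from above applies.\<close>

lemma compact_nbhd_volume:
  fixes T :: "'a::euclidean_space set"
  assumes T: "compact T" "T \<noteq> {}" and d: "d > 0"
  obtains r where "r > 0" "measure lborel {y. infdist y T \<le> r} \<le> measure lborel T + d"
    "emeasure lborel {y. infdist y T \<le> r} < \<infinity>"
proof -
  let ?N = "\<lambda>r. {y. infdist y T \<le> r}"
  obtain B where B: "\<And>y. y \<in> T \<Longrightarrow> norm y \<le> B" using T(1) compact_imp_bounded bounded_iff by metis
  have Nb: "?N r \<in> sets borel" for r
    by (intro borel_closed closed_Collect_le continuous_on_infdist continuous_intros)
  have sub: "?N r \<subseteq> ball 0 (B + r + 1)" for r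
  proof
    fix y assume "y \<in> ?N r"
    then have "infdist y T < r + 1" by simp
    then obtain q where "q \<in> T" "dist y q < r + 1" using T(2) by (rule infdist_less_obtain)
    then show "y \<in> ball 0 (B + r + 1)" using B[of q] norm_triangle_sub[of y q] by (simp add: dist_norm)
  qed
  have Nf: "emeasure lborel (?N r) < \<infinity>" for r
  proof -
    have "emeasure lborel (?N r) \<le> emeasure lborel (ball (0::'a) (B + r + 1))"
      by (rule emeasure_mono[OF sub]) simp
    also have "\<dots> < \<infinity>" by (rule emeasure_lborel_ball_finite)
    finally show ?thesis .
  qed
  have "(\<lambda>m. measure lborel (?N (1 / real (Suc m)))) \<longlonglongrightarrow> measure lborel (\<Inter>m. ?N (1 / real (Suc m)))"
  proof (rule Lim_measure_decseq)
    show "range (\<lambda>m. ?N (1 / real (Suc m))) \<subseteq> sets lborel" using Nb by auto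
    show "decseq (\<lambda>m. ?N (1 / real (Suc m)))"
    proof (rule decseq_SucI, rule Collect_mono, rule impI)
      fix m x assume "infdist x T \<le> 1 / real (Suc (Suc m))"
      also have "\<dots> \<le> 1 / real (Suc m)" by (intro frac_le) auto
      finally show "infdist x T \<le> 1 / real (Suc m)" .
    qed
    show "emeasure lborel (?N (1 / real (Suc m))) \<noteq> \<infinity>" for m using Nf[of "1 / real (Suc m)"] by auto
  qed
  also have "(\<Inter>m. ?N (1 / real (Suc m))) = T"
  proof
    show "(\<Inter>m. ?N (1 / real (Suc m))) \<subseteq> T"
    proof
      fix y assume y: "y \<in> (\<Inter>m. ?N (1 / real (Suc m)))"
      have "infdist y T \<le> 0"
      proof (rule field_le_epsilon)
        fix e :: real assume "e > 0"
        then obtain m where "1 / real (Suc m) < e" using nat_approx_posE by blast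
        moreover have "infdist y T \<le> 1 / real (Suc m)" using y by auto
        ultimately show "infdist y T \<le> 0 + e" by linarith
      qed
      then have "infdist y T = 0" using infdist_nonneg[of y T] by linarith
      then show "y \<in> T" using T compact_imp_closed in_closed_iff_infdist_zero by blast
    qed
    show "T \<subseteq> (\<Inter>m. ?N (1 / real (Suc m)))" by auto
  qed
  finally have "\<forall>\<^sub>F m in sequentially. measure lborel (?N (1 / real (Suc m))) < measure lborel T + d"
    by (rule order_tendstoD) (use d in simp)
  then obtain m where m: "measure lborel (?N (1 / real (Suc m))) < measure lborel T + d"
    by (auto simp: eventually_sequentially)
  show ?thesis by (rule that[of "1 / real (Suc m)"]) (use m Nf in auto)
qed

section \<open>Maximum principle\<close>

text \<open>Weak convergence tested on compact sets, enough to carry an inequality from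
  mollifications to \<open>w\<close> almost everywhere. Translation is shifted from \<open>w\<close>
  to the indicator of \<open>T\<close>, whose translates are close in L1 because a thin
  neighbourhood of \<open>T\<close> has almost the volume of \<open>T\<close>.\<close>

lemma mollify_weak:
  fixes w :: "'a::euclidean_space \<Rightarrow> real"
  assumes [measurable]: "w \<in> borel_measurable borel" and B: "\<And>y. \<bar>w y\<bar> \<le> B"
    and T: "compact T" and d: "d > 0"
  obtains r where "r > 0" "\<And>\<rho>. 0 < \<rho> \<Longrightarrow> \<rho> < r \<Longrightarrow>
    \<bar>(LINT x|lborel. indicator T x * mollify \<rho> w x) - (LINT x|lborel. indicator T x * w x)\<bar> < d"
proof (cases "T = {}")
  case True
  then show ?thesis using that[of 1] d by simp
next
  case False
  have Bp: "B \<ge> 0" using B[of 0] by linarith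
  have [measurable]: "T \<in> sets borel" using T by (simp add: compact_imp_closed)
  have Tfin: "emeasure lborel T < \<infinity>" using T by (rule emeasure_compact_finite)
  \<comment> \<open>Chosen so that 2 B d' is at most d/2; the added 1 covers the case
    \<open>B = 0\<close>.\<close>
  define d' where "d' = d / (2 * (B + 1) * 2)"
  have d': "d' > 0" using d Bp by (simp add: d'_def)
  obtain r where r: "r > 0" "measure lborel {y. infdist y T \<le> r} \<le> measure lborel T + d'"
    "emeasure lborel {y. infdist y T \<le> r} < \<infinity>"
    using compact_nbhd_volume[OF T False d'] by blast
  define N where "N = {y. infdist y T \<le> r}"
  have [measurable]: "N \<in> sets borel"
    unfolding N_def by (intro borel_closed closed_Collect_le continuous_on_infdist continuous_intros)
  have iN: "integrable lborel (indicator N :: 'a \<Rightarrow> real)"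
    using r by (intro integrable_real_indicator) (auto simp: N_def[symmetric])
  have iT: "integrable lborel (indicator T :: 'a \<Rightarrow> real)"
    using Tfin by (intro integrable_real_indicator) auto
  show ?thesis
  proof (rule that[OF r(1)])
    fix \<rho> :: real assume \<rho>: "0 < \<rho>" "\<rho> < r"
    let ?\<eta> = "mollifier \<rho> :: 'a \<Rightarrow> real"
    have \<eta>0: "0 \<le> ?\<eta> t" for t by (rule mollifier_nonneg[OF \<rho>(1)])
    have \<eta>i: "integrable lborel ?\<eta>" "(LINT t|lborel. ?\<eta> t) = 1"
      using mollifier_integral[OF \<rho>(1), where 'a='a] by (auto simp: has_bochner_integral_iff)
    let ?f = "\<lambda>t x. indicator T x * (w (x - t) * ?\<eta> t)"
    have fm: "(\<lambda>(t, x). ?f t x) \<in> borel_measurable (borel \<Otimes>\<^sub>M borel)" by measurable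
    have "(\<integral>\<^sup>+t. (\<integral>\<^sup>+x. ennreal \<bar>?f t x\<bar> \<partial>lborel) \<partial>lborel) \<le> (\<integral>\<^sup>+t. ennreal (B * ?\<eta> t) * emeasure lborel T \<partial>lborel)"
    proof (rule nn_integral_mono)
      fix t
      have "(\<integral>\<^sup>+x. ennreal \<bar>?f t x\<bar> \<partial>lborel) \<le> (\<integral>\<^sup>+x. ennreal (B * ?\<eta> t) * indicator T x \<partial>lborel)"
        using mult_right_mono[OF B \<eta>0] \<eta>0
        by (intro nn_integral_mono) (auto simp: indicator_def abs_mult intro!: ennreal_leI)
      also have "\<dots> = ennreal (B * ?\<eta> t) * emeasure lborel T" by (rule nn_integral_cmult_indicator) simp
      finally show "(\<integral>\<^sup>+x. ennreal \<bar>?f t x\<bar> \<partial>lborel) \<le> ennreal (B * ?\<eta> t) * emeasure lborel T" .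
    qed
    also have "\<dots> = (\<integral>\<^sup>+t. ennreal (B * ?\<eta> t) \<partial>lborel) * emeasure lborel T" by (rule nn_integral_multc) measurable
    also have "\<dots> < \<infinity>"
      using \<eta>i \<eta>0 Bp Tfin by (subst nn_integral_eq_integral) (auto simp: ennreal_mult_less_top)
    finally have fin: "(\<integral>\<^sup>+t. (\<integral>\<^sup>+x. ennreal \<bar>?f t x\<bar> \<partial>lborel) \<partial>lborel) < \<infinity>" .
    have in1: "(LINT t|lborel. ?f t x) = indicator T x * mollify \<rho> w x" for x
    proof -
      have "mollify \<rho> w x = (LINT t|lborel. w (x - t) * ?\<eta> (x - (x - t)))"
        unfolding mollify_def by (rule integral_reflect(1)[symmetric]) measurable
      then show ?thesis by simp
    qed
    define I where "I t = (LINT y|lborel. indicator T (y + t) * w y)" for t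
    have in2: "(LINT x|lborel. ?f t x) = ?\<eta> t * I t" for t
    proof -
      have "(LINT x|lborel. indicator T x * w (x - t)) = (LINT y|lborel. indicator T (y + t) * w ((y + t) - t))"
        by (rule integral_translate(1)[symmetric]) measurable
      then have "(LINT x|lborel. ?\<eta> t * (indicator T x * w (x - t))) = ?\<eta> t * I t" by (simp add: I_def)
      then show ?thesis by (simp add: mult_ac)
    qed
    have i2: "integrable lborel (\<lambda>t. ?\<eta> t * I t)" using fubini_nn(2)[OF fm fin] unfolding in2 .
    have e: "(LINT x|lborel. indicator T x * mollify \<rho> w x) = (LINT t|lborel. ?\<eta> t * I t)"
      using fubini_nn(1)[OF fm fin] unfolding in1 in2 by simp
    define J where "J = (LINT x|lborel. indicator T x * w x)"
    have iw: "integrable lborel (\<lambda>x. indicator T (x + t) * w x)" for t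
    proof (rule Bochner_Integration.integrable_bound)
      show "integrable lborel (\<lambda>x. B * indicator T (x + t))"
        using iT integral_translate(2)[of "indicator T :: 'a \<Rightarrow> real" t] by (intro integrable_mult_right) simp
      show "AE x in lborel. norm (indicator T (x + t) * w x) \<le> norm (B * indicator T (x + t) :: real)"
        using B Bp by (auto simp: indicator_def)
    qed measurable
    have near: "\<bar>I t - J\<bar> \<le> B * (2 * d')" if t: "norm t < \<rho>" for t
    proof -
      have iTt: "integrable lborel (\<lambda>y. indicator T (y + t) :: real)"
        "(LINT y|lborel. indicator T (y + t) :: real) = measure lborel T"
        using iT integral_translate[of "indicator T :: 'a \<Rightarrow> real" t] by auto
      have "I t - J = (LINT y|lborel. indicator T (y + t) * w y - indicator T y * w y)"
        unfolding I_def J_def using iw[of t] iw[of 0] by (subst Bochner_Integration.integral_diff) auto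
      \<comment> \<open>Both sets lie in \<open>N\<close>, so the difference of their indicators is
        at most the sum of the two gaps to \<open>N\<close>, and by translation invariance each gap
        has volume at most \<open>d'\<close>.\<close>
      also have "\<bar>\<dots>\<bar> \<le> (LINT y|lborel. B * (2 * indicator N y - indicator T y - indicator T (y + t)))"
      proof (intro integral_abs_bound[THEN order_trans] integral_mono)
        show "integrable lborel (\<lambda>y. \<bar>indicator T (y + t) * w y - indicator T y * w y\<bar>)"
          using iw[of t] iw[of 0] by (intro integrable_abs Bochner_Integration.integrable_diff) auto
        show "integrable lborel (\<lambda>y. B * (2 * indicator N y - indicator T y - indicator T (y + t)))"
          using iN iT iTt by (intro integrable_mult_right Bochner_Integration.integrable_diff) auto
        fix y
        have "y \<in> N" if "y + t \<in> T"
        proof -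
          have "infdist y T \<le> dist y (y + t)" using that by (rule infdist_le)
          then show ?thesis using t \<rho> by (simp add: N_def dist_norm)
        qed
        moreover have "y \<in> N" if "y \<in> T" using that r by (simp add: N_def)
        ultimately show "\<bar>indicator T (y + t) * w y - indicator T y * w y\<bar> \<le> B * (2 * indicator N y - indicator T y - indicator T (y + t))"
          using B[of y] Bp by (auto simp: indicator_def)
      qed
      also have "\<dots> = B * (2 * measure lborel N - measure lborel T - measure lborel T)"
        using iN iT iTt by simp
      also have "\<dots> \<le> B * (2 * d')"
        using r Bp by (intro mult_left_mono) (auto simp: N_def)
      finally show ?thesis .
    qed
    have "(LINT x|lborel. indicator T x * mollify \<rho> w x) - J = (LINT t|lborel. ?\<eta> t * I t - ?\<eta> t * J)"
      unfolding e using i2 \<eta>i by (subst Bochner_Integration.integral_diff) auto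
    also have "\<bar>\<dots>\<bar> \<le> (LINT t|lborel. ?\<eta> t * (B * (2 * d')))"
    proof (intro integral_abs_bound[THEN order_trans] integral_mono)
      show "integrable lborel (\<lambda>t. \<bar>?\<eta> t * I t - ?\<eta> t * J\<bar>)"
        using i2 \<eta>i by (intro integrable_abs Bochner_Integration.integrable_diff) auto
      show "integrable lborel (\<lambda>t. ?\<eta> t * (B * (2 * d')))" using \<eta>i by simp
      fix t
      show "\<bar>?\<eta> t * I t - ?\<eta> t * J\<bar> \<le> ?\<eta> t * (B * (2 * d'))"
      proof (cases "?\<eta> t = 0")
        case False
        then have t: "norm t < \<rho>" using mollifier_zero[OF \<rho>(1), of t] by force
        have "\<bar>?\<eta> t * I t - ?\<eta> t * J\<bar> = ?\<eta> t * \<bar>I t - J\<bar>"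
          using \<eta>0[of t] by (simp add: right_diff_distrib[symmetric] abs_mult)
        then show ?thesis using near[OF t] \<eta>0[of t] by (simp add: mult_left_mono)
      qed simp
    qed
    also have "\<dots> = B * (2 * d')" using \<eta>i by simp
    also have "\<dots> < d"
    proof -
      have "B * (2 * d') \<le> (B + 1) * (2 * d')" using d' by (intro mult_right_mono) auto
      also have "(B + 1) * (2 * d') = d / 2" using Bp by (simp add: d'_def field_simps)
      finally show ?thesis using d by linarith
    qed
    finally show "\<bar>(LINT x|lborel. indicator T x * mollify \<rho> w x) - (LINT x|lborel. indicator T x * w x)\<bar> < d"
      by (simp add: J_def)
  qed
qed

lemma integral_pos_on:
  fixes T :: "'a::euclidean_space set" and g :: "'a \<Rightarrow> real"
  assumes [measurable]: "T \<in> sets borel" and pos: "emeasure lborel T \<noteq> 0"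
    and i: "integrable lborel (\<lambda>x. indicator T x * g x)" and g: "\<And>x. x \<in> T \<Longrightarrow> 0 < g x"
  shows "0 < (LINT x|lborel. indicator T x * g x)"
proof -
  have nn: "AE x in lborel. 0 \<le> indicator T x * g x" using g by (auto simp: indicator_def intro!: AE_I2 less_imp_le)
  have "(LINT x|lborel. indicator T x * g x) \<noteq> 0"
  proof
    assume "(LINT x|lborel. indicator T x * g x) = 0"
    then have "AE x in lborel. indicator T x * g x = 0"
      using integral_nonneg_eq_0_iff_AE[OF i nn] by simp
    then have "AE x in lborel. x \<notin> T"
      by eventually_elim (use g in \<open>force simp: indicator_def\<close>)
    then have "T \<in> null_sets lborel" by (subst AE_iff_null_sets) auto
    then show False using pos by (simp add: null_sets_def)
  qed
  moreover have "(LINT x|lborel. indicator T x * g x) \<ge> 0" by (rule integral_nonneg_AE[OF nn])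
  ultimately show ?thesis by linarith
qed

text \<open>Inner regularity: a closed subset that misses less than the measure of \<open>N\<close>
  cannot be null.\<close>

lemma exists_compact_nonnull:
  fixes N :: "'a::euclidean_space set"
  assumes N: "N \<in> sets borel" "bounded N" and pos: "emeasure lborel N \<noteq> 0"
  obtains T where "compact T" "T \<subseteq> N" "emeasure lborel T \<noteq> 0"
proof -
  have NL: "N \<in> sets lebesgue" using N by auto
  have fin: "emeasure lborel N < \<infinity>" by (rule emeasure_bounded_finite[OF N(2)])
  define m where "m = measure lborel N"
  have em: "emeasure lborel N = ennreal m" using fin by (simp add: m_def emeasure_eq_ennreal_measure less_top)
  then have m: "m > 0" using pos by (metis ennreal_eq_0_iff not_le)
  obtain T where T: "closed T" "T \<subseteq> N" "N - T \<in> lmeasurable" "emeasure lebesgue (N - T) < ennreal m"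
    using sets_lebesgue_inner_closed[OF NL m] by blast
  show ?thesis
  proof (rule that[OF _ T(2)])
    show "compact T" using T(1,2) N(2) bounded_subset compact_eq_bounded_closed by blast
    show "emeasure lborel T \<noteq> 0"
    proof
      assume z: "emeasure lborel T = 0"
      have "emeasure lborel N \<le> emeasure lborel T + emeasure lborel (N - T)"
        using T N by (subst emeasure_Diff_null_set) (auto simp: null_sets_def z)
      also have "emeasure lborel (N - T) = emeasure lebesgue (N - T)" using N T by simp
      finally show False using T(4) z em by simp
    qed
  qed
qed

section \<open>Comparison with the barrier\<close>

context C2_domain
begin

text \<open>Mollification at scale rho \<le> tau spreads w into the outer layer {delta \<le> tau}, so the barrier
  has to be positive there as well.\<close>

definition barrier :: "real \<Rightarrow> real \<Rightarrow> 'a \<Rightarrow> real" where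
  "barrier \<epsilon> \<tau> y = (if y \<in> \<Omega> \<or> \<delta> y \<le> \<tau> then max (\<delta> y) \<tau> powr -\<epsilon> else 0)"

text \<open>Only the values of f_s inside the domain matter. The cut at tau keeps the comparison
  function bounded and leaves it unchanged in the half-distance ball of every point with
  \<open>2 * \<tau> < \<delta> x\<close>.\<close>

definition trunc :: "real \<Rightarrow> ('a \<Rightarrow> real) \<Rightarrow> 'a \<Rightarrow> real" where
  "trunc \<tau> f y = (if y \<in> \<Omega> \<and> \<tau> < \<delta> y then f y else 0)"

lemma borel_measurable_barrier [measurable]: "barrier \<epsilon> \<tau> \<in> borel_measurable borel"
  unfolding barrier_def by measurable

lemma borel_measurable_trunc [measurable]:
  assumes [measurable]: "f \<in> borel_measurable borel"
  shows "trunc \<tau> f \<in> borel_measurable borel"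
  unfolding trunc_def by measurable

text \<open>A limit point outside the open domain would lie on the frontier, where the distance is 0
  and not at least \<open>r\<close>.\<close>

lemma compact_inner: "0 < r \<Longrightarrow> compact {x \<in> \<Omega>. r \<le> \<delta> x}"
proof -
  assume r: "0 < r"
  have "x \<in> \<Omega>" if "x \<in> closure \<Omega>" "r \<le> \<delta> x" for x
  proof (rule ccontr)
    assume "x \<notin> \<Omega>"
    then have "x \<in> frontier \<Omega>" using that opn by (simp add: frontier_def interior_open)
    then have "\<delta> x = 0" by (simp add: \<delta>_def)
    then show False using that r by simp
  qed
  then have "{x \<in> \<Omega>. r \<le> \<delta> x} = closure \<Omega> \<inter> {x. r \<le> \<delta> x}"
    using closure_subset by auto
  moreover have "closed {x. r \<le> \<delta> x}"
    by (intro closed_Collect_le continuous_on_\<delta> continuous_intros)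
  ultimately show "compact {x \<in> \<Omega>. r \<le> \<delta> x}"
    using bdd by (simp add: compact_Int_closed)
qed

text \<open>If D = W - (trunc f + Q barrier) were positive somewhere, its maximum over all of space
  would be positive and attained where delta > 2 tau: in the strip the barrier wins, and farther
  outside D is 0. At a global maximum the operator on D is nonnegative, against the strict
  inequality \<open>op\<close>.\<close>

lemma max_principle:
  assumes [measurable]: "w \<in> borel_measurable borel" and wB: "\<And>y. \<bar>w y\<bar> \<le> B" and w0: "\<And>y. y \<notin> \<Omega> \<Longrightarrow> w y = 0"
    and fc: "continuous_on \<Omega> f" and fA: "\<And>y. y \<in> \<Omega> \<Longrightarrow> \<bar>f y\<bar> \<le> A * \<delta> y powr - (\<epsilon> / 2)"
    and \<epsilon>: "0 < \<epsilon>" and A: "0 \<le> A" and Q: "0 < Q" and \<tau>: "0 < \<tau>" and \<rho>: "0 < \<rho>" "\<rho> \<le> \<tau>"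
    and strip: "B + A * \<tau> powr - (\<epsilon> / 2) \<le> Q * (2 * \<tau>) powr -\<epsilon>"
    and op: "\<And>x. x \<in> \<Omega> \<Longrightarrow> 2 * \<tau> < \<delta> x \<Longrightarrow>
      integrable lborel (\<lambda>y. (mollify \<rho> w x - mollify \<rho> w y) * frac_ker s (x - y)) \<and>
      integrable lborel (\<lambda>y. (trunc \<tau> f x - trunc \<tau> f y) * frac_ker s (x - y)) \<and>
      integrable lborel (\<lambda>y. (barrier \<epsilon> \<tau> x - barrier \<epsilon> \<tau> y) * frac_ker s (x - y)) \<and>
      nl_op s (mollify \<rho> w) x < nl_op s (trunc \<tau> f) x + Q * nl_op s (barrier \<epsilon> \<tau>) x"
    and x: "x \<in> \<Omega>" "2 * \<tau> \<le> \<delta> x"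
  shows "mollify \<rho> w x \<le> f x + Q * \<delta> x powr -\<epsilon>"
proof (rule ccontr)
  let ?W = "mollify \<rho> w" and ?S = "\<lambda>y. trunc \<tau> f y + Q * barrier \<epsilon> \<tau> y"
  let ?D = "\<lambda>y. ?W y - ?S y"
  let ?K = "{x \<in> \<Omega>. 2 * \<tau> \<le> \<delta> x}"
  have S_in: "?S y = f y + Q * \<delta> y powr -\<epsilon>" if "y \<in> ?K" for y
    using that \<tau> by (simp add: trunc_def barrier_def max_def)
  assume "\<not> ?W x \<le> f x + Q * \<delta> x powr -\<epsilon>"
  then have Dx: "?D x > 0" using x S_in[of x] by simp
  have WB: "\<bar>?W y\<bar> \<le> B" for y by (rule mollify_bound[OF assms(1) wB \<rho>(1)])
  \<comment> \<open>In the strip the barrier is at least (2 tau)^(-eps), while W and the truncated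
    function are at most B and A tau^(-eps/2); hypothesis \<open>strip\<close> balances
    them.\<close>
  have strip_le: "?D y \<le> 0" if y: "y \<in> \<Omega> \<or> \<delta> y \<le> \<tau>" "\<delta> y \<le> 2 * \<tau>" for y
  proof -
    have "\<bar>trunc \<tau> f y\<bar> \<le> A * \<tau> powr - (\<epsilon> / 2)"
    proof (cases "y \<in> \<Omega> \<and> \<tau> < \<delta> y")
      case True
      have "\<bar>f y\<bar> \<le> A * \<delta> y powr - (\<epsilon> / 2)" using fA True by simp
      also have "\<dots> \<le> A * \<tau> powr - (\<epsilon> / 2)"
        using A True \<tau> \<epsilon> by (intro mult_left_mono powr_mono2') auto
      finally show ?thesis using True by (simp add: trunc_def)
    qed (use A in \<open>auto simp: trunc_def\<close>)
    moreover have "(2 * \<tau>) powr -\<epsilon> \<le> barrier \<epsilon> \<tau> y"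
      using y \<tau> \<epsilon> by (auto simp: barrier_def intro!: powr_mono2')
    then have "Q * (2 * \<tau>) powr -\<epsilon> \<le> Q * barrier \<epsilon> \<tau> y" using Q by simp
    ultimately show ?thesis using strip WB[of y] by linarith
  qed
  \<comment> \<open>A point farther than tau >= rho from the boundary, on the outside, is not
    reached by the mollification of \<open>w\<close>.\<close>
  have out: "?D y \<le> 0" if y: "y \<notin> \<Omega>" "\<tau> < \<delta> y" for y
  proof -
    have "w z * mollifier \<rho> (y - z) = 0" for z
    proof (cases "z \<in> \<Omega>")
      case True
      then have "\<delta> y \<le> norm (z - y)" using \<delta>_cross(2)[OF True y(1)] by simp
      then have "\<rho> \<le> norm (y - z)" using y \<rho> by (simp add: norm_minus_commute)
      then show ?thesis by (simp add: mollifier_zero[OF \<rho>(1)])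
    qed (simp add: w0)
    then have "?W y = 0" unfolding mollify_def by (simp only: Bochner_Integration.integral_zero)
    then show ?thesis using y by (simp add: trunc_def barrier_def)
  qed
  have "continuous_on ?K (\<lambda>y. ?W y - (f y + Q * \<delta> y powr -\<epsilon>))"
  proof (intro continuous_on_diff continuous_on_add continuous_on_mult continuous_on_const)
    show "continuous_on ?K ?W" by (rule continuous_on_mollify[OF assms(1) wB \<rho>(1)])
    show "continuous_on ?K f" by (rule continuous_on_subset[OF fc]) auto
    show "continuous_on ?K (\<lambda>y. \<delta> y powr -\<epsilon>)"
      using \<tau> by (intro continuous_on_powr continuous_on_\<delta> continuous_on_const) auto
  qed
  then have "continuous_on ?K ?D"
    by (rule continuous_on_eq) (use S_in in auto)
  then obtain x0 where x0: "x0 \<in> ?K" "\<And>y. y \<in> ?K \<Longrightarrow> ?D y \<le> ?D x0"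
    using continuous_attains_sup[OF compact_inner, of "2 * \<tau>" ?D] x \<tau> by auto
  have D0: "?D x0 > 0" using x0(2)[of x] x Dx by simp
  have d0: "2 * \<tau> < \<delta> x0" using strip_le[of x0] x0(1) D0 by force
  have mx: "?D y \<le> ?D x0" for y
  proof -
    consider "y \<in> ?K" | "y \<in> \<Omega> \<or> \<delta> y \<le> \<tau>" "\<delta> y \<le> 2 * \<tau>" | "y \<notin> \<Omega>" "\<tau> < \<delta> y"
      using \<tau> by force
    then show ?thesis
    proof cases
      case 2
      then show ?thesis using strip_le[of y] D0 by linarith
    next
      case 3
      then show ?thesis using out[of y] D0 by linarith
    qed (rule x0(2))
  qed
  have "x0 \<in> \<Omega>" using x0(1) by simp
  from op[OF this d0]
  have i: "integrable lborel (\<lambda>y. (?W x0 - ?W y) * frac_ker s (x0 - y))"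
    "integrable lborel (\<lambda>y. (trunc \<tau> f x0 - trunc \<tau> f y) * frac_ker s (x0 - y))"
    "integrable lborel (\<lambda>y. Q * ((barrier \<epsilon> \<tau> x0 - barrier \<epsilon> \<tau> y) * frac_ker s (x0 - y)))"
    and lt: "nl_op s ?W x0 < nl_op s (trunc \<tau> f) x0 + Q * nl_op s (barrier \<epsilon> \<tau>) x0"
    by auto
  have "0 \<le> (LINT y|lborel. (?D x0 - ?D y) * frac_ker s (x0 - y))"
    using mx by (intro integral_nonneg_AE AE_I2 mult_nonneg_nonneg) auto
  also have "\<dots> = (LINT y|lborel. (?W x0 - ?W y) * frac_ker s (x0 - y) - (trunc \<tau> f x0 - trunc \<tau> f y) * frac_ker s (x0 - y)
       - Q * ((barrier \<epsilon> \<tau> x0 - barrier \<epsilon> \<tau> y) * frac_ker s (x0 - y)))"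
    by (simp add: algebra_simps)
  also have "\<dots> = nl_op s ?W x0 - nl_op s (trunc \<tau> f) x0 - Q * nl_op s (barrier \<epsilon> \<tau>) x0"
    unfolding nl_op_def
    by (simp only: Bochner_Integration.integral_diff[OF Bochner_Integration.integrable_diff[OF i(1,2)] i(3)]
      Bochner_Integration.integral_diff[OF i(1,2)] integral_mult_right_zero)
  finally show False using lt by linarith
qed

text \<open>The order of the parameters: tau small for the strip condition, then rho so small that
  the mollification error on delta >= 2 tau is below the slack \<open>q\<close>. Weak convergence as
  rho tends to 0 gives the bound almost everywhere on delta >= 2 tau, and a sequence of tau tending
  to 0 exhausts the domain.\<close>

lemma comparison:
  assumes wm [measurable]: "w \<in> borel_measurable borel" and wB: "\<And>y. \<bar>w y\<bar> \<le> B" and w0: "\<And>y. y \<notin> \<Omega> \<Longrightarrow> w y = 0"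
    and fm [measurable]: "f \<in> borel_measurable borel"
    and fc: "continuous_on \<Omega> f" and fA: "\<And>y. y \<in> \<Omega> \<Longrightarrow> \<bar>f y\<bar> \<le> A * \<delta> y powr - (\<epsilon> / 2)"
    and \<epsilon>: "0 < \<epsilon>" and A: "0 \<le> A" and Q: "0 < Q" and q: "0 < q"
    and Wop: "\<And>x \<rho>. x \<in> \<Omega> \<Longrightarrow> 0 < \<rho> \<Longrightarrow> \<rho> \<le> \<delta> x / 2 \<Longrightarrow>
      integrable lborel (\<lambda>y. (mollify \<rho> w x - mollify \<rho> w y) * frac_ker s (x - y)) \<and>
      nl_op s (mollify \<rho> w) x \<le> E x + K * \<delta> x powr (-p) * \<rho>"
    and K: "0 \<le> K" and p: "0 \<le> p"
    and Sop: "\<And>x \<tau>. x \<in> \<Omega> \<Longrightarrow> 0 < \<tau> \<Longrightarrow> \<tau> < 1 \<Longrightarrow> 2 * \<tau> < \<delta> x \<Longrightarrow>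
      integrable lborel (\<lambda>y. (trunc \<tau> f x - trunc \<tau> f y) * frac_ker s (x - y)) \<and>
      integrable lborel (\<lambda>y. (barrier \<epsilon> \<tau> x - barrier \<epsilon> \<tau> y) * frac_ker s (x - y)) \<and>
      E x + q \<le> nl_op s (trunc \<tau> f) x + Q * nl_op s (barrier \<epsilon> \<tau>) x"
  shows "AE x in lborel. x \<in> \<Omega> \<longrightarrow> w x \<le> f x + Q * \<delta> x powr -\<epsilon>"
proof -
  \<comment> \<open>This is the strip condition multiplied by tau^eps. It holds for small tau
    because f grows only like delta^(-eps/2) and the barrier like delta^(-eps).\<close>
  have "((\<lambda>\<tau>. B * \<tau> powr \<epsilon> + A * \<tau> powr (\<epsilon> / 2)) \<longlongrightarrow> B * 0 + A * 0) (at_right 0)"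
  proof (intro tendsto_intros)
    show "((\<lambda>\<tau>. \<tau> powr \<epsilon>) \<longlongrightarrow> 0) (at_right 0)" using \<epsilon> by real_asymp
    show "((\<lambda>\<tau>. \<tau> powr (\<epsilon> / 2)) \<longlongrightarrow> 0) (at_right 0)" using \<epsilon> by real_asymp
  qed
  then have "\<forall>\<^sub>F \<tau> in at_right 0. B * \<tau> powr \<epsilon> + A * \<tau> powr (\<epsilon> / 2) < Q * 2 powr -\<epsilon>"
    by (rule order_tendstoD) (use Q in simp)
  then obtain \<tau>0 where \<tau>0: "\<tau>0 > 0" "\<And>\<tau>. 0 < \<tau> \<Longrightarrow> \<tau> < \<tau>0 \<Longrightarrow> B * \<tau> powr \<epsilon> + A * \<tau> powr (\<epsilon> / 2) < Q * 2 powr -\<epsilon>"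
    by (auto simp: eventually_at_right_field)
  have main: "mollify \<rho> w x \<le> f x + Q * \<delta> x powr -\<epsilon>"
    if \<tau>: "0 < \<tau>" "\<tau> < \<tau>0" "\<tau> < 1" and \<rho>: "0 < \<rho>" "\<rho> \<le> \<tau>" "K * (2 * \<tau>) powr (-p) * \<rho> < q" and x: "x \<in> \<Omega>" "2 * \<tau> \<le> \<delta> x" for \<tau> \<rho> x
  proof (rule max_principle[OF wm wB w0 fc fA \<epsilon> A Q \<tau>(1) \<rho>(1,2) _ _ x])
    have "\<tau> powr -\<epsilon> * (B * \<tau> powr \<epsilon> + A * \<tau> powr (\<epsilon> / 2)) \<le> \<tau> powr -\<epsilon> * (Q * 2 powr -\<epsilon>)"
      using \<tau>0(2)[OF \<tau>(1,2)] by (intro mult_left_mono) auto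
    moreover have "\<tau> powr -\<epsilon> * \<tau> powr \<epsilon> = 1" "\<tau> powr -\<epsilon> * \<tau> powr (\<epsilon> / 2) = \<tau> powr - (\<epsilon> / 2)"
      using \<tau> by (simp_all add: powr_add[symmetric])
    then have "\<tau> powr -\<epsilon> * (B * \<tau> powr \<epsilon> + A * \<tau> powr (\<epsilon> / 2)) = B + A * \<tau> powr - (\<epsilon> / 2)"
      by (simp add: distrib_left mult.left_commute)
    moreover have "(2 * \<tau>) powr -\<epsilon> = 2 powr -\<epsilon> * \<tau> powr -\<epsilon>" using \<tau> by (simp add: powr_mult)
    ultimately show "B + A * \<tau> powr - (\<epsilon> / 2) \<le> Q * (2 * \<tau>) powr -\<epsilon>" by (simp add: mult_ac)
  next
    fix z assume z: "z \<in> \<Omega>" "2 * \<tau> < \<delta> z"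
    have "\<rho> \<le> \<delta> z / 2" using \<rho> z by linarith
    note 1 = Wop[OF z(1) \<rho>(1) this]
    note 2 = Sop[OF z(1) \<tau>(1,3) z(2)]
    have "\<delta> z powr (-p) \<le> (2 * \<tau>) powr (-p)" using z \<tau> p by (intro powr_mono2') auto
    then have "K * \<delta> z powr (-p) * \<rho> \<le> K * (2 * \<tau>) powr (-p) * \<rho>"
      using K \<rho> by (intro mult_right_mono mult_left_mono) auto
    then have "nl_op s (mollify \<rho> w) z < nl_op s (trunc \<tau> f) z + Q * nl_op s (barrier \<epsilon> \<tau>) z"
      using 1 2 \<rho>(3) by linarith
    then show "integrable lborel (\<lambda>y. (mollify \<rho> w z - mollify \<rho> w y) * frac_ker s (z - y)) \<and>
      integrable lborel (\<lambda>y. (trunc \<tau> f z - trunc \<tau> f y) * frac_ker s (z - y)) \<and>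
      integrable lborel (\<lambda>y. (barrier \<epsilon> \<tau> z - barrier \<epsilon> \<tau> y) * frac_ker s (z - y)) \<and>
      nl_op s (mollify \<rho> w) z < nl_op s (trunc \<tau> f) z + Q * nl_op s (barrier \<epsilon> \<tau>) z"
      using 1 2 by blast
  qed
  let ?S = "\<lambda>x. f x + Q * \<delta> x powr -\<epsilon>"
  have null: "emeasure lborel {x \<in> \<Omega>. 2 * \<tau> \<le> \<delta> x \<and> ?S x < w x} = 0"
    if \<tau>: "0 < \<tau>" "\<tau> < \<tau>0" "\<tau> < 1" for \<tau>
  proof (rule ccontr)
    let ?N = "{x \<in> \<Omega>. 2 * \<tau> \<le> \<delta> x \<and> ?S x < w x}"
    assume "emeasure lborel ?N \<noteq> 0"
    moreover have "?N \<in> sets borel" by measurable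
    moreover have "bounded ?N" using bdd by (rule bounded_subset) auto
    ultimately obtain T where T: "compact T" "T \<subseteq> ?N" "emeasure lborel T \<noteq> 0"
      using exists_compact_nonnull by blast
    have Tb [measurable]: "T \<in> sets borel" using T by (simp add: compact_imp_closed)
    have Tfin: "emeasure lborel T < \<infinity>" using T(1) by (rule emeasure_compact_finite)
    define b where "b = A * (2 * \<tau>) powr - (\<epsilon> / 2) + Q * (2 * \<tau>) powr -\<epsilon>"
    have Sb: "\<bar>?S x\<bar> \<le> b" if "x \<in> T" for x
    proof -
      have x: "x \<in> \<Omega>" "2 * \<tau> \<le> \<delta> x" using that T(2) by auto
      have "\<bar>f x\<bar> \<le> A * \<delta> x powr - (\<epsilon> / 2)" by (rule fA[OF x(1)])
      also have "\<dots> \<le> A * (2 * \<tau>) powr - (\<epsilon> / 2)" using A x \<tau> \<epsilon> by (intro mult_left_mono powr_mono2') auto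
      finally have 1: "\<bar>f x\<bar> \<le> A * (2 * \<tau>) powr - (\<epsilon> / 2)" .
      have "Q * \<delta> x powr -\<epsilon> \<le> Q * (2 * \<tau>) powr -\<epsilon>" using Q x \<tau> \<epsilon> by (intro mult_left_mono powr_mono2') auto
      moreover have "0 \<le> Q * \<delta> x powr -\<epsilon>" using Q by simp
      ultimately show ?thesis using 1 unfolding b_def by linarith
    qed
    have int: "integrable lborel (\<lambda>x. indicator T x * k x)"
      if [measurable]: "k \<in> borel_measurable borel" and k: "\<And>x. x \<in> T \<Longrightarrow> \<bar>k x\<bar> \<le> c" for k :: "'a \<Rightarrow> real" and c
    proof (rule Bochner_Integration.integrable_bound)
      show "integrable lborel (\<lambda>x. c * indicator T x)"
        using Tfin by (intro integrable_mult_right integrable_real_indicator) auto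
      show "AE x in lborel. norm (indicator T x * k x) \<le> norm (c * indicator T x)"
        using k by (intro AE_I2) (force simp: indicator_def abs_mult)
    qed measurable
    have iS: "integrable lborel (\<lambda>x. indicator T x * ?S x)" by (rule int[OF _ Sb]) measurable
    have iw: "integrable lborel (\<lambda>x. indicator T x * w x)" by (rule int[OF _ wB]) measurable
    have "integrable lborel (\<lambda>x. indicator T x * (w x - ?S x))"
      using Bochner_Integration.integrable_diff[OF iw iS] by (simp add: right_diff_distrib)
    then have "0 < (LINT x|lborel. indicator T x * (w x - ?S x))"
      using T by (intro integral_pos_on[OF Tb]) auto
    also have "\<dots> = (LINT x|lborel. indicator T x * w x) - (LINT x|lborel. indicator T x * ?S x)"
      using Bochner_Integration.integral_diff[OF iw iS] by (simp only: right_diff_distrib)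
    finally have gap: "0 < (LINT x|lborel. indicator T x * w x) - (LINT x|lborel. indicator T x * ?S x)" .
    \<comment> \<open>The tolerance is the gap itself: mollification would have to lower the
      integral of \<open>w\<close> by at least the whole gap, which small radii cannot do.\<close>
    obtain r where r: "r > 0" "\<And>\<rho>. 0 < \<rho> \<Longrightarrow> \<rho> < r \<Longrightarrow>
      \<bar>(LINT x|lborel. indicator T x * mollify \<rho> w x) - (LINT x|lborel. indicator T x * w x)\<bar> <
        (LINT x|lborel. indicator T x * w x) - (LINT x|lborel. indicator T x * ?S x)"
      using mollify_weak[OF wm wB T(1) gap] by blast
    define k where "k = K * (2 * \<tau>) powr (-p)"
    have k: "k \<ge> 0" using K by (simp add: k_def)
    \<comment> \<open>Three requirements: below the radius from weak convergence, at most tau, and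
      mollification error below \<open>q\<close>; the term \<open>k + 1\<close> avoids dividing by
      zero.\<close>
    define \<rho> where "\<rho> = min (r / 2) (min \<tau> (q / (2 * (k + 1))))"
    have \<rho>: "0 < \<rho>" "\<rho> < r" "\<rho> \<le> \<tau>" using r \<tau> q k by (auto simp: \<rho>_def)
    have "k * \<rho> \<le> (k + 1) * (q / (2 * (k + 1)))" using k \<rho> by (intro mult_mono) (auto simp: \<rho>_def)
    also have "\<dots> = q / 2"
    proof -
      have *: "a * (q / (2 * a)) = q / 2" if "a > 0" for a :: real using that by simp
      show ?thesis by (rule *) (use k in simp)
    qed
    also have "\<dots> < q" using q by simp
    finally have k\<rho>: "K * (2 * \<tau>) powr (-p) * \<rho> < q" by (simp add: k_def)
    have "(LINT x|lborel. indicator T x * mollify \<rho> w x) \<le> (LINT x|lborel. indicator T x * ?S x)"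
    proof (rule integral_mono)
      show "integrable lborel (\<lambda>x. indicator T x * mollify \<rho> w x)"
        by (rule int[OF _ mollify_bound[OF wm wB \<rho>(1)]]) measurable
      show "integrable lborel (\<lambda>x. indicator T x * ?S x)" by (rule iS)
      show "indicator T x * mollify \<rho> w x \<le> indicator T x * ?S x" for x
        using main[OF \<tau> \<rho>(1,3) k\<rho>, of x] T(2) by (auto simp: indicator_def)
    qed
    then show False using r(2)[OF \<rho>(1,2)] by linarith
  qed
  \<comment> \<open>Countably many widths tending to 0, each below the thresholds
    \<open>\<tau>0\<close> and 1, turn the null sets into one.\<close>
  have "AE x in lborel. \<forall>m. x \<notin> {x \<in> \<Omega>. 2 * (min (\<tau>0/2) (1 / real (m + 2))) \<le> \<delta> x \<and> ?S x < w x}"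
  proof (rule AE_all_countable[THEN iffD2], rule allI)
    fix m
    have "emeasure lborel {x \<in> \<Omega>. 2 * (min (\<tau>0/2) (1 / real (m + 2))) \<le> \<delta> x \<and> ?S x < w x} = 0"
    proof (rule null)
      have "1 / real (m + 2) < 1" by simp
      then show "min (\<tau>0/2) (1 / real (m + 2)) < 1" by (rule min.strict_coboundedI2)
    qed (use \<tau>0 in auto)
    then show "AE x in lborel. x \<notin> {x \<in> \<Omega>. 2 * (min (\<tau>0/2) (1 / real (m + 2))) \<le> \<delta> x \<and> ?S x < w x}"
      by (intro AE_not_in null_setsI) measurable
  qed
  then show ?thesis
  proof eventually_elim
    case (elim x)
    show ?case
    proof (intro impI, rule ccontr)
      assume x: "x \<in> \<Omega>" "\<not> w x \<le> ?S x"
      have "0 < \<delta> x / 2" using \<delta>_pos[OF x(1)] by simp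
      then obtain m where "1 / real (Suc m) < \<delta> x / 2" using nat_approx_posE by blast
      moreover have "1 / real (m + 2) \<le> 1 / real (Suc m)" by (intro frac_le) auto
      ultimately have "2 * min (\<tau>0/2) (1 / real (m + 2)) \<le> \<delta> x" by linarith
      then show False using elim[rule_format, of m] x by auto
    qed
  qed
qed

end

section \<open>Small s\<close>

lemma tendsto_c_Ns:
  assumes "n > 0"
  shows "((\<lambda>s. c_Ns n s / s) \<longlongrightarrow> c_N n) (at_right 0)"
proof -
  have l: "((\<lambda>s. 4 powr s * Gamma (real n / 2 + s) / (Gamma (2 - s) * pi powr (real n / 2)) * (1 - s))
    \<longlongrightarrow> 4 powr 0 * Gamma (real n / 2 + 0) / (Gamma (2 - 0) * pi powr (real n / 2)) * (1 - 0)) (at_right 0)"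
  proof (intro tendsto_intros)
    show "real n / 2 + 0 \<notin> \<int>\<^sub>\<le>\<^sub>0" using assms by (auto dest: nonpos_Ints_nonpos)
    show "(2 - 0 :: real) \<notin> \<int>\<^sub>\<le>\<^sub>0" by (auto dest: nonpos_Ints_nonpos)
    show "Gamma (2 - 0 :: real) * pi powr (real n / 2) \<noteq> 0"
      by (simp add: Gamma_numeral)
  qed auto
  have e: "4 powr 0 * Gamma (real n / 2 + 0) / (Gamma (2 - 0) * pi powr (real n / 2)) * (1 - 0) = c_N n"
    by (simp add: c_N_def Gamma_numeral powr_minus divide_simps)
  have ev: "\<forall>\<^sub>F s in at_right 0. 4 powr s * Gamma (real n / 2 + s) / (Gamma (2 - s) * pi powr (real n / 2)) * (1 - s) = c_Ns n s / s"
    using eventually_at_right_less by eventually_elim (simp add: c_Ns_def)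
  show ?thesis using Lim_transform_eventually[OF l ev] unfolding e .
qed

text \<open>The identity behind the normalisation: with c_N = 2 / omega the quotient
  \<open>c_Ns n s * omega_sphere n / (2 * s)\<close> tends to exactly 1.\<close>

lemma c_N_omega: "n > 0 \<Longrightarrow> c_N n * omega_sphere n = 2"
proof -
  assume "n > 0"
  then have "Gamma (real n / 2) > 0" by (intro Gamma_real_pos) auto
  then show ?thesis by (simp add: c_N_def omega_sphere_def powr_minus divide_simps)
qed

lemma c_N_pos: "n > 0 \<Longrightarrow> c_N n > 0"
  unfolding c_N_def by (intro mult_pos_pos Gamma_real_pos) auto

lemma tendsto_c_Ns_0:
  assumes "n > 0"
  shows "(c_Ns n \<longlongrightarrow> 0) (at_right 0)"
proof -
  have l: "((\<lambda>s. c_Ns n s / s * s) \<longlongrightarrow> c_N n * 0) (at_right 0)"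
    by (intro tendsto_intros tendsto_c_Ns assms)
  have ev: "\<forall>\<^sub>F s in at_right 0. c_Ns n s / s * s = c_Ns n s"
    using eventually_at_right_less by eventually_elim simp
  show ?thesis using Lim_transform_eventually[OF l ev] by simp
qed

lemma tendsto_c_Ns_omega:
  assumes "n > 0"
  shows "((\<lambda>s. c_Ns n s * omega_sphere n / (2 * s)) \<longlongrightarrow> 1) (at_right 0)"
proof -
  have "((\<lambda>s. c_Ns n s / s * (omega_sphere n / 2)) \<longlongrightarrow> c_N n * (omega_sphere n / 2)) (at_right 0)"
    by (intro tendsto_intros tendsto_c_Ns assms)
  then show ?thesis using c_N_omega[OF assms] by (simp add: mult_ac)
qed

lemma c_Ns_pos: "0 < s \<Longrightarrow> s < 1 \<Longrightarrow> n > 0 \<Longrightarrow> c_Ns n s > 0"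
  unfolding c_Ns_def by (intro mult_pos_pos divide_pos_pos Gamma_real_pos) (auto intro: add_pos_pos)

text \<open>Convergence t^(-2s) to 1 is not uniform at t = 0, so a factor t^(-a) is conceded. For t
  < 1 write t^(-2s) = exp x and use exp x - 1 <= x exp x: half of a pays for the logarithm in x, the
  other half for exp x because 4 s <= a. For t >= 1 the deviation is at most 2 s ln R, and R^a
  t^(-a) >= 1.\<close>

lemma powr_near_one:
  fixes a t R s :: real
  assumes a: "0 < a" and t: "0 < t" "t \<le> R" and R: "1 \<le> R" and s: "0 \<le> s" "4 * s \<le> a"
  shows "\<bar>t powr (-2 * s) - 1\<bar> \<le> (4 / a + 2 * ln R * R powr a) * s * t powr (-a)"
proof -
  have lR: "0 \<le> ln R" using R by simp
  show ?thesis
  proof (cases "t < 1")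
    case True
    define x where "x = - 2 * s * ln t"
    have x: "0 \<le> x" using True t s by (simp add: x_def mult_nonneg_nonpos)
    have e: "t powr (-2 * s) = exp x" using t by (simp add: powr_def x_def)
    have "1 + (- x) \<le> exp (- x)" by (rule exp_ge_add_one_self)
    then have "(1 - x) * exp x \<le> exp (- x) * exp x" by (intro mult_right_mono) auto
    then have 1: "exp x - 1 \<le> x * exp x" by (simp add: exp_minus algebra_simps)
    have "ln (t powr (- (a / 2))) \<le> t powr (- (a / 2)) - 1" using t by (intro ln_le_minus_one) auto
    moreover have "ln (t powr (- (a / 2))) = - ln t * (a / 2)" using t by (simp add: ln_powr)
    ultimately have "- ln t * (a / 2) \<le> t powr (- (a / 2))" by linarith
    then have "- ln t \<le> 2 / a * t powr (- (a / 2))" using a by (simp add: field_simps)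
    then have "2 * s * (- ln t) \<le> 2 * s * (2 / a * t powr (- (a / 2)))" using s by (intro mult_left_mono) auto
    then have 2: "x \<le> 4 / a * s * t powr (- (a / 2))" by (simp add: x_def mult_ac)
    have 3: "exp x \<le> t powr (- (a / 2))"
      unfolding e[symmetric] using True t s by (intro powr_mono') auto
    have "x * exp x \<le> 4 / a * s * t powr (- (a / 2)) * t powr (- (a / 2))"
      using x 2 3 by (intro mult_mono) auto
    also have "\<dots> = 4 / a * s * t powr (-a)" by (simp add: mult.assoc powr_add[symmetric])
    also have "\<dots> \<le> (4 / a + 2 * ln R * R powr a) * s * t powr (-a)"
      using lR s by (intro mult_right_mono) auto
    finally show ?thesis using 1 x e by simp
  next
    case False
    then have t1: "1 \<le> t" by simp
    define x where "x = 2 * s * ln t"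
    have x: "0 \<le> x" using t1 s by (simp add: x_def)
    have e: "t powr (-2 * s) = exp (- x)" using t by (simp add: powr_def x_def)
    have "1 - exp (- x) \<le> x" using exp_ge_add_one_self[of "- x"] by simp
    also have "x \<le> 2 * s * ln R" unfolding x_def using t t1 s by (intro mult_left_mono) auto
    also have "\<dots> \<le> 2 * s * ln R * (R powr a * t powr (-a))"
    proof -
      have "t powr a \<le> R powr a" using t a by (intro powr_mono2) auto
      then have "1 \<le> R powr a * t powr (-a)" using t by (simp add: powr_minus field_simps)
      then show ?thesis using s lR mult_left_mono[of 1 "R powr a * t powr (-a)" "2 * s * ln R"] by simp
    qed
    also have "\<dots> = (2 * ln R * R powr a) * s * t powr (-a)" by simp
    also have "\<dots> \<le> (4 / a + 2 * ln R * R powr a) * s * t powr (-a)"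
      using a s by (intro mult_right_mono) auto
    finally show ?thesis using x e by simp
  qed
qed

section \<open>The one-sided comparison estimate\<close>

context C2_domain
begin

lemma continuous_on_ext_pot:
  assumes "h \<in> borel_measurable borel" and "\<And>y. \<bar>h y\<bar> \<le> M" and "\<And>y. y \<in> \<Omega> \<Longrightarrow> h y = 0"
    and s: "0 < s" "s \<le> 1/4"
  shows "continuous_on \<Omega> (ext_pot s h)"
proof (rule continuous_at_imp_continuous_on, intro ballI)
  fix x assume x: "x \<in> \<Omega>"
  have "((\<lambda>x'. ext_pot s h x' - ext_pot s h x) \<longlongrightarrow> 0) (at x)"
  proof (rule Lim_null_comparison)
    have "\<forall>\<^sub>F x' in at x. dist x' x < \<delta> x / 2"
      using \<delta>_pos[OF x] by (subst eventually_at) (auto intro!: exI[of _ "\<delta> x / 2"])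
    then show "\<forall>\<^sub>F x' in at x. norm (ext_pot s h x' - ext_pot s h x) \<le> lip_const * M * \<delta> x powr (-1 - 2 * s) * norm (x - x')"
    proof eventually_elim
      case (elim x')
      then have "norm (x - x') \<le> \<delta> x / 2" by (simp add: dist_norm norm_minus_commute)
      from ext_pot_lipschitz[OF assms(1-3) s x this] show ?case by (simp add: abs_minus_commute)
    qed
    show "((\<lambda>x'. lip_const * M * \<delta> x powr (-1 - 2 * s) * norm (x - x')) \<longlongrightarrow> 0) (at x)"
      by (auto intro!: tendsto_eq_intros)
  qed
  then show "isCont (ext_pot s h) x" by (simp add: isCont_def LIM_zero_iff)
qed

text \<open>In the half-distance ball the cut-offs at tau are invisible once
  \<open>2 * \<tau> < \<delta> x\<close>.\<close>

lemma near_in_\<Omega>: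
  assumes "x \<in> \<Omega>" "norm (x - y) < \<delta> x / 2"
  shows "y \<in> \<Omega>" "\<delta> x / 2 < \<delta> y"
  using assms \<delta>_pos[OF assms(1)] \<delta>_lipschitz[of x y] by (auto intro: mem_\<Omega>I)

text \<open>The supersolution is f + Q delta^(-eps) with f = f_s. With e = delta^(-eps-2s),
  \<open>c_Ns\<close> times the operator maps f to f up to an error of the form constant times e,
  and maps the barrier to at least e/2. If Q/2 exceeds that error constant, a positive slack
  remains, as \<open>comparison\<close> requires.\<close>

lemma main_estimate:
  assumes \<epsilon>: "0 < \<epsilon>" "\<epsilon> < 1"
  obtains C s0 where "C > 0" "0 < s0" "s0 \<le> 1/4"
    "\<And>s u w h c B M A \<theta> Q. \<lbrakk>0 < s; s < s0; u \<in> borel_measurable lebesgue;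
      w \<in> borel_measurable borel; h \<in> borel_measurable borel;
      AE y in lebesgue. u y = c + w y + h y; \<And>y. \<bar>w y\<bar> \<le> B; \<And>y. y \<notin> \<Omega> \<Longrightarrow> w y = 0;
      \<And>y. \<bar>h y\<bar> \<le> M; \<And>y. y \<in> \<Omega> \<Longrightarrow> h y = 0; s_harmonic s \<Omega> u; 0 \<le> A; 0 \<le> \<theta>;
      \<And>x. x \<in> \<Omega> \<Longrightarrow> \<bar>c_Ns DIM('a) s * ext_pot s h x\<bar> \<le> A * \<delta> x powr - (\<epsilon> / 2);
      \<And>x. x \<in> \<Omega> \<Longrightarrow> \<bar>c_Ns DIM('a) s * omega_sphere DIM('a) / (2 * s) * (\<delta> x / 2) powr (-2 * s) - 1\<bar> \<le> \<theta> * \<delta> x powr - (\<epsilon> / 2);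
      C * (\<theta> * A + c_Ns DIM('a) s * (A + c_Ns DIM('a) s * M)) < Q\<rbrakk> \<Longrightarrow>
      AE x in lborel. x \<in> \<Omega> \<longrightarrow> w x \<le> c_Ns DIM('a) s * ext_pot s h x + Q * \<delta> x powr -\<epsilon>"
proof -
  let ?o = "omega_sphere DIM('a)" and ?n = "DIM('a)"
  have o: "?o > 0" by (simp add: omega_sphere_pos)
  obtain C1 where C1: "C1 > 0"
    and oe: "\<And>s x G A \<Lambda>. \<lbrakk>0 < s; s \<le> 1/4; x \<in> \<Omega>; G \<in> borel_measurable borel; 0 \<le> A; 0 \<le> \<Lambda>;
      AE y in lborel. \<bar>G y\<bar> \<le> A * (\<delta> y powr -\<epsilon> * indicator nbd y);
      \<And>y. norm (x - y) < \<delta> x / 2 \<Longrightarrow> \<bar>G x - G y\<bar> \<le> \<Lambda> * \<delta> x powr (-1 - \<epsilon>) * norm (x - y)\<rbrakk> \<Longrightarrow>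
      integrable lborel (\<lambda>y. (G x - G y) * frac_ker s (x - y)) \<and>
      \<bar>nl_op s G x - G x * (?o * (\<delta> x / 2) powr (-2 * s) / (2 * s))\<bar>
        \<le> C1 * (A + \<Lambda>) * \<delta> x powr (- \<epsilon> - 2 * s)"
    using op_estimate[OF \<epsilon>] by blast
  \<comment> \<open>The 5 is the sum of the weight constant 1 and the Lipschitz constant 4 with
    which \<open>oe\<close> is applied to the barrier.\<close>
  have "((\<lambda>s. c_Ns ?n s * ?o / (2 * s) - 5 * C1 * c_Ns ?n s) \<longlongrightarrow> 1 - 5 * C1 * 0) (at_right 0)"
    by (intro tendsto_intros tendsto_c_Ns_omega tendsto_c_Ns_0) auto
  then have "\<forall>\<^sub>F s in at_right 0. 1/2 < c_Ns ?n s * ?o / (2 * s) - 5 * C1 * c_Ns ?n s"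
    by (rule order_tendstoD) simp
  then obtain s1 where s1: "s1 > 0" "\<And>s. 0 < s \<Longrightarrow> s < s1 \<Longrightarrow> 1/2 < c_Ns ?n s * ?o / (2 * s) - 5 * C1 * c_Ns ?n s"
    by (auto simp: eventually_at_right_field)
  \<comment> \<open>The bound by eps/4 ensures 2 s <= eps, so that the Lipschitz exponent -1 - 2s of
    the potential may be weakened to -1 - eps.\<close>
  define s0 where "s0 = min s1 (\<epsilon> / 4)"
  have lp: "lip_const \<ge> 0" using o by (simp add: lip_const_def)
  \<comment> \<open>The 2 compensates the one half in the barrier inequality, \<open>R0\<close> the
    exchange of exponents, and the bracket collects the error of the identity and that of
    \<open>oe\<close>.\<close>
  define C where "C = 2 * R0 * (1 + C1 * (1 + lip_const))"
  have C: "C > 0" using R0(1) C1 lp by (auto simp: C_def intro!: mult_pos_pos add_pos_nonneg)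
  show ?thesis
  proof (rule that[OF C])
    show "0 < s0" "s0 \<le> 1/4" using s1 \<epsilon> by (auto simp: s0_def)
    fix s c B M A \<theta> Q :: real and u w h :: "'a \<Rightarrow> real"
    assume s: "0 < s" "s < s0" and um: "u \<in> borel_measurable lebesgue"
      and wm [measurable]: "w \<in> borel_measurable borel" and hm [measurable]: "h \<in> borel_measurable borel"
      and eq: "AE y in lebesgue. u y = c + w y + h y" and wB: "\<And>y. \<bar>w y\<bar> \<le> B" and w0: "\<And>y. y \<notin> \<Omega> \<Longrightarrow> w y = 0"
      and hM: "\<And>y. \<bar>h y\<bar> \<le> M" and h0: "\<And>y. y \<in> \<Omega> \<Longrightarrow> h y = 0" and harm: "s_harmonic s \<Omega> u"
      and A: "0 \<le> A" and \<theta>: "0 \<le> \<theta>"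
      and fA: "\<And>x. x \<in> \<Omega> \<Longrightarrow> \<bar>c_Ns ?n s * ext_pot s h x\<bar> \<le> A * \<delta> x powr - (\<epsilon> / 2)"
      and \<kappa>: "\<And>x. x \<in> \<Omega> \<Longrightarrow> \<bar>c_Ns ?n s * ?o / (2 * s) * (\<delta> x / 2) powr (-2 * s) - 1\<bar> \<le> \<theta> * \<delta> x powr - (\<epsilon> / 2)"
      and Q: "C * (\<theta> * A + c_Ns ?n s * (A + c_Ns ?n s * M)) < Q"
    let ?c = "c_Ns ?n s"
    define f where "f x = ?c * ext_pot s h x" for x
    have s': "s \<le> 1/4" "s < 1" "s < s1" "2 * s \<le> \<epsilon>" using s \<epsilon> by (auto simp: s0_def)
    have c: "?c > 0" using s s' by (intro c_Ns_pos) auto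
    have M: "M \<ge> 0" using hM[of 0] by linarith
    have [measurable]: "ext_pot s h \<in> borel_measurable borel" unfolding ext_pot_def by measurable
    have fm [measurable]: "f \<in> borel_measurable borel" unfolding f_def by measurable
    \<comment> \<open>The coefficient of e that survives: the barrier gives Q/2, the deviation of
      the operator from the identity costs the second term, and the error of \<open>oe\<close> on f
      costs the third.\<close>
    define \<gamma> where "\<gamma> = Q / 2 - R0 * \<theta> * A - ?c * C1 * R0 * (A + ?c * lip_const * M)"
    have \<gamma>: "\<gamma> > 0"
    proof -
      have "2 * (R0 * \<theta> * A + ?c * C1 * R0 * (A + ?c * lip_const * M)) \<le> C * (\<theta> * A + ?c * (A + ?c * M))"
      proof -
        have "A + ?c * lip_const * M \<le> (1 + lip_const) * (A + ?c * M)"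
          using A c lp M by (simp add: algebra_simps)
        then have "?c * C1 * R0 * (A + ?c * lip_const * M) \<le> ?c * C1 * R0 * ((1 + lip_const) * (A + ?c * M))"
          using c C1 R0(1) by (intro mult_left_mono) auto
        moreover have "C * (\<theta> * A + ?c * (A + ?c * M)) = 2 * (R0 * \<theta> * A + ?c * C1 * R0 * ((1 + lip_const) * (A + ?c * M)))
           + 2 * R0 * C1 * (1 + lip_const) * (\<theta> * A) + 2 * R0 * (?c * (A + ?c * M))"
          by (simp add: C_def algebra_simps)
        moreover have "0 \<le> 2 * R0 * C1 * (1 + lip_const) * (\<theta> * A)" "0 \<le> 2 * R0 * (?c * (A + ?c * M))"
          using R0(1) C1 lp \<theta> A c M by auto
        moreover have "2 * (p + x) \<le> z" if "x \<le> y" "z = 2 * (p + y) + a + b" "0 \<le> a" "0 \<le> b" for p x y z a b :: real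
          using that by argo
        ultimately show ?thesis by blast
      qed
      then show ?thesis using Q by (simp add: \<gamma>_def)
    qed
    have Qp: "Q > 0"
    proof -
      have "0 \<le> C * (\<theta> * A + ?c * (A + ?c * M))" using C \<theta> A c M by simp
      then show ?thesis using Q by linarith
    qed
    \<comment> \<open>Since delta < R0 and eps + 2s <= 2, the surplus gamma e is at least gamma
      R0^(-2); dividing by \<open>?c\<close> turns it into slack for the unnormalised
      operator.\<close>
    define q where "q = \<gamma> * R0 powr -2 / ?c"
    have q: "q > 0" using \<gamma> c R0(1) by (simp add: q_def)
    \<comment> \<open>Lowering an exponent of delta by at most 1 costs one factor
      \<open>R0\<close>.\<close>
    have pw: "\<delta> x powr a \<le> R0 * \<delta> x powr b" if "x \<in> \<Omega>" "b \<le> a" "a \<le> b + 1" for x a b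
    proof -
      have "\<delta> x powr a = \<delta> x powr (a - b) * \<delta> x powr b" by (simp add: powr_add[symmetric])
      also have "\<delta> x powr (a - b) \<le> R0 powr (a - b)"
        using that R0(3)[OF that(1)] by (intro powr_mono2) auto
      also have "R0 powr (a - b) \<le> R0 powr 1" using that R0(1) by (intro powr_mono) auto
      finally show ?thesis using R0(1) by (simp add: mult_right_mono)
    qed
    have "AE x in lborel. x \<in> \<Omega> \<longrightarrow> w x \<le> f x + Q * \<delta> x powr -\<epsilon>"
    proof (rule comparison[OF wm wB w0 fm _ _ \<epsilon>(1) A Qp q])
      show "continuous_on \<Omega> f"
        unfolding f_def using continuous_on_ext_pot[OF hm hM h0 s(1) s'(1)] by (intro continuous_on_mult continuous_on_const)
      show "\<bar>f y\<bar> \<le> A * \<delta> y powr - (\<epsilon> / 2)" if "y \<in> \<Omega>" for y using fA[OF that] by (simp add: f_def)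
      show "0 \<le> lip_const * M" "0 \<le> 1 + 2 * s" using lp M s by auto
    next
      fix x \<rho> assume x: "x \<in> \<Omega>" and \<rho>: "0 < \<rho>" "\<rho> \<le> \<delta> x / 2"
      have cN: "?c \<noteq> 0" using c by simp
      note me = mollified_equation[OF um wm hm eq wB hM h0 harm s(1) s'(1) cN x \<rho>]
      have "- 1 - 2 * s = - (1 + 2 * s)" by simp
      then show "integrable lborel (\<lambda>y. (mollify \<rho> w x - mollify \<rho> w y) * frac_ker s (x - y)) \<and>
        nl_op s (mollify \<rho> w) x \<le> ext_pot s h x + lip_const * M * \<delta> x powr - (1 + 2 * s) * \<rho>"
        using me by (simp add: abs_le_iff)
    next
      fix x \<tau> assume x: "x \<in> \<Omega>" and \<tau>: "0 < \<tau>" "\<tau> < 1" and d: "2 * \<tau> < \<delta> x"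
      let ?k0 = "?o * (\<delta> x / 2) powr (-2 * s) / (2 * s)"
      let ?e = "\<delta> x powr (- \<epsilon> - 2 * s)"
      have dp: "\<delta> x > 0" by (rule \<delta>_pos[OF x])
      have G: "integrable lborel (\<lambda>y. (trunc \<tau> f x - trunc \<tau> f y) * frac_ker s (x - y)) \<and>
        \<bar>nl_op s (trunc \<tau> f) x - trunc \<tau> f x * ?k0\<bar> \<le> C1 * (A * R0 + ?c * lip_const * M * R0) * ?e"
      proof (rule oe[OF s(1) s'(1) x])
        show "AE y in lborel. \<bar>trunc \<tau> f y\<bar> \<le> A * R0 * (\<delta> y powr -\<epsilon> * indicator nbd y)"
        proof (rule AE_I2)
          fix y
          show "\<bar>trunc \<tau> f y\<bar> \<le> A * R0 * (\<delta> y powr -\<epsilon> * indicator nbd y)"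
          proof (cases "y \<in> \<Omega> \<and> \<tau> < \<delta> y")
            case True
            have "\<bar>f y\<bar> \<le> A * \<delta> y powr - (\<epsilon> / 2)" using fA True by (simp add: f_def)
            also have "\<dots> \<le> A * (R0 * \<delta> y powr -\<epsilon>)" using True \<epsilon> A by (intro mult_left_mono pw) auto
            finally show ?thesis using True by (simp add: trunc_def nbd_def mult_ac)
          next
            case False
            have "0 \<le> A * R0 * (\<delta> y powr -\<epsilon> * indicator nbd y)" using A R0(1) by simp
            moreover have "trunc \<tau> f y = 0" using False by (auto simp: trunc_def)
            ultimately show ?thesis by simp
          qed
        qed
        fix y assume y: "norm (x - y) < \<delta> x / 2"
        have "\<bar>ext_pot s h x - ext_pot s h y\<bar> \<le> lip_const * M * \<delta> x powr (-1 - 2 * s) * norm (x - y)"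
          using y by (intro ext_pot_lipschitz[OF hm hM h0 s(1) s'(1) x]) auto
        also have "\<dots> \<le> lip_const * M * (R0 * \<delta> x powr (-1 - \<epsilon>)) * norm (x - y)"
          using lp M \<epsilon> s s' by (intro mult_right_mono mult_left_mono pw x) auto
        finally have "?c * \<bar>ext_pot s h x - ext_pot s h y\<bar> \<le> ?c * (lip_const * M * (R0 * \<delta> x powr (-1 - \<epsilon>)) * norm (x - y))"
          using c by (intro mult_left_mono) auto
        moreover have "\<bar>trunc \<tau> f x - trunc \<tau> f y\<bar> = ?c * \<bar>ext_pot s h x - ext_pot s h y\<bar>"
          using near_in_\<Omega>[OF x y] x d \<tau> c by (simp add: trunc_def f_def right_diff_distrib[symmetric] abs_mult)
        ultimately show "\<bar>trunc \<tau> f x - trunc \<tau> f y\<bar> \<le> ?c * lip_const * M * R0 * \<delta> x powr (-1 - \<epsilon>) * norm (x - y)"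
          by (simp add: mult_ac)
      qed (use A R0(1) c lp M in auto)
      have Bar: "integrable lborel (\<lambda>y. (barrier \<epsilon> \<tau> x - barrier \<epsilon> \<tau> y) * frac_ker s (x - y)) \<and>
        \<bar>nl_op s (barrier \<epsilon> \<tau>) x - barrier \<epsilon> \<tau> x * ?k0\<bar> \<le> C1 * (1 + 4) * ?e"
      proof (rule oe[OF s(1) s'(1) x])
        show "AE y in lborel. \<bar>barrier \<epsilon> \<tau> y\<bar> \<le> 1 * (\<delta> y powr -\<epsilon> * indicator nbd y)"
          using AE_\<delta>_pos
        proof eventually_elim
          case (elim y)
          show ?case
          proof (cases "y \<in> \<Omega> \<or> \<delta> y \<le> \<tau>")
            case True
            then have "y \<in> nbd" using \<tau> by (auto simp: nbd_def)
            moreover have "max (\<delta> y) \<tau> powr -\<epsilon> \<le> \<delta> y powr -\<epsilon>" using elim \<epsilon> by (intro powr_mono2') auto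
            ultimately show ?thesis using True by (simp add: barrier_def)
          qed (simp add: barrier_def)
        qed
        fix y assume y: "norm (x - y) < \<delta> x / 2"
        have "\<bar>\<delta> x powr -\<epsilon> - \<delta> y powr -\<epsilon>\<bar> \<le> \<epsilon> * (\<delta> x / 2) powr (-\<epsilon> - 1) * \<bar>\<delta> x - \<delta> y\<bar>"
          using near_in_\<Omega>[OF x y] dp \<epsilon> by (intro powr_diff_bound) auto
        also have "\<dots> \<le> 1 * (4 * \<delta> x powr (-\<epsilon> - 1)) * norm (x - y)"
        proof (intro mult_mono \<delta>_lipschitz)
          have "(\<delta> x / 2) powr (-\<epsilon> - 1) = \<delta> x powr (-\<epsilon> - 1) / 2 powr (-\<epsilon> - 1)" by (rule powr_divide)
          also have "\<dots> = \<delta> x powr (-\<epsilon> - 1) * 2 powr (\<epsilon> + 1)"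
          proof -
            have "-\<epsilon> - 1 = - (\<epsilon> + 1)" by simp
            then show ?thesis by (simp only: powr_minus[of 2] divide_inverse inverse_inverse_eq)
          qed
          also have "\<dots> \<le> \<delta> x powr (-\<epsilon> - 1) * 2 powr 2" using \<epsilon> by (intro mult_left_mono powr_mono) auto
          finally show "(\<delta> x / 2) powr (-\<epsilon> - 1) \<le> 4 * \<delta> x powr (-\<epsilon> - 1)" by simp
        qed (use \<epsilon> in auto)
        finally have fin: "\<bar>\<delta> x powr -\<epsilon> - \<delta> y powr -\<epsilon>\<bar> \<le> 4 * \<delta> x powr (-\<epsilon> - 1) * norm (x - y)" by simp
        have b: "barrier \<epsilon> \<tau> x = \<delta> x powr -\<epsilon>" "barrier \<epsilon> \<tau> y = \<delta> y powr -\<epsilon>"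
          using near_in_\<Omega>[OF x y] x d \<tau> by (auto simp: barrier_def max_def)
        have ee: "-1 - \<epsilon> = -\<epsilon> - 1" by simp
        show "\<bar>barrier \<epsilon> \<tau> x - barrier \<epsilon> \<tau> y\<bar> \<le> 4 * \<delta> x powr (-1 - \<epsilon>) * norm (x - y)"
          unfolding b ee by (rule fin)
      qed auto
      have tx: "trunc \<tau> f x = f x" "barrier \<epsilon> \<tau> x = \<delta> x powr -\<epsilon>"
        using x d \<tau> by (auto simp: trunc_def barrier_def max_def)
      have k: "?c * ?k0 = ?c * ?o / (2 * s) * (\<delta> x / 2) powr (-2 * s)" by simp
      have "?c * nl_op s (trunc \<tau> f) x \<ge> ?c * (f x * ?k0 - C1 * (A * R0 + ?c * lip_const * M * R0) * ?e)"
        using G tx c by (intro mult_left_mono) (auto simp: abs_le_iff)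
      also have "?c * (f x * ?k0 - C1 * (A * R0 + ?c * lip_const * M * R0) * ?e) =
        f x + f x * (?c * ?k0 - 1) - ?c * C1 * R0 * (A + ?c * lip_const * M) * ?e"
        by (simp only: algebra_simps)
      finally have 1: "?c * nl_op s (trunc \<tau> f) x \<ge> f x + f x * (?c * ?k0 - 1) - ?c * C1 * R0 * (A + ?c * lip_const * M) * ?e" .
      \<comment> \<open>Here the two halves of eps meet: f and the deviation from the identity each
        contribute delta^(-eps/2).\<close>
      have "\<bar>f x * (?c * ?k0 - 1)\<bar> \<le> (A * \<delta> x powr - (\<epsilon> / 2)) * (\<theta> * \<delta> x powr - (\<epsilon> / 2))"
        unfolding abs_mult k using fA[OF x] \<kappa>[OF x] A by (intro mult_mono) (auto simp: f_def)
      also have "\<dots> = A * \<theta> * \<delta> x powr -\<epsilon>"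
      proof -
        have "\<delta> x powr - (\<epsilon> / 2) * \<delta> x powr - (\<epsilon> / 2) = \<delta> x powr -\<epsilon>" by (simp add: powr_add[symmetric])
        then show ?thesis by (metis mult.assoc mult.commute)
      qed
      also have "\<dots> \<le> A * \<theta> * (R0 * ?e)" using A \<theta> s s' \<epsilon> by (intro mult_left_mono pw x) auto
      finally have 2: "f x * (?c * ?k0 - 1) \<ge> - (R0 * \<theta> * A * ?e)" by (simp add: abs_le_iff mult_ac)
      have "?c * nl_op s (barrier \<epsilon> \<tau>) x \<ge> ?c * (\<delta> x powr -\<epsilon> * ?k0 - C1 * 5 * ?e)"
        using Bar tx c by (intro mult_left_mono) (auto simp: abs_le_iff)
      moreover have "?c * (\<delta> x powr -\<epsilon> * ?k0 - C1 * 5 * ?e) \<ge> 1/2 * ?e"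
      proof -
        have "\<delta> x powr (-2 * s) \<le> (\<delta> x / 2) powr (-2 * s)" using dp s by (intro powr_mono2') auto
        then have "?c * ?o / (2 * s) * \<delta> x powr (-2 * s) \<le> ?c * ?k0"
          unfolding k using c o s by (intro mult_left_mono) auto
        then have f1: "\<delta> x powr -\<epsilon> * (?c * ?o / (2 * s) * \<delta> x powr (-2 * s)) \<le> \<delta> x powr -\<epsilon> * (?c * ?k0)"
          by (intro mult_left_mono) auto
        have "\<delta> x powr -\<epsilon> * \<delta> x powr (-2 * s) = ?e" by (simp add: powr_add[symmetric])
        then have f2: "\<delta> x powr -\<epsilon> * (?c * ?o / (2 * s) * \<delta> x powr (-2 * s)) = ?c * ?o / (2 * s) * ?e"
          by (metis mult.left_commute)
        have f3: "?c * (\<delta> x powr -\<epsilon> * ?k0 - C1 * 5 * ?e) = \<delta> x powr -\<epsilon> * (?c * ?k0) - 5 * C1 * ?c * ?e"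
          by (simp only: algebra_simps)
        have "1/2 * ?e \<le> (?c * ?o / (2 * s) - 5 * C1 * ?c) * ?e"
          using s1(2)[OF s(1) s'(3)] by (intro mult_right_mono) auto
        then have f4: "1/2 * ?e \<le> ?c * ?o / (2 * s) * ?e - 5 * C1 * ?c * ?e" by (simp only: left_diff_distrib)
        show ?thesis unfolding f3 by (rule order_trans[OF f4 diff_right_mono[OF f1[unfolded f2]]])
      qed
      ultimately have "?c * nl_op s (barrier \<epsilon> \<tau>) x \<ge> 1/2 * ?e" by linarith
      then have "Q * (?c * nl_op s (barrier \<epsilon> \<tau>) x) \<ge> Q * (1/2 * ?e)" using Qp by (intro mult_left_mono) auto
      then have 3: "Q * (?c * nl_op s (barrier \<epsilon> \<tau>) x) \<ge> Q / 2 * ?e" by simp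
      have "\<gamma> * R0 powr -2 \<le> \<gamma> * ?e"
      proof (intro mult_left_mono)
        have "R0 powr -2 \<le> R0 powr (- \<epsilon> - 2 * s)" using R0(1) \<epsilon> s s' by (intro powr_mono) auto
        also have "\<dots> \<le> ?e" using R0(3)[OF x] dp \<epsilon> s by (intro powr_mono2') auto
        finally show "R0 powr -2 \<le> ?e" .
      qed (use \<gamma> in simp)
      also have "\<gamma> * ?e = Q / 2 * ?e - R0 * \<theta> * A * ?e - ?c * C1 * R0 * (A + ?c * lip_const * M) * ?e"
        by (simp only: \<gamma>_def left_diff_distrib)
      finally have "f x + \<gamma> * R0 powr -2 \<le> ?c * nl_op s (trunc \<tau> f) x + Q * (?c * nl_op s (barrier \<epsilon> \<tau>) x)"
        using 1 2 3 by linarith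
      moreover have "f x + \<gamma> * R0 powr -2 = ?c * (ext_pot s h x + q)" using c by (simp add: f_def q_def distrib_left)
      moreover have "?c * nl_op s (trunc \<tau> f) x + Q * (?c * nl_op s (barrier \<epsilon> \<tau>) x) = ?c * (nl_op s (trunc \<tau> f) x + Q * nl_op s (barrier \<epsilon> \<tau>) x)"
        by (simp add: distrib_left mult.left_commute)
      ultimately have "?c * (ext_pot s h x + q) \<le> ?c * (nl_op s (trunc \<tau> f) x + Q * nl_op s (barrier \<epsilon> \<tau>) x)" by simp
      then have "ext_pot s h x + q \<le> nl_op s (trunc \<tau> f) x + Q * nl_op s (barrier \<epsilon> \<tau>) x"
        using c by (simp only: mult_le_cancel_left_pos)
      then show "integrable lborel (\<lambda>y. (trunc \<tau> f x - trunc \<tau> f y) * frac_ker s (x - y)) \<and>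
        integrable lborel (\<lambda>y. (barrier \<epsilon> \<tau> x - barrier \<epsilon> \<tau> y) * frac_ker s (x - y)) \<and>
        ext_pot s h x + q \<le> nl_op s (trunc \<tau> f) x + Q * nl_op s (barrier \<epsilon> \<tau>) x"
        using G Bar by blast
    qed
    then show "AE x in lborel. x \<in> \<Omega> \<longrightarrow> w x \<le> ?c * ext_pot s h x + Q * \<delta> x powr -\<epsilon>"
      by (simp add: f_def)
  qed
qed

section \<open>Two-sided estimate and far-field decomposition\<close>

lemma ext_pot_uminus: "ext_pot s (\<lambda>y. - h y) x = - ext_pot s h (x::'a)"
  by (simp add: ext_pot_def)

text \<open>The whole problem is odd: the lower bound is the upper bound for -u with -c, -w and
  -h.\<close>

lemma two_sided_estimate:
  assumes \<epsilon>: "0 < \<epsilon>" "\<epsilon> < 1"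
  obtains C s0 where "C > 0" "0 < s0" "s0 \<le> 1/4"
    "\<And>s u w h c B M A \<theta> Q. \<lbrakk>0 < s; s < s0; u \<in> borel_measurable lebesgue;
      w \<in> borel_measurable borel; h \<in> borel_measurable borel;
      AE y in lebesgue. u y = c + w y + h y; \<And>y. \<bar>w y\<bar> \<le> B; \<And>y. y \<notin> \<Omega> \<Longrightarrow> w y = 0;
      \<And>y. \<bar>h y\<bar> \<le> M; \<And>y. y \<in> \<Omega> \<Longrightarrow> h y = 0; s_harmonic s \<Omega> u; 0 \<le> A; 0 \<le> \<theta>;
      \<And>x. x \<in> \<Omega> \<Longrightarrow> \<bar>c_Ns DIM('a) s * ext_pot s h x\<bar> \<le> A * \<delta> x powr - (\<epsilon> / 2);
      \<And>x. x \<in> \<Omega> \<Longrightarrow> \<bar>c_Ns DIM('a) s * omega_sphere DIM('a) / (2 * s) * (\<delta> x / 2) powr (-2 * s) - 1\<bar> \<le> \<theta> * \<delta> x powr - (\<epsilon> / 2);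
      C * (\<theta> * A + c_Ns DIM('a) s * (A + c_Ns DIM('a) s * M)) < Q\<rbrakk> \<Longrightarrow>
      AE x in lborel. x \<in> \<Omega> \<longrightarrow> \<bar>w x - c_Ns DIM('a) s * ext_pot s h x\<bar> \<le> Q * \<delta> x powr -\<epsilon>"
proof -
  obtain C s0 where C: "C > 0" "0 < s0" "s0 \<le> 1/4" and me:
    "\<And>s u w h c B M A \<theta> Q. \<lbrakk>0 < s; s < s0; u \<in> borel_measurable lebesgue;
      w \<in> borel_measurable borel; h \<in> borel_measurable borel;
      AE y in lebesgue. u y = c + w y + h y; \<And>y. \<bar>w y\<bar> \<le> B; \<And>y. y \<notin> \<Omega> \<Longrightarrow> w y = 0;
      \<And>y. \<bar>h y\<bar> \<le> M; \<And>y. y \<in> \<Omega> \<Longrightarrow> h y = 0; s_harmonic s \<Omega> u; 0 \<le> A; 0 \<le> \<theta>;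
      \<And>x. x \<in> \<Omega> \<Longrightarrow> \<bar>c_Ns DIM('a) s * ext_pot s h x\<bar> \<le> A * \<delta> x powr - (\<epsilon> / 2);
      \<And>x. x \<in> \<Omega> \<Longrightarrow> \<bar>c_Ns DIM('a) s * omega_sphere DIM('a) / (2 * s) * (\<delta> x / 2) powr (-2 * s) - 1\<bar> \<le> \<theta> * \<delta> x powr - (\<epsilon> / 2);
      C * (\<theta> * A + c_Ns DIM('a) s * (A + c_Ns DIM('a) s * M)) < Q\<rbrakk> \<Longrightarrow>
      AE x in lborel. x \<in> \<Omega> \<longrightarrow> w x \<le> c_Ns DIM('a) s * ext_pot s h x + Q * \<delta> x powr -\<epsilon>"
    using main_estimate[OF \<epsilon>] by blast
  show ?thesis
  proof (rule that[OF C])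
    fix s c B M A \<theta> Q :: real and u w h :: "'a \<Rightarrow> real"
    assume s: "0 < s" "s < s0" and um: "u \<in> borel_measurable lebesgue"
      and wm: "w \<in> borel_measurable borel" and hm: "h \<in> borel_measurable borel"
      and eq: "AE y in lebesgue. u y = c + w y + h y" and wB: "\<And>y. \<bar>w y\<bar> \<le> B" and w0: "\<And>y. y \<notin> \<Omega> \<Longrightarrow> w y = 0"
      and hM: "\<And>y. \<bar>h y\<bar> \<le> M" and h0: "\<And>y. y \<in> \<Omega> \<Longrightarrow> h y = 0" and harm: "s_harmonic s \<Omega> u"
      and A: "0 \<le> A" and \<theta>: "0 \<le> \<theta>"
      and fA: "\<And>x. x \<in> \<Omega> \<Longrightarrow> \<bar>c_Ns DIM('a) s * ext_pot s h x\<bar> \<le> A * \<delta> x powr - (\<epsilon> / 2)"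
      and \<kappa>: "\<And>x. x \<in> \<Omega> \<Longrightarrow> \<bar>c_Ns DIM('a) s * omega_sphere DIM('a) / (2 * s) * (\<delta> x / 2) powr (-2 * s) - 1\<bar> \<le> \<theta> * \<delta> x powr - (\<epsilon> / 2)"
      and Q: "C * (\<theta> * A + c_Ns DIM('a) s * (A + c_Ns DIM('a) s * M)) < Q"
    have up: "AE x in lborel. x \<in> \<Omega> \<longrightarrow> w x \<le> c_Ns DIM('a) s * ext_pot s h x + Q * \<delta> x powr -\<epsilon>"
      by (rule me[OF s um wm hm eq wB w0 hM h0 harm A \<theta> fA \<kappa> Q])
    have "AE x in lborel. x \<in> \<Omega> \<longrightarrow> - w x \<le> c_Ns DIM('a) s * ext_pot s (\<lambda>y. - h y) x + Q * \<delta> x powr -\<epsilon>"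
    proof (rule me[OF s, where u="\<lambda>y. - u y" and c="- c" and B=B and M=M and A=A and \<theta>=\<theta>])
      show "AE y in lebesgue. - u y = - c + - w y + - h y" using eq by eventually_elim simp
      show "s_harmonic s \<Omega> (\<lambda>y. - u y)" using harm by (simp add: s_harmonic_def)
    qed (use um wm hm wB w0 hM h0 A \<theta> fA \<kappa> Q in \<open>auto simp: ext_pot_uminus\<close>)
    with up show "AE x in lborel. x \<in> \<Omega> \<longrightarrow> \<bar>w x - c_Ns DIM('a) s * ext_pot s h x\<bar> \<le> Q * \<delta> x powr -\<epsilon>"
      by eventually_elim (auto simp: ext_pot_uminus abs_le_iff)
  qed
qed

text \<open>Absorbs constants that do not depend on the point into the weight.\<close>

lemma one_le_\<delta>:
  assumes "x \<in> \<Omega>" "0 \<le> a" "a \<le> 1"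
  shows "1 \<le> R0 * \<delta> x powr -a"
proof -
  have "\<delta> x powr a \<le> R0 powr a" using assms R0(3)[OF assms(1)] by (intro powr_mono2) auto
  also have "\<dots> \<le> R0 powr 1" using assms R0(1) by (intro powr_mono) auto
  finally show ?thesis using \<delta>_pos[OF assms(1)] R0(1) by (simp add: powr_minus field_simps)
qed

text \<open>The quantity is \<open>c_Ns\<close> times the coefficient of \<open>G x\<close> in
  \<open>op_estimate\<close>. It is a product of two factors tending to 1, the second only at the
  price of delta^(-a).\<close>

lemma killing_rate:
  assumes a: "0 < a" "a < 1"
  obtains \<theta> where "(\<theta> \<longlongrightarrow> 0) (at_right 0)" "\<And>s. 0 < s \<Longrightarrow> 0 \<le> \<theta> s"
    "\<And>s x. 0 < s \<Longrightarrow> 4 * s \<le> a \<Longrightarrow> x \<in> \<Omega> \<Longrightarrow>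
      \<bar>c_Ns DIM('a) s * omega_sphere DIM('a) / (2 * s) * (\<delta> x / 2) powr (-2 * s) - 1\<bar> \<le> \<theta> s * \<delta> x powr - a"
proof -
  let ?q = "\<lambda>s. c_Ns DIM('a) s * omega_sphere DIM('a) / (2 * s)"
  define C where "C = 4 / a + 2 * ln R0 * R0 powr a"
  have C: "C > 0" using a R0(1) by (auto simp: C_def intro!: add_pos_nonneg)
  \<comment> \<open>From q t - 1 = (q - 1) t + (t - 1): the bracket bounds t, the last term bounds t
    - 1, and the factors 2 come from using delta/2 in place of delta.\<close>
  define \<theta> where "\<theta> s = \<bar>?q s - 1\<bar> * (R0 + 2 * C * s) + 2 * C * s" for s
  show ?thesis
  proof (rule that[of \<theta>])
    have "(\<theta> \<longlongrightarrow> \<bar>1 - 1\<bar> * (R0 + 2 * C * 0) + 2 * C * 0) (at_right 0)"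
      unfolding \<theta>_def by (intro tendsto_intros tendsto_c_Ns_omega) auto
    then show "(\<theta> \<longlongrightarrow> 0) (at_right 0)" by simp
    show "0 \<le> \<theta> s" if "0 < s" for s using that C R0(1) by (simp add: \<theta>_def)
    fix s x assume s: "0 < s" "4 * s \<le> a" and x: "x \<in> \<Omega>"
    let ?t = "(\<delta> x / 2) powr (-2 * s)" and ?e = "\<delta> x powr -a"
    have "(\<delta> x / 2) powr -a = ?e * 2 powr a"
      using \<delta>_pos[OF x] by (simp add: powr_divide powr_minus divide_simps)
    also have "2 powr a \<le> 2 powr 1" using a by (intro powr_mono) auto
    finally have e2: "(\<delta> x / 2) powr -a \<le> 2 * ?e" by (simp add: mult.commute mult_right_mono)
    have "\<bar>?t - 1\<bar> \<le> C * s * (\<delta> x / 2) powr -a"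
      unfolding C_def using a s \<delta>_pos[OF x] R0(1) R0(3)[OF x] by (intro powr_near_one) auto
    also have "\<dots> \<le> C * s * (2 * ?e)" using C s by (intro mult_left_mono e2) auto
    finally have t1: "\<bar>?t - 1\<bar> \<le> 2 * C * s * ?e" by simp
    have t2: "\<bar>?t\<bar> \<le> (R0 + 2 * C * s) * ?e"
      using t1 one_le_\<delta>[OF x, of a] a by (simp add: distrib_right abs_le_iff)
    have "?q s * ?t - 1 = (?q s - 1) * ?t + (?t - 1)" by (simp add: left_diff_distrib)
    then have "\<bar>?q s * ?t - 1\<bar> \<le> \<bar>(?q s - 1) * ?t\<bar> + \<bar>?t - 1\<bar>" by (simp only: abs_triangle_ineq)
    also have "\<dots> \<le> \<bar>?q s - 1\<bar> * ((R0 + 2 * C * s) * ?e) + 2 * C * s * ?e"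
      unfolding abs_mult by (intro add_mono mult_left_mono t1 t2) auto
    also have "\<dots> = \<theta> s * ?e" by (simp only: \<theta>_def distrib_right mult.assoc)
    finally show "\<bar>?q s * ?t - 1\<bar> \<le> \<theta> s * ?e" .
  qed
qed

text \<open>The kernel-gradient constant times \<open>R0\<close>, which bounds the displacement norm
  x when the kernel is recentred at the origin.\<close>

definition far_const :: real where
  "far_const = (real DIM('a) + 1) * 2 powr (real DIM('a) + 2) * omega_sphere DIM('a) * R0"

lemma far_const_nonneg: "far_const \<ge> 0"
  using omega_sphere_pos[of "DIM('a)"] R0(1) by (simp add: far_const_def)

text \<open>Far from the domain the kernel may be centred at the origin with an error of order 1/R;
  the centred integral only sees the spherical averages of h.\<close>

lemma far_part:
  assumes [measurable]: "h \<in> borel_measurable borel" and hM: "\<And>y. \<bar>h y\<bar> \<le> M"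
    and R: "2 * R0 \<le> R" and J [measurable]: "J \<in> sets borel" and JR: "J \<subseteq> {R..}"
    and s: "0 \<le> s" "s \<le> 1/4" and x: "x \<in> \<Omega>"
    and int: "integrable lborel (\<lambda>y::'a. indicator J (norm y) * frac_ker s y)"
  shows "integrable lborel (\<lambda>y. indicator J (norm y) * h y * frac_ker s (x - y))"
    "\<bar>LINT y|lborel. indicator J (norm y) * h y * frac_ker s (x - y)\<bar> \<le>
      far_const * M / R + omega_sphere DIM('a) * \<bar>LINT t|lborel. indicator J t * t powr (-1 - 2 * s) * sph_avg h t\<bar>"
    "integrable lborel (\<lambda>t. indicator J t * t powr (-1 - 2 * s))"
proof -
  let ?n = "real DIM('a)" and ?o = "omega_sphere DIM('a)"
  have o: "?o > 0" by (simp add: omega_sphere_pos)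
  have M: "M \<ge> 0" using hM[of 0] by linarith
  have R1: "R \<ge> 2" using R R0(1) by linarith
  let ?d = "\<lambda>y. indicator J (norm y) * h y * (frac_ker s (x - y) - frac_ker s y)"
  define K where "K = (?n + 1) * 2 powr (?n + 2) * R0"
  have K: "K \<ge> 0" using R0(1) by (simp add: K_def)
  let ?a = "1 + 2 * s"
  have "(\<integral>\<^sup>+y. ennreal \<bar>?d y\<bar> \<partial>lborel) \<le> (\<integral>\<^sup>+y. ennreal (M * K) * (ennreal (norm (y::'a) powr (- (?n + ?a))) * indicator {R..} (norm y)) \<partial>lborel)"
  proof (rule nn_integral_mono)
    fix y :: 'a
    show "ennreal \<bar>?d y\<bar> \<le> ennreal (M * K) * (ennreal (norm y powr (- (?n + ?a))) * indicator {R..} (norm y))"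
    proof (cases "norm y \<in> J")
      case True
      then have y: "R \<le> norm y" using JR by auto
      let ?b = "norm y / 2"
      have b: "0 < ?b" using y R1 by linarith
      have "norm x \<le> ?b" using \<Omega>_norm[OF x] y R by linarith
      then have "?b \<le> norm (x - y)" using norm_triangle_ineq2[of y x] by (simp add: norm_minus_commute)
      then have "?b \<le> norm (x - y)" "?b \<le> norm (- y)" by auto
      then have "\<bar>frac_ker s (x - y) - frac_ker s (- y)\<bar> \<le> (?n + 2 * s) * ?b powr (- (?n + 2 * s) - 1) * norm ((x - y) - (- y))"
        using b s by (intro frac_ker_diff) auto
      also have "\<dots> \<le> (?n + 1) * (norm y powr (- (?n + ?a)) * 2 powr (?n + 2)) * R0"
      proof (intro mult_mono)
        have "?b powr (- (?n + ?a)) = norm y powr (- (?n + ?a)) / 2 powr (- (?n + ?a))" by (rule powr_divide)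
        also have "\<dots> = norm y powr (- (?n + ?a)) * 2 powr (?n + ?a)"
          by (simp only: powr_minus[of 2] divide_inverse inverse_inverse_eq)
        also have "\<dots> \<le> norm y powr (- (?n + ?a)) * 2 powr (?n + 2)" using s by (intro mult_left_mono powr_mono) auto
        finally have fin: "?b powr (- (?n + ?a)) \<le> norm y powr (- (?n + ?a)) * 2 powr (?n + 2)" .
        have "- (?n + 2 * s) - 1 = - (?n + ?a)" by simp
        then show "?b powr (- (?n + 2 * s) - 1) \<le> norm y powr (- (?n + ?a)) * 2 powr (?n + 2)"
          using fin by (simp only:)
      qed (use s \<Omega>_norm[OF x] in auto)
      finally have k: "\<bar>frac_ker s (x - y) - frac_ker s y\<bar> \<le> K * norm y powr (- (?n + ?a))"
        by (simp add: K_def mult_ac)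
      have "\<bar>?d y\<bar> = \<bar>h y\<bar> * \<bar>frac_ker s (x - y) - frac_ker s y\<bar>" using True by (simp add: abs_mult)
      also have "\<dots> \<le> M * (K * norm y powr (- (?n + ?a)))" using hM M k by (intro mult_mono) auto
      finally have le: "\<bar>?d y\<bar> \<le> (M * K) * norm y powr (- (?n + ?a))" by (simp only: mult.assoc)
      have "ennreal (M * K) * (ennreal (norm y powr (- (?n + ?a))) * indicator {R..} (norm y)) =
        ennreal ((M * K) * norm y powr (- (?n + ?a)))"
        using M K y by (subst ennreal_mult) auto
      then show ?thesis using le by (simp only: ennreal_leI)
    qed simp
  qed
  also have "\<dots> = ennreal (M * K) * (\<integral>\<^sup>+y. ennreal (norm (y::'a) powr (- (?n + ?a))) * indicator {R..} (norm y) \<partial>lborel)"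
    by (rule nn_integral_cmult) measurable
  also have "(\<integral>\<^sup>+y. ennreal (norm (y::'a) powr (- (?n + ?a))) * indicator {R..} (norm y) \<partial>lborel) = ennreal (?o * R powr (- ?a) / ?a)"
    using s R1 by (intro nn_integral_norm_powr_tail) auto
  also have "ennreal (M * K) * \<dots> = ennreal (M * K * (?o * R powr (- ?a) / ?a))"
    using M K o s by (intro ennreal_mult[symmetric]) auto
  also have "\<dots> \<le> ennreal (far_const * M / R)"
  proof (rule ennreal_leI)
    have "R powr (- ?a) \<le> R powr (-1)" using s R1 by (intro powr_mono) auto
    then have "R powr (- ?a) \<le> 1 / R" using R1 by (simp add: powr_minus_divide)
    then have "R powr (- ?a) / ?a \<le> 1 / R / 1" using s R1 by (intro frac_le) auto
    then have "M * K * ?o * (R powr (- ?a) / ?a) \<le> M * K * ?o * (1 / R)" using M K o by (intro mult_left_mono) auto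
    then show "M * K * (?o * R powr (- ?a) / ?a) \<le> far_const * M / R"
      by (simp add: K_def far_const_def mult_ac)
  qed
  finally have le: "(\<integral>\<^sup>+y. ennreal \<bar>?d y\<bar> \<partial>lborel) \<le> ennreal (far_const * M / R)" .
  have "far_const * M / R \<ge> 0" using far_const_nonneg M R1 by simp
  note d = integral_nn_bound[OF _ this le]
  have dm: "?d \<in> borel_measurable borel" by measurable
  let ?w = "\<lambda>t. indicator J t * t powr - (?n + 2 * s)"
  have w0: "\<And>r. 0 \<le> ?w r" by simp
  have w1: "\<And>r. r \<le> 0 \<Longrightarrow> ?w r = 0" using JR R1 by (auto simp: indicator_def)
  have wm: "?w \<in> borel_measurable borel" by measurable
  \<comment> \<open>Integrability is a hypothesis so that two situations are covered at once: the
    unbounded exterior with s > 0 and bounded shells with s = 0.\<close>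
  have wint: "integrable lborel (\<lambda>y::'a. ?w (norm y))" using int by (simp add: frac_ker_def)
  note sh = integral_shell_sph_avg[OF assms(1) wm hM w0 w1 wint]
  have pw: "r powr (?n - 1) * ?w r = indicator J r * r powr (-1 - 2 * s)" for r
    by (simp add: powr_add[symmetric])
  show "integrable lborel (\<lambda>t. indicator J t * t powr (-1 - 2 * s))" using sh(1) unfolding pw .
  have ih: "integrable lborel (\<lambda>y. h y * ?w (norm y))"
  proof (rule Bochner_Integration.integrable_bound)
    show "integrable lborel (\<lambda>y::'a. M * ?w (norm y))" using wint by (rule integrable_mult_right)
    show "AE y in lborel. norm (h y * ?w (norm y)) \<le> norm (M * ?w (norm y))"
      using M by (auto simp: abs_mult intro!: AE_I2 mult_right_mono order.trans[OF hM])
  qed measurable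
  have e: "(\<lambda>y. indicator J (norm y) * h y * frac_ker s (x - y)) = (\<lambda>y. ?d y + h y * ?w (norm y))"
    by (auto simp: fun_eq_iff frac_ker_def algebra_simps)
  show "integrable lborel (\<lambda>y. indicator J (norm y) * h y * frac_ker s (x - y))"
    unfolding e using d(1)[OF dm] ih by (rule Bochner_Integration.integrable_add)
  have "(LINT y|lborel. indicator J (norm y) * h y * frac_ker s (x - y)) = (LINT y|lborel. ?d y) + (LINT y|lborel. h y * ?w (norm y))"
    unfolding e using d(1)[OF dm] ih by (rule Bochner_Integration.integral_add)
  also have "(LINT y|lborel. h y * ?w (norm y)) = ?o * (LINT t|lborel. indicator J t * t powr (-1 - 2 * s) * sph_avg h t)"
    using sh(2) unfolding pw .
  finally have e2: "(LINT y|lborel. indicator J (norm y) * h y * frac_ker s (x - y)) =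
     (LINT y|lborel. ?d y) + ?o * (LINT t|lborel. indicator J t * t powr (-1 - 2 * s) * sph_avg h t)" .
  have "\<bar>LINT y|lborel. indicator J (norm y) * h y * frac_ker s (x - y)\<bar> \<le>
     \<bar>LINT y|lborel. ?d y\<bar> + \<bar>?o * (LINT t|lborel. indicator J t * t powr (-1 - 2 * s) * sph_avg h t)\<bar>"
    unfolding e2 by (rule abs_triangle_ineq)
  then show "\<bar>LINT y|lborel. indicator J (norm y) * h y * frac_ker s (x - y)\<bar> \<le>
      far_const * M / R + ?o * \<bar>LINT t|lborel. indicator J t * t powr (-1 - 2 * s) * sph_avg h t\<bar>"
    using d(2)[OF dm] o by (simp add: abs_mult)
qed

text \<open>For bounded \<open>y\<close> the kernels with parameters s and 0 are both dominated by
  norm (x - y)^(-N-a), whose tail beyond delta is of order delta^(-a)/a. Thus no factor 1/s appears,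
  and passing from s to 0 costs only O(s).\<close>

lemma near_part:
  assumes [measurable]: "h \<in> borel_measurable borel" and hM: "\<And>y. \<bar>h y\<bar> \<le> M" and h0: "\<And>y. y \<in> \<Omega> \<Longrightarrow> h y = 0"
    and R: "R0 \<le> R" and a: "0 < a" "a < 1" and s: "0 \<le> s" "4 * s \<le> a" and x: "x \<in> \<Omega>"
  shows "integrable lborel (\<lambda>y. indicator {..<R} (norm y) * h y * frac_ker s (x - y))"
    "\<bar>LINT y|lborel. indicator {..<R} (norm y) * h y * frac_ker s (x - y)\<bar> \<le>
       2 * R * M * omega_sphere DIM('a) / a * \<delta> x powr -a"
    "\<bar>(LINT y|lborel. indicator {..<R} (norm y) * h y * frac_ker s (x - y)) -
      (LINT y|lborel. indicator {..<R} (norm y) * h y * frac_ker 0 (x - y))\<bar> \<le>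
       (4 / a + 2 * ln (2 * R) * (2 * R) powr a) * s * (M * omega_sphere DIM('a) / a) * \<delta> x powr -a"
proof -
  let ?n = "real DIM('a)" and ?o = "omega_sphere DIM('a)"
  have o: "?o > 0" by (simp add: omega_sphere_pos)
  have M: "M \<ge> 0" using hM[of 0] by linarith
  have d: "\<delta> x > 0" by (rule \<delta>_pos[OF x])
  have R1: "R \<ge> 1" using R R0(1) by linarith
  let ?k = "\<lambda>y. norm (x - y) powr (- (?n + a)) * indicator {\<delta> x..} (norm (x - y))"
  have tail: "(\<integral>\<^sup>+y. ennreal (?k y) \<partial>lborel) = ennreal (?o * \<delta> x powr (-a) / a)"
  proof -
    have "(\<integral>\<^sup>+y. ennreal (?k y) \<partial>lborel) = (\<integral>\<^sup>+y. ennreal (norm y powr (- (?n + a)) * indicator {\<delta> x..} (norm (y::'a))) \<partial>lborel)"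
      by (rule nn_integral_shift) measurable
    also have "\<dots> = (\<integral>\<^sup>+y. ennreal (norm (y::'a) powr (- (?n + a))) * indicator {\<delta> x..} (norm y) \<partial>lborel)"
      by (intro nn_integral_cong) (auto simp: indicator_def)
    also have "\<dots> = ennreal (?o * \<delta> x powr (-a) / a)"
      using a d by (intro nn_integral_norm_powr_tail) auto
    finally show ?thesis .
  qed
  have bnd: "integrable lborel F \<and> \<bar>LINT y|lborel. F y\<bar> \<le> c * (M * ?o / a) * \<delta> x powr -a"
    if Fm: "F \<in> borel_measurable borel" and c: "0 \<le> c"
      and F: "\<And>y. norm y < R \<Longrightarrow> y \<notin> \<Omega> \<Longrightarrow> \<bar>F y\<bar> \<le> M * (c * norm (x - y) powr (- (?n + a)))"
      and F0: "\<And>y. \<not> norm y < R \<or> y \<in> \<Omega> \<Longrightarrow> F y = 0" for F and c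
  proof -
    have "(\<integral>\<^sup>+y. ennreal \<bar>F y\<bar> \<partial>lborel) \<le> (\<integral>\<^sup>+y. ennreal (M * c) * ennreal (?k y) \<partial>lborel)"
    proof (rule nn_integral_mono)
      fix y
      have "\<bar>F y\<bar> \<le> (M * c) * ?k y"
      proof (cases "norm y < R \<and> y \<notin> \<Omega>")
        case True
        then have "\<delta> x \<le> norm (x - y)" using \<delta>_cross(1)[OF x] by auto
        then show ?thesis using F[of y] True by (simp add: mult.assoc)
      next
        case False
        then show ?thesis using F0[of y] M c by auto
      qed
      then show "ennreal \<bar>F y\<bar> \<le> ennreal (M * c) * ennreal (?k y)"
        using M c by (subst ennreal_mult[symmetric]) (auto intro!: ennreal_leI)
    qed
    also have "\<dots> = ennreal (M * c) * ennreal (?o * \<delta> x powr (-a) / a)"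
      by (subst nn_integral_cmult) (measurable, simp only: tail)
    also have "\<dots> = ennreal (M * c * (?o * \<delta> x powr (-a) / a))"
      using M c o a by (intro ennreal_mult[symmetric]) auto
    also have "M * c * (?o * \<delta> x powr (-a) / a) = c * (M * ?o / a) * \<delta> x powr -a" by simp
    finally have le: "(\<integral>\<^sup>+y. ennreal \<bar>F y\<bar> \<partial>lborel) \<le> ennreal (c * (M * ?o / a) * \<delta> x powr -a)" .
    have "0 \<le> c * (M * ?o / a) * \<delta> x powr -a" using M c o a by simp
    from integral_nn_bound[OF Fm this le] show ?thesis by blast
  qed
  have nz: "0 < norm (x - y)" "norm (x - y) \<le> 2 * R" if "norm y < R" "y \<notin> \<Omega>" for y
    using that x \<Omega>_norm[OF x] R norm_triangle_ineq4[of x y] by auto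
  have b1: "integrable lborel (\<lambda>y. indicator {..<R} (norm y) * h y * frac_ker s' (x - y)) \<and>
    \<bar>LINT y|lborel. indicator {..<R} (norm y) * h y * frac_ker s' (x - y)\<bar> \<le> (2 * R) * (M * ?o / a) * \<delta> x powr -a"
    if s': "0 \<le> s'" "4 * s' \<le> a" for s'
  proof (rule bnd)
    fix y assume y: "norm y < R" "y \<notin> \<Omega>"
    note z = nz[OF y]
    \<comment> \<open>The surplus power a - 2s' lies in [0,1] and is evaluated at a distance of at
      most 2 R, hence contributes at most 2 R.\<close>
    have "frac_ker s' (x - y) = norm (x - y) powr (a - 2 * s') * norm (x - y) powr (- (?n + a))"
      by (simp add: frac_ker_def powr_add[symmetric] algebra_simps)
    also have "norm (x - y) powr (a - 2 * s') \<le> (2 * R) powr (a - 2 * s')" using z s' a by (intro powr_mono2) auto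
    also have "(2 * R) powr (a - 2 * s') \<le> (2 * R) powr 1" using R1 a s' by (intro powr_mono) auto
    finally have "frac_ker s' (x - y) \<le> (2 * R) * norm (x - y) powr (- (?n + a))"
      using R1 by (simp add: mult_right_mono)
    then have "\<bar>h y\<bar> * frac_ker s' (x - y) \<le> M * ((2 * R) * norm (x - y) powr (- (?n + a)))"
      using hM M by (intro mult_mono) auto
    then show "\<bar>indicator {..<R} (norm y) * h y * frac_ker s' (x - y)\<bar> \<le> M * ((2 * R) * norm (x - y) powr (- (?n + a)))"
      using y by (simp add: abs_mult)
  qed (use R1 h0 in auto)
  have a4: "(0::real) \<le> 0" "4 * 0 \<le> a" using a by auto
  show "integrable lborel (\<lambda>y. indicator {..<R} (norm y) * h y * frac_ker s (x - y))" using b1[OF s] by blast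
  show "\<bar>LINT y|lborel. indicator {..<R} (norm y) * h y * frac_ker s (x - y)\<bar> \<le>
       2 * R * M * omega_sphere DIM('a) / a * \<delta> x powr -a" using b1[OF s] by simp
  define C where "C = 4 / a + 2 * ln (2 * R) * (2 * R) powr a"
  have C: "C \<ge> 0" using a R1 by (auto simp: C_def intro!: add_nonneg_nonneg)
  let ?F = "\<lambda>y. indicator {..<R} (norm y) * h y * frac_ker s (x - y) - indicator {..<R} (norm y) * h y * frac_ker 0 (x - y)"
  have "integrable lborel ?F \<and> \<bar>LINT y|lborel. ?F y\<bar> \<le> (C * s) * (M * ?o / a) * \<delta> x powr -a"
  proof (rule bnd)
    fix y assume y: "norm y < R" "y \<notin> \<Omega>"
    note z = nz[OF y]
    let ?z = "norm (x - y)"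
    have "?F y = h y * (?z powr (- ?n) * (?z powr (-2 * s) - 1))"
      using y by (simp add: frac_ker_def right_diff_distrib powr_add[symmetric])
    then have "\<bar>?F y\<bar> = \<bar>h y\<bar> * (?z powr (- ?n) * \<bar>?z powr (-2 * s) - 1\<bar>)" by (simp add: abs_mult)
    also have "\<dots> \<le> M * (?z powr (- ?n) * (C * s * ?z powr (-a)))"
    proof (intro mult_mono mult_left_mono hM)
      show "\<bar>?z powr (-2 * s) - 1\<bar> \<le> C * s * ?z powr (-a)"
        unfolding C_def using z a s R1 by (intro powr_near_one) auto
    qed (use M in auto)
    also have "\<dots> = M * (C * s * ?z powr (- (?n + a)))"
    proof -
      have "?z powr (- (?n + a)) = ?z powr (- ?n) * ?z powr (-a)" by (simp add: powr_add[symmetric])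
      then show ?thesis by (simp only: mult_ac)
    qed
    finally show "\<bar>?F y\<bar> \<le> M * (C * s * ?z powr (- (?n + a)))" .
  qed (use C s h0 in auto)
  then show "\<bar>(LINT y|lborel. indicator {..<R} (norm y) * h y * frac_ker s (x - y)) -
      (LINT y|lborel. indicator {..<R} (norm y) * h y * frac_ker 0 (x - y))\<bar> \<le>
       (4 / a + 2 * ln (2 * R) * (2 * R) powr a) * s * (M * omega_sphere DIM('a) / a) * \<delta> x powr -a"
    using b1[OF s] b1[OF a4] by (simp only: C_def Bochner_Integration.integral_diff)
qed

end

text \<open>The Cauchy criterion along integers, extended to real radii by the same bound. The rate
  \<open>G\<close> is kept because it will be uniform in the point.\<close>

lemma limit_at_top_of_tail_bound:
  fixes F :: "real \<Rightarrow> real" and G :: "nat \<Rightarrow> real"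
  assumes G: "G \<longlonglongrightarrow> 0" and FG: "\<And>k r. k0 \<le> k \<Longrightarrow> real k \<le> r \<Longrightarrow> \<bar>F r - F (real k)\<bar> \<le> G k"
  obtains l where "(F \<longlongrightarrow> l) at_top" "\<And>k. k0 \<le> k \<Longrightarrow> \<bar>l - F (real k)\<bar> \<le> G k"
proof -
  have ex: "\<exists>k\<ge>k0. G k < e" if "e > 0" for e
  proof -
    have "\<forall>\<^sub>F k in sequentially. G k < e" using G that by (rule order_tendstoD)
    then have "\<forall>\<^sub>F k in sequentially. k0 \<le> k \<and> G k < e"
      using eventually_ge_at_top by (rule eventually_conj[rotated])
    then obtain N where "\<forall>k\<ge>N. k0 \<le> k \<and> G k < e" unfolding eventually_sequentially by blast
    then show ?thesis by (intro exI[of _ N]) auto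
  qed
  have "Cauchy (\<lambda>k. F (real k))"
  proof (rule metric_CauchyI)
    fix e :: real assume "e > 0"
    then obtain k where k: "k0 \<le> k" "G k < e / 2" using ex[of "e / 2"] by auto
    have "dist (F (real m)) (F (real n)) < e" if "m \<ge> k" "n \<ge> k" for m n
      using FG[OF k(1), of "real m"] FG[OF k(1), of "real n"] that k(2) by (auto simp: dist_real_def)
    then show "\<exists>M. \<forall>m\<ge>M. \<forall>n\<ge>M. dist (F (real m)) (F (real n)) < e" by blast
  qed
  then obtain l where l: "(\<lambda>k. F (real k)) \<longlonglongrightarrow> l"
    by (auto simp: Cauchy_convergent_iff convergent_def)
  have lk: "\<bar>l - F (real k)\<bar> \<le> G k" if k: "k0 \<le> k" for k
  proof (rule tendsto_upperbound)
    show "(\<lambda>m. \<bar>F (real m) - F (real k)\<bar>) \<longlonglongrightarrow> \<bar>l - F (real k)\<bar>" by (intro tendsto_intros l)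
    show "\<forall>\<^sub>F m in sequentially. \<bar>F (real m) - F (real k)\<bar> \<le> G k"
      using eventually_ge_at_top[of k] by eventually_elim (use FG[OF k] in auto)
  qed simp
  show ?thesis
  proof (rule that[OF _ lk])
    show "(F \<longlongrightarrow> l) at_top"
    proof (rule tendstoI)
      fix e :: real assume "e > 0"
      then obtain k where k: "k0 \<le> k" "G k < e / 2" using ex[of "e / 2"] by auto
      show "\<forall>\<^sub>F r in at_top. dist (F r) l < e"
        using eventually_ge_at_top[of "real k"]
      proof eventually_elim
        case (elim r)
        then show ?case using FG[OF k(1) elim] lk[OF k(1)] k(2) by (simp add: dist_real_def)
      qed
    qed
  qed
qed

lemma tendsto_integral_tail:
  fixes f :: "real \<Rightarrow> real"
  assumes "integrable lborel f"
  shows "(\<lambda>k. LINT t|lborel. indicator {real k..} t * f t) \<longlonglongrightarrow> 0"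
proof -
  have [measurable]: "f \<in> borel_measurable borel" using assms by auto
  have "(\<lambda>k. LINT t|lborel. indicator {real k..} t * f t) \<longlonglongrightarrow> (LINT t::real|lborel. (0::real))"
  proof (rule integral_dominated_convergence[where w="\<lambda>t. \<bar>f t\<bar>"])
    show "AE t in lborel. (\<lambda>k. indicator {real k..} t * f t) \<longlonglongrightarrow> 0"
    proof (rule AE_I2, rule tendsto_eventually)
      fix t :: real
      show "\<forall>\<^sub>F k in sequentially. indicator {real k..} t * f t = 0"
        using eventually_gt_at_top[of "nat \<lceil>t\<rceil>"]
      proof eventually_elim
        case (elim k)
        then have "t < real k" by linarith
        then show ?case by simp
      qed
    qed
    show "integrable lborel (\<lambda>t. \<bar>f t\<bar>)" using assms by (rule integrable_abs)
  qed (auto simp: indicator_def)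
  then show ?thesis by simp
qed

section \<open>Representatives of the data and the uniform estimate\<close>

context C2_domain
begin

text \<open>Small exponents suffice: delta is bounded by \<open>R0\<close> on the domain, so raising
  the exponent costs only a power of \<open>R0\<close>. This is why all boundary estimates may
  assume eps < 1.\<close>

lemma almost_unif_convI:
  assumes "\<And>\<epsilon> \<eta>. 0 < \<epsilon> \<Longrightarrow> \<epsilon> < 1 \<Longrightarrow> 0 < \<eta> \<Longrightarrow>
    \<forall>\<^sub>F s in at_right 0. AE x in lborel. x \<in> \<Omega> \<longrightarrow> \<bar>v s x - w x\<bar> \<le> \<eta> * \<delta> x powr -\<epsilon>"
  shows "almost_unif_conv \<Omega> v w"
  unfolding almost_unif_conv_def
proof (intro allI impI)
  fix \<epsilon>0 \<eta> :: real assume \<epsilon>0: "\<epsilon>0 > 0" and \<eta>: "\<eta> > 0"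
  define \<epsilon> where "\<epsilon> = min \<epsilon>0 (1/2)"
  have \<epsilon>: "0 < \<epsilon>" "\<epsilon> < 1" "\<epsilon> \<le> \<epsilon>0" using \<epsilon>0 by (auto simp: \<epsilon>_def)
  let ?P = "R0 powr (\<epsilon>0 - \<epsilon>)"
  have P: "?P > 0" using R0(1) by simp
  have "\<forall>\<^sub>F s in at_right 0. AE x in lborel. x \<in> \<Omega> \<longrightarrow> \<bar>v s x - w x\<bar> \<le> \<eta> / ?P * \<delta> x powr -\<epsilon>"
    using \<epsilon> \<eta> P by (intro assms) auto
  then show "\<forall>\<^sub>F s in at_right 0. AE x in lebesgue. x \<in> \<Omega> \<longrightarrow> infdist x (frontier \<Omega>) powr \<epsilon>0 * \<bar>v s x - w x\<bar> \<le> \<eta>"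
  proof eventually_elim
    case (elim s)
    then have "AE x in lebesgue. x \<in> \<Omega> \<longrightarrow> \<bar>v s x - w x\<bar> \<le> \<eta> / ?P * \<delta> x powr -\<epsilon>"
      by (rule AE_completion)
    then show ?case
    proof eventually_elim
      case (elim x)
      show ?case
      proof
        assume x: "x \<in> \<Omega>"
        have "\<delta> x powr \<epsilon>0 * \<bar>v s x - w x\<bar> \<le> \<delta> x powr \<epsilon>0 * (\<eta> / ?P * \<delta> x powr -\<epsilon>)"
          using elim x by (intro mult_left_mono) auto
        also have "\<dots> = \<eta> / ?P * \<delta> x powr (\<epsilon>0 - \<epsilon>)" by (simp add: powr_diff powr_minus divide_simps)
        also have "\<dots> \<le> \<eta> / ?P * ?P"
          using \<eta> P \<epsilon> R0(3)[OF x] by (intro mult_left_mono powr_mono2) auto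
        also have "\<dots> = \<eta>" using P by simp
        finally show "infdist x (frontier \<Omega>) powr \<epsilon>0 * \<bar>v s x - w x\<bar> \<le> \<eta>" by (simp add: \<delta>_def)
      qed
    qed
  qed
qed

text \<open>Clamping at the essential bound gives a representative of g - c that is bounded
  everywhere, as the later integral estimates require.\<close>

lemma exterior_data:
  assumes [measurable]: "g \<in> borel_measurable borel" and gL: "Linf_on (- \<Omega>) g"
  obtains h M where "h \<in> borel_measurable borel" "\<And>y. \<bar>h y\<bar> \<le> M" "\<And>y. y \<in> \<Omega> \<Longrightarrow> h y = 0"
    "AE y in lborel. y \<notin> \<Omega> \<longrightarrow> h y = g y - c"
proof -
  obtain M where M: "AE y in lebesgue. y \<in> - \<Omega> \<longrightarrow> \<bar>g y\<bar> \<le> M" using gL by (auto simp: Linf_on_def)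
  define K where "K = max 0 M"
  define h where "h y = (if y \<in> \<Omega> then 0 else max (-K) (min K (g y)) - c)" for y
  show ?thesis
  proof (rule that[of h "K + \<bar>c\<bar>"])
    show "h \<in> borel_measurable borel" unfolding h_def by measurable
    show "\<bar>h y\<bar> \<le> K + \<bar>c\<bar>" for y by (auto simp: h_def K_def max_def min_def)
    show "y \<in> \<Omega> \<Longrightarrow> h y = 0" for y by (simp add: h_def)
    have "AE y in lborel. y \<in> - \<Omega> \<longrightarrow> \<bar>g y\<bar> \<le> M" using M by (simp add: AE_completion_iff)
    then show "AE y in lborel. y \<notin> \<Omega> \<longrightarrow> h y = g y - c"
      by eventually_elim (auto simp: h_def K_def max_def min_def abs_le_iff)
  qed
qed

text \<open>The decomposition of the overview for one s, with a bounded Borel \<open>w\<close>. The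
  bound may depend on s: it only enters the strip condition, where s is fixed.\<close>

lemma solution_data:
  assumes sol: "poisson_solution s \<Omega> g u" and hg: "AE y in lborel. y \<notin> \<Omega> \<longrightarrow> h y = g y - c"
    and h0: "\<And>y. y \<in> \<Omega> \<Longrightarrow> h y = 0"
  obtains w B where "w \<in> borel_measurable borel" "\<And>y. \<bar>w y\<bar> \<le> B" "\<And>y. y \<notin> \<Omega> \<Longrightarrow> w y = 0"
    "AE y in lebesgue. u y = c + w y + h y" "u \<in> borel_measurable lebesgue" "s_harmonic s \<Omega> u"
proof -
  from sol obtain M where um: "u \<in> borel_measurable lebesgue" and M: "AE y in lebesgue. \<bar>u y\<bar> \<le> M"
    and harm: "s_harmonic s \<Omega> u" and ug: "AE y in lebesgue. y \<notin> \<Omega> \<longrightarrow> u y = g y"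
    by (auto simp: poisson_solution_def Linf_on_def)
  obtain u' where u' [measurable]: "u' \<in> borel_measurable lborel" and uu': "AE y in lborel. u y = u' y"
    using completion_ex_borel_measurable_real[OF um] by blast
  define K where "K = max 0 M"
  define w where "w y = (if y \<in> \<Omega> then max (-K) (min K (u' y)) - c else 0)" for y
  show ?thesis
  proof (rule that[of w "K + \<bar>c\<bar>"])
    show "w \<in> borel_measurable borel" unfolding w_def using u' by measurable
    show "\<bar>w y\<bar> \<le> K + \<bar>c\<bar>" for y by (auto simp: w_def K_def max_def min_def)
    show "w y = 0" if "y \<notin> \<Omega>" for y using that by (simp add: w_def)
    have "AE y in lebesgue. u y = u' y" "AE y in lebesgue. y \<notin> \<Omega> \<longrightarrow> h y = g y - c"
      using AE_completion[OF uu'] AE_completion[OF hg] by auto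
    with M ug show "AE y in lebesgue. u y = c + w y + h y"
      by eventually_elim (auto simp: w_def K_def h0 max_def min_def abs_le_iff)
  qed (use um harm in auto)
qed

text \<open>The summand s^2 makes the constant strictly larger than the bound demanded of
  \<open>Q\<close>; being o(s), it is harmless at both orders of the expansion.\<close>

lemma uniform_estimate:
  assumes hm: "h \<in> borel_measurable borel" and hM: "\<And>y. \<bar>h y\<bar> \<le> M" and h0: "\<And>y. y \<in> \<Omega> \<Longrightarrow> h y = 0"
    and hg: "AE y in lborel. y \<notin> \<Omega> \<longrightarrow> h y = g y - c"
    and sol: "\<And>s. s \<in> {0<..<1} \<Longrightarrow> poisson_solution s \<Omega> g (u s)"
    and \<epsilon>: "0 < \<epsilon>" "\<epsilon> < 1" and A: "\<And>s. 0 < s \<Longrightarrow> 0 \<le> A s"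
    and fA: "\<forall>\<^sub>F s in at_right 0. \<forall>x\<in>\<Omega>. \<bar>c_Ns DIM('a) s * ext_pot s h x\<bar> \<le> A s * \<delta> x powr - (\<epsilon> / 2)"
  obtains \<theta> C where "(\<theta> \<longlongrightarrow> 0) (at_right 0)"
    "\<forall>\<^sub>F s in at_right 0. AE x in lborel. x \<in> \<Omega> \<longrightarrow>
      \<bar>u s x - c - c_Ns DIM('a) s * ext_pot s h x\<bar> \<le>
       (C * (\<theta> s * A s + c_Ns DIM('a) s * (A s + c_Ns DIM('a) s * M)) + s\<^sup>2) * \<delta> x powr -\<epsilon>"
proof -
  obtain C s0 where C: "C > 0" "0 < s0" "s0 \<le> 1/4" and me:
    "\<And>s u w h c B M A \<theta> Q. \<lbrakk>0 < s; s < s0; u \<in> borel_measurable lebesgue;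
      w \<in> borel_measurable borel; h \<in> borel_measurable borel;
      AE y in lebesgue. u y = c + w y + h y; \<And>y. \<bar>w y\<bar> \<le> B; \<And>y. y \<notin> \<Omega> \<Longrightarrow> w y = 0;
      \<And>y. \<bar>h y\<bar> \<le> M; \<And>y. y \<in> \<Omega> \<Longrightarrow> h y = 0; s_harmonic s \<Omega> u; 0 \<le> A; 0 \<le> \<theta>;
      \<And>x. x \<in> \<Omega> \<Longrightarrow> \<bar>c_Ns DIM('a) s * ext_pot s h x\<bar> \<le> A * \<delta> x powr - (\<epsilon> / 2);
      \<And>x. x \<in> \<Omega> \<Longrightarrow> \<bar>c_Ns DIM('a) s * omega_sphere DIM('a) / (2 * s) * (\<delta> x / 2) powr (-2 * s) - 1\<bar> \<le> \<theta> * \<delta> x powr - (\<epsilon> / 2);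
      C * (\<theta> * A + c_Ns DIM('a) s * (A + c_Ns DIM('a) s * M)) < Q\<rbrakk> \<Longrightarrow>
      AE x in lborel. x \<in> \<Omega> \<longrightarrow> \<bar>w x - c_Ns DIM('a) s * ext_pot s h x\<bar> \<le> Q * \<delta> x powr -\<epsilon>"
    using two_sided_estimate[OF \<epsilon>] by blast
  have a: "0 < \<epsilon> / 2" "\<epsilon> / 2 < 1" using \<epsilon> by auto
  obtain \<theta> where \<theta>: "(\<theta> \<longlongrightarrow> 0) (at_right 0)" "\<And>s. 0 < s \<Longrightarrow> 0 \<le> \<theta> s"
    and \<kappa>: "\<And>s x. 0 < s \<Longrightarrow> 4 * s \<le> \<epsilon> / 2 \<Longrightarrow> x \<in> \<Omega> \<Longrightarrow>
      \<bar>c_Ns DIM('a) s * omega_sphere DIM('a) / (2 * s) * (\<delta> x / 2) powr (-2 * s) - 1\<bar> \<le> \<theta> s * \<delta> x powr - (\<epsilon> / 2)"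
    using killing_rate[OF a] by blast
  have "\<forall>\<^sub>F s in at_right 0. s \<in> {0<..<min s0 (\<epsilon> / 8)}"
    using C \<epsilon> by (intro eventually_at_right_real) auto
  then have "\<forall>\<^sub>F s in at_right 0. AE x in lborel. x \<in> \<Omega> \<longrightarrow>
      \<bar>u s x - c - c_Ns DIM('a) s * ext_pot s h x\<bar> \<le>
       (C * (\<theta> s * A s + c_Ns DIM('a) s * (A s + c_Ns DIM('a) s * M)) + s\<^sup>2) * \<delta> x powr -\<epsilon>"
    using fA
  proof eventually_elim
    case (elim s)
    then have s: "0 < s" "s < s0" "4 * s \<le> \<epsilon> / 2" "s \<in> {0<..<1}" using C by auto
    obtain w B where w: "w \<in> borel_measurable borel" "\<And>y. \<bar>w y\<bar> \<le> B" "\<And>y. y \<notin> \<Omega> \<Longrightarrow> w y = 0"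
      "AE y in lebesgue. u s y = c + w y + h y" "u s \<in> borel_measurable lebesgue" "s_harmonic s \<Omega> (u s)"
      using solution_data[OF sol[OF s(4)] hg h0] by blast
    have "AE x in lborel. x \<in> \<Omega> \<longrightarrow> \<bar>w x - c_Ns DIM('a) s * ext_pot s h x\<bar> \<le>
       (C * (\<theta> s * A s + c_Ns DIM('a) s * (A s + c_Ns DIM('a) s * M)) + s\<^sup>2) * \<delta> x powr -\<epsilon>"
    proof (rule me[OF s(1,2) w(5,1) hm w(4,2,3) hM h0 w(6) A[OF s(1)] \<theta>(2)[OF s(1)]])
      show "\<bar>c_Ns DIM('a) s * ext_pot s h x\<bar> \<le> A s * \<delta> x powr - (\<epsilon> / 2)" if "x \<in> \<Omega>" for x
        using elim(2) that by blast
      show "\<bar>c_Ns DIM('a) s * omega_sphere DIM('a) / (2 * s) * (\<delta> x / 2) powr (-2 * s) - 1\<bar> \<le> \<theta> s * \<delta> x powr - (\<epsilon> / 2)" if "x \<in> \<Omega>" for x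
        by (rule \<kappa>[OF s(1,3) that])
    qed (use s in auto)
    moreover have "AE x in lborel. u s x = c + w x + h x" using w(4) by (simp add: AE_completion_iff)
    ultimately show ?case by eventually_elim (auto simp: h0)
  qed
  with \<theta>(1) show ?thesis by (rule that)
qed

section \<open>Behaviour of the exterior potential as s tends to 0\<close>

lemma ext_pot_split:
  assumes "integrable lborel (\<lambda>y. indicator {..<R} (norm y) * h y * frac_ker s (x - y))"
    "integrable lborel (\<lambda>y. indicator {R..} (norm y) * h y * frac_ker s (x - y))"
  shows "ext_pot s h x = (LINT y|lborel. indicator {..<R} (norm y) * h y * frac_ker s (x - y)) +
     (LINT y|lborel. indicator {R..} (norm y) * h y * frac_ker s (x - y))"
proof -
  have "ext_pot s h x = (LINT y|lborel. indicator {..<R} (norm y) * h y * frac_ker s (x - y) +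
     indicator {R..} (norm y) * h y * frac_ker s (x - y))"
    unfolding ext_pot_def by (rule Bochner_Integration.integral_cong) (auto simp: indicator_def)
  then show ?thesis using Bochner_Integration.integral_add[OF assms] by simp
qed

lemma integrable_frac_ker_outer:
  assumes "0 < s" "0 < R"
  shows "integrable lborel (\<lambda>y::'a. indicator {R..} (norm y) * frac_ker s y)"
  using has_integral_frac_ker_tail[OF assms, of "0::'a"] by (simp add: has_bochner_integral_iff mult.commute)

text \<open>Beyond a large radius the averages are at most eta', so the radial integral is at most
  eta'/(2s), and \<open>c_Ns\<close> times the surface area turns this into at most 2 eta'. All
  other contributions lack the factor 1/s and vanish with \<open>c_Ns\<close>.\<close>

lemma ext_pot_small:
  assumes hm [measurable]: "h \<in> borel_measurable borel" and hM: "\<And>y. \<bar>h y\<bar> \<le> M" and h0: "\<And>y. y \<in> \<Omega> \<Longrightarrow> h y = 0"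
    and lim: "\<And>\<eta>. 0 < \<eta> \<Longrightarrow> \<exists>R. AE r in lborel. R < r \<longrightarrow> \<bar>sph_avg h r\<bar> \<le> \<eta>"
    and a: "0 < a" "a < 1" and \<eta>: "0 < \<eta>"
  shows "\<forall>\<^sub>F s in at_right 0. \<forall>x\<in>\<Omega>. \<bar>c_Ns DIM('a) s * ext_pot s h x\<bar> \<le> \<eta> * \<delta> x powr -a"
proof -
  let ?c = "c_Ns DIM('a)" and ?o = "omega_sphere DIM('a)"
  have o: "?o > 0" by (simp add: omega_sphere_pos)
  have M: "M \<ge> 0" using hM[of 0] by linarith
  \<comment> \<open>The far field amounts to at most 3 eta', absorbed into the weight by one factor
    \<open>R0\<close>: 3/8 of eta. The near field takes another quarter.\<close>
  define \<eta>' where "\<eta>' = \<eta> / (8 * R0)"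
  have \<eta>': "\<eta>' > 0" using \<eta> R0(1) by (simp add: \<eta>'_def)
  obtain R' where R': "AE r in lborel. R' < r \<longrightarrow> \<bar>sph_avg h r\<bar> \<le> \<eta>'" using lim[OF \<eta>'] by blast
  define R where "R = max (2 * R0) (R' + 1)"
  have R: "2 * R0 \<le> R" "R0 \<le> R" "R' < R" "1 \<le> R" using R0(1) by (auto simp: R_def)
  have t0: "(?c \<longlongrightarrow> 0) (at_right 0)" by (intro tendsto_c_Ns_0) simp
  have "((\<lambda>s. ?c s * (2 * R * M * ?o / a)) \<longlongrightarrow> 0 * (2 * R * M * ?o / a)) (at_right 0)"
    by (intro tendsto_intros t0)
  then have e1: "\<forall>\<^sub>F s in at_right 0. ?c s * (2 * R * M * ?o / a) < \<eta> / 4"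
    by (rule order_tendstoD) (use \<eta> in simp)
  have "((\<lambda>s. ?c s * (far_const * M / R)) \<longlongrightarrow> 0 * (far_const * M / R)) (at_right 0)"
    by (intro tendsto_intros t0)
  then have e2: "\<forall>\<^sub>F s in at_right 0. ?c s * (far_const * M / R) < \<eta>'"
    by (rule order_tendstoD) (use \<eta>' in simp)
  have e3: "\<forall>\<^sub>F s in at_right 0. ?c s * ?o / (2 * s) < 2"
    by (rule order_tendstoD[OF tendsto_c_Ns_omega]) auto
  have e4: "\<forall>\<^sub>F s in at_right 0. s \<in> {0<..<a / 4}" using a by (intro eventually_at_right_real) auto
  show ?thesis
    using e1 e2 e3 e4
  proof eventually_elim
    case (elim s)
    then have s: "0 < s" "0 \<le> s" "4 * s \<le> a" "s \<le> 1/4" "s < 1" using a by auto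
    have c: "?c s > 0" using s by (intro c_Ns_pos) auto
    show ?case
    proof
      fix x assume x: "x \<in> \<Omega>"
      note n = near_part[OF hm hM h0 R(2) a s(2,3) x]
      have Rp: "0 < R" using R by linarith
      note f = far_part[OF hm hM R(1) _ _ s(2,4) x integrable_frac_ker_outer[OF s(1) Rp]]
      let ?T = "LINT t|lborel. indicator {R..} t * t powr (-1 - 2 * s) * sph_avg h t"
      have "\<bar>?T\<bar> \<le> \<eta>' * (1 / (2 * s))"
      proof (rule integral_nn_bound(2))
        have "(\<integral>\<^sup>+t. ennreal \<bar>indicator {R..} t * t powr (-1 - 2 * s) * sph_avg h t\<bar> \<partial>lborel) \<le>
          (\<integral>\<^sup>+t. ennreal \<eta>' * (ennreal (t powr (-1 - 2 * s)) * indicator {R..} t) \<partial>lborel)"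
        proof (rule nn_integral_mono_AE, use R' in eventually_elim)
          case (elim t)
          show ?case
          proof (cases "R \<le> t")
            case True
            then have "\<bar>sph_avg h t\<bar> \<le> \<eta>'" using elim R(3) by simp
            then have "t powr (-1 - 2 * s) * \<bar>sph_avg h t\<bar> \<le> t powr (-1 - 2 * s) * \<eta>'" by (intro mult_left_mono) auto
            then show ?thesis using True \<eta>' by (auto simp: abs_mult ennreal_mult[symmetric] mult.commute intro!: ennreal_leI)
          qed simp
        qed
        also have "\<dots> = ennreal \<eta>' * ennreal (R powr (- (2 * s)) / (2 * s))"
          using s Rp by (subst nn_integral_cmult) (measurable, simp add: nn_integral_powr_tail)
        also have "\<dots> = ennreal (\<eta>' * (R powr (- (2 * s)) / (2 * s)))" using \<eta>' s by (intro ennreal_mult[symmetric]) auto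
        also have "\<dots> \<le> ennreal (\<eta>' * (1 / (2 * s)))"
        proof (intro ennreal_leI mult_left_mono divide_right_mono)
          have "R powr (- (2 * s)) \<le> R powr 0" using R s by (intro powr_mono) auto
          then show "R powr (- (2 * s)) \<le> 1" using Rp by simp
        qed (use \<eta>' s in auto)
        finally show "(\<integral>\<^sup>+t. ennreal \<bar>indicator {R..} t * t powr (-1 - 2 * s) * sph_avg h t\<bar> \<partial>lborel) \<le> ennreal (\<eta>' * (1 / (2 * s)))" .
      qed (use \<eta>' s in auto)
      then have "?o * \<bar>?T\<bar> \<le> ?o * (\<eta>' * (1 / (2 * s)))" using o by (intro mult_left_mono) auto
      then have far: "\<bar>LINT y|lborel. indicator {R..} (norm y) * h y * frac_ker s (x - y)\<bar> \<le> far_const * M / R + ?o * (\<eta>' * (1 / (2 * s)))"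
        using f(2) by simp
      have "\<bar>ext_pot s h x\<bar> \<le> 2 * R * M * ?o / a * \<delta> x powr -a + (far_const * M / R + ?o * (\<eta>' * (1 / (2 * s))))"
        using n(2) far ext_pot_split[OF n(1) f(1)] by auto
      then have "?c s * \<bar>ext_pot s h x\<bar> \<le> ?c s * (2 * R * M * ?o / a * \<delta> x powr -a + (far_const * M / R + ?o * (\<eta>' * (1 / (2 * s)))))"
        using c by (intro mult_left_mono) auto
      also have "\<dots> = ?c s * (2 * R * M * ?o / a) * \<delta> x powr -a + (?c s * (far_const * M / R) + ?c s * ?o / (2 * s) * \<eta>')"
        by (simp add: distrib_left mult_ac)
      also have "\<dots> \<le> \<eta> / 4 * \<delta> x powr -a + (\<eta>' + 2 * \<eta>')"
        using elim(1-3) \<eta>' by (intro add_mono mult_right_mono) auto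
      also have "\<dots> \<le> \<eta> / 4 * \<delta> x powr -a + 3 * \<eta>' * (R0 * \<delta> x powr -a)"
        using mult_left_mono[OF one_le_\<delta>[OF x, of a], of "3 * \<eta>'"] \<eta>' a by simp
      also have "\<dots> = (\<eta> / 4 + 3 / 8 * \<eta>) * \<delta> x powr -a" using R0(1) by (simp add: \<eta>'_def distrib_right)
      also have "\<dots> \<le> \<eta> * \<delta> x powr -a" using \<eta> by (intro mult_right_mono) auto
      finally show "\<bar>?c s * ext_pot s h x\<bar> \<le> \<eta> * \<delta> x powr -a" using c by (simp add: abs_mult)
    qed
  qed
qed

text \<open>At s = 0 the kernel is not integrable at infinity, so the limit L_g is reached through
  bounded shells.\<close>

lemma integrable_frac_ker_shell:
  assumes "1 \<le> R"
  shows "integrable lborel (\<lambda>y::'a. indicator {R..<r} (norm y) * frac_ker 0 y)"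
proof (rule Bochner_Integration.integrable_bound)
  have "emeasure lborel (ball (0::'a) r) < \<infinity>" by (rule emeasure_lborel_ball_finite)
  then show "integrable lborel (indicator (ball (0::'a) r) :: 'a \<Rightarrow> real)"
    by (intro integrable_real_indicator) auto
  show "AE y in lborel. norm (indicator {R..<r} (norm y) * frac_ker 0 y) \<le> norm (indicator (ball (0::'a) r) y :: real)"
  proof (rule AE_I2)
    fix y :: 'a
    show "norm (indicator {R..<r} (norm y) * frac_ker 0 y) \<le> norm (indicator (ball (0::'a) r) y :: real)"
    proof (cases "norm y \<in> {R..<r}")
      case True
      have "norm y powr - real DIM('a) \<le> norm y powr 0" using True assms by (intro powr_mono) auto
      moreover have "y \<noteq> 0" using True assms by auto
      ultimately show ?thesis using True by (simp add: frac_ker_def)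
    qed simp
  qed
qed measurable

text \<open>The tail beyond radius k is bounded by \<open>G k\<close> uniformly in the point and in
  small s, including s = 0, since t^(-1-2s) <= 1/t for t >= 1. Hence the limits k to infinity and s
  to 0 may be exchanged: potential and limit are each replaced by integrals over norm y < k, which
  \<open>near_part\<close> compares.\<close>

lemma ext_pot_expansion:
  assumes hm [measurable]: "h \<in> borel_measurable borel" and hM: "\<And>y. \<bar>h y\<bar> \<le> M" and h0: "\<And>y. y \<in> \<Omega> \<Longrightarrow> h y = 0"
    and int: "integrable lborel (\<lambda>t. indicator {R1..} t * (\<bar>sph_avg h t\<bar> / t))"
  obtains L where
    "\<And>x. x \<in> \<Omega> \<Longrightarrow> ((\<lambda>r. c_N DIM('a) * (LINT y|lborel. indicator {..<r} (norm y) * h y * frac_ker 0 (x - y))) \<longlongrightarrow> L x) at_top"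
    "\<And>a. 0 < a \<Longrightarrow> a < 1 \<Longrightarrow> \<exists>K>0. \<forall>x\<in>\<Omega>. \<bar>L x\<bar> \<le> K * \<delta> x powr -a"
    "\<And>a \<eta>. 0 < a \<Longrightarrow> a < 1 \<Longrightarrow> 0 < \<eta> \<Longrightarrow>
      \<forall>\<^sub>F s in at_right 0. \<forall>x\<in>\<Omega>. \<bar>c_Ns DIM('a) s * ext_pot s h x / s - L x\<bar> \<le> \<eta> * \<delta> x powr -a"
proof -
  let ?o = "omega_sphere DIM('a)" and ?n = "DIM('a)"
  have o: "?o > 0" by (simp add: omega_sphere_pos)
  have M: "M \<ge> 0" using hM[of 0] by linarith
  define T where "T k = (LINT t|lborel. indicator {real k..} t * (indicator {R1..} t * (\<bar>sph_avg h t\<bar> / t)))" for k :: nat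
  have T0: "T \<longlonglongrightarrow> 0" unfolding T_def by (rule tendsto_integral_tail[OF int])
  \<comment> \<open>The first term is the cost of recentring the kernel beyond radius k, the second
    the tail of the integrable averages.\<close>
  define G where "G k = far_const * M / real k + ?o * T k" for k :: nat
  have "(\<lambda>k. far_const * M / real k + ?o * T k) \<longlonglongrightarrow> 0 + ?o * 0"
    by (intro tendsto_intros T0 lim_const_over_n)
  then have G0: "G \<longlonglongrightarrow> 0" by (simp add: G_def[abs_def])
  define k0 where "k0 = nat \<lceil>max (2 * R0) R1\<rceil>"
  have k0: "2 * R0 \<le> real k" "R0 \<le> real k" "R1 \<le> real k" "1 \<le> real k" if "k0 \<le> k" for k
  proof -
    have "max (2 * R0) R1 \<le> real k0" unfolding k0_def by (rule real_nat_ceiling_ge)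
    also have "real k0 \<le> real k" using that by simp
    finally show "2 * R0 \<le> real k" "R0 \<le> real k" "R1 \<le> real k" "1 \<le> real k" using R0(1) by auto
  qed
  have tail: "\<bar>LINT t|lborel. indicator J t * t powr (-1 - 2 * s) * sph_avg h t\<bar> \<le> T k"
    if k: "k0 \<le> k" and s: "0 \<le> s" and J [measurable]: "J \<in> sets borel" "J \<subseteq> {real k..}" for k s J
  proof (rule integral_nn_bound(2))
    let ?g = "\<lambda>t. indicator {real k..} t * (indicator {R1..} t * (\<bar>sph_avg h t\<bar> / t))"
    have gi: "integrable lborel ?g"
      by (rule Bochner_Integration.integrable_bound[OF int]) (auto simp: indicator_def)
    have g0: "0 \<le> ?g t" for t using k0(4)[OF k] by (auto simp: indicator_def)
    show "0 \<le> T k" unfolding T_def by (intro integral_nonneg_AE AE_I2 g0)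
    have "(\<integral>\<^sup>+t. ennreal \<bar>indicator J t * t powr (-1 - 2 * s) * sph_avg h t\<bar> \<partial>lborel) \<le> (\<integral>\<^sup>+t. ennreal (?g t) \<partial>lborel)"
    proof (intro nn_integral_mono ennreal_leI)
      fix t
      show "\<bar>indicator J t * t powr (-1 - 2 * s) * sph_avg h t\<bar> \<le> ?g t"
      proof (cases "t \<in> J")
        case True
        then have t: "real k \<le> t" using J by auto
        have t1: "1 \<le> t" using t k0(4)[OF k] by linarith
        have "t powr (-1 - 2 * s) \<le> t powr -1" using t1 s by (intro powr_mono) auto
        then have "t powr (-1 - 2 * s) * \<bar>sph_avg h t\<bar> \<le> t powr -1 * \<bar>sph_avg h t\<bar>" by (intro mult_right_mono) auto
        then show ?thesis using True t t1 k0(3)[OF k] by (simp add: abs_mult powr_minus_divide)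
      qed (use g0 in auto)
    qed
    also have "\<dots> = ennreal (T k)" unfolding T_def using gi g0 by (intro nn_integral_eq_integral) auto
    finally show "(\<integral>\<^sup>+t. ennreal \<bar>indicator J t * t powr (-1 - 2 * s) * sph_avg h t\<bar> \<partial>lborel) \<le> ennreal (T k)" .
  qed measurable
  define F where "F s x r = (LINT y|lborel. indicator {..<r} (norm y) * h y * frac_ker s (x - y))" for s x r
  have FG: "\<bar>F 0 x r - F 0 x (real k)\<bar> \<le> G k" if x: "x \<in> \<Omega>" and k: "k0 \<le> k" and r: "real k \<le> r" for x k r
  proof -
    \<comment> \<open>The exponent 1/2 is arbitrary here; \<open>near_part\<close> is only used for
      integrability.\<close>
    have h2: "(0::real) < 1/2" "(1/2::real) < 1" "(0::real) \<le> 0" "4 * (0::real) \<le> 1/2" "(0::real) \<le> 1/4" by auto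
    have rR: "R0 \<le> r" using r k0(2)[OF k] by linarith
    note i1 = near_part(1)[OF hm hM h0 rR h2(1-4) x]
    note i2 = near_part(1)[OF hm hM h0 k0(2)[OF k] h2(1-4) x]
    have J: "{real k..<r} \<in> sets borel" "{real k..<r} \<subseteq> {real k..}" by auto
    note f = far_part[OF hm hM k0(1)[OF k] J h2(3,5) x integrable_frac_ker_shell[OF k0(4)[OF k]]]
    have "F 0 x r - F 0 x (real k) = (LINT y|lborel. indicator {..<r} (norm y) * h y * frac_ker 0 (x - y) -
        indicator {..<real k} (norm y) * h y * frac_ker 0 (x - y))"
      unfolding F_def by (rule Bochner_Integration.integral_diff[OF i1 i2, symmetric])
    also have "\<dots> = (LINT y|lborel. indicator {real k..<r} (norm y) * h y * frac_ker 0 (x - y))"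
      using r by (intro Bochner_Integration.integral_cong) (auto simp: indicator_def)
    also have "\<bar>\<dots>\<bar> \<le> far_const * M / real k + ?o * \<bar>LINT t|lborel. indicator {real k..<r} t * t powr (-1 - 2 * 0) * sph_avg h t\<bar>"
      by (rule f(2))
    also have "\<dots> \<le> G k"
      unfolding G_def using tail[OF k _ J, of 0] o by (intro add_left_mono mult_left_mono) auto
    finally show ?thesis .
  qed
  have EG: "\<bar>ext_pot s h x - F s x (real k)\<bar> \<le> G k"
    if x: "x \<in> \<Omega>" and k: "k0 \<le> k" and s: "0 < s" "s \<le> 1/8" for x k s
  proof -
    have h2: "(0::real) < 1/2" "(1/2::real) < 1" "0 \<le> s" "4 * s \<le> 1/2" "s \<le> 1/4" using s by auto
    have kp: "0 < real k" using k0(4)[OF k] by linarith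
    note i2 = near_part(1)[OF hm hM h0 k0(2)[OF k] h2(1-4) x]
    have J: "{real k..} \<in> sets borel" "{real k..} \<subseteq> {real k..}" by auto
    note f = far_part[OF hm hM k0(1)[OF k] J h2(3,5) x integrable_frac_ker_outer[OF s(1) kp]]
    have "ext_pot s h x - F s x (real k) = (LINT y|lborel. indicator {real k..} (norm y) * h y * frac_ker s (x - y))"
      unfolding F_def using ext_pot_split[OF i2 f(1)] by simp
    also have "\<bar>\<dots>\<bar> \<le> far_const * M / real k + ?o * \<bar>LINT t|lborel. indicator {real k..} t * t powr (-1 - 2 * s) * sph_avg h t\<bar>"
      by (rule f(2))
    also have "\<dots> \<le> G k"
      unfolding G_def using tail[OF k h2(3) J] o by (intro add_left_mono mult_left_mono) auto
    finally show ?thesis .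
  qed
  have "\<exists>l. (F 0 x \<longlongrightarrow> l) at_top \<and> (\<forall>k\<ge>k0. \<bar>l - F 0 x (real k)\<bar> \<le> G k)" if x: "x \<in> \<Omega>" for x
    using limit_at_top_of_tail_bound[OF G0 FG[OF x], of k0] by blast
  then obtain l where l: "\<And>x. x \<in> \<Omega> \<Longrightarrow> (F 0 x \<longlongrightarrow> l x) at_top"
    and lG: "\<And>x k. x \<in> \<Omega> \<Longrightarrow> k0 \<le> k \<Longrightarrow> \<bar>l x - F 0 x (real k)\<bar> \<le> G k"
    by (metis (no_types, lifting) bchoice)
  have cN: "c_N ?n > 0" by (rule c_N_pos) simp
  have Gk: "0 \<le> G k" if "k0 \<le> k" for k
  proof -
    obtain x where "x \<in> \<Omega>" using ne by blast
    from lG[OF this that] show ?thesis by linarith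
  qed
  have lbound: "\<exists>K>0. \<forall>x\<in>\<Omega>. \<bar>l x\<bar> \<le> K * \<delta> x powr -a" if a: "0 < a" "a < 1" for a
  proof -
    let ?A = "2 * real k0 * M * ?o / a"
    have "?A \<ge> 0" using M o a by simp
    moreover have "0 \<le> G k0 * R0" using Gk R0(1) by simp
    ultimately have K: "?A + G k0 * R0 + 1 > 0" by linarith
    have "\<bar>l x\<bar> \<le> (?A + G k0 * R0 + 1) * \<delta> x powr -a" if x: "x \<in> \<Omega>" for x
    proof -
      have z: "(0::real) \<le> 0" "4 * (0::real) \<le> a" using a by auto
      have "\<bar>F 0 x (real k0)\<bar> \<le> ?A * \<delta> x powr -a"
        unfolding F_def by (rule near_part(2)[OF hm hM h0 k0(2)[OF order_refl] a z x])
      moreover have "\<bar>l x - F 0 x (real k0)\<bar> \<le> G k0 * (R0 * \<delta> x powr -a)"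
        using lG[OF x order_refl] mult_left_mono[OF one_le_\<delta>[OF x, of a] Gk[OF order_refl]] a by simp
      moreover have "(?A + G k0 * R0 + 1) * \<delta> x powr -a = ?A * \<delta> x powr -a + G k0 * (R0 * \<delta> x powr -a) + \<delta> x powr -a"
        by (simp only: distrib_right mult.assoc mult_1)
      moreover have "0 \<le> \<delta> x powr -a" by simp
      ultimately show ?thesis by linarith
    qed
    then show ?thesis using K by blast
  qed
  show ?thesis
  proof (rule that[of "\<lambda>x. c_N ?n * l x"])
    show "((\<lambda>r. c_N ?n * (LINT y|lborel. indicator {..<r} (norm y) * h y * frac_ker 0 (x - y))) \<longlongrightarrow> c_N ?n * l x) at_top" if "x \<in> \<Omega>" for x
      using tendsto_mult_left[OF l[OF that], of "c_N ?n"] by (simp add: F_def)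
    show "\<exists>K>0. \<forall>x\<in>\<Omega>. \<bar>c_N ?n * l x\<bar> \<le> K * \<delta> x powr -a" if a: "0 < a" "a < 1" for a
    proof -
      obtain K where K: "K > 0" "\<forall>x\<in>\<Omega>. \<bar>l x\<bar> \<le> K * \<delta> x powr -a" using lbound[OF a] by blast
      show ?thesis
        by (rule exI[of _ "c_N ?n * K"]) (use K cN in \<open>auto simp: abs_mult mult.assoc\<close>)
    qed
    fix a \<eta> :: real assume a: "0 < a" "a < 1" and \<eta>: "0 < \<eta>"
    obtain K where K: "K > 0" "\<forall>x\<in>\<Omega>. \<bar>l x\<bar> \<le> K * \<delta> x powr -a" using lbound[OF a] by blast
    \<comment> \<open>Potential minus limit gets eta/(3 c_N): half from the near comparison and a
      quarter from each of the two tails. The factor \<open>c_Ns / s\<close>, less than 2 c_N, makes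
      this 2/3 of eta; the last third pays for replacing it by c_N.\<close>
    define \<eta>1 where "\<eta>1 = \<eta> / (12 * c_N ?n * R0)"
    have \<eta>1: "\<eta>1 > 0" using \<eta> cN R0(1) by (simp add: \<eta>1_def)
    have "\<forall>\<^sub>F k in sequentially. G k < \<eta>1" using G0 \<eta>1 by (rule order_tendstoD)
    then have "\<forall>\<^sub>F k in sequentially. k0 \<le> k \<and> G k < \<eta>1"
      using eventually_ge_at_top by (rule eventually_conj[rotated])
    then obtain k where k: "k0 \<le> k" "G k < \<eta>1" unfolding eventually_sequentially by blast
    \<comment> \<open>This constant grows with \<open>k\<close>, which is why \<open>k\<close> is
      fixed before s is made small.\<close>
    define D where "D = (4 / a + 2 * ln (2 * real k) * (2 * real k) powr a) * (M * ?o / a)"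
    have t: "((\<lambda>s. c_Ns ?n s / s) \<longlongrightarrow> c_N ?n) (at_right 0)" by (rule tendsto_c_Ns) simp
    have e1: "\<forall>\<^sub>F s in at_right 0. c_Ns ?n s / s < 2 * c_N ?n"
      by (rule order_tendstoD[OF t]) (use cN in simp)
    have "((\<lambda>s. D * s) \<longlongrightarrow> D * 0) (at_right 0)" by (intro tendsto_intros)
    then have e2: "\<forall>\<^sub>F s in at_right 0. D * s < \<eta> / (6 * c_N ?n)"
      by (rule order_tendstoD) (use \<eta> cN in simp)
    have "((\<lambda>s. \<bar>c_Ns ?n s / s - c_N ?n\<bar> * K) \<longlongrightarrow> \<bar>c_N ?n - c_N ?n\<bar> * K) (at_right 0)"
      by (intro tendsto_intros t)
    then have e3: "\<forall>\<^sub>F s in at_right 0. \<bar>c_Ns ?n s / s - c_N ?n\<bar> * K < \<eta> / 3"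
      by (rule order_tendstoD) (use \<eta> in simp)
    have e4: "\<forall>\<^sub>F s in at_right 0. s \<in> {0<..<min (a / 4) (1 / 8)}" using a by (intro eventually_at_right_real) auto
    show "\<forall>\<^sub>F s in at_right 0. \<forall>x\<in>\<Omega>. \<bar>c_Ns ?n s * ext_pot s h x / s - c_N ?n * l x\<bar> \<le> \<eta> * \<delta> x powr -a"
      using e1 e2 e3 e4
    proof eventually_elim
      case (elim s)
      then have s: "0 < s" "0 \<le> s" "4 * s \<le> a" "s \<le> 1/8" "s < 1" by auto
      have cs: "0 < c_Ns ?n s / s" using s c_Ns_pos[of s ?n] by simp
      show ?case
      proof
        fix x assume x: "x \<in> \<Omega>"
        let ?e = "\<delta> x powr -a"
        have "\<bar>F s x (real k) - F 0 x (real k)\<bar> \<le> D * s * ?e"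
          using near_part(3)[OF hm hM h0 k0(2)[OF k(1)] a s(2,3) x] by (simp add: F_def D_def mult_ac)
        moreover have "D * s * ?e \<le> \<eta> / (6 * c_N ?n) * ?e" using elim(2) by (intro mult_right_mono) auto
        moreover have "\<eta>1 \<le> \<eta>1 * (R0 * ?e)" using mult_left_mono[OF one_le_\<delta>[OF x, of a], of \<eta>1] \<eta>1 a by simp
        ultimately have "\<bar>ext_pot s h x - l x\<bar> \<le> \<eta> / (6 * c_N ?n) * ?e + 2 * (\<eta>1 * (R0 * ?e))"
          using EG[OF x k(1) s(1,4)] lG[OF x k(1)] k(2) by linarith
        also have "\<eta>1 * (R0 * ?e) = \<eta> / (12 * c_N ?n) * ?e" using R0(1) by (simp add: \<eta>1_def)
        also have "\<eta> / (6 * c_N ?n) * ?e + 2 * (\<eta> / (12 * c_N ?n) * ?e) = \<eta> / (3 * c_N ?n) * ?e"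
          using cN by (simp add: field_simps)
        finally have 1: "\<bar>ext_pot s h x - l x\<bar> \<le> \<eta> / (3 * c_N ?n) * ?e" .
        have "c_Ns ?n s / s * \<bar>ext_pot s h x - l x\<bar> \<le> 2 * c_N ?n * (\<eta> / (3 * c_N ?n) * ?e)"
          using elim(1) 1 cs cN by (intro mult_mono) auto
        also have "\<dots> = 2 / 3 * \<eta> * ?e" using cN by simp
        finally have A: "\<bar>c_Ns ?n s / s * (ext_pot s h x - l x)\<bar> \<le> 2 / 3 * \<eta> * ?e"
          using cs by (simp only: abs_mult abs_of_pos)
        have "\<bar>(c_Ns ?n s / s - c_N ?n) * l x\<bar> \<le> \<bar>c_Ns ?n s / s - c_N ?n\<bar> * (K * ?e)"
          unfolding abs_mult using K x by (intro mult_left_mono) auto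
        also have "\<dots> \<le> \<eta> / 3 * ?e"
          unfolding mult.assoc[symmetric] using elim(3) by (intro mult_right_mono) auto
        finally have B: "\<bar>(c_Ns ?n s / s - c_N ?n) * l x\<bar> \<le> \<eta> / 3 * ?e" .
        have "c_Ns ?n s * ext_pot s h x / s - c_N ?n * l x = c_Ns ?n s / s * (ext_pot s h x - l x) + (c_Ns ?n s / s - c_N ?n) * l x"
          by (simp add: algebra_simps)
        then have "\<bar>c_Ns ?n s * ext_pot s h x / s - c_N ?n * l x\<bar> \<le> 2 / 3 * \<eta> * ?e + \<eta> / 3 * ?e"
          using A B by linarith
        also have "\<dots> = \<eta> * ?e" by simp
        finally show "\<bar>c_Ns ?n s * ext_pot s h x / s - c_N ?n * l x\<bar> \<le> \<eta> * ?e" .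
      qed
    qed
  qed
qed

section \<open>Passage to the limit\<close>

lemma ess_lim_sph_avg:
  assumes hm: "h \<in> borel_measurable borel" and gm: "g \<in> borel_measurable borel" and hM: "\<And>y. \<bar>h y\<bar> \<le> M"
    and hg: "AE y in lborel. y \<notin> \<Omega> \<longrightarrow> h y = g y - c"
    and lim: "ess_lim_at_top (sph_mean g) c" and \<eta>: "0 < \<eta>"
  shows "\<exists>R. AE r in lborel. R < r \<longrightarrow> \<bar>sph_avg h r\<bar> \<le> \<eta>"
proof -
  obtain R where R: "AE r in lborel. R < r \<longrightarrow> \<bar>sph_mean g r - c\<bar> < \<eta>"
    using lim \<eta> by (auto simp: ess_lim_at_top_def)
  have "AE y in lborel. norm y \<ge> R0 \<longrightarrow> h y = g y - c"
    using hg by eventually_elim (use \<Omega>_norm in force)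
  then have "AE r in lborel. r \<ge> R0 \<longrightarrow> sph_avg h r = sph_mean g r - c"
    using R0(1) by (intro AE_sph_avg_cong[OF hm gm hM]) auto
  with R have "AE r in lborel. max R R0 < r \<longrightarrow> \<bar>sph_avg h r\<bar> \<le> \<eta>"
    by eventually_elim auto
  then show ?thesis by blast
qed

lemma integrable_sph_avg_tail:
  assumes hm [measurable]: "h \<in> borel_measurable borel" and gm: "g \<in> borel_measurable borel" and hM: "\<And>y. \<bar>h y\<bar> \<le> M"
    and hg: "AE y in lborel. y \<notin> \<Omega> \<longrightarrow> h y = g y - c"
    and R: "1 \<le> R" "\<Omega> \<subseteq> ball 0 R"
    and int: "set_integrable lborel {R..} (\<lambda>r. \<bar>sph_mean g r - c\<bar> / r)"
  shows "integrable lborel (\<lambda>t. indicator {R..} t * (\<bar>sph_avg h t\<bar> / t))"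
proof -
  have "AE y in lborel. norm y \<ge> R \<longrightarrow> h y = g y - c"
    using hg by eventually_elim (use R(2) in force)
  then have "AE r in lborel. r \<ge> R \<longrightarrow> sph_avg h r = sph_mean g r - c"
    using R(1) by (intro AE_sph_avg_cong[OF hm gm hM]) auto
  then have ae: "AE t in lborel. indicator {R..} t *\<^sub>R (\<bar>sph_mean g t - c\<bar> / t) = indicator {R..} t * (\<bar>sph_avg h t\<bar> / t)"
    by eventually_elim (auto simp: indicator_def)
  have i: "integrable lborel (\<lambda>t. indicator {R..} t *\<^sub>R (\<bar>sph_mean g t - c\<bar> / t))"
    using int by (simp add: set_integrable_def)
  have "integrable lborel (\<lambda>t. indicator {R..} t *\<^sub>R (\<bar>sph_mean g t - c\<bar> / t)) \<longleftrightarrow>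
    integrable lborel (\<lambda>t. indicator {R..} t * (\<bar>sph_avg h t\<bar> / t))"
    by (rule integrable_cong_AE[OF borel_measurable_integrable[OF i] _ ae]) measurable
  then show ?thesis using i by simp
qed

lemma exterior_integral_eq:
  assumes hm [measurable]: "h \<in> borel_measurable borel" and gm [measurable]: "g \<in> borel_measurable borel"
    and h0: "\<And>y. y \<in> \<Omega> \<Longrightarrow> h y = 0"
    and hg: "AE y in lborel. y \<notin> \<Omega> \<longrightarrow> h y = g y - c" and x: "x \<in> \<Omega>"
  shows "(LINT y : ball 0 r - \<Omega> | lebesgue. (g y - c) / norm (x - y) ^ DIM('a)) =
    (LINT y|lborel. indicator {..<r} (norm y) * h y * frac_ker 0 (x - y))"
proof -
  have [measurable]: "ball 0 r - \<Omega> \<in> sets borel" by auto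
  have "(LINT y : ball 0 r - \<Omega> | lebesgue. (g y - c) / norm (x - y) ^ DIM('a)) =
    (LINT y|lborel. indicator (ball 0 r - \<Omega>) y *\<^sub>R ((g y - c) / norm (x - y) ^ DIM('a)))"
    unfolding set_lebesgue_integral_def by (rule integral_completion) measurable
  also have "\<dots> = (LINT y|lborel. indicator {..<r} (norm y) * h y * frac_ker 0 (x - y))"
  proof (rule integral_cong_AE)
    show "AE y in lborel. indicator (ball 0 r - \<Omega>) y *\<^sub>R ((g y - c) / norm (x - y) ^ DIM('a)) =
      indicator {..<r} (norm y) * h y * frac_ker 0 (x - y)"
      using hg
    proof eventually_elim
      case (elim y)
      show ?case
      proof (cases "y \<in> \<Omega>")
        case False
        then have "0 < norm (x - y)" using x by auto
        then have "frac_ker 0 (x - y) = 1 / norm (x - y) ^ DIM('a)"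
          by (simp add: frac_ker_def powr_minus_divide powr_realpow)
        then show ?thesis using False elim by (auto simp: indicator_def)
      qed (simp add: h0)
    qed
  qed measurable
  finally show ?thesis .
qed

text \<open>Converts the half exponent allowed for f_s into the exponent of the final
  estimate.\<close>

lemma \<delta>_powr_half:
  assumes "x \<in> \<Omega>" "0 < \<epsilon>" "\<epsilon> < 1"
  shows "\<delta> x powr - (\<epsilon> / 2) \<le> R0 * \<delta> x powr -\<epsilon>"
proof -
  have "1 \<le> R0 * \<delta> x powr - (\<epsilon> / 2)" using assms by (intro one_le_\<delta>) auto
  then have "1 * \<delta> x powr - (\<epsilon> / 2) \<le> R0 * \<delta> x powr - (\<epsilon> / 2) * \<delta> x powr - (\<epsilon> / 2)"
    by (rule mult_right_mono) simp
  also have "\<dots> = R0 * \<delta> x powr -\<epsilon>" by (simp add: mult.assoc powr_add[symmetric])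
  finally show ?thesis by simp
qed

text \<open>Both w - f_s and f_s itself are small in the weighted norm, hence so is u - c inside the
  domain.\<close>

lemma zeroth_order:
  assumes gm: "g \<in> borel_measurable borel" and gL: "Linf_on (- \<Omega>) g"
    and sol: "\<And>s. s \<in> {0<..<1} \<Longrightarrow> poisson_solution s \<Omega> g (u s)"
    and lim: "ess_lim_at_top (sph_mean g) c"
  shows "almost_unif_conv \<Omega> u (\<lambda>x. c)"
proof -
  obtain h M where hm: "h \<in> borel_measurable borel" and hM: "\<And>y. \<bar>h y\<bar> \<le> M" and h0: "\<And>y. y \<in> \<Omega> \<Longrightarrow> h y = 0"
    and hg: "AE y in lborel. y \<notin> \<Omega> \<longrightarrow> h y = g y - c"
    using exterior_data[OF gm gL] by blast
  have small: "\<forall>\<^sub>F s in at_right 0. \<forall>x\<in>\<Omega>. \<bar>c_Ns DIM('a) s * ext_pot s h x\<bar> \<le> \<eta> * \<delta> x powr -a"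
    if "0 < a" "a < 1" "0 < \<eta>" for a \<eta>
    by (rule ext_pot_small[OF hm hM h0 ess_lim_sph_avg[OF hm gm hM hg lim] that])
  show ?thesis
  proof (rule almost_unif_convI)
    fix \<epsilon> \<eta> :: real assume \<epsilon>: "0 < \<epsilon>" "\<epsilon> < 1" and \<eta>: "0 < \<eta>"
    have a: "0 < \<epsilon> / 2" "\<epsilon> / 2 < 1" using \<epsilon> by auto
    obtain \<theta> C where \<theta>: "(\<theta> \<longlongrightarrow> 0) (at_right 0)"
      and est: "\<forall>\<^sub>F s in at_right 0. AE x in lborel. x \<in> \<Omega> \<longrightarrow>
        \<bar>u s x - c - c_Ns DIM('a) s * ext_pot s h x\<bar> \<le>
         (C * (\<theta> s * 1 + c_Ns DIM('a) s * (1 + c_Ns DIM('a) s * M)) + s\<^sup>2) * \<delta> x powr -\<epsilon>"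
      \<comment> \<open>The bound 1 for f_s is enough here: it is multiplied by theta or by
        \<open>c_Ns\<close>, both of which tend to 0.\<close>
      using uniform_estimate[OF hm hM h0 hg sol \<epsilon>, of "\<lambda>_. 1"] small[OF a zero_less_one] by auto
    have c0: "(c_Ns DIM('a) \<longlongrightarrow> 0) (at_right 0)" by (rule tendsto_c_Ns_0) simp
    have "((\<lambda>s. C * (\<theta> s * 1 + c_Ns DIM('a) s * (1 + c_Ns DIM('a) s * M)) + s\<^sup>2) \<longlongrightarrow> C * (0 * 1 + 0 * (1 + 0 * M)) + 0\<^sup>2) (at_right 0)"
      by (intro tendsto_intros \<theta> c0)
    then have q: "\<forall>\<^sub>F s in at_right 0. C * (\<theta> s * 1 + c_Ns DIM('a) s * (1 + c_Ns DIM('a) s * M)) + s\<^sup>2 < \<eta> / 2"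
      by (rule order_tendstoD) (use \<eta> in simp)
    have "0 < \<eta> / (2 * R0)" using \<eta> R0(1) by simp
    from small[OF a this] est q
    show "\<forall>\<^sub>F s in at_right 0. AE x in lborel. x \<in> \<Omega> \<longrightarrow> \<bar>u s x - c\<bar> \<le> \<eta> * \<delta> x powr -\<epsilon>"
    proof eventually_elim
      case (elim s)
      from elim(2) show ?case
      proof eventually_elim
        case (elim x)
        show ?case
        proof
          assume x: "x \<in> \<Omega>"
          have "\<bar>u s x - c - c_Ns DIM('a) s * ext_pot s h x\<bar> \<le>
             (C * (\<theta> s * 1 + c_Ns DIM('a) s * (1 + c_Ns DIM('a) s * M)) + s\<^sup>2) * \<delta> x powr -\<epsilon>" using elim x by blast
          also have "\<dots> \<le> \<eta> / 2 * \<delta> x powr -\<epsilon>"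
            using \<open>C * (\<theta> s * 1 + c_Ns DIM('a) s * (1 + c_Ns DIM('a) s * M)) + s\<^sup>2 < \<eta> / 2\<close> by (intro mult_right_mono) auto
          finally have 1: "\<bar>u s x - c - c_Ns DIM('a) s * ext_pot s h x\<bar> \<le> \<eta> / 2 * \<delta> x powr -\<epsilon>" .
          have "\<bar>c_Ns DIM('a) s * ext_pot s h x\<bar> \<le> \<eta> / (2 * R0) * \<delta> x powr - (\<epsilon> / 2)"
            using \<open>\<forall>x\<in>\<Omega>. \<bar>c_Ns DIM('a) s * ext_pot s h x\<bar> \<le> \<eta> / (2 * R0) * \<delta> x powr - (\<epsilon> / 2)\<close> x by blast
          also have "\<dots> \<le> \<eta> / (2 * R0) * (R0 * \<delta> x powr -\<epsilon>)"
            using \<eta> R0(1) by (intro mult_left_mono \<delta>_powr_half x \<epsilon>) auto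
          also have "\<dots> = \<eta> / 2 * \<delta> x powr -\<epsilon>" using R0(1) by simp
          finally have "\<bar>u s x - c\<bar> \<le> \<eta> / 2 * \<delta> x powr -\<epsilon> + \<eta> / 2 * \<delta> x powr -\<epsilon>" using 1 by linarith
          then show "\<bar>u s x - c\<bar> \<le> \<eta> * \<delta> x powr -\<epsilon>" by simp
        qed
      qed
    qed
  qed
qed

text \<open>Dividing by s leaves two errors: (w - f_s)/s, controlled by the uniform estimate with a
  bound of order s for f_s, and f_s/s - L, controlled by the expansion of the potential.\<close>

lemma first_order:
  assumes gm: "g \<in> borel_measurable borel" and gL: "Linf_on (- \<Omega>) g"
    and sol: "\<And>s. s \<in> {0<..<1} \<Longrightarrow> poisson_solution s \<Omega> g (u s)"
    and R: "1 \<le> R" "\<Omega> \<subseteq> ball 0 R"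
    and int: "set_integrable lborel {R..} (\<lambda>r. \<bar>sph_mean g r - c\<bar> / r)"
  shows "\<exists>L. (\<forall>x\<in>\<Omega>. ((\<lambda>r. c_N DIM('a) *
                     (LINT y : ball 0 r - \<Omega> | lebesgue. (g y - c) / norm (x - y) ^ DIM('a)))
                   \<longlongrightarrow> L x) at_top)
                 \<and> almost_unif_conv \<Omega> (\<lambda>s x. (u s x - c) / s - L x) (\<lambda>x. 0)"
proof -
  let ?c = "c_Ns DIM('a)"
  obtain h M where hm: "h \<in> borel_measurable borel" and hM: "\<And>y. \<bar>h y\<bar> \<le> M" and h0: "\<And>y. y \<in> \<Omega> \<Longrightarrow> h y = 0"
    and hg: "AE y in lborel. y \<notin> \<Omega> \<longrightarrow> h y = g y - c"
    using exterior_data[OF gm gL] by blast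
  obtain L where L1: "\<And>x. x \<in> \<Omega> \<Longrightarrow> ((\<lambda>r. c_N DIM('a) * (LINT y|lborel. indicator {..<r} (norm y) * h y * frac_ker 0 (x - y))) \<longlongrightarrow> L x) at_top"
    and L2: "\<And>a. 0 < a \<Longrightarrow> a < 1 \<Longrightarrow> \<exists>K>0. \<forall>x\<in>\<Omega>. \<bar>L x\<bar> \<le> K * \<delta> x powr -a"
    and L3: "\<And>a \<eta>. 0 < a \<Longrightarrow> a < 1 \<Longrightarrow> 0 < \<eta> \<Longrightarrow>
      \<forall>\<^sub>F s in at_right 0. \<forall>x\<in>\<Omega>. \<bar>?c s * ext_pot s h x / s - L x\<bar> \<le> \<eta> * \<delta> x powr -a"
    using ext_pot_expansion[OF hm hM h0 integrable_sph_avg_tail[OF hm gm hM hg R int]] by blast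
  have "almost_unif_conv \<Omega> (\<lambda>s x. (u s x - c) / s - L x) (\<lambda>x. 0)"
  proof (rule almost_unif_convI)
    fix \<epsilon> \<eta> :: real assume \<epsilon>: "0 < \<epsilon>" "\<epsilon> < 1" and \<eta>: "0 < \<eta>"
    have a: "0 < \<epsilon> / 2" "\<epsilon> / 2 < 1" using \<epsilon> by auto
    obtain K where K: "K > 0" "\<forall>x\<in>\<Omega>. \<bar>L x\<bar> \<le> K * \<delta> x powr - (\<epsilon> / 2)" using L2[OF a] by blast
    have pos: "\<forall>\<^sub>F s in at_right (0::real). 0 < s" by (rule eventually_at_right_less)
    \<comment> \<open>The bound linear in s comes from the expansion with tolerance 1 together with
      the bound \<open>K\<close> for \<open>L\<close>. It is what improves the error from o(1) to
      o(s).\<close>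
    have fA: "\<forall>\<^sub>F s in at_right 0. \<forall>x\<in>\<Omega>. \<bar>?c s * ext_pot s h x\<bar> \<le> s * (K + 1) * \<delta> x powr - (\<epsilon> / 2)"
      using L3[OF a zero_less_one] pos
    proof eventually_elim
      case (elim s)
      show ?case
      proof
        fix x assume x: "x \<in> \<Omega>"
        have "\<bar>?c s * ext_pot s h x / s\<bar> \<le> (K + 1) * \<delta> x powr - (\<epsilon> / 2)"
          using bspec[OF elim(1) x] bspec[OF K(2) x] unfolding distrib_right by linarith
        then show "\<bar>?c s * ext_pot s h x\<bar> \<le> s * (K + 1) * \<delta> x powr - (\<epsilon> / 2)"
          using elim(2) by (simp add: abs_divide divide_le_eq mult_ac)
      qed
    qed
    have A0: "\<And>s. 0 < s \<Longrightarrow> 0 \<le> s * (K + 1)" using K by simp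
    obtain \<theta> C where \<theta>: "(\<theta> \<longlongrightarrow> 0) (at_right 0)"
      and est: "\<forall>\<^sub>F s in at_right 0. AE x in lborel. x \<in> \<Omega> \<longrightarrow>
        \<bar>u s x - c - ?c s * ext_pot s h x\<bar> \<le>
         (C * (\<theta> s * (s * (K + 1)) + ?c s * (s * (K + 1) + ?c s * M)) + s\<^sup>2) * \<delta> x powr -\<epsilon>"
      using uniform_estimate[OF hm hM h0 hg sol \<epsilon> A0 fA] by blast
    have c0: "(?c \<longlongrightarrow> 0) (at_right 0)" by (rule tendsto_c_Ns_0) simp
    have c1: "((\<lambda>s. ?c s / s) \<longlongrightarrow> c_N DIM('a)) (at_right 0)" by (rule tendsto_c_Ns) simp
    \<comment> \<open>The error constant divided by s; the quadratic term in \<open>c_Ns\<close>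
      becomes \<open>c_Ns\<close> times the bounded quotient \<open>c_Ns / s\<close>.\<close>
    let ?q = "\<lambda>s. C * (\<theta> s * (K + 1) + ?c s * ((K + 1) + ?c s / s * M)) + s"
    have "(?q \<longlongrightarrow> C * (0 * (K + 1) + 0 * ((K + 1) + c_N DIM('a) * M)) + 0) (at_right 0)"
      by (intro tendsto_intros \<theta> c0 c1)
    then have q: "\<forall>\<^sub>F s in at_right 0. ?q s < \<eta> / 2"
      by (rule order_tendstoD) (use \<eta> in simp)
    have "0 < \<eta> / (2 * R0)" using \<eta> R0(1) by simp
    from L3[OF a this] est q pos
    show "\<forall>\<^sub>F s in at_right 0. AE x in lborel. x \<in> \<Omega> \<longrightarrow> \<bar>(u s x - c) / s - L x - 0\<bar> \<le> \<eta> * \<delta> x powr -\<epsilon>"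
    proof eventually_elim
      case (elim s)
      note E = elim(1) and qs = elim(3) and s = elim(4)
      have sq: "C * (\<theta> s * (s * (K + 1)) + ?c s * (s * (K + 1) + ?c s * M)) + s\<^sup>2 = s * ?q s"
        using s by (simp add: power2_eq_square algebra_simps)
      from elim(2) show ?case
      proof eventually_elim
        case (elim x)
        show ?case
        proof
          assume x: "x \<in> \<Omega>"
          have "\<bar>u s x - c - ?c s * ext_pot s h x\<bar> \<le> s * ?q s * \<delta> x powr -\<epsilon>" using elim x unfolding sq by blast
          then have "\<bar>u s x - c - ?c s * ext_pot s h x\<bar> / s \<le> ?q s * \<delta> x powr -\<epsilon>"
            using s by (simp add: divide_le_eq mult_ac)
          also have "\<dots> \<le> \<eta> / 2 * \<delta> x powr -\<epsilon>" using qs by (intro mult_right_mono) auto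
          finally have 1: "\<bar>(u s x - c - ?c s * ext_pot s h x) / s\<bar> \<le> \<eta> / 2 * \<delta> x powr -\<epsilon>"
            using s by (simp add: abs_divide)
          have "\<bar>?c s * ext_pot s h x / s - L x\<bar> \<le> \<eta> / (2 * R0) * \<delta> x powr - (\<epsilon> / 2)"
            using E x by blast
          also have "\<dots> \<le> \<eta> / (2 * R0) * (R0 * \<delta> x powr -\<epsilon>)"
            using \<eta> R0(1) by (intro mult_left_mono \<delta>_powr_half x \<epsilon>) auto
          also have "\<dots> = \<eta> / 2 * \<delta> x powr -\<epsilon>" using R0(1) by simp
          finally have 2: "\<bar>?c s * ext_pot s h x / s - L x\<bar> \<le> \<eta> / 2 * \<delta> x powr -\<epsilon>" .
          have "(u s x - c) / s - L x = (u s x - c - ?c s * ext_pot s h x) / s + (?c s * ext_pot s h x / s - L x)"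
            by (simp add: diff_divide_distrib)
          then have "\<bar>(u s x - c) / s - L x - 0\<bar> \<le> \<eta> / 2 * \<delta> x powr -\<epsilon> + \<eta> / 2 * \<delta> x powr -\<epsilon>"
            using 1 2 by linarith
          then show "\<bar>(u s x - c) / s - L x - 0\<bar> \<le> \<eta> * \<delta> x powr -\<epsilon>" by simp
        qed
      qed
    qed
  qed
  moreover have "\<forall>x\<in>\<Omega>. ((\<lambda>r. c_N DIM('a) *
                     (LINT y : ball 0 r - \<Omega> | lebesgue. (g y - c) / norm (x - y) ^ DIM('a)))
                   \<longlongrightarrow> L x) at_top"
    using L1 exterior_integral_eq[OF hm gm h0 hg] by simp
  ultimately show ?thesis by blast
qed

end

theorem theorem1p2:
  fixes \<Omega> :: "'a::euclidean_space set"
    and g :: "'a \<Rightarrow> real"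
    and u :: "real \<Rightarrow> 'a \<Rightarrow> real"
  assumes N2: "DIM('a) \<ge> 2"
    and bdd: "bounded \<Omega>" and opn: "open \<Omega>" and C2: "C2_boundary \<Omega>"
    and gmeas: "g \<in> borel_measurable borel" and gLinf: "Linf_on (- \<Omega>) g"
    and sol: "\<And>s. s \<in> {0<..<1} \<Longrightarrow> poisson_solution s \<Omega> g (u s)"
  shows "(\<forall>c. ess_lim_at_top (sph_mean g) c \<longrightarrow> almost_unif_conv \<Omega> u (\<lambda>x. c))
     \<and> (\<forall>c. ess_lim_at_top (sph_mean g) c
           \<and> (\<exists>R\<ge>1. \<Omega> \<subseteq> ball 0 R \<and>
                 set_integrable lborel {R..} (\<lambda>r. \<bar>sph_mean g r - c\<bar> / r))
         \<longrightarrow> (\<exists>L. (\<forall>x\<in>\<Omega>. ((\<lambda>r. c_N DIM('a) *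
                     (LINT y : ball 0 r - \<Omega> | lebesgue. (g y - c) / norm (x - y) ^ DIM('a)))
                   \<longlongrightarrow> L x) at_top)
                 \<and> almost_unif_conv \<Omega> (\<lambda>s x. (u s x - c) / s - L x) (\<lambda>x. 0)))"
proof (cases "\<Omega> = {}")
  case True
  \<comment> \<open>On the empty domain all claims about points are vacuous; the locale needs a
    nonempty domain to have a frontier.\<close>
  then show ?thesis by (simp add: almost_unif_conv_def)
next
  case False
  then interpret C2_domain \<Omega> using bdd opn C2 by unfold_locales
  show ?thesis
    using zeroth_order[OF gmeas gLinf sol] first_order[OF gmeas gLinf sol] by blast
qed

end
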